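(* Let $p^\star$ be an $(\alpha,\beta,K)$-weakly log-concave probability measure on $\mathbb R^d$ with $\alpha,K>0$ and $\beta\in(0,1]$. Then there exists $C>0$ independent of the dimension (depending only on $\alpha,\beta,K$) such that for any divergence $\Psi$ on a closed interval $I\subset\mathbb R$ and any smooth $f:\mathbb R^d\to I$ (with $\int f\,dp^\star\in I$), $$\mathrm{Ent}_{\Psi,p^\star}(f)\le C\int_{\mathbb R^d}\Psi''(f(x))\,|\nabla f(x)|^2\,dp^\star(x).$$ In particular, for smooth $f:\mathbb R^d\to\mathbb R$, $$\mathrm{Var}_{p^\star}(f)\le2C\int|\nabla f|^2\,dp^\star,\qquad\mathrm{Ent}_{p^\star}(f^2)\le4C\int|\nabla f|^2\,dp^\star,$$ so $p^\star$ satisfies the Poincaré inequality and the log-Sobolev inequality.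
   Context: Weak log-concavity. For $\alpha,K>0$ and $\beta\in(0,1]$, a probability density $p$ on $\mathbb R^d$ (identified with the corresponding measure) is $(\alpha,\beta,K)$-weakly log-concave if $p=\exp(-u+a)$ where (1) $u:\mathbb R^d\to\mathbb R\cup\{+\infty\}$ is convex, $C^2$ on the interior of the support, with $\nabla^2u\succeq\alpha\,\mathrm{Id}$ there; (2) $|a(x)-a(y)|\le K\|x-y\|^\beta$ for all $x,y\in\mathbb R^d$. Let $I\subset\mathbb R$ be a closed interval and $\Psi:I\to\mathbb R$ twice differentiable. $\Psi$ is a divergence if $\Psi$, $\Psi''$ and $-1/\Psi''$ are convex on $I$. For a probability measure $\nu$ on $\mathbb R^d$ and $\zeta:\mathbb R^d\to I$ with $\int\zeta\,d\nu\in I$, $\mathrm{Ent}_{\Psi,\nu}(\zeta):=\int\Psi(\zeta)\,d\nu-\Psi\big(\int\zeta\,d\nu\big)$. $\mathrm{Ent}_\nu$ denotes the usual entropy, i.e. the case $\Psi(x)=x\log x$ on $\mathbb R_+$. *)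

theory Defs
  imports "HOL-Analysis.Analysis"
begin

(* The dimension d must be quantified inside the statement (one constant for all d), so R^d is
   not a type here but the carrier {..<d} \<rightarrow>\<^sub>E UNIV of functions nat \<Rightarrow> real, which is the space of
   the product Lebesgue measure on {..<d}. Its Euclidean topology is the subspace topology of
   nat \<Rightarrow> real, its Euclidean norm is L2_set _ {..<d}. *)

definition eucl :: "nat \<Rightarrow> (nat \<Rightarrow> real) set" where
  "eucl d = {..<d} \<rightarrow>\<^sub>E UNIV"

definition leb :: "nat \<Rightarrow> (nat \<Rightarrow> real) measure" where
  "leb d = PiM {..<d} (\<lambda>_. lborel)"

lemma space_leb: "space (leb d) = eucl d"
  by (simp add: leb_def eucl_def space_PiM)

definition enorm :: "nat \<Rightarrow> (nat \<Rightarrow> real) \<Rightarrow> real" where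
  "enorm d x = L2_set x {..<d}"

definition partial :: "nat \<Rightarrow> ((nat \<Rightarrow> real) \<Rightarrow> real) \<Rightarrow> (nat \<Rightarrow> real) \<Rightarrow> real" where
  "partial i f x = deriv (\<lambda>t. f (x(i := t))) (x i)"

(* C^k on a set S that is open in R^d: all iterated partial derivatives of order at most k exist
   and are continuous on S. *)
definition Ck_on :: "nat \<Rightarrow> nat \<Rightarrow> (nat \<Rightarrow> real) set \<Rightarrow> ((nat \<Rightarrow> real) \<Rightarrow> real) \<Rightarrow> bool" where
  "Ck_on d k S f \<longleftrightarrow>
     (\<forall>is. set is \<subseteq> {..<d} \<and> length is \<le> k \<longrightarrow>
        continuous_on S (foldr partial is f) \<and>
        (length is < k \<longrightarrow>
          (\<forall>i<d. \<forall>x\<in>S. (\<lambda>t. foldr partial is f (x(i := t))) differentiable (at (x i)))))"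

definition smooth :: "nat \<Rightarrow> ((nat \<Rightarrow> real) \<Rightarrow> real) \<Rightarrow> bool" where
  "smooth d f \<longleftrightarrow> (\<forall>k. Ck_on d k (eucl d) f)"

definition grad :: "((nat \<Rightarrow> real) \<Rightarrow> real) \<Rightarrow> (nat \<Rightarrow> real) \<Rightarrow> nat \<Rightarrow> real" where
  "grad f x = (\<lambda>i. partial i f x)"

definition hessian_ge :: "nat \<Rightarrow> real \<Rightarrow> ((nat \<Rightarrow> real) \<Rightarrow> real) \<Rightarrow> (nat \<Rightarrow> real) \<Rightarrow> bool" where
  "hessian_ge d \<alpha> f x \<longleftrightarrow>
     (\<forall>v. (\<Sum>i<d. \<Sum>j<d. partial i (partial j f) x * v i * v j) \<ge> \<alpha> * (enorm d v)\<^sup>2)"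

definition ext_convex :: "nat \<Rightarrow> ((nat \<Rightarrow> real) \<Rightarrow> ereal) \<Rightarrow> bool" where
  "ext_convex d u \<longleftrightarrow>
     (\<forall>x\<in>eucl d. \<forall>y\<in>eucl d. \<forall>t. 0 < t \<and> t < 1 \<longrightarrow>
        u (\<lambda>i\<in>{..<d}. (1 - t) * x i + t * y i) \<le> ereal (1 - t) * u x + ereal t * u y)"

definition prob_density :: "nat \<Rightarrow> ((nat \<Rightarrow> real) \<Rightarrow> real) \<Rightarrow> bool" where
  "prob_density d p \<longleftrightarrow>
     p \<in> borel_measurable (leb d) \<and> (\<forall>x\<in>eucl d. 0 \<le> p x) \<and> (\<integral>\<^sup>+x. ennreal (p x) \<partial>leb d) = 1"

definition dmeasure :: "nat \<Rightarrow> ((nat \<Rightarrow> real) \<Rightarrow> real) \<Rightarrow> (nat \<Rightarrow> real) measure" where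
  "dmeasure d p = density (leb d) (\<lambda>x. ennreal (p x))"

definition dsupport :: "nat \<Rightarrow> ((nat \<Rightarrow> real) \<Rightarrow> real) \<Rightarrow> (nat \<Rightarrow> real) set" where
  "dsupport d p = top_of_set (eucl d) closure_of {x \<in> eucl d. p x \<noteq> 0}"

(* In the C^2 condition real_of_ereal discards nothing: the domain of u is the convex set
   {p \<noteq> 0}, and the interior of its closure is its interior, where u is finite. *)
definition weakly_log_concave ::
    "nat \<Rightarrow> real \<Rightarrow> real \<Rightarrow> real \<Rightarrow> ((nat \<Rightarrow> real) \<Rightarrow> real) \<Rightarrow> bool" where
  "weakly_log_concave d \<alpha> \<beta> K p \<longleftrightarrow>
     prob_density d p \<and>
     (\<exists>(u :: (nat \<Rightarrow> real) \<Rightarrow> ereal) (a :: (nat \<Rightarrow> real) \<Rightarrow> real).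
        (\<forall>x\<in>eucl d. p x = (if u x = \<infinity> then 0 else exp (- real_of_ereal (u x) + a x))) \<and>
        (\<forall>x\<in>eucl d. u x \<noteq> -\<infinity>) \<and>
        ext_convex d u \<and>
        (let S = top_of_set (eucl d) interior_of dsupport d p;
             v = (\<lambda>x. real_of_ereal (u x))
         in Ck_on d 2 S v \<and> (\<forall>x\<in>S. hessian_ge d \<alpha> v x)) \<and>
        (\<forall>x\<in>eucl d. \<forall>y\<in>eucl d. \<bar>a x - a y\<bar> \<le> K * enorm d (\<lambda>i. x i - y i) powr \<beta>))"

(* Differentiability at the end points of I is not required, only continuity: otherwise
   s * ln s on {0..} would be excluded. Values of the second derivative at the end points never
   matter below, since the gradient of f vanishes wherever f attains an end point of I.
   With 1 / 0 = 0, a zero of the second derivative in the interior is compatible with the last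
   condition only if \<Psi> is affine. *)
definition divergence :: "real set \<Rightarrow> (real \<Rightarrow> real) \<Rightarrow> bool" where
  "divergence I \<Psi> \<longleftrightarrow>
     continuous_on I \<Psi> \<and>
     (\<forall>s\<in>interior I. \<Psi> differentiable (at s) \<and> deriv \<Psi> differentiable (at s)) \<and>
     convex_on I \<Psi> \<and>
     convex_on (interior I) (deriv (deriv \<Psi>)) \<and>
     convex_on (interior I) (\<lambda>s. - 1 / deriv (deriv \<Psi>) s)"

(* Integral with values in the extended reals, so that divergent integrals are not read as 0:
   ennreal truncates at 0, hence this is the integral of the positive part minus that of the
   negative part (and \<infinity> - \<infinity> = \<infinity> in ereal). *)
definition ext_integral :: "'a measure \<Rightarrow> ('a \<Rightarrow> real) \<Rightarrow> ereal" where
  "ext_integral M g =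
     enn2ereal (\<integral>\<^sup>+x. ennreal (g x) \<partial>M) - enn2ereal (\<integral>\<^sup>+x. ennreal (- g x) \<partial>M)"

lemma ext_integral_eq_integral:
  assumes "integrable M g"
  shows "ext_integral M g = ereal (integral\<^sup>L M g)"
proof -
  have "(\<integral>\<^sup>+x. ennreal (g x) \<partial>M) \<noteq> \<infinity>" "(\<integral>\<^sup>+x. ennreal (- g x) \<partial>M) \<noteq> \<infinity>"
    using assms by (simp_all add: real_integrable_def)
  then show ?thesis
    unfolding ext_integral_def real_lebesgue_integral_def[OF assms]
    by (cases "\<integral>\<^sup>+x. ennreal (g x) \<partial>M"; cases "\<integral>\<^sup>+x. ennreal (- g x) \<partial>M") (auto simp: enn2ereal_ennreal)
qed

lemma ext_integral_nonneg:
  assumes "\<And>x. x \<in> space M \<Longrightarrow> 0 \<le> g x"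
  shows "ext_integral M g = enn2ereal (\<integral>\<^sup>+x. ennreal (g x) \<partial>M)"
proof -
  have "(\<integral>\<^sup>+x. ennreal (- g x) \<partial>M) = (\<integral>\<^sup>+x. 0 \<partial>M)"
    by (rule nn_integral_cong) (simp add: assms ennreal_neg)
  then show ?thesis by (simp add: ext_integral_def zero_ennreal.rep_eq)
qed

definition Ent :: "(real \<Rightarrow> real) \<Rightarrow> 'a measure \<Rightarrow> ('a \<Rightarrow> real) \<Rightarrow> ereal" where
  "Ent \<Psi> \<nu> \<zeta> = ext_integral \<nu> (\<lambda>x. \<Psi> (\<zeta> x)) - ereal (\<Psi> (\<integral>x. \<zeta> x \<partial>\<nu>))"

(* Equals \<infinity> whenever f is not square integrable, also if f is not integrable. *)
definition Var :: "'a measure \<Rightarrow> ('a \<Rightarrow> real) \<Rightarrow> ereal" where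
  "Var \<nu> f = ext_integral \<nu> (\<lambda>x. (f x - (\<integral>y. f y \<partial>\<nu>))\<^sup>2)"

end

theory Submission
  imports Defs "HOL-Probability.Probability" "HOL-Real_Asymp.Real_Asymp"
begin

text \<open>
  An infimal convolution splits the Hoelder function a into a K-Lipschitz function b and a remainder with values in
  [0, K]. Comparing weights (Holley-Stroock), it suffices to treat Lipschitz perturbations of strongly log-concave
  measures, restricted to cubes. There the Prekopa-Leindler inequality, applied to the measure itself, is expanded
  to first order in the interpolation parameter. Because b varies by at most K r over a distance r, this yields a
  defective logarithmic Sobolev inequality; without perturbation it yields the Poincare inequality and exponential
  moments of b. A logistic cutoff in b turns the latter two into a weak Poincare inequality, and truncating functions
  at a high level, with the error controlled by the defective inequality, upgrades it to a Poincare inequality.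
  For a divergence, the substitution W' = sqrt of the second derivative bounds the Bregman divergence of f from
  its mean m by the square of W f - W m times 1 + ln (1 + (f - a) / (m - a)). Since the argument of the logarithm has
  mean 2, duality for the entropy reduces the claim to the two previous inequalities. No constant sees the dimension.
\<close>

section \<open>Prekopa-Leindler inequality\<close>

text \<open>The obstacle is that the Lipschitz part \<open>b\<close> is unbounded: comparing weights
  would cost the exponential of its oscillation, which grows with the diameter of the cube. In the
  displacement inequality only increments of \<open>b\<close> enter, so \<open>b\<close> costs an
  error linear in the distance, and the curvature absorbs it. What remains is a defect in the
  logarithmic Sobolev inequality that does not vanish for constants, so it gives no spectral gap by
  itself. The gap has to be imported from the unperturbed measure, whose energy is not dominated by
  the perturbed one where exp b is tiny. Cutting this region off leaves an error that the
  exponential moments make small, but only relative to the supremum of the function; this is what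
  forces the truncation.

  For a divergence, concavity of the reciprocal of the second derivative traps the second
  derivative, after a split at its minimum point, between a constant and the inverse distance to an
  end point. These extremes are variance and entropy, and one substitution serves everything in
  between. It moves the centre from the mean of W f to W m, and this shift must be shown to cost no
  more than a variance.\<close>

lemma emeasure_lborel_affine_image:
  fixes c t :: real
  assumes "0 < t" "compact A"
  shows "emeasure lborel ((\<lambda>x. c + t * x) ` A) = ennreal t * emeasure lborel A"
proof -
  let ?B = "(\<lambda>x. c + t * x) ` A"
  have B: "?B \<in> sets borel"
    by (intro borel_compact compact_continuous_image assms continuous_intros)
  have "emeasure lborel ?B = (\<integral>\<^sup>+x. indicator ?B x \<partial>lborel)" using B by simp
  also have "\<dots> = ennreal \<bar>t\<bar> * (\<integral>\<^sup>+x. indicator ?B (c + t * x) \<partial>lborel)"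
    using assms B by (intro nn_integral_real_affine) auto
  also have "(\<lambda>x. indicator ?B (c + t * x) :: ennreal) = indicator A"
    using assms by (auto simp: fun_eq_iff indicator_def)
  finally show ?thesis using assms by (simp add: borel_compact)
qed

text \<open>With \<open>a\<close> the maximum of \<open>A\<close> and \<open>b\<close> the minimum
  of \<open>B\<close>, the sets t A + (1 - t) b and t a + (1 - t) B both lie in \<open>C\<close> and
  meet at most in the point t a + (1 - t) b, so their measures add up.\<close>

lemma brunn_minkowski_compact:
  fixes A B C :: "real set"
  assumes "compact A" "compact B" "A \<noteq> {}" "B \<noteq> {}" "C \<in> sets borel" "0 < t" "t < 1"
    and sub: "\<And>x y. x \<in> A \<Longrightarrow> y \<in> B \<Longrightarrow> t * x + (1 - t) * y \<in> C"
  shows "ennreal t * emeasure lborel A + ennreal (1 - t) * emeasure lborel B \<le> emeasure lborel C"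
proof -
  obtain a where a: "a \<in> A" "\<And>x. x \<in> A \<Longrightarrow> x \<le> a"
    using compact_attains_sup[of A] assms by blast
  obtain b where b: "b \<in> B" "\<And>x. x \<in> B \<Longrightarrow> b \<le> x"
    using compact_attains_inf[of B] assms by blast
  let ?A = "(\<lambda>x. (1 - t) * b + t * x) ` A" and ?B = "(\<lambda>x. t * a + (1 - t) * x) ` B"
  have mA: "?A \<in> sets borel" and mB: "?B \<in> sets borel"
    by (intro borel_compact compact_continuous_image assms continuous_intros)+
  let ?p = "t * a + (1 - t) * b"
  have int: "?A \<inter> ?B \<subseteq> {?p}"
  proof
    fix z assume "z \<in> ?A \<inter> ?B"
    then obtain x y where xy: "x \<in> A" "y \<in> B" "z = (1 - t) * b + t * x" "z = t * a + (1 - t) * y"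
      by auto
    have "t * x \<le> t * a" "(1 - t) * b \<le> (1 - t) * y"
      using a(2)[OF xy(1)] b(2)[OF xy(2)] assms by (auto intro: mult_left_mono)
    then have "z = ?p" using xy(3,4) by linarith
    then show "z \<in> {?p}" by simp
  qed
  have "emeasure lborel (?A \<inter> ?B) \<le> emeasure lborel {?p}"
    by (rule emeasure_mono[OF int]) simp
  then have "?A \<inter> ?B \<in> null_sets lborel" using mA mB by (auto simp: null_sets_def)
  then have "emeasure lborel (?A \<union> ?B) = emeasure lborel ?A + emeasure lborel ?B"
    using mA mB by (intro emeasure_Un') auto
  also have "\<dots> = ennreal t * emeasure lborel A + ennreal (1 - t) * emeasure lborel B"
    using assms by (simp add: emeasure_lborel_affine_image)
  finally have eq: "emeasure lborel (?A \<union> ?B) = ennreal t * emeasure lborel A + ennreal (1 - t) * emeasure lborel B" .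
  have "?A \<union> ?B \<subseteq> C" using sub a b by (auto simp: algebra_simps)
  then have "emeasure lborel (?A \<union> ?B) \<le> emeasure lborel C"
    using assms by (intro emeasure_mono) auto
  then show ?thesis using eq by simp
qed

lemma inner_compact:
  fixes A :: "real set"
  assumes "A \<in> sets borel" "bounded A" "A \<noteq> {}" "0 < e"
  obtains T where "compact T" "T \<subseteq> A" "T \<noteq> {}" "emeasure lborel A \<le> emeasure lborel T + ennreal e"
proof -
  have "A \<in> sets lebesgue" using assms by auto
  then obtain T where T: "closed T" "T \<subseteq> A" "A - T \<in> lmeasurable" "emeasure lebesgue (A - T) < ennreal e"
    using sets_lebesgue_inner_closed[OF _ assms(4)] by metis
  obtain x where x: "x \<in> A" using assms by blast
  \<comment> \<open>The closed set \<open>T\<close> may be empty, and the compact version of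
    Brunn-Minkowski needs a nonempty set; one more point of \<open>A\<close> repairs this.\<close>
  have cT: "compact (insert x T)" using T assms
    by (meson bounded_subset compact_eq_bounded_closed compact_insert)
  have "emeasure lborel A \<le> emeasure lborel (T \<union> (A - T))"
    using T assms by (intro emeasure_mono) (auto intro: borel_closed)
  also have "\<dots> \<le> emeasure lborel T + emeasure lborel (A - T)"
    using T assms by (intro emeasure_subadditive) (auto intro: borel_closed)
  also have "emeasure lborel (A - T) = emeasure lebesgue (A - T)"
    using T assms by (simp add: borel_closed)
  also have "emeasure lborel T + emeasure lebesgue (A - T) \<le> emeasure lborel (insert x T) + ennreal e"
    using T cT by (intro add_mono emeasure_mono) (auto intro: borel_compact)
  finally show ?thesis using that[OF cT] T x by blast
qed

text \<open>Approximation from inside by compact sets; the weights sum to 1, so the total error is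
  \<open>e\<close>. A Borel set \<open>C\<close> that contains the combinations takes the place of
  the Minkowski sum, which need not be Borel.\<close>

lemma brunn_minkowski_bounded:
  fixes A B C :: "real set"
  assumes "A \<in> sets borel" "B \<in> sets borel" "bounded A" "bounded B" "A \<noteq> {}" "B \<noteq> {}"
    "C \<in> sets borel" "0 < t" "t < 1"
    and sub: "\<And>x y. x \<in> A \<Longrightarrow> y \<in> B \<Longrightarrow> t * x + (1 - t) * y \<in> C"
  shows "ennreal t * emeasure lborel A + ennreal (1 - t) * emeasure lborel B \<le> emeasure lborel C"
proof (rule ennreal_le_epsilon)
  fix e :: real assume e: "0 < e"
  obtain S where S: "compact S" "S \<subseteq> A" "S \<noteq> {}" "emeasure lborel A \<le> emeasure lborel S + ennreal e"
    using inner_compact[OF assms(1,3,5) e] by metis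
  obtain T where T: "compact T" "T \<subseteq> B" "T \<noteq> {}" "emeasure lborel B \<le> emeasure lborel T + ennreal e"
    using inner_compact[OF assms(2,4,6) e] by metis
  have "ennreal t * emeasure lborel A + ennreal (1 - t) * emeasure lborel B
     \<le> ennreal t * (emeasure lborel S + ennreal e) + ennreal (1 - t) * (emeasure lborel T + ennreal e)"
    using S T by (intro add_mono mult_left_mono) auto
  also have "\<dots> = (ennreal t * emeasure lborel S + ennreal (1 - t) * emeasure lborel T)
        + (ennreal t + ennreal (1 - t)) * ennreal e"
    by (simp add: algebra_simps)
  also have "(ennreal t + ennreal (1 - t)) = 1" using assms by (simp flip: ennreal_plus)
  also have "ennreal t * emeasure lborel S + ennreal (1 - t) * emeasure lborel T \<le> emeasure lborel C"
    using S T assms by (intro brunn_minkowski_compact) auto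
  finally show "ennreal t * emeasure lborel A + ennreal (1 - t) * emeasure lborel B
     \<le> emeasure lborel C + ennreal e" by (simp add: add_mono)
qed

text \<open>Fubini for the region under the graph. Restricting the levels to (0, 1) produces the cap
  at 1, which changes nothing for functions bounded by 1.\<close>

lemma layer_cake_unit:
  fixes u :: "real \<Rightarrow> real"
  assumes u[measurable]: "u \<in> borel_measurable borel" and "\<And>x. 0 \<le> u x" 
  shows "(\<integral>\<^sup>+l. indicator {0<..<1} l * emeasure lborel {x. l < u x} \<partial>lborel)
    = (\<integral>\<^sup>+x. ennreal (min 1 (u x)) \<partial>lborel)"
proof -
  have "(\<integral>\<^sup>+l. indicator {0<..<1} l * emeasure lborel {x. l < u x} \<partial>lborel)
     = (\<integral>\<^sup>+l. (\<integral>\<^sup>+x. indicator {0<..<1::real} l * indicator {x. l < u x} x \<partial>lborel) \<partial>lborel)"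
    by (intro nn_integral_cong) (simp add: nn_integral_cmult)
  also have "\<dots> = (\<integral>\<^sup>+x. (\<integral>\<^sup>+l. indicator {0<..<1::real} l * indicator {x. l < u x} x \<partial>lborel) \<partial>lborel)"
    by (rule lborel_pair.Fubini') measurable
  also have "\<dots> = (\<integral>\<^sup>+x. ennreal (min 1 (u x)) \<partial>lborel)"
  proof (rule nn_integral_cong)
    fix x
    have "(\<lambda>l. indicator {0<..<1::real} l * indicator {x. l < u x} x :: ennreal) = indicator {0<..<min 1 (u x)}"
      by (auto simp: fun_eq_iff indicator_def)
    then have "(\<integral>\<^sup>+l. indicator {0<..<1::real} l * indicator {x. l < u x} x \<partial>lborel)
        = emeasure lborel {0<..<min 1 (u x)}" by simp
    also have "\<dots> = ennreal (min 1 (u x))" using assms(2)[of x] by simp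
    finally show "(\<integral>\<^sup>+l. indicator {0<..<1::real} l * indicator {x. l < u x} x \<partial>lborel) = ennreal (min 1 (u x))" .
  qed
  finally show ?thesis .
qed

text \<open>Bounded support and bounded height keep all integrals finite and the superlevel sets at
  positive levels bounded, as the Brunn-Minkowski inequality above requires.\<close>

definition boxed1 :: "real \<Rightarrow> real \<Rightarrow> (real \<Rightarrow> real) \<Rightarrow> bool" where
  "boxed1 n R u \<longleftrightarrow> u \<in> borel_measurable borel \<and> (\<forall>x. 0 \<le> u x \<and> u x \<le> n \<and> (u x \<noteq> 0 \<longrightarrow> \<bar>x\<bar> \<le> R))"

lemma boxed1_integrable:
  assumes "boxed1 n R u" shows "integrable lborel u"
proof (rule Bochner_Integration.integrable_bound)
  show "integrable lborel (\<lambda>x. indicator {-R..R} x * n)" by (intro integrable_mult_left integrable_real_indicator) (auto simp: emeasure_lborel_Icc_eq)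
  show "u \<in> borel_measurable lborel" using assms by (simp add: boxed1_def)
  show "AE x in lborel. norm (u x) \<le> norm (indicator {-R..R} x * n)"
  proof (rule AE_I2)
    fix x show "norm (u x) \<le> norm (indicator {-R..R} x * n)"
      using assms[unfolded boxed1_def, THEN conjunct2, rule_format, of x]
      by (cases "u x = 0") (auto simp: indicator_def)
  qed
qed

lemma powr_superlevel:
  fixes l :: real
  assumes "0 < l" "l < a" "l < b" "0 < t" "t < 1"
  shows "l < a powr t * b powr (1 - t)"
proof -
  have "l powr t < a powr t" "l powr (1-t) < b powr (1-t)"
    using assms by (auto intro: powr_less_mono2)
  then have "l powr t * l powr (1-t) < a powr t * b powr (1-t)"
    using assms by (intro mult_strict_mono) auto
  then show ?thesis using assms by (simp flip: powr_add)
qed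

text \<open>Because both suprema are 1, at every level in (0, 1) the superlevel sets of
  \<open>u\<close> and \<open>v\<close> are nonempty, and their combinations lie in that of
  \<open>w\<close>. Integrating Brunn-Minkowski over the level gives an arithmetic mean on the left,
  which is stronger than the geometric one.\<close>

lemma prekopa_leindler_unit:
  fixes u v w :: "real \<Rightarrow> real"
  assumes "boxed1 1 R u" "boxed1 1 R v" "boxed1 n R' w" and t: "0 < t" "t < 1"
    and su: "\<And>l. l < 1 \<Longrightarrow> \<exists>x. l < u x" and sv: "\<And>l. l < 1 \<Longrightarrow> \<exists>x. l < v x"
    and le: "\<And>x y. u x powr t * v y powr (1 - t) \<le> w (t * x + (1 - t) * y)"
  shows "t * (\<integral>x. u x \<partial>lborel) + (1 - t) * (\<integral>x. v x \<partial>lborel) \<le> (\<integral>x. w x \<partial>lborel)"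
proof -
  note d = assms(1-3)[unfolded boxed1_def]
  have m[measurable]: "u \<in> borel_measurable borel" "v \<in> borel_measurable borel" "w \<in> borel_measurable borel"
    and nn: "\<And>x. 0 \<le> u x" "\<And>x. 0 \<le> v x" "\<And>x. 0 \<le> w x" 
    and mn: "\<And>x. min 1 (u x) = u x" "\<And>x. min 1 (v x) = v x"
    using d by (auto simp: min_absorb2)
  note int = assms(1-3)[THEN boxed1_integrable]
  have bdd: "bounded {x. l < f x}" if "boxed1 n R f" "0 < l" for n R f and l :: real
  proof (rule bounded_subset)
    show "{x. l < f x} \<subseteq> {-R..R}" 
    proof
      fix x assume "x \<in> {x. l < f x}"
      then have "f x \<noteq> 0" using that by auto
      then show "x \<in> {-R..R}" using that by (auto simp: boxed1_def abs_le_iff)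
    qed
  qed simp
  let ?I = "\<lambda>l::real. indicator {0<..<1} l :: ennreal"
  have meas: "(\<lambda>l. emeasure lborel {x. l < f x}) \<in> borel_measurable lborel"
    if [measurable]: "f \<in> borel_measurable borel" for f :: "real \<Rightarrow> real"
  proof -
    have "(\<lambda>l. \<integral>\<^sup>+x. indicator {x. l < f x} x \<partial>lborel) \<in> borel_measurable lborel"
      by measurable
    then show ?thesis by simp
  qed
  have "ennreal t * (\<integral>\<^sup>+x. ennreal (u x) \<partial>lborel) + ennreal (1 - t) * (\<integral>\<^sup>+x. ennreal (v x) \<partial>lborel)
      = ennreal t * (\<integral>\<^sup>+l. ?I l * emeasure lborel {x. l < u x} \<partial>lborel)
       + ennreal (1 - t) * (\<integral>\<^sup>+l. ?I l * emeasure lborel {x. l < v x} \<partial>lborel)"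
    using nn by (simp add: layer_cake_unit mn)
  also have "\<dots> = (\<integral>\<^sup>+l. ennreal t * (?I l * emeasure lborel {x. l < u x})
       + ennreal (1 - t) * (?I l * emeasure lborel {x. l < v x}) \<partial>lborel)"
    using meas[OF m(1)] meas[OF m(2)]
    by (subst nn_integral_add) (auto simp: nn_integral_cmult)
  also have "\<dots> \<le> (\<integral>\<^sup>+l. ?I l * emeasure lborel {x. l < w x} \<partial>lborel)"
  proof (rule nn_integral_mono)
    fix l :: real
    show "ennreal t * (?I l * emeasure lborel {x. l < u x}) + ennreal (1 - t) * (?I l * emeasure lborel {x. l < v x})
        \<le> ?I l * emeasure lborel {x. l < w x}"
    proof (cases "0 < l \<and> l < 1")
      case True
      have "ennreal t * emeasure lborel {x. l < u x} + ennreal (1 - t) * emeasure lborel {x. l < v x}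
         \<le> emeasure lborel {x. l < w x}"
      proof (rule brunn_minkowski_bounded)
        fix x y assume "x \<in> {x. l < u x}" "y \<in> {x. l < v x}"
        then have "l < u x powr t * v y powr (1 - t)"
          using True t by (intro powr_superlevel) auto
        then show "t * x + (1 - t) * y \<in> {x. l < w x}" using le[of x y] by auto
      qed (use True t su[of l] sv[of l] bdd assms in \<open>auto\<close>)
      then show ?thesis using True by simp
    qed (auto simp: indicator_def)
  qed
  also have "\<dots> = (\<integral>\<^sup>+x. ennreal (min 1 (w x)) \<partial>lborel)" using nn by (simp add: layer_cake_unit)
  also have "\<dots> \<le> (\<integral>\<^sup>+x. ennreal (w x) \<partial>lborel)" by (intro nn_integral_mono ennreal_leI) simp
  finally have "ennreal t * ennreal (\<integral>x. u x \<partial>lborel) + ennreal (1-t) * ennreal (\<integral>x. v x \<partial>lborel)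
     \<le> ennreal (\<integral>x. w x \<partial>lborel)"
    using int nn by (simp add: nn_integral_eq_integral)
  then show ?thesis using t nn
    by (simp add: ennreal_mult[symmetric] ennreal_plus[symmetric] integral_nonneg_AE del: ennreal_plus)
qed

text \<open>The inequality is homogeneous: dividing \<open>u\<close> and \<open>v\<close> by their
  suprema, and \<open>w\<close> by the matching geometric mean \<open>c\<close>, reduces it to the
  normalized case. The weighted inequality between arithmetic and geometric means then turns the sum
  into the product.\<close>

lemma prekopa_leindler_1d:
  fixes u v w :: "real \<Rightarrow> real"
  assumes "boxed1 n1 R1 u" "boxed1 n2 R2 v" "boxed1 n R' w" and t: "0 < t" "t < 1"
    and le: "\<And>x y. u x powr t * v y powr (1 - t) \<le> w (t * x + (1 - t) * y)"
  shows "(\<integral>x. u x \<partial>lborel) powr t * (\<integral>x. v x \<partial>lborel) powr (1 - t) \<le> (\<integral>x. w x \<partial>lborel)"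
proof (cases "(\<integral>x. u x \<partial>lborel) = 0 \<or> (\<integral>x. v x \<partial>lborel) = 0")
  case True
  have "0 \<le> (\<integral>x. w x \<partial>lborel)" using assms(3) by (intro integral_nonneg_AE) (auto simp: boxed1_def)
  then show ?thesis using True t by auto
next
  case False
  define U where "U = Sup (range u)" define V where "V = Sup (range v)"
  have bu: "bdd_above (range u)" and bv: "bdd_above (range v)"
    using assms(1,2) by (auto simp: boxed1_def intro!: bdd_aboveI2)
  have uU: "u x \<le> U" for x using bu by (auto simp: U_def intro: cSup_upper)
  have vV: "v x \<le> V" for x using bv by (auto simp: V_def intro: cSup_upper)
  have nn: "0 \<le> u x" "0 \<le> v x" "0 \<le> w x" for x using assms by (auto simp: boxed1_def)
  have "U \<noteq> 0"
  proof
    assume "U = 0" then have "u x = 0" for x using uU[of x] nn(1)[of x] by simp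
    then show False using False by simp
  qed
  then have U: "0 < U" using uU[of 0] nn(1)[of 0] by simp
  have "V \<noteq> 0"
  proof
    assume "V = 0" then have "v x = 0" for x using vV[of x] nn(2)[of x] by simp
    then show False using False by simp
  qed
  then have V: "0 < V" using vV[of 0] nn(2)[of 0] by simp
  define c where "c = U powr t * V powr (1 - t)"
  have c: "0 < c" using U V by (simp add: c_def)
  let ?R = "max R1 R2"
  have "t * (\<integral>x. u x / U \<partial>lborel) + (1 - t) * (\<integral>x. v x / V \<partial>lborel) \<le> (\<integral>x. w x / c \<partial>lborel)"
  proof (rule prekopa_leindler_unit[OF _ _ _ t])
    show "boxed1 1 ?R (\<lambda>x. u x / U)" using assms(1) U uU unfolding boxed1_def by force
    show "boxed1 1 ?R (\<lambda>x. v x / V)" using assms(2) V vV unfolding boxed1_def by force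
    show "boxed1 (n / c) R' (\<lambda>x. w x / c)" using assms(3) c unfolding boxed1_def
      by (auto simp: divide_right_mono)
    show "\<exists>x. l < u x / U" if "l < 1" for l
    proof -
      have "l * U < U" using that U by simp
      then obtain x where "l * U < u x" unfolding U_def using less_cSup_iff[OF _ bu] by auto
      then show ?thesis using U by (auto simp: field_simps)
    qed
    show "\<exists>x. l < v x / V" if "l < 1" for l
    proof -
      have "l * V < V" using that V by simp
      then obtain x where "l * V < v x" unfolding V_def using less_cSup_iff[OF _ bv] by auto
      then show ?thesis using V by (auto simp: field_simps)
    qed
    show "(u x / U) powr t * (v y / V) powr (1 - t) \<le> w (t * x + (1 - t) * y) / c" for x y
      using le[of x y] c U V nn(1)[of x] nn(2)[of y]
      by (simp add: powr_divide c_def field_simps)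
  qed
  moreover have "(\<integral>x. u x / U \<partial>lborel) powr t * (\<integral>x. v x / V \<partial>lborel) powr (1 - t)
      \<le> t * (\<integral>x. u x / U \<partial>lborel) + (1 - t) * (\<integral>x. v x / V \<partial>lborel)"
  proof (rule Youngs_inequality_0)
    have "0 \<le> (\<integral>x. u x \<partial>lborel)" "0 \<le> (\<integral>x. v x \<partial>lborel)" using nn by (auto intro: integral_nonneg_AE)
    then show "0 < (\<integral>x. u x / U \<partial>lborel)" "0 < (\<integral>x. v x / V \<partial>lborel)" using False U V by auto
  qed (use t in auto)
  moreover have "0 \<le> (\<integral>x. u x \<partial>lborel)" "0 \<le> (\<integral>x. v x \<partial>lborel)"
    using nn by (auto intro!: integral_nonneg_AE)
  ultimately have "((\<integral>x. u x \<partial>lborel) powr t * (\<integral>x. v x \<partial>lborel) powr (1 - t)) / c \<le> (\<integral>x. w x \<partial>lborel) / c"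
    using U V by (simp add: powr_divide c_def)
  then show ?thesis using c by (simp add: divide_le_cancel)
qed

section \<open>Prekopa-Leindler in R^d by induction on the dimension\<close>

text \<open>The weight \<open>t\<close> belongs to the first point, whereas in
  \<open>ext_convex\<close> it belongs to the second.\<close>

definition cmb :: "nat \<Rightarrow> real \<Rightarrow> (nat \<Rightarrow> real) \<Rightarrow> (nat \<Rightarrow> real) \<Rightarrow> nat \<Rightarrow> real" where
  "cmb d t x y = (\<lambda>i\<in>{..<d}. t * x i + (1 - t) * y i)"

lemma cmb_in_eucl [simp]: "cmb d t x y \<in> eucl d"
  by (simp add: cmb_def eucl_def)

lemma cmb_nth [simp]: "i < d \<Longrightarrow> cmb d t x y i = t * x i + (1 - t) * y i"
  by (simp add: cmb_def)

lemma eucl_undefined: "x \<in> eucl d \<Longrightarrow> \<not> i < d \<Longrightarrow> x i = undefined"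
  by (auto simp: eucl_def PiE_def extensional_def)

lemma eucl_eqI: "x \<in> eucl d \<Longrightarrow> y \<in> eucl d \<Longrightarrow> (\<And>i. i < d \<Longrightarrow> x i = y i) \<Longrightarrow> x = y"
  by (auto simp: eucl_def intro: PiE_ext)

lemma eucl_upd [intro]: "x \<in> eucl d \<Longrightarrow> i < d \<Longrightarrow> x(i := s) \<in> eucl d"
  by (auto simp: eucl_def PiE_def extensional_def)

lemma eucl_Suc_upd [simp]: "x \<in> eucl d \<Longrightarrow> x(d := s) \<in> eucl (Suc d)"
  by (auto simp: eucl_def PiE_def extensional_def)

lemma cmb_upd_Suc:
  "cmb (Suc d) t (x(d := r)) (y(d := s)) = (cmb d t x y)(d := t * r + (1 - t) * s)"
  by (auto simp: cmb_def fun_eq_iff)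

lemma leb_Suc: "leb (Suc d) = PiM (insert d {..<d}) (\<lambda>_. lborel)"
  by (simp add: leb_def lessThan_Suc)

interpretation leb: product_sigma_finite "\<lambda>_::nat. lborel :: real measure"
  by standard

lemma sigma_finite_leb: "sigma_finite_measure (leb d)"
  unfolding leb_def by (rule leb.sigma_finite) simp

lemma nn_integral_leb_Suc:
  assumes "f \<in> borel_measurable (leb (Suc d))"
  shows "(\<integral>\<^sup>+x. f x \<partial>leb (Suc d)) = (\<integral>\<^sup>+s. (\<integral>\<^sup>+x. f (x(d := s)) \<partial>leb d) \<partial>lborel)"
  using assms unfolding leb_Suc unfolding leb_def
  by (intro leb.product_nn_integral_insert_rev) auto

lemma measurable_leb_upd:
  "(\<lambda>p. (snd p)(d := fst p)) \<in> lborel \<Otimes>\<^sub>M leb d \<rightarrow>\<^sub>M leb (Suc d)"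
  unfolding leb_Suc unfolding leb_def by measurable

lemma measurable_leb_upd1:
  assumes "f \<in> borel_measurable (leb (Suc d))" shows "(\<lambda>x. f (x(d := s))) \<in> borel_measurable (leb d)"
proof -
  have "(\<lambda>x. (snd (s, x))(d := fst (s, x))) \<in> leb d \<rightarrow>\<^sub>M leb (Suc d)"
    by (rule measurable_compose[OF measurable_Pair1' measurable_leb_upd]) simp
  from measurable_compose[OF this assms] show ?thesis by simp
qed

definition boxed :: "nat \<Rightarrow> real \<Rightarrow> real \<Rightarrow> ((nat \<Rightarrow> real) \<Rightarrow> real) \<Rightarrow> bool" where
  "boxed d n R u \<longleftrightarrow> u \<in> borel_measurable (leb d) \<and>
     (\<forall>x\<in>eucl d. 0 \<le> u x \<and> u x \<le> n \<and> (u x \<noteq> 0 \<longrightarrow> (\<forall>i<d. \<bar>x i\<bar> \<le> R)))"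

lemma boxed_upd: "boxed (Suc d) n R u \<Longrightarrow> boxed d n R (\<lambda>x. u (x(d := s)))"
  unfolding boxed_def
proof (intro conjI ballI impI allI)
  assume u: "u \<in> borel_measurable (leb (Suc d)) \<and> (\<forall>x\<in>eucl (Suc d). 0 \<le> u x \<and> u x \<le> n \<and> (u x \<noteq> 0 \<longrightarrow> (\<forall>i<Suc d. \<bar>x i\<bar> \<le> R)))"
  show "(\<lambda>x. u (x(d := s))) \<in> borel_measurable (leb d)" using u by (intro measurable_leb_upd1) blast
  fix x assume x: "x \<in> eucl d"
  note ux = u[THEN conjunct2, rule_format, OF eucl_Suc_upd[OF x, of s]]
  show "0 \<le> u (x(d := s))" "u (x(d := s)) \<le> n" using ux by blast+
  fix i assume "u (x(d := s)) \<noteq> 0" "i < d"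
  then have "\<bar>(x(d := s)) i\<bar> \<le> R" using ux by (metis less_SucI)
  then show "\<bar>x i\<bar> \<le> R" using \<open>i < d\<close> by simp
qed

lemma boxed_nn_integral_le:
  assumes "boxed d n R u" "0 \<le> R" "0 \<le> n"
  shows "(\<integral>\<^sup>+x. ennreal (u x) \<partial>leb d) \<le> ennreal (n * (2 * R) ^ d)"
  using assms(1)
proof (induction d arbitrary: u)
  case 0
  then have "undefined \<in> eucl 0 \<Longrightarrow> u (\<lambda>_. undefined) \<le> n" by (auto simp: boxed_def eucl_def)
  have "(\<lambda>_. undefined) \<in> eucl 0" by (auto simp: eucl_def)
  then have "u (\<lambda>_. undefined) \<le> n" using 0 by (auto simp: boxed_def)
  then show ?case
    by (simp add: leb_def leb.nn_integral_empty ennreal_leI)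
next
  case (Suc d)
  have m: "(\<lambda>x. ennreal (u x)) \<in> borel_measurable (leb (Suc d))" using Suc.prems by (auto simp: boxed_def)
  have "(\<integral>\<^sup>+x. ennreal (u x) \<partial>leb (Suc d)) = (\<integral>\<^sup>+s. (\<integral>\<^sup>+x. ennreal (u (x(d := s))) \<partial>leb d) \<partial>lborel)"
    by (rule nn_integral_leb_Suc[OF m])
  also have "\<dots> \<le> (\<integral>\<^sup>+s. ennreal (n * (2 * R) ^ d) * indicator {-R..R} s \<partial>lborel)"
  proof (rule nn_integral_mono)
    fix s :: real
    show "(\<integral>\<^sup>+x. ennreal (u (x(d := s))) \<partial>leb d) \<le> ennreal (n * (2 * R) ^ d) * indicator {-R..R} s"
    proof (cases "\<bar>s\<bar> \<le> R")
      case True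
      then have ind: "indicator {-R..R} s = (1::ennreal)" by (simp add: indicator_def abs_le_iff)
      show ?thesis unfolding ind mult_1_right by (rule Suc.IH[OF boxed_upd[OF Suc.prems]])
    next
      case False
      have "u (x(d := s)) = 0" if "x \<in> eucl d" for x
        using Suc.prems False eucl_Suc_upd[OF that, of s] unfolding boxed_def
        by (metis fun_upd_same lessI)
      then have "(\<integral>\<^sup>+x. ennreal (u (x(d := s))) \<partial>leb d) = (\<integral>\<^sup>+x. 0 \<partial>leb d)"
        by (intro nn_integral_cong) (simp add: space_leb)
      then show ?thesis by simp
    qed
  qed
  also have "\<dots> = ennreal (n * (2 * R) ^ d) * ennreal (2 * R)"
    using assms by (subst nn_integral_cmult_indicator) auto
  also have "\<dots> = ennreal (n * (2 * R) ^ Suc d)" using assms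
    by (simp add: ennreal_mult[symmetric] mult_ac)
  finally show ?case .
qed

lemma boxed_mono_R: "boxed d n R u \<Longrightarrow> R \<le> R' \<Longrightarrow> n \<le> n' \<Longrightarrow> boxed d n' R' u"
  unfolding boxed_def by (meson order_trans)

lemma boxed_integrable:
  assumes "boxed d n R u" shows "integrable (leb d) u"
proof (rule integrableI_bounded)
  have "boxed d \<bar>n\<bar> \<bar>R\<bar> u" using assms by (rule boxed_mono_R) auto
  from boxed_nn_integral_le[OF this]
  have "(\<integral>\<^sup>+x. ennreal (u x) \<partial>leb d) < \<infinity>" by (simp add: le_less_trans)
  also have "(\<integral>\<^sup>+x. ennreal (u x) \<partial>leb d) = (\<integral>\<^sup>+x. ennreal (norm (u x)) \<partial>leb d)"
    using assms by (intro nn_integral_cong) (auto simp: boxed_def space_leb)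
  finally show "(\<integral>\<^sup>+x. ennreal (norm (u x)) \<partial>leb d) < \<infinity>" .
qed (use assms in \<open>auto simp: boxed_def\<close>)

text \<open>Integrating out the first \<open>d\<close> coordinates multiplies the height by at most
  the volume of a cube, so marginals stay in the class for which the one-dimensional inequality is
  proved.\<close>

lemma boxed_marginal:
  assumes u: "boxed (Suc d) n R u" and "0 \<le> R" "0 \<le> n"
  shows "boxed1 (n * (2 * R) ^ d) R (\<lambda>s. \<integral>x. u (x(d := s)) \<partial>leb d)"
    and "(\<integral>s. (\<integral>x. u (x(d := s)) \<partial>leb d) \<partial>lborel) = (\<integral>x. u x \<partial>leb (Suc d))"
proof -
  interpret L: sigma_finite_measure "leb d" by (rule sigma_finite_leb)
  let ?U = "\<lambda>s. \<integral>x. u (x(d := s)) \<partial>leb d"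
  have um[measurable]: "u \<in> borel_measurable (leb (Suc d))" using u by (simp add: boxed_def)
  have b: "boxed d n R (\<lambda>x. u (x(d := s)))" for s by (rule boxed_upd[OF u])
  have nn: "0 \<le> u x" if "x \<in> eucl (Suc d)" for x using u that by (auto simp: boxed_def)
  have eq: "(\<integral>\<^sup>+x. ennreal (u (x(d := s))) \<partial>leb d) = ennreal (?U s)" for s
    by (intro nn_integral_eq_integral boxed_integrable[OF b]) (auto simp: space_leb nn)
  have nnU: "0 \<le> ?U s" for s by (intro integral_nonneg_AE) (auto simp: space_leb nn)
  have "(\<lambda>p. u ((snd p)(d := fst p))) \<in> borel_measurable (lborel \<Otimes>\<^sub>M leb d)"
    by (rule measurable_compose[OF measurable_leb_upd um])
  then have m: "?U \<in> borel_measurable lborel"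
    by (intro L.borel_measurable_lebesgue_integral) (simp add: case_prod_unfold)
  have zero: "?U s = 0" if "\<not> \<bar>s\<bar> \<le> R" for s
  proof -
    have "u (x(d := s)) = 0" if "x \<in> eucl d" for x
      using u \<open>\<not> \<bar>s\<bar> \<le> R\<close> eucl_Suc_upd[OF that, of s] unfolding boxed_def
      by (metis fun_upd_same lessI)
    then have "?U s = (\<integral>x. 0 \<partial>leb d)"
      by (intro Bochner_Integration.integral_cong) (auto simp: space_leb)
    then show ?thesis by simp
  qed
  have "ennreal (?U s) \<le> ennreal (n * (2 * R) ^ d)" for s
    using boxed_nn_integral_le[OF b[of s]] assms eq by simp
  then have le: "?U s \<le> n * (2 * R) ^ d" for s using assms by (simp add: ennreal_le_iff)
  show b1: "boxed1 (n * (2 * R) ^ d) R ?U"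
    using m nnU zero le by (auto simp: boxed1_def)
  have "ennreal (\<integral>s. ?U s \<partial>lborel) = (\<integral>\<^sup>+s. ennreal (?U s) \<partial>lborel)"
    using boxed1_integrable[OF b1] nnU by (subst nn_integral_eq_integral) auto
  also have "\<dots> = (\<integral>\<^sup>+x. ennreal (u x) \<partial>leb (Suc d))"
    by (subst nn_integral_leb_Suc) (auto simp: eq)
  also have "\<dots> = ennreal (\<integral>x. u x \<partial>leb (Suc d))"
    using boxed_integrable[OF u] nn by (subst nn_integral_eq_integral) (auto simp: space_leb)
  finally show "(\<integral>s. ?U s \<partial>lborel) = (\<integral>x. u x \<partial>leb (Suc d))"
    using nnU nn by (subst (asm) ennreal_inj) (auto intro!: integral_nonneg_AE simp: space_leb)
qed

text \<open>For fixed last coordinates \<open>r\<close> and \<open>s\<close> the induction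
  hypothesis, applied to slices, is exactly the pointwise hypothesis of the one-dimensional
  inequality for the marginals. In dimension 0 the measure is a point mass and the claim is the
  hypothesis itself.\<close>

lemma prekopa_leindler_boxed:
  assumes "boxed d n R u" "boxed d n R v" "boxed d n R w" and t: "0 < t" "t < 1"
    and nR: "0 \<le> R" "0 \<le> n"
    and le: "\<And>x y. x \<in> eucl d \<Longrightarrow> y \<in> eucl d \<Longrightarrow> u x powr t * v y powr (1 - t) \<le> w (cmb d t x y)"
  shows "(\<integral>x. u x \<partial>leb d) powr t * (\<integral>x. v x \<partial>leb d) powr (1 - t) \<le> (\<integral>x. w x \<partial>leb d)"
  using assms(1-3) le
proof (induction d arbitrary: u v w)
  case 0
  let ?o = "\<lambda>_::nat. undefined :: real"
  have o: "?o \<in> eucl 0" by (auto simp: eucl_def)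
  have c: "cmb 0 t ?o ?o = ?o" by (auto simp: cmb_def)
  have i: "integral\<^sup>L (leb 0) f = f ?o" for f :: "_ \<Rightarrow> real"
    by (simp add: leb_def PiM_empty lebesgue_integral_count_space_finite)
  show ?case unfolding i using 0(4)[OF o o] unfolding c .
next
  case (Suc d)
  show ?case
    unfolding boxed_marginal(2)[OF Suc.prems(1) nR, symmetric] boxed_marginal(2)[OF Suc.prems(2) nR, symmetric]
      boxed_marginal(2)[OF Suc.prems(3) nR, symmetric]
  proof (rule prekopa_leindler_1d[OF boxed_marginal(1)[OF Suc.prems(1) nR] boxed_marginal(1)[OF Suc.prems(2) nR]
      boxed_marginal(1)[OF Suc.prems(3) nR] t])
    fix r s :: real
    show "(\<integral>x. u (x(d := r)) \<partial>leb d) powr t * (\<integral>x. v (x(d := s)) \<partial>leb d) powr (1 - t)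
       \<le> (\<integral>x. w (x(d := t * r + (1 - t) * s)) \<partial>leb d)"
    proof (rule Suc.IH[OF Suc.prems(1-3)[THEN boxed_upd]])
      fix x y assume "x \<in> eucl d" "y \<in> eucl d"
      then show "u (x(d := r)) powr t * v (y(d := s)) powr (1 - t) \<le> w ((cmb d t x y)(d := t * r + (1 - t) * s))"
        using Suc.prems(4)[OF eucl_Suc_upd eucl_Suc_upd, of x y r s] unfolding cmb_upd_Suc by blast
    qed
  qed
qed

text \<open>All three functions are cut at the same height \<open>n\<close> and restricted to the
  same cube. The pointwise hypothesis survives, since the cube is convex and a weighted geometric
  mean of numbers at most \<open>n\<close> is at most \<open>n\<close>. Dominated convergence
  removes the truncation.\<close>

theorem prekopa_leindler:
  assumes int: "integrable (leb d) u" "integrable (leb d) v" "integrable (leb d) w"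
    and nn: "\<And>x. x \<in> eucl d \<Longrightarrow> 0 \<le> u x" "\<And>x. x \<in> eucl d \<Longrightarrow> 0 \<le> v x" "\<And>x. x \<in> eucl d \<Longrightarrow> 0 \<le> w x"
    and t: "0 < t" "t < 1"
    and le: "\<And>x y. x \<in> eucl d \<Longrightarrow> y \<in> eucl d \<Longrightarrow> u x powr t * v y powr (1 - t) \<le> w (cmb d t x y)"
  shows "(\<integral>x. u x \<partial>leb d) powr t * (\<integral>x. v x \<partial>leb d) powr (1 - t) \<le> (\<integral>x. w x \<partial>leb d)"
proof -
  define Q where "Q n = {x \<in> eucl d. \<forall>i<d. \<bar>x i\<bar> \<le> real n}" for n
  define T where "T f n x = min (f x) (real n) * indicator (Q n) x" for f :: "(nat \<Rightarrow> real) \<Rightarrow> real" and n x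
  have Q[measurable]: "Q n \<in> sets (leb d)" for n
  proof -
    have "Q n = PiE {..<d} (\<lambda>_. {- real n..real n})"
      by (rule set_eqI) (simp add: Q_def eucl_def PiE_iff abs_le_iff minus_le_iff, blast)
    also have "\<dots> \<in> sets (leb d)" unfolding leb_def by (intro sets_PiM_I_finite) auto
    finally show ?thesis .
  qed
  have bx: "boxed d (real n) (real n) (T f n)"
    if "f \<in> borel_measurable (leb d)" "\<And>x. x \<in> eucl d \<Longrightarrow> 0 \<le> f x" for f n
    unfolding boxed_def
  proof (intro conjI ballI)
    have [measurable]: "f \<in> borel_measurable (leb d)" by (rule that)
    show "T f n \<in> borel_measurable (leb d)" unfolding T_def by measurable
    fix x assume x: "x \<in> eucl d"
    show "0 \<le> T f n x" "T f n x \<le> real n" using that(2)[OF x] by (simp_all add: T_def indicator_def)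
    show "T f n x \<noteq> 0 \<longrightarrow> (\<forall>i<d. \<bar>x i\<bar> \<le> real n)" by (simp add: T_def Q_def indicator_def)
  qed
  have conv: "(\<lambda>n. \<integral>x. T f n x \<partial>leb d) \<longlonglongrightarrow> (\<integral>x. f x \<partial>leb d)"
    if f: "integrable (leb d) f" "\<And>x. x \<in> eucl d \<Longrightarrow> 0 \<le> f x" for f
  proof (rule integral_dominated_convergence[where w = f])
    show "AE x in leb d. (\<lambda>n. T f n x) \<longlonglongrightarrow> f x"
    proof (rule AE_I2)
      fix x assume x: "x \<in> space (leb d)"
      define N where "N = nat \<lceil>\<bar>f x\<bar> + (\<Sum>i<d. \<bar>x i\<bar>)\<rceil>"
      have N: "\<bar>f x\<bar> + (\<Sum>i<d. \<bar>x i\<bar>) \<le> real N" unfolding N_def by linarith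
      have "T f n x = f x" if n: "N \<le> n" for n
      proof -
        have nN: "real N \<le> real n" using n by simp
        have "\<bar>x i\<bar> \<le> (\<Sum>i<d. \<bar>x i\<bar>)" if "i < d" for i
          using that by (intro member_le_sum) auto
        then have "\<bar>x i\<bar> \<le> real n" if "i < d" for i using N nN abs_ge_zero[of "f x"] that order_trans by (meson add_increasing)
        moreover have "f x \<le> real n" 
        proof -
          have "0 \<le> (\<Sum>i<d. \<bar>x i\<bar>)" by (rule sum_nonneg) simp
          then show ?thesis using N nN by linarith
        qed
        ultimately show ?thesis using x by (simp add: T_def Q_def space_leb)
      qed
      then show "(\<lambda>n. T f n x) \<longlonglongrightarrow> f x"
        by (intro tendsto_eventually) (auto simp: eventually_sequentially)
    qed
    show "AE x in leb d. norm (T f n x) \<le> f x" for n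
      using f(2) by (intro AE_I2) (auto simp: T_def indicator_def space_leb)
    show "f \<in> borel_measurable (leb d)" using f by auto
    then show "T f n \<in> borel_measurable (leb d)" for n unfolding T_def by measurable
  qed (use f in auto)
  have ineq: "(\<integral>x. T u n x \<partial>leb d) powr t * (\<integral>x. T v n x \<partial>leb d) powr (1 - t) \<le> (\<integral>x. T w n x \<partial>leb d)" for n
  proof (rule prekopa_leindler_boxed[OF bx bx bx t])
    fix x y assume xy: "x \<in> eucl d" "y \<in> eucl d"
    show "T u n x powr t * T v n y powr (1 - t) \<le> T w n (cmb d t x y)"
    proof (cases "x \<in> Q n \<and> y \<in> Q n")
      case True
      have "\<bar>t * x i + (1 - t) * y i\<bar> \<le> real n" if "i < d" for i
      proof -
        have "\<bar>t * x i + (1 - t) * y i\<bar> \<le> t * \<bar>x i\<bar> + (1 - t) * \<bar>y i\<bar>"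
          using t by (intro order_trans[OF abs_triangle_ineq]) (simp add: abs_mult)
        also have "\<dots> \<le> t * real n + (1 - t) * real n"
          using True that t by (intro add_mono mult_left_mono) (auto simp: Q_def)
        finally show ?thesis by (simp add: algebra_simps)
      qed
      then have c: "cmb d t x y \<in> Q n" by (auto simp: Q_def)
      let ?a = "min (u x) (real n)" and ?b = "min (v y) (real n)"
      have "?a powr t * ?b powr (1 - t) \<le> u x powr t * v y powr (1 - t)"
        using t nn xy by (intro mult_mono powr_mono2) auto
      moreover have "?a powr t * ?b powr (1 - t) \<le> real n powr t * real n powr (1 - t)"
        using t nn xy by (intro mult_mono powr_mono2) auto
      moreover have "real n powr t * real n powr (1 - t) \<le> real n"
        unfolding powr_add[symmetric] by simp
      ultimately show ?thesis using True c le[OF xy] by (simp add: T_def)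
    next
      case False
      then have "T u n x powr t * T v n y powr (1 - t) = 0" by (auto simp: T_def)
      moreover have "0 \<le> T w n (cmb d t x y)" using nn(3)[of "cmb d t x y"] by (simp add: T_def)
      ultimately show ?thesis by auto
    qed
  qed (use int nn in auto)
  have a: "(\<lambda>n. (\<integral>x. T u n x \<partial>leb d) powr t * (\<integral>x. T v n x \<partial>leb d) powr (1 - t))
      \<longlonglongrightarrow> (\<integral>x. u x \<partial>leb d) powr t * (\<integral>x. v x \<partial>leb d) powr (1 - t)"
  proof -
    have T0: "0 \<le> (\<integral>x. T f n x \<partial>leb d)" if "\<And>x. x \<in> eucl d \<Longrightarrow> 0 \<le> f x" for f n
      using that by (intro integral_nonneg_AE AE_I2) (simp add: T_def space_leb)
    have c: "(\<lambda>n. (\<integral>x. T f n x \<partial>leb d) powr e) \<longlonglongrightarrow> (\<integral>x. f x \<partial>leb d) powr e"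
      if "integrable (leb d) f" "\<And>x. x \<in> eucl d \<Longrightarrow> 0 \<le> f x" "0 < e" for f e
      by (rule tendsto_powr'[OF conv[OF that(1,2)] tendsto_const]) (use that(3) T0[OF that(2)] in auto)
    show ?thesis using t by (intro tendsto_mult c[OF int(1) nn(1)] c[OF int(2) nn(2)]) auto
  qed
  show ?thesis
    by (rule LIMSEQ_le[OF a conv[OF int(3) nn(3)]]) (use ineq in auto)
qed

section \<open>Logarithmic Sobolev and Poincare inequalities from displacement convexity\<close>

definition bfun :: "'a measure \<Rightarrow> ('a \<Rightarrow> real) \<Rightarrow> bool" where
  "bfun M f \<longleftrightarrow> f \<in> borel_measurable M \<and> (\<exists>B. \<forall>x\<in>space M. \<bar>f x\<bar> \<le> B)"

text \<open>An upper gradient up to a quadratic error. Unlike a gradient, it survives truncation and composition with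
  functions that are only Lipschitz, and first order expansions need nothing more.\<close>

definition slope :: "'a set \<Rightarrow> ('a \<Rightarrow> 'a \<Rightarrow> real) \<Rightarrow> ('a \<Rightarrow> real) \<Rightarrow> ('a \<Rightarrow> real) \<Rightarrow> bool" where
  "slope S r f G \<longleftrightarrow> (\<forall>x\<in>S. 0 \<le> G x) \<and>
     (\<exists>H\<ge>0. \<forall>x\<in>S. \<forall>z\<in>S. \<bar>f x - f z\<bar> \<le> G z * r x z + H * (r x z)\<^sup>2)"

lemma bfunI: "f \<in> borel_measurable M \<Longrightarrow> (\<And>x. x \<in> space M \<Longrightarrow> \<bar>f x\<bar> \<le> B) \<Longrightarrow> bfun M f"
  by (auto simp: bfun_def)

lemma bfun_meas [measurable_dest]: "bfun M f \<Longrightarrow> f \<in> borel_measurable M"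
  by (simp add: bfun_def)

lemma bfun_bound:
  assumes "bfun M f" obtains B where "0 < B" "\<And>x. x \<in> space M \<Longrightarrow> \<bar>f x\<bar> \<le> B"
proof -
  obtain B where "\<forall>x\<in>space M. \<bar>f x\<bar> \<le> B" using assms by (auto simp: bfun_def)
  then show ?thesis by (intro that[of "\<bar>B\<bar> + 1"]) force+
qed

lemma bfun_const [simp, intro]: "bfun M (\<lambda>x. c)"
  by (rule bfunI[of _ _ "\<bar>c\<bar>"]) auto

text \<open>Extension by 0 outside the closed set \<open>K\<close> keeps the function Borel, and the
  part of \<open>K\<close> that the bounded \<open>f\<close> can reach is compact. This covers
  functions such as the logarithm that are continuous only on part of the line.\<close>

lemma bfun_comp_cont:
  assumes "bfun M f" and ph: "continuous_on K \<phi>" "closed K" "\<And>x. x \<in> space M \<Longrightarrow> f x \<in> K"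
  shows "bfun M (\<lambda>x. \<phi> (f x))"
proof -
  obtain B where B: "0 < B" "\<And>x. x \<in> space M \<Longrightarrow> \<bar>f x\<bar> \<le> B" using bfun_bound[OF assms(1)] by blast
  let ?K = "K \<inter> {-B..B}"
  have "compact ?K" using ph by (intro closed_Int_compact) auto
  then have "compact (\<phi> ` ?K)" using ph by (intro compact_continuous_image) (auto intro: continuous_on_subset)
  then obtain C where C: "\<And>y. y \<in> \<phi> ` ?K \<Longrightarrow> \<bar>y\<bar> \<le> C" using compact_imp_bounded bounded_real by metis
  show ?thesis
  proof (rule bfunI)
    have f[measurable]: "f \<in> borel_measurable M" using assms(1) by (rule bfun_meas)
    have "(\<lambda>y. if y \<in> K then \<phi> y else 0) \<in> borel_measurable borel"
      using ph by (intro borel_measurable_continuous_on_if) auto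
    then have "(\<lambda>x. (\<lambda>y. if y \<in> K then \<phi> y else 0) (f x)) \<in> borel_measurable M"
      by (rule measurable_compose[OF f])
    then show "(\<lambda>x. \<phi> (f x)) \<in> borel_measurable M"
      by (rule subst[OF measurable_cong, rotated]) (simp add: ph)
    show "\<bar>\<phi> (f x)\<bar> \<le> C" if "x \<in> space M" for x
      using C[of "\<phi> (f x)"] B(2)[OF that] ph(3)[OF that] by (auto simp: abs_le_iff)
  qed
qed

lemma bfun_add [intro]: assumes "bfun M f" "bfun M g" shows "bfun M (\<lambda>x. f x + g x)"
proof -
  obtain B C where "\<And>x. x \<in> space M \<Longrightarrow> \<bar>f x\<bar> \<le> B" "\<And>x. x \<in> space M \<Longrightarrow> \<bar>g x\<bar> \<le> C"
    using bfun_bound assms by metis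
  then show ?thesis using assms
    by (intro bfunI[of _ _ "B + C"]) (auto intro: bfun_meas order_trans[OF abs_triangle_ineq] add_mono)
qed

lemma bfun_mult [intro]: assumes "bfun M f" "bfun M g" shows "bfun M (\<lambda>x. f x * g x)"
proof -
  obtain B C where "0 < B" "\<And>x. x \<in> space M \<Longrightarrow> \<bar>f x\<bar> \<le> B" "\<And>x. x \<in> space M \<Longrightarrow> \<bar>g x\<bar> \<le> C"
    using bfun_bound assms by metis
  then show ?thesis using assms
    by (intro bfunI[of _ _ "B * C"]) (auto simp: abs_mult intro: bfun_meas mult_mono)
qed

lemma bfun_cont [intro]: "bfun M f \<Longrightarrow> continuous_on UNIV \<phi> \<Longrightarrow> bfun M (\<lambda>x. \<phi> (f x))"
  by (rule bfun_comp_cont) auto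

lemma bfun_uminus [intro]: "bfun M f \<Longrightarrow> bfun M (\<lambda>x. - f x)"
  by (rule bfun_cont) (auto intro!: continuous_intros)

lemma bfun_diff [intro]: "bfun M f \<Longrightarrow> bfun M g \<Longrightarrow> bfun M (\<lambda>x. f x - g x)"
  using bfun_add[of M f "\<lambda>x. - g x"] by auto

lemma bfun_cdiv [intro]: "bfun M f \<Longrightarrow> bfun M (\<lambda>x. f x / c)"
  using bfun_mult[of M f "\<lambda>x. 1 / c"] by auto

lemma bfun_power [intro]: "bfun M f \<Longrightarrow> bfun M (\<lambda>x. f x ^ n)"
  by (rule bfun_cont) (auto intro!: continuous_intros)

lemma bfun_abs [intro]: "bfun M f \<Longrightarrow> bfun M (\<lambda>x. \<bar>f x\<bar>)"
  by (rule bfun_cont) (auto intro!: continuous_intros)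

lemma bfun_exp [intro]: "bfun M f \<Longrightarrow> bfun M (\<lambda>x. exp (f x))"
  by (rule bfun_cont) (auto intro!: continuous_intros)

lemma bfun_ln: "bfun M f \<Longrightarrow> 0 < c \<Longrightarrow> (\<And>x. x \<in> space M \<Longrightarrow> c \<le> f x) \<Longrightarrow> bfun M (\<lambda>x. ln (f x))"
  by (rule bfun_comp_cont[where K = "{c..}"]) (auto intro!: continuous_intros)

lemma bfun_divide: "bfun M g \<Longrightarrow> bfun M f \<Longrightarrow> 0 < c \<Longrightarrow> (\<And>x. x \<in> space M \<Longrightarrow> c \<le> f x) \<Longrightarrow> bfun M (\<lambda>x. g x / f x)"
  using bfun_mult[of M g "\<lambda>x. 1 / f x"] bfun_comp_cont[of M f "{c..}" "\<lambda>y. 1 / y"]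
  by (force intro!: continuous_intros)

lemma (in finite_measure) bfun_integrable [intro]: assumes "bfun M f" shows "integrable M f"
proof -
  obtain B where "\<And>x. x \<in> space M \<Longrightarrow> \<bar>f x\<bar> \<le> B" using bfun_bound[OF assms] by metis
  then show ?thesis using assms by (intro integrable_const_bound[of _ B]) (auto intro: bfun_meas)
qed

lemma slopeI:
  "(\<And>x. x \<in> S \<Longrightarrow> 0 \<le> G x) \<Longrightarrow> 0 \<le> H \<Longrightarrow>
   (\<And>x z. x \<in> S \<Longrightarrow> z \<in> S \<Longrightarrow> \<bar>f x - f z\<bar> \<le> G z * r x z + H * (r x z)\<^sup>2) \<Longrightarrow> slope S r f G"
  by (auto simp: slope_def)

lemma slopeE:
  assumes "slope S r f G"
  obtains H where "0 \<le> H" "\<And>x. x \<in> S \<Longrightarrow> 0 \<le> G x"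
    "\<And>x z. x \<in> S \<Longrightarrow> z \<in> S \<Longrightarrow> \<bar>f x - f z\<bar> \<le> G z * r x z + H * (r x z)\<^sup>2"
  using assms by (auto simp: slope_def)

text \<open>The same \<open>G\<close> and the same error constant work. Truncations, absolute values
  and shifts are all instances.\<close>

lemma slope_contraction:
  assumes "slope S r f G" "\<And>s t. \<bar>\<phi> s - \<phi> t\<bar> \<le> \<bar>s - t\<bar>"
  shows "slope S r (\<lambda>x. \<phi> (f x)) G"
  using assms(1) by (rule slopeE) (rule slopeI, auto intro: order_trans[OF assms(2)])

lemma slope_cmult: assumes "slope S r f G" shows "slope S r (\<lambda>x. c * f x) (\<lambda>x. \<bar>c\<bar> * G x)"
  using assms
proof (rule slopeE)
  fix H assume H: "0 \<le> H" "\<And>x. x \<in> S \<Longrightarrow> 0 \<le> G x"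
    "\<And>x z. x \<in> S \<Longrightarrow> z \<in> S \<Longrightarrow> \<bar>f x - f z\<bar> \<le> G z * r x z + H * (r x z)\<^sup>2"
  show ?thesis
  proof (rule slopeI[where H = "\<bar>c\<bar> * H"])
    fix x z assume "x \<in> S" "z \<in> S"
    have "\<bar>c * f x - c * f z\<bar> = \<bar>c\<bar> * \<bar>f x - f z\<bar>" by (simp flip: abs_mult right_diff_distrib)
    also have "\<dots> \<le> \<bar>c\<bar> * (G z * r x z + H * (r x z)\<^sup>2)"
      using H(3)[OF \<open>x \<in> S\<close> \<open>z \<in> S\<close>] by (intro mult_left_mono) auto
    finally show "\<bar>c * f x - c * f z\<bar> \<le> \<bar>c\<bar> * G z * r x z + \<bar>c\<bar> * H * (r x z)\<^sup>2" by (simp add: algebra_simps)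
  qed (use H in auto)
qed

lemma slope_shift: "slope S r f G \<Longrightarrow> slope S r (\<lambda>x. f x + c) G"
  by (rule slope_contraction) auto

locale bounded_space = prob_space M for M :: "'a measure" +
  fixes r :: "'a \<Rightarrow> 'a \<Rightarrow> real" and diam :: real
  assumes r_nonneg: "x \<in> space M \<Longrightarrow> y \<in> space M \<Longrightarrow> 0 \<le> r x y"
    and r_diam: "x \<in> space M \<Longrightarrow> y \<in> space M \<Longrightarrow> r x y \<le> diam"
begin

abbreviation "E f \<equiv> integral\<^sup>L M f"
abbreviation "sl \<equiv> slope (space M) r"

lemma diam_nonneg: "0 \<le> diam"
  using r_nonneg r_diam not_empty by (meson ex_in_conv order_trans)

lemma E_mono:
  "bfun M f \<Longrightarrow> bfun M g \<Longrightarrow> (\<And>x. x \<in> space M \<Longrightarrow> f x \<le> g x) \<Longrightarrow> E f \<le> E g"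
  by (intro integral_mono) auto

lemma E_nonneg: fixes f :: "'a \<Rightarrow> real" assumes "\<And>x. x \<in> space M \<Longrightarrow> 0 \<le> f x" shows "0 \<le> E f"
  by (intro integral_nonneg_AE AE_I2 assms)

lemma E_add: "bfun M f \<Longrightarrow> bfun M g \<Longrightarrow> E (\<lambda>x. f x + g x) = E f + E g"
  by (intro Bochner_Integration.integral_add) auto

lemma E_diff: "bfun M f \<Longrightarrow> bfun M g \<Longrightarrow> E (\<lambda>x. f x - g x) = E f - E g"
  by (intro Bochner_Integration.integral_diff) auto

lemma E_const [simp]: "E (\<lambda>x. c :: real) = c" and prob_one [simp]: "prob (space M) = 1"
  by (simp_all add: prob_space)

lemma E_exp_pos: assumes "bfun M f" shows "0 < E (\<lambda>x. exp (f x))"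
proof -
  obtain B where B: "\<And>x. x \<in> space M \<Longrightarrow> \<bar>f x\<bar> \<le> B" using bfun_bound[OF assms] by metis
  have "E (\<lambda>x. exp (- B)) \<le> E (\<lambda>x. exp (f x))"
    using assms B by (intro E_mono) (auto simp: abs_le_iff, force)
  then show ?thesis by (simp add: less_le_trans[OF exp_gt_zero])
qed

text \<open>A finite diameter absorbs the quadratic error into a linear one. The resulting constant
  serves only to bound products of increments, so it ends up in quadratic error terms and never in a
  final constant.\<close>

lemma slope_lip_bound:
  assumes "bfun M G" "sl f G"
  obtains C where "0 \<le> C" "\<And>x z. x \<in> space M \<Longrightarrow> z \<in> space M \<Longrightarrow> \<bar>f x - f z\<bar> \<le> C * r x z"
proof -
  obtain H where H: "0 \<le> H" "\<And>x. x \<in> space M \<Longrightarrow> 0 \<le> G x"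
    "\<And>x z. x \<in> space M \<Longrightarrow> z \<in> space M \<Longrightarrow> \<bar>f x - f z\<bar> \<le> G z * r x z + H * (r x z)\<^sup>2"
    using slopeE[OF assms(2)] by metis
  obtain B where B: "0 < B" "\<And>x. x \<in> space M \<Longrightarrow> \<bar>G x\<bar> \<le> B" using bfun_bound[OF assms(1)] by metis
  show ?thesis
  proof
    show "0 \<le> B + H * diam" using B H diam_nonneg by simp
    fix x z assume xz: "x \<in> space M" "z \<in> space M"
    have "G z * r x z \<le> B * r x z" using B(2)[OF xz(2)] r_nonneg[OF xz] by (intro mult_right_mono) auto
    moreover have "H * (r x z)\<^sup>2 \<le> H * (diam * r x z)"
      unfolding power2_eq_square using r_nonneg[OF xz] r_diam[OF xz] H by (intro mult_left_mono mult_right_mono) auto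
    ultimately show "\<bar>f x - f z\<bar> \<le> (B + H * diam) * r x z" using H(3)[OF xz] by (simp add: algebra_simps)
  qed
qed

lemma slope_mult:
  assumes "bfun M f" "bfun M g" "bfun M F" "bfun M G" "sl f F" "sl g G"
  shows "sl (\<lambda>x. f x * g x) (\<lambda>x. \<bar>f x\<bar> * G x + \<bar>g x\<bar> * F x)"
proof -
  obtain H where H: "0 \<le> H" "\<And>x. x \<in> space M \<Longrightarrow> 0 \<le> F x"
    "\<And>x z. x \<in> space M \<Longrightarrow> z \<in> space M \<Longrightarrow> \<bar>f x - f z\<bar> \<le> F z * r x z + H * (r x z)\<^sup>2"
    using slopeE[OF assms(5)] by metis
  obtain K where K: "0 \<le> K" "\<And>x. x \<in> space M \<Longrightarrow> 0 \<le> G x"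
    "\<And>x z. x \<in> space M \<Longrightarrow> z \<in> space M \<Longrightarrow> \<bar>g x - g z\<bar> \<le> G z * r x z + K * (r x z)\<^sup>2"
    using slopeE[OF assms(6)] by metis
  obtain B where B: "0 < B" "\<And>x. x \<in> space M \<Longrightarrow> \<bar>f x\<bar> \<le> B" using bfun_bound[OF assms(1)] by metis
  obtain C where C: "0 < C" "\<And>x. x \<in> space M \<Longrightarrow> \<bar>g x\<bar> \<le> C" using bfun_bound[OF assms(2)] by metis
  obtain P where P: "0 \<le> P" "\<And>x z. x \<in> space M \<Longrightarrow> z \<in> space M \<Longrightarrow> \<bar>f x - f z\<bar> \<le> P * r x z"
    using slope_lip_bound[OF assms(3,5)] by metis
  obtain Q where Q: "0 \<le> Q" "\<And>x z. x \<in> space M \<Longrightarrow> z \<in> space M \<Longrightarrow> \<bar>g x - g z\<bar> \<le> Q * r x z"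
    using slope_lip_bound[OF assms(4,6)] by metis
  show ?thesis
  proof (rule slopeI)
    show "0 \<le> B * K + C * H + P * Q" using B C H K P Q by simp
    fix x z assume xz: "x \<in> space M" "z \<in> space M"
    have "\<bar>f x * g x - f z * g z\<bar> = \<bar>f z * (g x - g z) + g z * (f x - f z) + (f x - f z) * (g x - g z)\<bar>"
      by (simp add: algebra_simps)
    also have "\<dots> \<le> \<bar>f z\<bar> * \<bar>g x - g z\<bar> + \<bar>g z\<bar> * \<bar>f x - f z\<bar> + \<bar>f x - f z\<bar> * \<bar>g x - g z\<bar>"
      by (metis (no_types, opaque_lifting) abs_mult abs_triangle_ineq add_mono_thms_linordered_semiring(3) order_trans)
    also have "\<bar>f x - f z\<bar> * \<bar>g x - g z\<bar> \<le> (P * r x z) * (Q * r x z)"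
      using P Q xz r_nonneg by (intro mult_mono) auto
    also have "\<bar>f z\<bar> * \<bar>g x - g z\<bar> \<le> \<bar>f z\<bar> * (G z * r x z) + B * (K * (r x z)\<^sup>2)"
    proof -
      have "\<bar>f z\<bar> * \<bar>g x - g z\<bar> \<le> \<bar>f z\<bar> * (G z * r x z + K * (r x z)\<^sup>2)" using K xz by (intro mult_left_mono) auto
      moreover have "\<bar>f z\<bar> * (K * (r x z)\<^sup>2) \<le> B * (K * (r x z)\<^sup>2)" using B K xz by (intro mult_right_mono) auto
      ultimately show ?thesis by (simp add: algebra_simps)
    qed
    also have "\<bar>g z\<bar> * \<bar>f x - f z\<bar> \<le> \<bar>g z\<bar> * (F z * r x z) + C * (H * (r x z)\<^sup>2)"
    proof -
      have "\<bar>g z\<bar> * \<bar>f x - f z\<bar> \<le> \<bar>g z\<bar> * (F z * r x z + H * (r x z)\<^sup>2)" using H xz by (intro mult_left_mono) auto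
      moreover have "\<bar>g z\<bar> * (H * (r x z)\<^sup>2) \<le> C * (H * (r x z)\<^sup>2)" using C H xz by (intro mult_right_mono) auto
      ultimately show ?thesis by (simp add: algebra_simps)
    qed
    finally show "\<bar>f x * g x - f z * g z\<bar> \<le> (\<bar>f z\<bar> * G z + \<bar>g z\<bar> * F z) * r x z
        + (B * K + C * H + P * Q) * (r x z)\<^sup>2"
      by (simp add: algebra_simps power2_eq_square)
  qed (use H K in auto)
qed

text \<open>A chain rule in which \<open>\<phi>\<close> is a function on the space, not on the line:
  only its increments along values of \<open>f\<close> need control. This allows outer functions
  that are regular only on the range of \<open>f\<close>.\<close>

lemma slope_comp:
  assumes "bfun M G" "sl f G" and C: "0 \<le> C" and D0: "\<And>z. z \<in> space M \<Longrightarrow> 0 \<le> D z"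
    and D: "bfun M D"
    and ph: "\<And>x z. x \<in> space M \<Longrightarrow> z \<in> space M \<Longrightarrow>
        \<bar>\<phi> x - \<phi> z\<bar> \<le> D z * \<bar>f x - f z\<bar> + C * \<bar>f x - f z\<bar>\<^sup>2"
  shows "sl \<phi> (\<lambda>x. D x * G x)"
proof -
  obtain H where H: "0 \<le> H" "\<And>x. x \<in> space M \<Longrightarrow> 0 \<le> G x"
    "\<And>x z. x \<in> space M \<Longrightarrow> z \<in> space M \<Longrightarrow> \<bar>f x - f z\<bar> \<le> G z * r x z + H * (r x z)\<^sup>2"
    using slopeE[OF assms(2)] by metis
  obtain B where B: "0 < B" "\<And>x. x \<in> space M \<Longrightarrow> \<bar>D x\<bar> \<le> B" using bfun_bound[OF D] by metis
  obtain P where P: "0 \<le> P" "\<And>x z. x \<in> space M \<Longrightarrow> z \<in> space M \<Longrightarrow> \<bar>f x - f z\<bar> \<le> P * r x z"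
    using slope_lip_bound[OF assms(1,2)] by metis
  show ?thesis
  proof (rule slopeI)
    show "0 \<le> B * H + C * P\<^sup>2" using B H C by simp
    fix x z assume xz: "x \<in> space M" "z \<in> space M"
    have "\<bar>f x - f z\<bar>\<^sup>2 \<le> (P * r x z)\<^sup>2" using P(2)[OF xz] by (intro power_mono) auto
    then have 1: "C * \<bar>f x - f z\<bar>\<^sup>2 \<le> C * (P * r x z)\<^sup>2" using C by (intro mult_left_mono) auto
    have 2: "D z * \<bar>f x - f z\<bar> \<le> D z * (G z * r x z + H * (r x z)\<^sup>2)"
      using H xz D0 by (intro mult_left_mono) auto
    have 3: "D z * (H * (r x z)\<^sup>2) \<le> B * (H * (r x z)\<^sup>2)" using B(2)[OF xz(2)] H by (intro mult_right_mono) auto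
    show "\<bar>\<phi> x - \<phi> z\<bar> \<le> D z * G z * r x z + (B * H + C * P\<^sup>2) * (r x z)\<^sup>2"
      using ph[OF xz] 1 2 3 by (simp add: algebra_simps power_mult_distrib)
  qed (use H D0 in auto)
qed

end

text \<open>Prekopa-Leindler for a measure whose density is the exponential of an L-Lipschitz function times an \<alpha>-strongly
  log-concave one; the Lipschitz factor costs at most 2 L t (1 - t) r.\<close>

locale displacement = bounded_space +
  fixes cmb :: "real \<Rightarrow> 'a \<Rightarrow> 'a \<Rightarrow> 'a" and \<alpha> L :: real
  assumes alpha: "0 < \<alpha>" and L: "0 \<le> L"
    and cmb_space: "0 < t \<Longrightarrow> t < 1 \<Longrightarrow> x \<in> space M \<Longrightarrow> y \<in> space M \<Longrightarrow> cmb t x y \<in> space M"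
    and r_cmb_left: "0 < t \<Longrightarrow> t < 1 \<Longrightarrow> x \<in> space M \<Longrightarrow> y \<in> space M \<Longrightarrow> r x (cmb t x y) = (1 - t) * r x y"
    and r_cmb_right: "0 < t \<Longrightarrow> t < 1 \<Longrightarrow> x \<in> space M \<Longrightarrow> y \<in> space M \<Longrightarrow> r y (cmb t x y) = t * r x y"
    and pl: "0 < t \<Longrightarrow> t < 1 \<Longrightarrow> bfun M U \<Longrightarrow> bfun M V \<Longrightarrow> bfun M W \<Longrightarrow>
      (\<And>x y. x \<in> space M \<Longrightarrow> y \<in> space M \<Longrightarrow>
         t * U x + (1 - t) * V y + 2 * L * t * (1 - t) * r x y
           \<le> W (cmb t x y) + \<alpha> / 2 * t * (1 - t) * (r x y)\<^sup>2) \<Longrightarrow>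
      (integral\<^sup>L M (\<lambda>x. exp (U x))) powr t * (integral\<^sup>L M (\<lambda>x. exp (V x))) powr (1 - t)
        \<le> integral\<^sup>L M (\<lambda>x. exp (W x))"
begin

text \<open>Completing the square. This is how the distance is eliminated from the displacement
  hypotheses in \<open>lsi_step\<close>, \<open>poincare_base\<close> and
  \<open>exp_moments\<close>.\<close>

lemma quadratic_bound:
  fixes c k p :: real assumes "0 < k" shows "c * p - k / 2 * p\<^sup>2 \<le> c\<^sup>2 / (2 * k)"
proof -
  have "0 \<le> (c - k * p)\<^sup>2 / (2 * k)" using assms by simp
  also have "(c - k * p)\<^sup>2 / (2 * k) = c\<^sup>2 / (2 * k) - (c * p - k / 2 * p\<^sup>2)"
    using assms by (simp add: field_simps power2_eq_square)
  finally show ?thesis by simp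
qed

lemma half_square_quotient: "(a / 2)\<^sup>2 / (2 * (k / 8)) = a\<^sup>2 / k" for a k :: real
  by (cases "k = 0") (simp_all add: field_simps power2_eq_square)

text \<open>Prekopa-Leindler with weight 1 - s on exp (g / (1 - s)), weight s on the constant 1, and
  W = g + s q Q, where Q is the density (G + 2 L)^2 / (2 \<alpha>). Both sides equal 1 at s = 0; to
  first order in s the left grows by the entropy and the right by the mean of exp g times Q. The
  factor \<open>q\<close> collects the loss of curvature, by 1 - s and by the slope error
  \<open>H\<close>, and tends to 1.\<close>

lemma lsi_step:
  assumes g: "bfun M g" "bfun M G" "\<And>x. x \<in> space M \<Longrightarrow> 0 \<le> G x" and H: "0 \<le> H"
    and gH: "\<And>x z. x \<in> space M \<Longrightarrow> z \<in> space M \<Longrightarrow> \<bar>g x - g z\<bar> \<le> G z * r x z + H * (r x z)\<^sup>2"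
    and one: "E (\<lambda>x. exp (g x)) = 1"
    and B: "\<And>x. x \<in> space M \<Longrightarrow> (G x + 2 * L)\<^sup>2 / (2 * \<alpha>) \<le> B"
    and s: "0 < s" "s < 1" "0 < \<alpha> * (1 - s) - 2 * H * s"
  defines "q \<equiv> \<alpha> / (\<alpha> * (1 - s) - 2 * H * s)"
  defines "ent \<equiv> E (\<lambda>x. g x * exp (g x))"
  shows "ent / (1 + s / (1 - s) * ent)
    \<le> q * exp (s * q * B) * E (\<lambda>x. exp (g x) * ((G x + 2 * L)\<^sup>2 / (2 * \<alpha>)))" (is "_ \<le> _ * E (\<lambda>x. _ * ?Q x)")
proof -
  have q: "0 < q" using s alpha by (simp add: q_def)
  have Qb: "bfun M ?Q" using g by (intro bfun_cdiv bfun_power bfun_add) auto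
  have Q0: "0 \<le> ?Q x" for x using alpha by simp
  have B0: "0 \<le> B" using B Q0 not_empty by (meson ex_in_conv order_trans)
  have "E (\<lambda>x. exp (g x)) - 1 \<le> ent"
  proof -
    have "exp (g x) - 1 \<le> g x * exp (g x)" for x
    proof -
      have "1 - g x \<le> exp (- g x)" using exp_ge_add_one_self[of "- g x"] by simp
      then have "(1 - g x) * exp (g x) \<le> exp (- g x) * exp (g x)" by (intro mult_right_mono) auto
      then show ?thesis by (simp add: algebra_simps flip: exp_add)
    qed
    then have "E (\<lambda>x. exp (g x) - 1) \<le> ent" unfolding ent_def using g by (intro E_mono) auto
    then show ?thesis using g by (subst (asm) E_diff) auto
  qed
  then have Ent0: "0 \<le> ent" using one by simp
  let ?t = "1 - s"
  have bW: "bfun M (\<lambda>x. g x + s * q * ?Q x)" using g Qb by (intro bfun_add bfun_mult bfun_const)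
  have "(E (\<lambda>x. exp (g x / ?t))) powr ?t * (E (\<lambda>x. exp 0)) powr (1 - ?t) \<le> E (\<lambda>x. exp (g x + s * q * ?Q x))"
  proof (rule pl)
    fix x y assume xy: "x \<in> space M" "y \<in> space M"
    let ?z = "cmb ?t x y" and ?p = "r x y"
    have z: "?z \<in> space M" using cmb_space[of ?t] s xy by simp
    have rz: "r x ?z = s * ?p" using r_cmb_left[of ?t] s xy by simp
    have p: "0 \<le> ?p" using r_nonneg xy by simp
    \<comment> \<open>The slope is evaluated at the interpolated point, whose distance from
      \<open>x\<close> is only s \<open>?p\<close>; the error term is therefore of order s^2 and can
      be charged to the curvature.\<close>
    have 1: "g x \<le> g ?z + G ?z * (s * ?p) + H * (s * ?p)\<^sup>2" using gH[OF xy(1) z] rz by auto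
    have "(G ?z + 2 * L) * ?p - (\<alpha> * ?t - 2 * H * s) / 2 * ?p\<^sup>2 \<le> (G ?z + 2 * L)\<^sup>2 / (2 * (\<alpha> * ?t - 2 * H * s))"
      using s by (intro quadratic_bound) auto
    also have "\<dots> = q * ?Q ?z" using alpha by (simp add: q_def)
    finally have "s * ((G ?z + 2 * L) * ?p - (\<alpha> * ?t - 2 * H * s) / 2 * ?p\<^sup>2) \<le> s * (q * ?Q ?z)"
      using s by (intro mult_left_mono) auto
    moreover have "L * (1 - s) * (s * ?p) \<le> L * 1 * (s * ?p)" using L s p by (intro mult_right_mono mult_left_mono) auto
    moreover define Qz where "Qz = ?Q ?z"
    ultimately have P: "0 \<le> s * (q * Qz) - s * ((G ?z + 2 * L) * ?p - (\<alpha> * ?t - 2 * H * s) / 2 * ?p\<^sup>2)"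
      "0 \<le> 2 * (L * 1 * (s * ?p) - L * (1 - s) * (s * ?p))" by simp_all
    have Q: "0 \<le> g ?z + G ?z * (s * ?p) + H * (s * ?p)\<^sup>2 - g x" using 1 by simp
    have "(g ?z + s * q * Qz + \<alpha> / 2 * ?t * (1 - ?t) * ?p\<^sup>2) - (g x + (1 - ?t) * 0 + 2 * L * ?t * (1 - ?t) * ?p)
      = (s * (q * Qz) - s * ((G ?z + 2 * L) * ?p - (\<alpha> * ?t - 2 * H * s) / 2 * ?p\<^sup>2))
       + (g ?z + G ?z * (s * ?p) + H * (s * ?p)\<^sup>2 - g x) + 2 * (L * 1 * (s * ?p) - L * (1 - s) * (s * ?p))"
      by (simp add: field_simps power2_eq_square)
    also have "0 \<le> \<dots>" by (intro add_nonneg_nonneg P Q)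
    finally have "g x + (1 - ?t) * 0 + 2 * L * ?t * (1 - ?t) * ?p \<le> g ?z + s * q * Qz + \<alpha> / 2 * ?t * (1 - ?t) * ?p\<^sup>2"
      by (simp only: diff_ge_0_iff_ge)
    moreover have "?t * (g x / ?t) = g x" using s by simp
    ultimately show "?t * (g x / ?t) + (1 - ?t) * 0 + 2 * L * ?t * (1 - ?t) * ?p
       \<le> g ?z + s * q * ?Q ?z + \<alpha> / 2 * ?t * (1 - ?t) * ?p\<^sup>2"
      unfolding Qz_def[symmetric] by presburger
  qed (use s g bW in auto)
  then have main: "(E (\<lambda>x. exp (g x / ?t))) powr ?t \<le> E (\<lambda>x. exp (g x + s * q * ?Q x))" by simp
  have e1: "1 + s / ?t * ent \<le> E (\<lambda>x. exp (g x / ?t))"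
  proof -
    have eq: "exp (g x / ?t) = exp (g x) * exp (s / ?t * g x)" for x
      using s by (simp flip: exp_add) (simp add: field_simps)
    have b1: "bfun M (\<lambda>x. exp (g x) + s / ?t * (g x * exp (g x)))" and b2: "bfun M (\<lambda>x. exp (g x / ?t))"
      by (intro bfun_add bfun_mult bfun_cdiv bfun_exp bfun_const g)+
    have "E (\<lambda>x. exp (g x) + s / ?t * (g x * exp (g x))) \<le> E (\<lambda>x. exp (g x / ?t))"
    proof (rule E_mono[OF b1 b2])
      fix x
      have "exp (g x) * (1 + s / ?t * g x) \<le> exp (g x) * exp (s / ?t * g x)"
        by (intro mult_left_mono exp_ge_add_one_self) auto
      then show "exp (g x) + s / ?t * (g x * exp (g x)) \<le> exp (g x / ?t)"
        unfolding eq by (simp add: algebra_simps)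
    qed
    moreover have "E (\<lambda>x. exp (g x) + s / ?t * (g x * exp (g x))) = 1 + s / ?t * ent"
      using E_add[OF bfun_exp[OF g(1)] bfun_mult[OF bfun_const bfun_mult[OF g(1) bfun_exp[OF g(1)]]], of "s / ?t"]
      by (simp add: one ent_def)
    ultimately show ?thesis by simp
  qed
  have pos: "0 < 1 + s / ?t * ent" using Ent0 s by (simp add: add_pos_nonneg)
  let ?X = "E (\<lambda>x. exp (g x / ?t))"
  have X: "0 < ?X" using e1 pos by simp
  let ?y = "s / ?t * ent"
  have y: "0 \<le> ?y" using Ent0 s by simp
  \<comment> \<open>A rational lower bound for the logarithm. It is the source of the denominator in
    the conclusion, which tends to 1 with s tending to 0.\<close>
  have "?y / (1 + ?y) \<le> ln (1 + ?y)"
  proof -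
    have "- ln (1 + ?y) = ln (1 / (1 + ?y))" using y by (simp add: ln_div)
    also have "\<dots> \<le> 1 / (1 + ?y) - 1" using y by (intro ln_le_minus_one) auto
    also have "\<dots> = - (?y / (1 + ?y))"
    proof -
      have "1 / (1 + z) - 1 = - (z / (1 + z))" if "0 \<le> z" for z :: real using that by (simp add: field_simps)
      from this[OF y] show ?thesis .
    qed
    finally show ?thesis by simp
  qed
  also have "\<dots> \<le> ln ?X" using e1 pos by (subst ln_le_cancel_iff) auto
  finally have "?t * (?y / (1 + ?y)) \<le> ?t * ln ?X" using s by (intro mult_left_mono) auto
  moreover have "1 + ?t * ln ?X \<le> ?X powr ?t"
    using X exp_ge_add_one_self[of "?t * ln ?X"] by (simp add: powr_def)
  ultimately have l: "1 + ?t * (?y / (1 + ?y)) \<le> ?X powr ?t" by linarith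
  have "?t * ?y = s * ent" using s by simp
  then have l: "1 + s * (ent / (1 + ?y)) \<le> ?X powr ?t" using l by (metis times_divide_eq_right)
  have "E (\<lambda>x. exp (g x + s * q * ?Q x)) \<le> E (\<lambda>x. exp (g x) + s * q * exp (s * q * B) * (exp (g x) * ?Q x))"
  proof (rule E_mono)
    fix x assume x: "x \<in> space M"
    let ?k = "s * q * ?Q x"
    have k: "0 \<le> ?k" by (intro mult_nonneg_nonneg Q0) (use s q in auto)
    have "1 - ?k \<le> exp (- ?k)" using exp_ge_add_one_self[of "- ?k"] by simp
    then have "(1 - ?k) * exp ?k \<le> exp (- ?k) * exp ?k" by (intro mult_right_mono) auto
    then have "exp ?k \<le> 1 + ?k * exp ?k" by (simp add: algebra_simps flip: exp_add)
    also have "\<dots> \<le> 1 + ?k * exp (s * q * B)" using k s q mult_left_mono[OF B[OF x], of "s * q"] by (intro add_left_mono mult_left_mono) (simp_all only: exp_le_cancel_iff, auto)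
    finally have "exp (g x) * exp ?k \<le> exp (g x) * (1 + ?k * exp (s * q * B))" by (intro mult_left_mono) auto
    then show "exp (g x + ?k) \<le> exp (g x) + s * q * exp (s * q * B) * (exp (g x) * ?Q x)"
      by (simp add: exp_add algebra_simps)
  qed (rule bfun_exp[OF bW], rule bfun_add[OF bfun_exp[OF g(1)] bfun_mult[OF bfun_const bfun_mult[OF bfun_exp[OF g(1)] Qb]]])
  also have "\<dots> = 1 + s * q * exp (s * q * B) * E (\<lambda>x. exp (g x) * ?Q x)"
    using E_add[OF bfun_exp[OF g(1)] bfun_mult[OF bfun_const bfun_mult[OF bfun_exp[OF g(1)] Qb]], of "s * q * exp (s * q * B)"]
    unfolding one integral_mult_right_zero .
  finally have "s * (ent / (1 + ?y)) \<le> s * (q * exp (s * q * B) * E (\<lambda>x. exp (g x) * ?Q x))"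
    using l main by (simp add: algebra_simps)
  then show ?thesis by (rule mult_left_le_imp_le) (use s in simp)
qed

text \<open>Limit of \<open>lsi_step\<close> for s tending to 0 from the right: the denominator,
  \<open>q\<close> and the exponential factor all tend to 1, and the error constant \<open>H\<close>
  disappears.\<close>

lemma lsi_exp:
  assumes g: "bfun M g" "bfun M G" "sl g G" and one: "E (\<lambda>x. exp (g x)) = 1"
  shows "E (\<lambda>x. g x * exp (g x)) \<le> E (\<lambda>x. exp (g x) * ((G x + 2 * L)\<^sup>2 / (2 * \<alpha>)))" (is "?Ent \<le> ?J")
proof -
  obtain H where H: "0 \<le> H" "\<And>x. x \<in> space M \<Longrightarrow> 0 \<le> G x"
    "\<And>x z. x \<in> space M \<Longrightarrow> z \<in> space M \<Longrightarrow> \<bar>g x - g z\<bar> \<le> G z * r x z + H * (r x z)\<^sup>2"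
    using slopeE[OF g(3)] by metis
  have "bfun M (\<lambda>x. (G x + 2 * L)\<^sup>2 / (2 * \<alpha>))" using g by (intro bfun_cdiv bfun_power bfun_add) auto
  then obtain B where B: "\<And>x. x \<in> space M \<Longrightarrow> \<bar>(G x + 2 * L)\<^sup>2 / (2 * \<alpha>)\<bar> \<le> B" using bfun_bound by metis
  let ?k = "\<lambda>s. \<alpha> * (1 - s) - 2 * H * s"
  have k: "(?k \<longlongrightarrow> \<alpha> * (1 - 0) - 2 * H * 0) (at_right 0)" by (intro tendsto_intros)
  have "\<forall>\<^sub>F s in at_right 0. 0 < ?k s" using order_tendstoD(1)[OF k, of 0] alpha by simp
  moreover have "\<forall>\<^sub>F s in at_right 0. s \<in> {0<..<1::real}" by (rule eventually_at_right_real) simp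
  ultimately have ev: "\<forall>\<^sub>F s in at_right 0. ?Ent / (1 + s / (1 - s) * ?Ent)
      \<le> \<alpha> / ?k s * exp (s * (\<alpha> / ?k s) * B) * ?J"
  proof eventually_elim
    case (elim s)
    have "(G x + 2 * L)\<^sup>2 / (2 * \<alpha>) \<le> B" if "x \<in> space M" for x using B[OF that] abs_ge_self order_trans by blast
    then show ?case using elim by (intro lsi_step[OF g(1,2) H(2,1,3) one]) auto
  qed
  have q: "((\<lambda>s. \<alpha> / ?k s) \<longlongrightarrow> \<alpha> / (\<alpha> * (1 - 0) - 2 * H * 0)) (at_right 0)"
    using alpha by (intro tendsto_intros) auto
  have 1: "((\<lambda>s. \<alpha> / ?k s * exp (s * (\<alpha> / ?k s) * B) * ?J)
     \<longlongrightarrow> \<alpha> / (\<alpha> * (1 - 0) - 2 * H * 0) * exp (0 * (\<alpha> / (\<alpha> * (1 - 0) - 2 * H * 0)) * B) * ?J) (at_right 0)"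
    by (intro tendsto_mult q tendsto_exp tendsto_const tendsto_ident_at)
  have 2: "((\<lambda>s. ?Ent / (1 + s / (1 - s) * ?Ent)) \<longlongrightarrow> ?Ent / (1 + 0 / (1 - 0) * ?Ent)) (at_right 0)"
    by (intro tendsto_intros) auto
  show ?thesis using tendsto_le[OF trivial_limit_at_right_real 1 2 ev] alpha by simp
qed

lemma ln_slope_bound:
  fixes s t d :: real assumes "0 < d" "d \<le> s" "d \<le> t"
  shows "\<bar>ln s - ln t\<bar> \<le> 1 / t * \<bar>s - t\<bar> + 1 / d\<^sup>2 * \<bar>s - t\<bar>\<^sup>2"
proof -
  have st: "0 < s" "0 < t" using assms by auto
  have "ln s - ln t \<le> (s - t) / t"
    using ln_le_minus_one[of "s / t"] st by (simp add: ln_div diff_divide_distrib)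
  also have "\<dots> \<le> 1 / t * \<bar>s - t\<bar>" using st by (simp add: divide_right_mono)
  finally have 1: "ln s - ln t \<le> 1 / t * \<bar>s - t\<bar>" .
  have "ln t - ln s \<le> (t - s) / s"
    using ln_le_minus_one[of "t / s"] st by (simp add: ln_div diff_divide_distrib)
  also have "\<dots> = (t - s) / t + (t - s)\<^sup>2 / (s * t)" using st by (simp add: field_simps power2_eq_square)
  also have "(t - s)\<^sup>2 / (s * t) \<le> (t - s)\<^sup>2 / (d * d)" using assms st by (intro divide_left_mono mult_mono) auto
  also have "(t - s) / t \<le> \<bar>s - t\<bar> / t" using st by (intro divide_right_mono) auto
  finally have 2: "ln t - ln s \<le> 1 / t * \<bar>s - t\<bar> + 1 / d\<^sup>2 * \<bar>s - t\<bar>\<^sup>2"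
    by (simp add: power2_eq_square algebra_simps add_divide_distrib diff_divide_distrib)
  have "0 \<le> 1 / d\<^sup>2 * \<bar>s - t\<bar>\<^sup>2" by simp
  then show ?thesis using 1 2 by linarith
qed

text \<open>Apply \<open>lsi_exp\<close> to g = ln (h^2 / N), whose slope is 2 G / h. The entropy is
  bounded from below by duality, that is by ln x \<le> x - 1 at x = Y / (T exp g). On the right the
  weight h^2 cancels the denominators, and (G + L h)^2 \<le> 2 G^2 + 2 L^2 h^2 separates the energy
  from the defect 4 L^2 / \<alpha>.\<close>

lemma lsi_dual_pos:
  assumes h: "bfun M h" "bfun M G" "sl h G" and d: "0 < d" "\<And>x. x \<in> space M \<Longrightarrow> d \<le> h x"
    and Y: "bfun M Y" "\<And>x. x \<in> space M \<Longrightarrow> 1 \<le> Y x"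
  shows "E (\<lambda>x. (h x)\<^sup>2 * ln (Y x)) \<le> 4 / \<alpha> * E (\<lambda>x. (G x)\<^sup>2) + (4 * L\<^sup>2 / \<alpha> + ln (E Y)) * E (\<lambda>x. (h x)\<^sup>2)"
proof -
  define N where "N = E (\<lambda>x. (h x)\<^sup>2)"
  define T where "T = E Y"
  have "E (\<lambda>x. d\<^sup>2) \<le> N" unfolding N_def using h d by (intro E_mono) (auto intro!: power_mono)
  then have N: "0 < N" using d by (simp add: less_le_trans[of 0 "d\<^sup>2"])
  have "E (\<lambda>x. 1) \<le> T" unfolding T_def using Y by (intro E_mono) auto
  then have T: "1 \<le> T" by simp
  have G0: "0 \<le> G x" if "x \<in> space M" for x using h(3) that by (auto simp: slope_def)
  have hp: "0 < h x" if "x \<in> space M" for x using d(1) d(2)[OF that] by simp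
  define g where "g x = 2 * ln (h x) - ln N" for x
  define F where "F x = 2 * (1 / h x * G x)" for x
  have lnh: "bfun M (\<lambda>x. ln (h x))" using h d by (intro bfun_ln) auto
  have inv: "bfun M (\<lambda>x. 1 / h x)" using h d by (intro bfun_divide) auto
  have bg: "bfun M g" unfolding g_def using lnh by (intro bfun_diff bfun_mult) auto
  have bF: "bfun M F" unfolding F_def using inv h by (intro bfun_mult) auto
  have bY: "bfun M (\<lambda>x. ln (Y x))" using Y by (intro bfun_ln[of _ _ 1]) auto
  have "sl (\<lambda>x. ln (h x)) (\<lambda>x. 1 / h x * G x)"
    by (rule slope_comp[OF h(2,3) _ _ inv ln_slope_bound[OF d(1)]]) (use d hp in \<open>auto simp: less_imp_le\<close>)
  then have "sl (\<lambda>x. 2 * ln (h x) + (- ln N)) (\<lambda>x. \<bar>2\<bar> * (1 / h x * G x))" by (intro slope_shift slope_cmult)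
  then have slg: "sl g F" by (simp add: g_def[abs_def] F_def[abs_def])
  have eg: "exp (g x) = (h x)\<^sup>2 / N" if "x \<in> space M" for x
    using hp[OF that] N by (simp add: g_def exp_diff exp_double)
  have one: "E (\<lambda>x. exp (g x)) = 1"
  proof -
    have "E (\<lambda>x. exp (g x)) = E (\<lambda>x. (h x)\<^sup>2 / N)" by (intro Bochner_Integration.integral_cong) (auto simp: eg)
    then show ?thesis using N by (simp add: N_def)
  qed
  have bz: "bfun M (\<lambda>x. exp (g x))" using bg by auto
  have "E (\<lambda>x. exp (g x) * ln (Y x) - ln T * exp (g x)) \<le> E (\<lambda>x. g x * exp (g x) + (Y x / T - exp (g x)))"
  proof (rule E_mono)
    fix x assume x: "x \<in> space M"
    have Yx: "0 < Y x" using Y(2)[OF x] by simp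
    have "ln (Y x / T / exp (g x)) \<le> Y x / T / exp (g x) - 1" using Yx T by (intro ln_le_minus_one) auto
    then have "ln (Y x) - ln T - g x \<le> Y x / T / exp (g x) - 1" using Yx T by (simp add: ln_div ln_mult)
    then have "exp (g x) * (ln (Y x) - ln T - g x) \<le> exp (g x) * (Y x / T / exp (g x) - 1)" by (intro mult_left_mono) auto
    then show "exp (g x) * ln (Y x) - ln T * exp (g x) \<le> g x * exp (g x) + (Y x / T - exp (g x))"
      by (simp add: algebra_simps)
  qed (use bg bz bY Y in \<open>auto intro!: bfun_add bfun_mult bfun_diff\<close>)
  also have "\<dots> = E (\<lambda>x. g x * exp (g x)) + (E (\<lambda>x. Y x / T) - E (\<lambda>x. exp (g x)))"
    using bg bz Y E_diff[OF bfun_cdiv[OF Y(1)] bz] by (subst E_add) auto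
  also have "E (\<lambda>x. Y x / T) = 1" using T by (simp add: T_def)
  also have "E (\<lambda>x. exp (g x) * ln (Y x) - ln T * exp (g x)) = E (\<lambda>x. exp (g x) * ln (Y x)) - ln T"
    using bz bY by (subst E_diff) (auto simp: one)
  also have "E (\<lambda>x. g x * exp (g x)) \<le> E (\<lambda>x. exp (g x) * ((F x + 2 * L)\<^sup>2 / (2 * \<alpha>)))"
    by (rule lsi_exp[OF bg bF slg one])
  finally have 1: "E (\<lambda>x. exp (g x) * ln (Y x)) \<le> ln T + E (\<lambda>x. exp (g x) * ((F x + 2 * L)\<^sup>2 / (2 * \<alpha>)))"
    using one by simp
  have "E (\<lambda>x. exp (g x) * ((F x + 2 * L)\<^sup>2 / (2 * \<alpha>))) \<le> E (\<lambda>x. (4 / \<alpha> / N) * (G x)\<^sup>2 + (4 * L\<^sup>2 / \<alpha> / N) * (h x)\<^sup>2)"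
  proof (rule E_mono)
    fix x assume x: "x \<in> space M"
    have "exp (g x) * ((F x + 2 * L)\<^sup>2 / (2 * \<alpha>)) = 2 / \<alpha> / N * (G x + L * h x)\<^sup>2"
      unfolding eg[OF x] F_def using hp[OF x] N alpha by (simp add: field_simps power2_eq_square)
    also have "(G x + L * h x)\<^sup>2 \<le> 2 * ((G x)\<^sup>2 + (L * h x)\<^sup>2)"
      using sum_squares_bound[of "G x" "L * h x"] by (simp add: power2_sum)
    finally show "exp (g x) * ((F x + 2 * L)\<^sup>2 / (2 * \<alpha>)) \<le> (4 / \<alpha> / N) * (G x)\<^sup>2 + (4 * L\<^sup>2 / \<alpha> / N) * (h x)\<^sup>2"
      using N alpha by (simp add: field_simps)
  qed (use bz bF h in \<open>auto intro!: bfun_add bfun_mult bfun_cdiv\<close>)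
  also have "\<dots> = 4 / \<alpha> / N * E (\<lambda>x. (G x)\<^sup>2) + 4 * L\<^sup>2 / \<alpha>"
    using h N by (subst E_add) (auto simp: N_def intro!: bfun_mult)
  finally have 2: "E (\<lambda>x. exp (g x) * ln (Y x)) \<le> ln T + 4 / \<alpha> / N * E (\<lambda>x. (G x)\<^sup>2) + 4 * L\<^sup>2 / \<alpha>"
    using 1 by simp
  have "E (\<lambda>x. (h x)\<^sup>2 * ln (Y x)) = N * E (\<lambda>x. exp (g x) * ln (Y x))"
    unfolding integral_mult_right_zero[symmetric] using N
    by (intro Bochner_Integration.integral_cong) (auto simp: eg)
  also have "\<dots> \<le> N * (ln T + 4 / \<alpha> / N * E (\<lambda>x. (G x)\<^sup>2) + 4 * L\<^sup>2 / \<alpha>)"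
    using 2 N by (intro mult_left_mono) auto
  also have "\<dots> = 4 / \<alpha> * E (\<lambda>x. (G x)\<^sup>2) + (4 * L\<^sup>2 / \<alpha> + ln T) * N" using N by (simp add: algebra_simps)
  finally show ?thesis by (simp add: N_def T_def)
qed

text \<open>The function |f| + d has the same slope as f and stays away from 0; then d tends to 0.
  Since Y is at least 1, its logarithm is nonnegative, so replacing f^2 by (|f| + d)^2 only
  increases the left side.\<close>

lemma lsi_dual:
  assumes f: "bfun M f" "bfun M G" "sl f G" and Y: "bfun M Y" "\<And>x. x \<in> space M \<Longrightarrow> 1 \<le> Y x"
  shows "E (\<lambda>x. (f x)\<^sup>2 * ln (Y x)) \<le> 4 / \<alpha> * E (\<lambda>x. (G x)\<^sup>2) + (4 * L\<^sup>2 / \<alpha> + ln (E Y)) * E (\<lambda>x. (f x)\<^sup>2)"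
proof -
  let ?c = "4 * L\<^sup>2 / \<alpha> + ln (E Y)"
  have bY: "bfun M (\<lambda>x. ln (Y x))" using Y by (intro bfun_ln[of _ _ 1]) auto
  have ev: "\<forall>\<^sub>F d in at_right 0. E (\<lambda>x. (f x)\<^sup>2 * ln (Y x)) \<le> 4 / \<alpha> * E (\<lambda>x. (G x)\<^sup>2)
      + ?c * (E (\<lambda>x. (f x)\<^sup>2) + 2 * d * E (\<lambda>x. \<bar>f x\<bar>) + d\<^sup>2)"
    unfolding eventually_at_right_field
  proof (intro exI[of _ 1] conjI allI impI)
    fix d :: real assume d: "0 < d"
    have s: "sl (\<lambda>x. \<bar>f x\<bar> + d) G" by (intro slope_shift slope_contraction[OF f(3)]) simp
    have "E (\<lambda>x. (f x)\<^sup>2 * ln (Y x)) \<le> E (\<lambda>x. (\<bar>f x\<bar> + d)\<^sup>2 * ln (Y x))"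
    proof (rule E_mono)
      fix x assume "x \<in> space M"
      then have "0 \<le> ln (Y x)" using Y by simp
      moreover have "(f x)\<^sup>2 \<le> (\<bar>f x\<bar> + d)\<^sup>2" using d by (subst power2_abs[symmetric], intro power_mono) auto
      ultimately show "(f x)\<^sup>2 * ln (Y x) \<le> (\<bar>f x\<bar> + d)\<^sup>2 * ln (Y x)" by (rule mult_right_mono[rotated])
    qed (use f bY in \<open>auto intro!: bfun_mult bfun_power bfun_add\<close>)
    also have "\<dots> \<le> 4 / \<alpha> * E (\<lambda>x. (G x)\<^sup>2) + ?c * E (\<lambda>x. (\<bar>f x\<bar> + d)\<^sup>2)"
      by (rule lsi_dual_pos[OF _ f(2) s d _ Y]) (use f in auto)
    also have "E (\<lambda>x. (\<bar>f x\<bar> + d)\<^sup>2) = E (\<lambda>x. (f x)\<^sup>2 + 2 * d * \<bar>f x\<bar> + d\<^sup>2)"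
      by (intro Bochner_Integration.integral_cong) (auto simp: power2_sum)
    also have "\<dots> = E (\<lambda>x. (f x)\<^sup>2) + 2 * d * E (\<lambda>x. \<bar>f x\<bar>) + d\<^sup>2"
      using f by (subst E_add | subst E_const | force)+
    finally show "E (\<lambda>x. (f x)\<^sup>2 * ln (Y x)) \<le> 4 / \<alpha> * E (\<lambda>x. (G x)\<^sup>2)
      + ?c * (E (\<lambda>x. (f x)\<^sup>2) + 2 * d * E (\<lambda>x. \<bar>f x\<bar>) + d\<^sup>2)" .
  qed simp
  have "((\<lambda>d. 4 / \<alpha> * E (\<lambda>x. (G x)\<^sup>2) + ?c * (E (\<lambda>x. (f x)\<^sup>2) + 2 * d * E (\<lambda>x. \<bar>f x\<bar>) + d\<^sup>2))
     \<longlongrightarrow> 4 / \<alpha> * E (\<lambda>x. (G x)\<^sup>2) + ?c * (E (\<lambda>x. (f x)\<^sup>2) + 2 * 0 * E (\<lambda>x. \<bar>f x\<bar>) + 0\<^sup>2)) (at_right 0)"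
    by (intro tendsto_intros)
  from tendsto_lowerbound[OF this ev] show ?thesis by simp
qed


text \<open>Taylor expansion with a remainder valid for both signs. The crude coefficient 1 of the
  cube suffices, because that term is of order e^3 in \<open>poincare_base\<close>.\<close>

lemma exp_cubic_lower:
  fixes x :: real shows "1 + x + x\<^sup>2 / 2 - \<bar>x\<bar> ^ 3 \<le> exp x"
proof (cases "0 \<le> x")
  case True
  have "1 + x + x\<^sup>2 / 2 \<le> exp x" using exp_lower_Taylor_quadratic[OF True] .
  then show ?thesis using True by (smt (verit) zero_le_power abs_ge_zero)
next
  case False
  obtain t where t: "x < t" "t < 0" "exp x = (\<Sum>m<3. exp 0 / fact m * x ^ m) + exp t / fact 3 * x ^ 3"
  proof -
    have "\<exists>t. x < t \<and> t < 0 \<and> exp x = (\<Sum>m<3. exp 0 / fact m * x ^ m) + exp t / fact 3 * x ^ 3"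
      by (rule Maclaurin_minus[where diff = "\<lambda>_. exp"]) (use False in \<open>auto intro!: derivative_eq_intros\<close>)
    then show ?thesis using that by blast
  qed
  have "exp t / fact 3 * \<bar>x\<bar> ^ 3 \<le> \<bar>x\<bar> ^ 3"
  proof -
    have "exp t / fact 3 \<le> 1" using t(2) by (simp add: fact_numeral) (smt (verit) exp_le_one_iff)
    then show ?thesis by (intro mult_left_le_one_le) auto
  qed
  moreover have "x ^ 3 = - (\<bar>x\<bar> ^ 3)" using False by (simp add: power3_eq_cube)
  ultimately show ?thesis using t(3) by (simp add: eval_nat_numeral)
qed

text \<open>Here the interpolation parameter stays at 1/2 and the expansion is in the amplitude
  \<open>e\<close>: U = e h and V = - e h with h centred, so the linear terms have mean 0. The left
  side is at least 1 + e^2 V / 2 up to order e^3, while maximizing over the distance leaves e^2 G^2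
  / \<open>?k e\<close> on the right, with \<open>?k e\<close> tending to 2 \<alpha>.\<close>

lemma poincare_base:
  assumes L0: "L = 0" and f: "bfun M f" "bfun M G" "sl f G"
  shows "E (\<lambda>x. (f x - E f)\<^sup>2) \<le> E (\<lambda>x. (G x)\<^sup>2) / \<alpha>"
proof -
  define h where "h x = f x - E f" for x
  have bh: "bfun M h" unfolding h_def using f by auto
  have h0: "E h = 0" unfolding h_def using f by (subst E_diff) auto
  have "sl h G" using slope_shift[OF f(3), of "- E f"] by (simp add: h_def[abs_def])
  then obtain H where H: "0 \<le> H" "\<And>x. x \<in> space M \<Longrightarrow> 0 \<le> G x"
    "\<And>x z. x \<in> space M \<Longrightarrow> z \<in> space M \<Longrightarrow> \<bar>h x - h z\<bar> \<le> G z * r x z + H * (r x z)\<^sup>2"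
    using slopeE by metis
  obtain B where B: "0 < B" "\<And>x. x \<in> space M \<Longrightarrow> \<bar>h x\<bar> \<le> B" using bfun_bound[OF bh] by metis
  obtain C where C: "0 < C" "\<And>x. x \<in> space M \<Longrightarrow> \<bar>(G x)\<^sup>2\<bar> \<le> C" using bfun_bound[OF bfun_power[OF f(2)]] by metis
  \<comment> \<open>One sixteenth of this is the quadratic coefficient that remains: \<alpha> / 8
    from the midpoint, minus H e / 4 from the slope errors of the two half steps.\<close>
  let ?k = "\<lambda>e. 2 * \<alpha> - 4 * H * e"
  let ?V = "E (\<lambda>x. (h x)\<^sup>2)" and ?J = "E (\<lambda>x. (G x)\<^sup>2)"
  have step: "?V / 2 - e * B ^ 3 \<le> ?J / ?k e * exp (e\<^sup>2 * C / ?k e)" if e: "0 < e" "0 < ?k e" for e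
  proof -
    let ?W = "\<lambda>x. e\<^sup>2 * (G x)\<^sup>2 / ?k e"
    have bW: "bfun M ?W" using f by (intro bfun_cdiv bfun_mult bfun_power) auto
    have lower: "1 + e\<^sup>2 * (?V / 2) - e ^ 3 * B ^ 3 \<le> E (\<lambda>x. exp (c * h x))" if c: "\<bar>c\<bar> = e" for c
    proof -
      have "E (\<lambda>x. (1 - e ^ 3 * B ^ 3) + (c * h x + e\<^sup>2 / 2 * (h x)\<^sup>2)) \<le> E (\<lambda>x. exp (c * h x))"
      proof (rule E_mono)
        fix x assume x: "x \<in> space M"
        have "\<bar>c * h x\<bar> ^ 3 \<le> (e * B) ^ 3" unfolding abs_mult c using B(2)[OF x] e
          by (intro power_mono mult_left_mono) auto
        moreover have "c\<^sup>2 = e\<^sup>2" using c by (metis power2_abs)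
        ultimately show "(1 - e ^ 3 * B ^ 3) + (c * h x + e\<^sup>2 / 2 * (h x)\<^sup>2) \<le> exp (c * h x)"
          using exp_cubic_lower[of "c * h x"] by (simp add: power_mult_distrib)
      qed (use bh in \<open>auto intro!: bfun_add bfun_mult bfun_exp bfun_power\<close>)
      also have "E (\<lambda>x. (1 - e ^ 3 * B ^ 3) + (c * h x + e\<^sup>2 / 2 * (h x)\<^sup>2))
          = (1 - e ^ 3 * B ^ 3) + (E (\<lambda>x. c * h x) + E (\<lambda>x. e\<^sup>2 / 2 * (h x)\<^sup>2))"
        using bh by (subst E_add | force intro!: bfun_add bfun_mult bfun_power)+
      finally show ?thesis using h0 by simp
    qed
    have "(E (\<lambda>x. exp (e * h x))) powr (1/2) * (E (\<lambda>x. exp (- e * h x))) powr (1 - 1/2) \<le> E (\<lambda>x. exp (?W x))"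
    proof (rule pl)
      fix x y assume xy: "x \<in> space M" "y \<in> space M"
      let ?z = "cmb (1/2) x y" and ?p = "r x y"
      have z: "?z \<in> space M" using cmb_space[of "1/2"] xy by simp
      have rz: "r x ?z = 1/2 * ?p" "r y ?z = 1/2 * ?p" using r_cmb_left[of "1/2"] r_cmb_right[of "1/2"] xy by auto
      have p: "0 \<le> ?p" using r_nonneg xy by simp
      have "h x - h ?z \<le> G ?z * (1/2 * ?p) + H * (1/2 * ?p)\<^sup>2" "h ?z - h y \<le> G ?z * (1/2 * ?p) + H * (1/2 * ?p)\<^sup>2"
        using H(3)[OF xy(1) z] H(3)[OF xy(2) z] rz by auto
      then have "h x - h y \<le> G ?z * ?p + H * ?p\<^sup>2 / 2" by (simp add: power_mult_distrib power_divide)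
      then have "e / 2 * (h x - h y) \<le> e / 2 * (G ?z * ?p + H * ?p\<^sup>2 / 2)" using e by (intro mult_left_mono) auto
      moreover have "(e * G ?z / 2) * ?p - (?k e / 8) / 2 * ?p\<^sup>2 \<le> (e * G ?z / 2)\<^sup>2 / (2 * (?k e / 8))"
        using e by (intro quadratic_bound) auto
      moreover have "(e * G ?z / 2)\<^sup>2 / (2 * (?k e / 8)) = ?W ?z"
        using half_square_quotient[of "e * G ?z" "?k e"] e by (simp only: power_mult_distrib)
      moreover define Wz where "Wz = ?W ?z"
      ultimately have a: "e / 2 * (h x - h y) \<le> e / 2 * (G ?z * ?p + H * ?p\<^sup>2 / 2)"
        "(e * G ?z / 2) * ?p - (?k e / 8) / 2 * ?p\<^sup>2 \<le> Wz" by simp_all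
      have "1/2 * (e * h x) + (1 - 1/2) * (- e * h y) = e / 2 * (h x - h y)" by (simp add: algebra_simps)
      also have "\<dots> \<le> e / 2 * (G ?z * ?p + H * ?p\<^sup>2 / 2)" by (rule a)
      also have "\<dots> = ((e * G ?z / 2) * ?p - (?k e / 8) / 2 * ?p\<^sup>2) + \<alpha> / 8 * ?p\<^sup>2" by (simp add: field_simps)
      also have "\<dots> \<le> Wz + \<alpha> / 8 * ?p\<^sup>2" using a(2) by simp
      finally show "1/2 * (e * h x) + (1 - 1/2) * (- e * h y) + 2 * L * (1/2) * (1 - 1/2) * ?p
         \<le> ?W ?z + \<alpha> / 2 * (1/2) * (1 - 1/2) * ?p\<^sup>2"
        unfolding L0 Wz_def by simp
    qed (use bh bW in \<open>auto intro!: bfun_mult\<close>)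
    then have sq: "sqrt (E (\<lambda>x. exp (e * h x)) * E (\<lambda>x. exp (- e * h x))) \<le> E (\<lambda>x. exp (?W x))"
      by (simp add: powr_half_sqrt E_nonneg real_sqrt_mult)
    let ?y = "1 + e\<^sup>2 * (?V / 2) - e ^ 3 * B ^ 3"
    \<comment> \<open>Both exponential means are at least \<open>?y\<close>, so their geometric mean
      is too. The lower bound may be negative when \<open>e\<close> is not small, and then nothing
      has to be shown.\<close>
    have "?y \<le> E (\<lambda>x. exp (?W x))"
    proof (cases "0 \<le> ?y")
      case True
      have "?y * ?y \<le> E (\<lambda>x. exp (e * h x)) * E (\<lambda>x. exp (- e * h x))"
        using True lower[of e] lower[of "- e"] e by (intro mult_mono) (auto simp: E_nonneg)
      then have "?y \<le> sqrt (E (\<lambda>x. exp (e * h x)) * E (\<lambda>x. exp (- e * h x)))"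
        by (simp add: real_le_rsqrt power2_eq_square)
      then show ?thesis using sq by simp
    next
      case False
      moreover have "0 \<le> E (\<lambda>x. exp (?W x))" by (rule E_nonneg) simp
      ultimately show ?thesis by linarith
    qed
    also have "\<dots> \<le> E (\<lambda>x. 1 + e\<^sup>2 / ?k e * exp (e\<^sup>2 * C / ?k e) * (G x)\<^sup>2)"
    proof (rule E_mono)
      fix x assume x: "x \<in> space M"
      let ?w = "?W x"
      have w: "0 \<le> ?w" using e by simp
      have "1 - ?w \<le> exp (- ?w)" using exp_ge_add_one_self[of "- ?w"] by simp
      then have "(1 - ?w) * exp ?w \<le> exp (- ?w) * exp ?w" by (intro mult_right_mono) auto
      then have "exp ?w \<le> 1 + ?w * exp ?w" by (simp add: algebra_simps flip: exp_add)
      also have "\<dots> \<le> 1 + ?w * exp (e\<^sup>2 * C / ?k e)"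
        using w e C(2)[OF x] by (intro add_left_mono mult_left_mono) (auto intro!: divide_right_mono mult_left_mono)
      finally show "exp ?w \<le> 1 + e\<^sup>2 / ?k e * exp (e\<^sup>2 * C / ?k e) * (G x)\<^sup>2" by (simp add: mult_ac)
    qed (use bW f in \<open>auto intro!: bfun_add bfun_mult bfun_power\<close>)
    also have "\<dots> = 1 + e\<^sup>2 * (?J / ?k e * exp (e\<^sup>2 * C / ?k e))"
      using f by (subst E_add) (auto intro!: bfun_mult bfun_power simp: mult_ac)
    finally have "e\<^sup>2 * (?V / 2 - e * B ^ 3) \<le> e\<^sup>2 * (?J / ?k e * exp (e\<^sup>2 * C / ?k e))"
      by (simp add: algebra_simps power2_eq_square power3_eq_cube)
    then show ?thesis by (rule mult_left_le_imp_le) (use e in simp)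
  qed
  have k: "(?k \<longlongrightarrow> 2 * \<alpha> - 4 * H * 0) (at_right 0)" by (intro tendsto_intros)
  have ev0: "\<forall>\<^sub>F e in at_right 0. 0 < ?k e" using order_tendstoD(1)[OF k, of 0] alpha by simp
  moreover have "\<forall>\<^sub>F e in at_right 0. 0 < (e::real)" by (simp add: eventually_at_right_less)
  ultimately have ev: "\<forall>\<^sub>F e in at_right 0. ?V / 2 - e * B ^ 3 \<le> ?J / ?k e * exp (e\<^sup>2 * C / ?k e)"
    by eventually_elim (rule step)
  have 1: "((\<lambda>e. ?J / ?k e * exp (e\<^sup>2 * C / ?k e)) \<longlongrightarrow> ?J / (2 * \<alpha> - 4 * H * 0) * exp (0\<^sup>2 * C / (2 * \<alpha> - 4 * H * 0))) (at_right 0)"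
    using alpha by (intro tendsto_intros) auto
  have 2: "((\<lambda>e. ?V / 2 - e * B ^ 3) \<longlongrightarrow> ?V / 2 - 0 * B ^ 3) (at_right 0)" by (intro tendsto_intros)
  have "?V \<le> ?J / \<alpha>" using tendsto_le[OF trivial_limit_at_right_real 1 2 ev] by (simp add: field_simps)
  then show ?thesis by (simp add: h_def)
qed

end

section \<open>Poincare inequality for a Lipschitz tilt\<close>

lemma deriv_lipschitz_bound:
  fixes \<phi> :: "real \<Rightarrow> real"
  assumes d: "\<And>x. (\<phi> has_real_derivative \<phi>' x) (at x)"
    and C: "\<And>x y. \<bar>\<phi>' x - \<phi>' y\<bar> \<le> C * \<bar>x - y\<bar>" "0 \<le> C"
  shows "\<bar>\<phi> s - \<phi> t\<bar> \<le> \<bar>\<phi>' t\<bar> * \<bar>s - t\<bar> + C * \<bar>s - t\<bar>\<^sup>2"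
proof -
  have mvt: "\<exists>z. \<bar>z - t\<bar> \<le> \<bar>s - t\<bar> \<and> \<bar>\<phi> s - \<phi> t\<bar> = \<bar>s - t\<bar> * \<bar>\<phi>' z\<bar>"
  proof (cases s t rule: linorder_cases)
    case less
    then obtain z where "s < z" "z < t" "\<phi> t - \<phi> s = (t - s) * \<phi>' z" using MVT2[OF less d] by blast
    then show ?thesis by (subst abs_minus_commute[of "\<phi> s"], intro exI[of _ z]) (auto simp: abs_mult)
  next
    case greater
    then obtain z where "t < z" "z < s" "\<phi> s - \<phi> t = (s - t) * \<phi>' z" using MVT2[OF greater d] by blast
    then show ?thesis by (intro exI[of _ z]) (auto simp: abs_mult abs_minus_commute)
  qed auto
  then obtain z where z: "\<bar>z - t\<bar> \<le> \<bar>s - t\<bar>" "\<bar>\<phi> s - \<phi> t\<bar> = \<bar>s - t\<bar> * \<bar>\<phi>' z\<bar>" by blast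
  have "\<bar>\<phi>' z\<bar> \<le> \<bar>\<phi>' t\<bar> + C * \<bar>z - t\<bar>" using C(1)[of z t] by linarith
  also have "\<dots> \<le> \<bar>\<phi>' t\<bar> + C * \<bar>s - t\<bar>" using z(1) C(2) by (intro add_left_mono mult_left_mono)
  finally have "\<bar>s - t\<bar> * \<bar>\<phi>' z\<bar> \<le> \<bar>s - t\<bar> * (\<bar>\<phi>' t\<bar> + C * \<bar>s - t\<bar>)" by (intro mult_left_mono) auto
  then show ?thesis using z(2) by (simp add: algebra_simps power2_eq_square)
qed

text \<open>A smooth cutoff p with derivative p (1 - p). Its tails p \<le> exp t and 1 - p \<le> exp
  (- t) are exponential, hence match the weight exp b and the exponential moments of b.\<close>

definition logistic :: "real \<Rightarrow> real" where "logistic t = 1 / (1 + exp (- t))"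

lemma logistic_bounds:
  "0 < logistic t" "logistic t < 1" "logistic t \<le> exp t" "1 - logistic t \<le> exp (- t)"
proof -
  have p: "0 < exp (- t)" by simp
  then show "0 < logistic t" "logistic t < 1" by (auto simp: logistic_def add_pos_pos)
  have "1 / (1 + exp (- t)) \<le> 1 / exp (- t)" using p by (intro divide_left_mono mult_pos_pos add_pos_pos) auto
  then show "logistic t \<le> exp t" by (simp add: logistic_def exp_minus inverse_eq_divide)
  have p1: "0 < 1 + exp (- t)" using p by linarith
  then have "1 - logistic t = exp (- t) / (1 + exp (- t))" by (simp add: logistic_def field_simps)
  also have "\<dots> \<le> exp (- t) / 1" using p p1 by (intro divide_left_mono) auto
  finally show "1 - logistic t \<le> exp (- t)" by simp
qed

lemma logistic_deriv: "(logistic has_real_derivative logistic t * (1 - logistic t)) (at t)"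
proof -
  have p: "1 + exp (- t) \<noteq> 0" using exp_gt_zero[of "- t"] by linarith
  have "((\<lambda>t. 1 / (1 + exp (- t))) has_real_derivative exp (- t) / (1 + exp (- t))\<^sup>2) (at t)"
    using p by (auto intro!: derivative_eq_intros simp: power2_eq_square)
  moreover have "exp (- t) / (1 + exp (- t))\<^sup>2 = logistic t * (1 - logistic t)"
    using p by (simp add: logistic_def field_simps power2_eq_square)
  ultimately show ?thesis by (simp add: logistic_def[abs_def])
qed

lemma logistic_slope:
  "\<bar>logistic s - logistic t\<bar> \<le> logistic t * (1 - logistic t) * \<bar>s - t\<bar> + 1 * \<bar>s - t\<bar>\<^sup>2"
proof -
  have d1: "\<bar>logistic x * (1 - logistic x)\<bar> \<le> 1" for x
    using logistic_bounds(1,2)[of x] mult_le_one[of "logistic x" "1 - logistic x"] by (simp add: abs_mult)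
  have lip: "\<bar>logistic x - logistic y\<bar> \<le> \<bar>x - y\<bar>" for x y
    using field_differentiable_bound[of UNIV logistic "\<lambda>x. logistic x * (1 - logistic x)" 1 x y] d1 logistic_deriv
    by (simp add: abs_minus_commute)
  have "\<bar>logistic x * (1 - logistic x) - logistic y * (1 - logistic y)\<bar> \<le> 1 * \<bar>x - y\<bar>" for x y
  proof -
    have "logistic x * (1 - logistic x) - logistic y * (1 - logistic y)
        = (logistic x - logistic y) * (1 - logistic x - logistic y)" by (simp add: algebra_simps)
    moreover have "\<bar>1 - logistic x - logistic y\<bar> \<le> 1"
      using logistic_bounds(1,2)[of x] logistic_bounds(1,2)[of y] by simp
    ultimately have "\<bar>logistic x * (1 - logistic x) - logistic y * (1 - logistic y)\<bar> \<le> \<bar>logistic x - logistic y\<bar> * 1"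
      by (simp only: abs_mult) (intro mult_left_mono, auto)
    then show ?thesis using lip[of x y] by simp
  qed
  from deriv_lipschitz_bound[OF logistic_deriv this, of s t] show ?thesis
    using logistic_bounds(1,2)[of t] by simp
qed

context displacement
begin

text \<open>The midpoint inequality for 2 b and - 2 b, with a constant on the right, bounds only the
  product of the two moments. By the normalization each factor is at least 1 (tangents at u = 1 to
  u^2 and to 1 / u^2, with u = exp b), so the bound for the product holds for each of them.\<close>

lemma exp_moments:
  assumes L0: "L = 0" and b: "bfun M b" and Lb: "0 \<le> Lb"
    and lip: "\<And>x z. x \<in> space M \<Longrightarrow> z \<in> space M \<Longrightarrow> \<bar>b x - b z\<bar> \<le> Lb * r x z"
    and one: "E (\<lambda>x. exp (b x)) = 1"
  shows "E (\<lambda>x. exp (2 * b x)) \<le> exp (4 * Lb\<^sup>2 / \<alpha>)" "E (\<lambda>x. exp (- 2 * b x)) \<le> exp (4 * Lb\<^sup>2 / \<alpha>)"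
proof -
  let ?P = "E (\<lambda>x. exp (2 * b x))" and ?N = "E (\<lambda>x. exp (- 2 * b x))"
  have "?P powr (1/2) * ?N powr (1 - 1/2) \<le> E (\<lambda>x. exp (2 * Lb\<^sup>2 / \<alpha>))"
  proof (rule pl)
    fix x y assume xy: "x \<in> space M" "y \<in> space M"
    have "Lb * r x y - (\<alpha> / 4) / 2 * (r x y)\<^sup>2 \<le> Lb\<^sup>2 / (2 * (\<alpha> / 4))"
      using alpha by (intro quadratic_bound) auto
    moreover have "b x - b y \<le> Lb * r x y" using lip[OF xy] by simp
    ultimately show "1/2 * (2 * b x) + (1 - 1/2) * (- 2 * b y) + 2 * L * (1/2) * (1 - 1/2) * r x y
        \<le> 2 * Lb\<^sup>2 / \<alpha> + \<alpha> / 2 * (1/2) * (1 - 1/2) * (r x y)\<^sup>2"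
      unfolding L0 by (simp add: mult.commute)
  qed (use b in \<open>auto intro!: bfun_mult bfun_uminus\<close>)
  then have "sqrt (?P * ?N) \<le> exp (2 * Lb\<^sup>2 / \<alpha>)"
    by (simp add: powr_half_sqrt E_nonneg real_sqrt_mult)
  then have "(sqrt (?P * ?N))\<^sup>2 \<le> (exp (2 * Lb\<^sup>2 / \<alpha>))\<^sup>2" by (intro power_mono) (auto simp: E_nonneg)
  then have PN: "?P * ?N \<le> exp (4 * Lb\<^sup>2 / \<alpha>)"
    by (simp add: E_nonneg flip: exp_double)
  have P1: "1 \<le> ?P"
  proof -
    have "E (\<lambda>x. 2 * exp (b x) - 1) \<le> ?P"
    proof (rule E_mono)
      fix x have "0 \<le> (exp (b x) - 1)\<^sup>2" by simp
      then show "2 * exp (b x) - 1 \<le> exp (2 * b x)" by (simp add: power2_diff exp_double)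
    qed (use b in \<open>auto intro!: bfun_diff bfun_mult\<close>)
    moreover have "E (\<lambda>x. 2 * exp (b x) - 1) = 1" using b one by (subst E_diff) (auto intro!: bfun_mult)
    ultimately show ?thesis by simp
  qed
  have N1: "1 \<le> ?N"
  proof -
    have "E (\<lambda>x. 3 - 2 * exp (b x)) \<le> ?N"
    proof (rule E_mono)
      fix x
      define u where "u = exp (b x)"
      have u: "0 < u" by (simp add: u_def)
      have "0 \<le> (u - 1)\<^sup>2 * (2 * u + 1) / u\<^sup>2" using u by simp
      also have "(u - 1)\<^sup>2 * (2 * u + 1) / u\<^sup>2 = 1 / u\<^sup>2 - (3 - 2 * u)"
        using u by (simp add: field_simps power2_eq_square)
      finally have "3 - 2 * u \<le> 1 / u\<^sup>2" by simp
      also have "1 / u\<^sup>2 = exp (- 2 * b x)"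
        by (simp add: u_def exp_minus inverse_eq_divide flip: exp_double)
      finally show "3 - 2 * exp (b x) \<le> exp (- 2 * b x)" by (simp add: u_def)
    qed (use b in \<open>auto intro!: bfun_diff bfun_mult bfun_exp bfun_uminus\<close>)
    moreover have "E (\<lambda>x. 3 - 2 * exp (b x)) = 1" using b one by (subst E_diff) (auto intro!: bfun_mult)
    ultimately show ?thesis by simp
  qed
  have "?P * 1 \<le> ?P * ?N" using P1 N1 by (intro mult_left_mono) auto
  then show "?P \<le> exp (4 * Lb\<^sup>2 / \<alpha>)" using PN by simp
  have "1 * ?N \<le> ?P * ?N" using P1 N1 by (intro mult_right_mono) auto
  then show "?N \<le> exp (4 * Lb\<^sup>2 / \<alpha>)" using PN by simp
qed

text \<open>The Poincare inequality of the base measure is applied to F = f p with p = logistic (b +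
  m). As p^2 \<le> exp (b + m), the base energy of F is controlled by the tilted energy of f. The
  slope of p, the cut-off part of f and the region b > m are paid for by the moments of exp (- 2 b)
  and exp (2 b) times R^2. Raising \<open>m\<close> makes this error small and the energy factor
  large.\<close>

lemma weak_poincare:
  assumes L0: "L = 0" and b: "bfun M b" and Lb: "0 \<le> Lb"
    and lip: "\<And>x z. x \<in> space M \<Longrightarrow> z \<in> space M \<Longrightarrow> \<bar>b x - b z\<bar> \<le> Lb * r x z"
    and one: "E (\<lambda>x. exp (b x)) = 1"
    and f: "bfun M f" "bfun M G" "sl f G" and R: "\<And>x. x \<in> space M \<Longrightarrow> \<bar>f x\<bar> \<le> R"
  shows "\<exists>c. E (\<lambda>x. exp (b x) * (f x - c)\<^sup>2) \<le> 4 / \<alpha> * exp (2 * m) * E (\<lambda>x. exp (b x) * (G x)\<^sup>2)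
     + exp (4 * Lb\<^sup>2 / \<alpha>) * (4 * Lb\<^sup>2 / \<alpha> + 6) * exp (- m) * R\<^sup>2"
proof -
  define K where "K = exp (4 * Lb\<^sup>2 / \<alpha>)"
  note mom = exp_moments[OF L0 b Lb lip one, folded K_def]
  have R0: "0 \<le> R" using R not_empty by (meson abs_ge_zero ex_in_conv order_trans)
  let ?p = "\<lambda>x. logistic (b x + m)"
  let ?D = "\<lambda>x. logistic (b x + m) * (1 - logistic (b x + m))"
  have cont: "continuous_on UNIV logistic"
    using logistic_deriv by (meson DERIV_continuous continuous_at_imp_continuous_on)
  have bp: "bfun M ?p" using b by (intro bfun_cont[OF _ cont]) auto
  have bD: "bfun M ?D" using bp by (intro bfun_mult bfun_diff) auto
  have slb: "sl (\<lambda>x. b x + m) (\<lambda>_. Lb)"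
    by (intro slope_shift slopeI[where H = 0]) (use lip Lb in auto)
  have slp: "sl ?p (\<lambda>x. ?D x * Lb)"
    by (rule slope_comp[OF _ slb _ _ bD logistic_slope]) (use logistic_bounds in \<open>auto simp: less_imp_le\<close>)
  define F where "F x = f x * ?p x" for x
  let ?GF = "\<lambda>x. \<bar>f x\<bar> * (?D x * Lb) + \<bar>?p x\<bar> * G x"
  have slF: "sl F ?GF" unfolding F_def
    by (rule slope_mult[OF f(1) bp f(2) bfun_mult[OF bD bfun_const] f(3) slp])
  have bF: "bfun M F" unfolding F_def using f bp by auto
  have bGF: "bfun M ?GF" using f bD bp by (intro bfun_add bfun_mult bfun_abs) auto
  define c where "c = E F"
  have FR: "\<bar>F x\<bar> \<le> R" if "x \<in> space M" for x
  proof -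
    have "\<bar>F x\<bar> = \<bar>f x\<bar> * ?p x" using logistic_bounds(1)[of "b x + m"] by (simp add: F_def abs_mult)
    also have "\<dots> \<le> R * 1" using R[OF that] R0 logistic_bounds(1,2)[of "b x + m"] by (intro mult_mono) auto
    finally show ?thesis by simp
  qed
  have cR: "\<bar>c\<bar> \<le> R"
  proof -
    have "- R \<le> F x" "F x \<le> R" if "x \<in> space M" for x using FR[OF that] by linarith+
    then have "E F \<le> E (\<lambda>_. R)" and "E (\<lambda>_. - R) \<le> E F"
      using E_mono[OF bF bfun_const] E_mono[OF bfun_const bF] by blast+
    then show ?thesis by (simp add: c_def abs_le_iff)
  qed
  have bG2: "bfun M (\<lambda>x. exp (b x) * (G x)\<^sup>2)" using b f by (intro bfun_mult bfun_exp bfun_power) auto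
  have bm: "bfun M (\<lambda>x. exp (- 2 * b x))" "bfun M (\<lambda>x. exp (2 * b x))" using b by (auto intro!: bfun_exp bfun_mult bfun_uminus)
  have "E (\<lambda>x. (?GF x)\<^sup>2) \<le> E (\<lambda>x. 2 * R\<^sup>2 * Lb\<^sup>2 * exp (- 2 * m) * exp (- 2 * b x) + 2 * exp m * (exp (b x) * (G x)\<^sup>2))"
  proof (rule E_mono)
    fix x assume x: "x \<in> space M"
    note lb = logistic_bounds[of "b x + m"]
    have "?D x \<le> 1 * exp (- (b x + m))" using lb by (intro mult_mono) auto
    then have "\<bar>f x\<bar> * (?D x * Lb) \<le> R * (exp (- (b x + m)) * Lb)"
      using R[OF x] R0 Lb lb by (intro mult_mono) auto
    then have "(\<bar>f x\<bar> * (?D x * Lb))\<^sup>2 \<le> (R * (exp (- (b x + m)) * Lb))\<^sup>2"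
      using lb Lb by (intro power_mono) auto
    also have "\<dots> = R\<^sup>2 * Lb\<^sup>2 * exp (- 2 * m) * exp (- 2 * b x)"
      by (simp add: power_mult_distrib exp_double[symmetric] flip: exp_add)
    finally have 1: "(\<bar>f x\<bar> * (?D x * Lb))\<^sup>2 \<le> R\<^sup>2 * Lb\<^sup>2 * exp (- 2 * m) * exp (- 2 * b x)" .
    have "(?p x)\<^sup>2 \<le> 1 * exp (b x + m)" unfolding power2_eq_square using lb by (intro mult_mono) auto
    then have "(?p x)\<^sup>2 * (G x)\<^sup>2 \<le> exp (b x + m) * (G x)\<^sup>2" by (intro mult_right_mono) auto
    then have 2: "(\<bar>?p x\<bar> * G x)\<^sup>2 \<le> exp m * (exp (b x) * (G x)\<^sup>2)" by (simp add: power_mult_distrib exp_add mult_ac)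
    have "(u + v)\<^sup>2 \<le> 2 * u\<^sup>2 + 2 * v\<^sup>2" for u v :: real using sum_squares_bound[of u v] by (simp add: power2_sum)
    from this[of "\<bar>f x\<bar> * (?D x * Lb)" "\<bar>?p x\<bar> * G x"] 1 2
    show "(?GF x)\<^sup>2 \<le> 2 * R\<^sup>2 * Lb\<^sup>2 * exp (- 2 * m) * exp (- 2 * b x) + 2 * exp m * (exp (b x) * (G x)\<^sup>2)" by linarith
  qed (rule bfun_power[OF bGF], rule bfun_add[OF bfun_mult[OF bfun_const bm(1)] bfun_mult[OF bfun_const bG2]])
  also have "\<dots> = 2 * R\<^sup>2 * Lb\<^sup>2 * exp (- 2 * m) * E (\<lambda>x. exp (- 2 * b x)) + 2 * exp m * E (\<lambda>x. exp (b x) * (G x)\<^sup>2)"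
    using bG2 bm by (subst E_add) (auto intro!: bfun_mult)
  also have "\<dots> \<le> 2 * R\<^sup>2 * Lb\<^sup>2 * exp (- 2 * m) * K + 2 * exp m * E (\<lambda>x. exp (b x) * (G x)\<^sup>2)"
    using mom by (intro add_right_mono mult_left_mono) auto
  finally have GF: "E (\<lambda>x. (?GF x)\<^sup>2) \<le> 2 * R\<^sup>2 * Lb\<^sup>2 * exp (- 2 * m) * K + 2 * exp m * E (\<lambda>x. exp (b x) * (G x)\<^sup>2)" .
  have "E (\<lambda>x. (F x - c)\<^sup>2) \<le> E (\<lambda>x. (?GF x)\<^sup>2) / \<alpha>" unfolding c_def by (rule poincare_base[OF L0 bF bGF slF])
  also have "\<dots> \<le> (2 * R\<^sup>2 * Lb\<^sup>2 * exp (- 2 * m) * K + 2 * exp m * E (\<lambda>x. exp (b x) * (G x)\<^sup>2)) / \<alpha>"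
    using GF alpha by (intro divide_right_mono) auto
  finally have PF: "E (\<lambda>x. (F x - c)\<^sup>2) \<le> (2 * R\<^sup>2 * Lb\<^sup>2 * exp (- 2 * m) * K + 2 * exp m * E (\<lambda>x. exp (b x) * (G x)\<^sup>2)) / \<alpha>" .
  have "E (\<lambda>x. exp (b x) * (f x - c)\<^sup>2) \<le> E (\<lambda>x. 2 * exp m * (F x - c)\<^sup>2
      + (2 * R\<^sup>2 * exp (- m) * exp (- 2 * b x) + 4 * R\<^sup>2 * exp (- m) * exp (2 * b x)))"
  proof (rule E_mono)
    fix x assume x: "x \<in> space M"
    note lb = logistic_bounds[of "b x + m"]
    \<comment> \<open>Where b exceeds m the weight is not comparable to a constant, but there it is
      at most exp (2 b - m), whose mean is known.\<close>
    have e: "exp (b x) \<le> exp m + exp (- m) * exp (2 * b x)"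
    proof (cases "b x \<le> m")
      case True then show ?thesis by (simp add: add_increasing2)
    next
      case False
      then have "exp (b x) \<le> exp (2 * b x - m)" by simp
      also have "\<dots> = exp (- m) * exp (2 * b x)" by (simp flip: exp_add)
      finally show ?thesis by (simp add: add_increasing)
    qed
    have sq: "(u + v)\<^sup>2 \<le> 2 * u\<^sup>2 + 2 * v\<^sup>2" for u v :: real using sum_squares_bound[of u v] by (simp add: power2_sum)
    have "\<bar>f x - c\<bar> \<le> 2 * R" using R[OF x] cR by linarith
    then have "\<bar>f x - c\<bar>\<^sup>2 \<le> (2 * R)\<^sup>2" by (intro power_mono) auto
    then have s1: "(f x - c)\<^sup>2 \<le> 4 * R\<^sup>2" by (simp add: power_mult_distrib)
    have "\<bar>f x * (1 - ?p x)\<bar> \<le> R * exp (- (b x + m))"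
      unfolding abs_mult using R[OF x] R0 lb by (intro mult_mono) auto
    then have "\<bar>f x * (1 - ?p x)\<bar>\<^sup>2 \<le> (R * exp (- (b x + m)))\<^sup>2" by (intro power_mono) auto
    also have "\<dots> = R\<^sup>2 * exp (- 2 * m) * exp (- 2 * b x)"
      by (simp add: power_mult_distrib exp_double[symmetric] flip: exp_add)
    finally have s2: "(f x * (1 - ?p x))\<^sup>2 \<le> R\<^sup>2 * exp (- 2 * m) * exp (- 2 * b x)" by simp
    have dec: "f x - c = (F x - c) + f x * (1 - ?p x)" by (simp add: F_def algebra_simps)
    have s3: "(f x - c)\<^sup>2 \<le> 2 * (F x - c)\<^sup>2 + 2 * (R\<^sup>2 * exp (- 2 * m) * exp (- 2 * b x))"
      unfolding dec using sq[of "F x - c" "f x * (1 - ?p x)"] s2 by linarith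
    have "exp (b x) * (f x - c)\<^sup>2 \<le> (exp m + exp (- m) * exp (2 * b x)) * (f x - c)\<^sup>2"
      using e by (intro mult_right_mono) auto
    also have "\<dots> = exp m * (f x - c)\<^sup>2 + exp (- m) * exp (2 * b x) * (f x - c)\<^sup>2" by (simp add: algebra_simps)
    also have "\<dots> \<le> exp m * (2 * (F x - c)\<^sup>2 + 2 * (R\<^sup>2 * exp (- 2 * m) * exp (- 2 * b x)))
        + exp (- m) * exp (2 * b x) * (4 * R\<^sup>2)"
      using s1 s3 by (intro add_mono mult_left_mono) auto
    also have "exp m * (2 * (F x - c)\<^sup>2 + 2 * (R\<^sup>2 * exp (- 2 * m) * exp (- 2 * b x)))
        = 2 * exp m * (F x - c)\<^sup>2 + 2 * R\<^sup>2 * (exp m * exp (- 2 * m)) * exp (- 2 * b x)"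
      by (simp add: algebra_simps)
    also have "exp m * exp (- 2 * m) = exp (- m)" by (simp flip: exp_add)
    finally show "exp (b x) * (f x - c)\<^sup>2 \<le> 2 * exp m * (F x - c)\<^sup>2
      + (2 * R\<^sup>2 * exp (- m) * exp (- 2 * b x) + 4 * R\<^sup>2 * exp (- m) * exp (2 * b x))" by (simp add: mult_ac)
  qed (use b f bF bm in \<open>auto intro!: bfun_add bfun_mult bfun_power bfun_diff bfun_exp\<close>)
  also have "\<dots> = 2 * exp m * E (\<lambda>x. (F x - c)\<^sup>2) + (2 * R\<^sup>2 * exp (- m) * E (\<lambda>x. exp (- 2 * b x))
     + 4 * R\<^sup>2 * exp (- m) * E (\<lambda>x. exp (2 * b x)))"
  proof -
    have a: "bfun M (\<lambda>x. 2 * exp m * (F x - c)\<^sup>2)" using bF by (intro bfun_mult bfun_power bfun_diff) auto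
    have b': "bfun M (\<lambda>x. 2 * R\<^sup>2 * exp (- m) * exp (- 2 * b x))" "bfun M (\<lambda>x. 4 * R\<^sup>2 * exp (- m) * exp (2 * b x))"
      using bm by (auto intro!: bfun_mult)
    show ?thesis unfolding E_add[OF a bfun_add[OF b']] E_add[OF b'] by simp
  qed
  also have "\<dots> \<le> 2 * exp m * ((2 * R\<^sup>2 * Lb\<^sup>2 * exp (- 2 * m) * K + 2 * exp m * E (\<lambda>x. exp (b x) * (G x)\<^sup>2)) / \<alpha>)
     + (2 * R\<^sup>2 * exp (- m) * K + 4 * R\<^sup>2 * exp (- m) * K)"
    using mom PF by (intro add_mono mult_left_mono) auto
  also have "\<dots> = 4 / \<alpha> * (exp m * exp m) * E (\<lambda>x. exp (b x) * (G x)\<^sup>2)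
     + K * (4 * Lb\<^sup>2 / \<alpha> * (exp m * exp (- 2 * m)) + 6 * exp (- m)) * R\<^sup>2"
    using alpha by (simp add: field_simps)
  also have "exp m * exp m = exp (2 * m)" by (simp flip: exp_add)
  also have "exp m * exp (- 2 * m) = exp (- m)" by (simp flip: exp_add)
  finally have "E (\<lambda>x. exp (b x) * (f x - c)\<^sup>2) \<le> 4 / \<alpha> * exp (2 * m) * E (\<lambda>x. exp (b x) * (G x)\<^sup>2)
     + K * (4 * Lb\<^sup>2 / \<alpha> + 6) * exp (- m) * R\<^sup>2" by (simp add: algebra_simps)
  then show ?thesis unfolding K_def by blast
qed


lemma tilted_E:
  assumes "bfun M b" "bfun M f"
  shows "integral\<^sup>L (density M (\<lambda>x. ennreal (exp (b x)))) f = E (\<lambda>x. exp (b x) * f x)"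
proof -
  have [measurable]: "b \<in> borel_measurable M" "f \<in> borel_measurable M" using assms by (auto intro: bfun_meas)
  show ?thesis by (subst integral_real_density) auto
qed

text \<open>The end points lie at distances (1 - t) r and t r from the interpolated point, so the
  weighted mean of \<open>b\<close> at the ends exceeds its value there by at most 2 Lb t (1 - t) r.
  This is exactly the linear term in the locale, with Lb in the place of L.\<close>

lemma tilt:
  assumes L0: "L = 0" and b: "bfun M b" and Lb: "0 \<le> Lb"
    and lip: "\<And>x z. x \<in> space M \<Longrightarrow> z \<in> space M \<Longrightarrow> \<bar>b x - b z\<bar> \<le> Lb * r x z"
    and one: "E (\<lambda>x. exp (b x)) = 1"
  shows "displacement (density M (\<lambda>x. ennreal (exp (b x)))) r diam cmb \<alpha> Lb"
proof -
  let ?N = "density M (\<lambda>x. ennreal (exp (b x)))"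
  have [measurable]: "b \<in> borel_measurable M" using b by (rule bfun_meas)
  have bN: "bfun ?N f \<longleftrightarrow> bfun M f" for f by (simp add: bfun_def)
  have "prob_space ?N"
  proof
    have "emeasure ?N (space ?N) = (\<integral>\<^sup>+x. ennreal (exp (b x)) \<partial>M)"
      by (simp add: emeasure_density cong: nn_integral_cong)
    also have "\<dots> = ennreal (E (\<lambda>x. exp (b x)))"
      using b by (intro nn_integral_eq_integral) auto
    finally show "emeasure ?N (space ?N) = 1" using one by simp
  qed
  then interpret N: prob_space ?N .
  show ?thesis
  proof
    fix t U V W
    assume t: "0 < (t::real)" "t < 1" and UVW: "bfun ?N U" "bfun ?N V" "bfun ?N W"
      and le: "\<And>x y. x \<in> space ?N \<Longrightarrow> y \<in> space ?N \<Longrightarrow> t * U x + (1 - t) * V y + 2 * Lb * t * (1 - t) * r x y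
         \<le> W (cmb t x y) + \<alpha> / 2 * t * (1 - t) * (r x y)\<^sup>2"
    note UVW = UVW[unfolded bN]
    have i: "integral\<^sup>L ?N (\<lambda>x. exp (F x)) = E (\<lambda>x. exp (b x + F x))" if "bfun M F" for F
      using that b by (simp add: tilted_E bfun_exp exp_add)
    show "(integral\<^sup>L ?N (\<lambda>x. exp (U x))) powr t * (integral\<^sup>L ?N (\<lambda>x. exp (V x))) powr (1 - t)
        \<le> integral\<^sup>L ?N (\<lambda>x. exp (W x))"
      unfolding i[OF UVW(1)] i[OF UVW(2)] i[OF UVW(3)]
    proof (rule pl[OF t])
      fix x y assume xy: "x \<in> space M" "y \<in> space M"
      let ?z = "cmb t x y" and ?p = "r x y"
      have z: "?z \<in> space M" using cmb_space t xy by simp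
      have "b x - b ?z \<le> Lb * ((1 - t) * ?p)" "b y - b ?z \<le> Lb * (t * ?p)"
        using lip[OF xy(1) z] lip[OF xy(2) z] r_cmb_left[OF t xy] r_cmb_right[OF t xy] by auto
      then have "t * (b x - b ?z) \<le> t * (Lb * ((1 - t) * ?p))" "(1 - t) * (b y - b ?z) \<le> (1 - t) * (Lb * (t * ?p))"
        using t by (auto intro!: mult_left_mono simp del: mult_le_cancel_left_pos)
      then have "t * b x + (1 - t) * b y - b ?z \<le> 2 * Lb * t * (1 - t) * ?p"
        by (simp add: algebra_simps)
      then show "t * (b x + U x) + (1 - t) * (b y + V y) + 2 * L * t * (1 - t) * ?p
        \<le> b ?z + W ?z + \<alpha> / 2 * t * (1 - t) * ?p\<^sup>2"
        using le[of x y] xy unfolding L0 by (simp add: distrib_left)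
    qed (use b UVW in \<open>auto intro!: bfun_add\<close>)
  qed (use r_nonneg r_diam alpha Lb cmb_space r_cmb_left r_cmb_right in auto)
qed

end

text \<open>\<open>D\<close> is the defect of the logarithmic Sobolev inequality, \<open>K\<close>
  the factor of R^2 exp (- m) in \<open>weak_poincare\<close>, and \<open>\<kappa>\<close> the
  squared truncation level in units of the variance. The square of 8 K \<kappa> is exp (2 m) for the
  cutoff parameter chosen in \<open>tilted_poincare\<close>.\<close>

definition poincare_const :: "real \<Rightarrow> real \<Rightarrow> real" where
  "poincare_const \<alpha> L = (let D = 4 * L\<^sup>2 / \<alpha>; K = exp D * (D + 6); \<kappa> = exp (8 * (D + 1))
     in 2 * (8 / \<alpha> * (8 * K * \<kappa>)\<^sup>2 + 1 / \<alpha>))"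

lemma poincare_const_pos: "0 < \<alpha> \<Longrightarrow> 0 < poincare_const \<alpha> L"
  by (simp add: poincare_const_def Let_def add_nonneg_pos)

text \<open>The centred function h is truncated at level R = sqrt (\<kappa> V), with V its variance.
  The weak Poincare inequality bounds the truncation and the defective logarithmic Sobolev
  inequality the excess. Each estimate contains V / 8; doubling in (u + v)^2 \<le> 2 u^2 + 2 v^2
  makes this V / 2, which is absorbed on the left.\<close>

lemma (in displacement) tilted_poincare:
  assumes L0: "L = 0" and b: "bfun M b" and Lb: "0 \<le> Lb"
    and lip: "\<And>x z. x \<in> space M \<Longrightarrow> z \<in> space M \<Longrightarrow> \<bar>b x - b z\<bar> \<le> Lb * r x z"
    and one: "E (\<lambda>x. exp (b x)) = 1"
    and f: "bfun M f" "bfun M G" "sl f G"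
  defines "N \<equiv> density M (\<lambda>x. ennreal (exp (b x)))"
  shows "integral\<^sup>L N (\<lambda>x. (f x - integral\<^sup>L N f)\<^sup>2) \<le> poincare_const \<alpha> Lb * integral\<^sup>L N (\<lambda>x. (G x)\<^sup>2)"
proof -
  interpret N: displacement N r diam cmb \<alpha> Lb
    unfolding N_def by (rule tilt[OF L0 b Lb lip one])
  have sp: "space N = space M" by (simp add: N_def)
  have bN: "bfun N h \<longleftrightarrow> bfun M h" for h by (simp add: bfun_def N_def)
  have EN: "N.E h = E (\<lambda>x. exp (b x) * h x)" if "bfun M h" for h
    unfolding N_def by (rule tilted_E[OF b that])
  define h where "h x = f x - N.E f" for x
  have bh: "bfun M h" unfolding h_def using f by auto
  have bhN: "bfun N h" "bfun N G" "bfun N f" using bh f by (auto simp: bN)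
  have h0: "N.E h = 0" unfolding h_def using bhN by (subst N.E_diff) auto
  have slh: "sl h G" using slope_shift[OF f(3), of "- N.E f"] by (simp add: h_def[abs_def])
  define V where "V = N.E (\<lambda>x. (h x)\<^sup>2)"
  define I where "I = N.E (\<lambda>x. (G x)\<^sup>2)"
  have I0: "0 \<le> I" unfolding I_def by (rule N.E_nonneg) simp
  have V0: "0 \<le> V" unfolding V_def by (rule N.E_nonneg) simp
  define D where "D = 4 * Lb\<^sup>2 / \<alpha>"
  have D0: "0 \<le> D" using alpha by (simp add: D_def)
  define K where "K = exp D * (D + 6)"
  \<comment> \<open>Chosen so that ln \<kappa> is eight times the coefficient D + 1 of V in the
    entropy bound \<open>ent\<close>.\<close>
  define \<kappa> where "\<kappa> = exp (8 * (D + 1))"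
  \<comment> \<open>With R^2 = \<kappa> V this makes the error term K exp (- m) R^2 of the weak
    inequality equal to V / 8.\<close>
  define m where "m = ln (8 * K * \<kappa>)"
  have K1: "1 \<le> K" unfolding K_def using D0 by (intro order_trans[OF _ mult_mono[of 1 "exp D" 1 "D + 6"]]) auto
  have k1: "0 < \<kappa>" by (simp add: \<kappa>_def)
  have em: "exp m = 8 * K * \<kappa>" unfolding m_def using K1 k1 by simp
  have "V \<le> 2 * (8 / \<alpha> * exp (2 * m) + 1 / \<alpha>) * I"
  proof (cases "V = 0")
    case True
    then show ?thesis using I0 alpha by simp
  next
    case False
    then have V: "0 < V" using V0 by simp
    define R where "R = sqrt (\<kappa> * V)"
    have R: "0 < R" "R\<^sup>2 = \<kappa> * V" using V k1 by (auto simp: R_def)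
    define cl where "cl s = max (- R) (min R s)" for s
    define hR where "hR x = cl (h x)" for x
    have bR: "bfun M hR" unfolding hR_def by (rule bfun_cont[OF bh]) (auto simp: cl_def intro!: continuous_intros)
    have slR: "sl hR G" unfolding hR_def by (rule slope_contraction[OF slh]) (auto simp: cl_def)
    have hRR: "\<bar>hR x\<bar> \<le> R" for x using R(1) by (auto simp: hR_def cl_def)
    obtain c where c: "E (\<lambda>x. exp (b x) * (hR x - c)\<^sup>2) \<le> 4 / \<alpha> * exp (2 * m) * E (\<lambda>x. exp (b x) * (G x)\<^sup>2)
       + exp D * (D + 6) * exp (- m) * R\<^sup>2"
      using weak_poincare[OF L0 b Lb lip one bR f(2) slR, of R m] hRR unfolding D_def by blast
    have c: "N.E (\<lambda>x. (hR x - c)\<^sup>2) \<le> 4 / \<alpha> * exp (2 * m) * I + K * exp (- m) * (\<kappa> * V)"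
      using c bR f by (simp add: EN I_def K_def R(2) bfun_power bfun_diff)
    have kv: "K * exp (- m) * (\<kappa> * V) = V / 8"
      unfolding exp_minus em using K1 k1 by (simp add: field_simps)
    have c: "N.E (\<lambda>x. (hR x - c)\<^sup>2) \<le> 4 / \<alpha> * exp (2 * m) * I + V / 8" using c unfolding kv .
    \<comment> \<open>This \<open>?Y\<close> has mean 2, so its contribution ln 2 to the dual
      inequality is below 1, while ln \<open>?Y\<close> is at least ln \<kappa> wherever |h| exceeds
      R.\<close>
    let ?Y = "\<lambda>x. 1 + (h x)\<^sup>2 / V"
    have bY: "bfun N ?Y" using bhN by (intro bfun_add bfun_cdiv bfun_power) auto
    have bl: "bfun N (\<lambda>x. ln (?Y x))" using bY V by (intro bfun_ln[of _ _ 1]) auto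
    have EY: "N.E ?Y = 2" using bhN V by (subst N.E_add) (auto simp: V_def intro!: bfun_cdiv bfun_power)
    have "N.E (\<lambda>x. (h x)\<^sup>2 * ln (?Y x)) \<le> 4 / \<alpha> * I + (D + ln (N.E ?Y)) * V"
      unfolding I_def V_def D_def
      by (rule N.lsi_dual[OF bhN(1,2) _ bY[unfolded V_def]]) (use slh V0 in \<open>auto simp: sp V_def\<close>)
    also have "\<dots> \<le> 4 / \<alpha> * I + (D + 1) * V"
      unfolding EY using V ln_2_less_1 by (intro add_left_mono mult_right_mono) auto
    finally have ent: "N.E (\<lambda>x. (h x)\<^sup>2 * ln (?Y x)) \<le> 4 / \<alpha> * I + (D + 1) * V" .
    have "N.E (\<lambda>x. 8 * (D + 1) * (h x - hR x)\<^sup>2) \<le> N.E (\<lambda>x. (h x)\<^sup>2 * ln (?Y x))"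
    proof (rule N.E_mono)
      fix x
      show "8 * (D + 1) * (h x - hR x)\<^sup>2 \<le> (h x)\<^sup>2 * ln (?Y x)"
      proof (cases "\<bar>h x\<bar> \<le> R")
        case True
        then have "hR x = h x" by (auto simp: hR_def cl_def)
        moreover have "0 \<le> ln (?Y x)" using V by (intro ln_ge_zero) auto
        ultimately show ?thesis by simp
      next
        case False
        have "\<bar>h x - hR x\<bar> \<le> \<bar>h x\<bar>" using R(1) by (auto simp: hR_def cl_def)
        then have 1: "(h x - hR x)\<^sup>2 \<le> (h x)\<^sup>2" by (simp add: abs_le_square_iff)
        have "R\<^sup>2 \<le> \<bar>h x\<bar>\<^sup>2" using False R(1) by (intro power_mono) auto
        then have "\<kappa> \<le> (h x)\<^sup>2 / V" using R(2) V by (simp add: field_simps)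
        then have "ln \<kappa> \<le> ln (?Y x)" using k1 by (subst ln_le_cancel_iff) auto
        then have 2: "8 * (D + 1) \<le> ln (?Y x)" by (simp add: \<kappa>_def)
        show ?thesis using mult_mono[OF 2 1] D0 2 by (simp add: mult.commute)
      qed
    qed (use bhN bl bR in \<open>auto simp: bN intro!: bfun_mult bfun_power bfun_diff\<close>)
    then have "8 * (D + 1) * N.E (\<lambda>x. (h x - hR x)\<^sup>2) \<le> 4 / \<alpha> * I + (D + 1) * V" using ent by simp
    then have "N.E (\<lambda>x. (h x - hR x)\<^sup>2) \<le> (4 / \<alpha> * I + (D + 1) * V) / (8 * (D + 1))"
      using D0 by (simp add: pos_le_divide_eq mult.commute)
    also have "\<dots> = (4 / \<alpha> * I) / (8 * (D + 1)) + V / 8"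
    proof -
      have "(u + d * V) / (8 * d) = u / (8 * d) + V / 8" if "0 < d" for u d using that by (simp add: field_simps)
      from this[of "D + 1"] D0 show ?thesis by simp
    qed
    also have "(4 / \<alpha> * I) / (8 * (D + 1)) \<le> (4 / \<alpha> * I) / 8"
      using D0 alpha I0 by (intro divide_left_mono) auto
    finally have tail: "N.E (\<lambda>x. (h x - hR x)\<^sup>2) \<le> I / (2 * \<alpha>) + V / 8" by simp
    \<comment> \<open>The mean minimizes the quadratic deviation, so the unspecified centre
      \<open>c\<close> of the weak inequality may be inserted.\<close>
    have "V \<le> N.E (\<lambda>x. (h x - c)\<^sup>2)"
    proof -
      have "N.E (\<lambda>x. (h x - c)\<^sup>2) = N.E (\<lambda>x. (h x)\<^sup>2 + ((- 2 * c) * h x + c\<^sup>2))"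
        by (intro Bochner_Integration.integral_cong) (auto simp: power2_diff)
      also have "\<dots> = V + ((- 2 * c) * N.E h + c\<^sup>2)"
        using N.E_add[OF bfun_power[OF bhN(1)] bfun_add[OF bfun_mult[OF bfun_const bhN(1)] bfun_const], of 2 "- 2 * c" "c\<^sup>2"]
          N.E_add[OF bfun_mult[OF bfun_const bhN(1)] bfun_const, of "- 2 * c" "c\<^sup>2"]
        by (simp add: V_def)
      finally show ?thesis using h0 by simp
    qed
    also have "\<dots> \<le> N.E (\<lambda>x. 2 * (hR x - c)\<^sup>2 + 2 * (h x - hR x)\<^sup>2)"
    proof (rule N.E_mono)
      fix x
      have "(u + v)\<^sup>2 \<le> 2 * u\<^sup>2 + 2 * v\<^sup>2" for u v :: real using sum_squares_bound[of u v] by (simp add: power2_sum)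
      from this[of "hR x - c" "h x - hR x"] show "(h x - c)\<^sup>2 \<le> 2 * (hR x - c)\<^sup>2 + 2 * (h x - hR x)\<^sup>2" by simp
    qed (use bh bR in \<open>auto simp: bN intro!: bfun_add bfun_mult bfun_power bfun_diff\<close>)
    also have "\<dots> = 2 * N.E (\<lambda>x. (hR x - c)\<^sup>2) + 2 * N.E (\<lambda>x. (h x - hR x)\<^sup>2)"
      using bh bR by (subst N.E_add) (auto simp: bN intro!: bfun_mult bfun_power bfun_diff)
    also have "\<dots> \<le> 2 * (4 / \<alpha> * exp (2 * m) * I + V / 8) + 2 * (I / (2 * \<alpha>) + V / 8)"
      using c tail by (intro add_mono mult_left_mono) auto
    finally have "V \<le> 2 * (4 / \<alpha> * exp (2 * m) * I + V / 8) + 2 * (I / (2 * \<alpha>) + V / 8)" .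
    moreover have "2 * (8 / \<alpha> * exp (2 * m) + 1 / \<alpha>) * I = 4 * (4 / \<alpha> * exp (2 * m) * I) + 4 * (I / (2 * \<alpha>))"
      using alpha by (simp add: field_simps)
    moreover have "V \<le> 4 * a + 4 * c" if "V \<le> 2 * (a + V / 8) + 2 * (c + V / 8)" for a c using that by simp
    ultimately show ?thesis by metis
  qed
  also have "exp (2 * m) = (8 * K * \<kappa>)\<^sup>2" by (simp add: exp_double em)
  finally show ?thesis unfolding V_def I_def h_def poincare_const_def Let_def K_def \<kappa>_def D_def .
qed

section \<open>From the logarithmic Sobolev inequality to general divergences\<close>

lemma increment_ge:
  fixes g :: "real \<Rightarrow> real"
  assumes "s \<le> t" "\<And>x. s \<le> x \<Longrightarrow> x \<le> t \<Longrightarrow> (g has_real_derivative g' x) (at x)" "\<And>x. s \<le> x \<Longrightarrow> x \<le> t \<Longrightarrow> 0 \<le> g' x"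
  shows "g s \<le> g t"
  using assms by (intro DERIV_nonneg_imp_nondecreasing[of s t g]) blast+

text \<open>The two monotonicity conditions hold when 1 / k is positive, concave and increasing.
  Their extreme cases are k constant and k = 1 / (s - a), the second derivatives for variance and
  for entropy. The choice W' = sqrt k turns the weighted energy k (f) G^2 into the plain energy of W
  f.\<close>

locale half_convex =
  fixes a b :: real and k W \<Phi> \<Phi>' :: "real \<Rightarrow> real"
  assumes k_pos: "s \<in> {a<..<b} \<Longrightarrow> 0 < k s"
    and k_anti: "s \<in> {a<..<b} \<Longrightarrow> t \<in> {a<..<b} \<Longrightarrow> s \<le> t \<Longrightarrow> k t \<le> k s"
    and k_mono: "s \<in> {a<..<b} \<Longrightarrow> t \<in> {a<..<b} \<Longrightarrow> s \<le> t \<Longrightarrow> (s - a) * k s \<le> (t - a) * k t"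
    and k_cont: "continuous_on {a<..<b} k"
    and dW: "s \<in> {a<..<b} \<Longrightarrow> (W has_real_derivative sqrt (k s)) (at s)"
    and d1: "s \<in> {a<..<b} \<Longrightarrow> (\<Phi> has_real_derivative \<Phi>' s) (at s)"
    and d2: "s \<in> {a<..<b} \<Longrightarrow> (\<Phi>' has_real_derivative k s) (at s)"
begin

definition "breg s m = \<Phi> s - \<Phi> m - \<Phi>' m * (s - m)"

lemma W_increment:
  assumes "s \<in> {a<..<b}" "t \<in> {a<..<b}" "s < t"
  obtains z where "s < z" "z < t" "W t - W s = (t - s) * sqrt (k z)"
  using MVT2[OF assms(3), of W "\<lambda>z. sqrt (k z)"] dW assms by force

lemma W_increment_ge:
  assumes "s \<in> {a<..<b}" "t \<in> {a<..<b}" "s \<le> t"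
  shows "(t - s) * sqrt (k t) \<le> W t - W s"
proof (cases "s = t")
  case False
  then have "s < t" using assms by simp
  then obtain z where z: "s < z" "z < t" "W t - W s = (t - s) * sqrt (k z)" using W_increment assms by metis
  have "sqrt (k t) \<le> sqrt (k z)" using z assms by (intro real_sqrt_le_mono k_anti) auto
  then show ?thesis using z assms by (simp add: mult_left_mono)
qed simp

lemma W_tangent:
  assumes "s \<in> {a<..<b}" "m \<in> {a<..<b}"
  shows "W s \<le> W m + sqrt (k m) * (s - m)"
proof (cases s m rule: linorder_cases)
  case less
  then show ?thesis using W_increment_ge[of s m] assms by (simp add: algebra_simps)
next
  case greater
  then obtain z where z: "m < z" "z < s" "W s - W m = (s - m) * sqrt (k z)" using W_increment assms by metis
  have "sqrt (k z) \<le> sqrt (k m)" using z assms by (intro real_sqrt_le_mono k_anti) auto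
  then have "(s - m) * sqrt (k z) \<le> (s - m) * sqrt (k m)" using greater by (intro mult_left_mono) auto
  then show ?thesis using z by (simp add: algebra_simps)
qed simp

text \<open>Differentiate both sides in the base point \<open>m\<close>: the claim becomes k (m) (m
  - s) \<le> (W m - W s) sqrt (k m), which holds because W' = sqrt k decreases.\<close>

lemma breg_left:
  assumes s: "s \<in> {a<..<b}" and m: "m \<in> {a<..<b}" and sm: "s \<le> m"
  shows "breg s m \<le> (W s - W m)\<^sup>2 / 2"
proof -
  let ?g = "\<lambda>m. (W m - W s)\<^sup>2 / 2 - (\<Phi> s - \<Phi> m - \<Phi>' m * (s - m))"
  have "?g s \<le> ?g m"
  proof (rule increment_ge[OF sm, where g' = "\<lambda>m. (W m - W s) * sqrt (k m) - k m * (m - s)"])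
    fix x assume x: "s \<le> x" "x \<le> m"
    then have xJ: "x \<in> {a<..<b}" using s m by auto
    show "(?g has_real_derivative (W x - W s) * sqrt (k x) - k x * (x - s)) (at x)"
      by (rule derivative_eq_intros dW[OF xJ] d1[OF xJ] d2[OF xJ] refl | simp add: field_simps)+
    have "(x - s) * sqrt (k x) * sqrt (k x) \<le> (W x - W s) * sqrt (k x)"
      using W_increment_ge[OF s xJ x(1)] k_pos[OF xJ] by (intro mult_right_mono) auto
    moreover have "(x - s) * sqrt (k x) * sqrt (k x) = k x * (x - s)"
      using k_pos[OF xJ] by (simp add: mult.assoc)
    ultimately show "0 \<le> (W x - W s) * sqrt (k x) - k x * (x - s)" by linarith
  qed
  then show ?thesis by (simp add: breg_def power2_commute)
qed

lemma ln_ratio_nonneg: "m \<in> {a<..<b} \<Longrightarrow> m \<le> s \<Longrightarrow> 0 \<le> ln ((s - a) / (m - a))"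
  by (intro ln_ge_zero) auto

text \<open>Integrate k u \<le> k s (s - a) / (u - a), a form of \<open>k_mono\<close>, over u
  between m and s.\<close>

lemma dk_increment_le:
  assumes s: "s \<in> {a<..<b}" and m: "m \<in> {a<..<b}" and ms: "m \<le> s"
  shows "\<Phi>' s - \<Phi>' m \<le> k s * (s - a) * ln ((s - a) / (m - a))"
proof -
  let ?g = "\<lambda>u. k s * (s - a) * (ln (u - a) - ln (m - a)) - (\<Phi>' u - \<Phi>' m)"
  have "?g m \<le> ?g s"
  proof (rule increment_ge[OF ms, where g' = "\<lambda>u. k s * (s - a) * (1 / (u - a)) - k u"])
    fix x assume x: "m \<le> x" "x \<le> s"
    then have xJ: "x \<in> {a<..<b}" using s m by auto
    then show "(?g has_real_derivative k s * (s - a) * (1 / (x - a)) - k x) (at x)"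
      by (auto intro!: derivative_eq_intros d2)
    have "k x \<le> k s * (s - a) / (x - a)" using k_mono[OF xJ s x(2)] xJ by (simp add: pos_le_divide_eq mult.commute)
    then show "0 \<le> k s * (s - a) * (1 / (x - a)) - k x" by simp
  qed
  then show ?thesis using s m by (simp add: ln_div)
qed

text \<open>Differentiate in \<open>s\<close>. To the right of m the decreasing \<open>k\<close> may
  have been much larger earlier on, so the square of the increment of \<open>W\<close> alone is not
  enough. With l = ln ((x - a) / (m - a)), the increment of the first derivative is at most k (x -
  a) l, and (x - a) l \<le> (x - m) (1 + l) follows from ln y \<le> y - 1.\<close>

lemma breg_right:
  assumes s: "s \<in> {a<..<b}" and m: "m \<in> {a<..<b}" and ms: "m \<le> s"
  shows "breg s m \<le> (W s - W m)\<^sup>2 / 2 * (1 + ln ((s - a) / (m - a)))"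
proof -
  let ?l = "\<lambda>s. ln (s - a) - ln (m - a)"
  let ?g = "\<lambda>s. (W s - W m)\<^sup>2 / 2 * (1 + ?l s) - (\<Phi> s - \<Phi> m - \<Phi>' m * (s - m))"
  let ?g' = "\<lambda>s. (W s - W m) * sqrt (k s) * (1 + ?l s) + (W s - W m)\<^sup>2 / 2 * (1 / (s - a)) - (\<Phi>' s - \<Phi>' m)"
  have "?g m \<le> ?g s"
  proof (rule increment_ge[OF ms, where g' = ?g'])
    fix x assume x: "m \<le> x" "x \<le> s"
    then have xJ: "x \<in> {a<..<b}" using s m by auto
    have xa: "x - a > 0" using xJ by simp
    show "(?g has_real_derivative ?g' x) (at x)"
      by (rule derivative_eq_intros dW[OF xJ] d1[OF xJ] refl xa | simp add: field_simps)+
    have l: "?l x = ln ((x - a) / (m - a))" using xJ m by (simp add: ln_div)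
    have l0: "0 \<le> ?l x" unfolding l using ln_ratio_nonneg[OF m x(1)] .
    have "?l x \<le> (x - a) / (m - a) - 1" unfolding l using xJ m by (intro ln_le_minus_one) auto
    then have "?l x * (m - a) \<le> ((x - a) / (m - a) - 1) * (m - a)" using m by (intro mult_right_mono) auto
    also have "\<dots> = x - m" using m by (simp add: field_simps)
    finally have "(x - a) * ?l x \<le> (x - m) * (1 + ?l x)" by (simp add: algebra_simps)
    then have "k x * ((x - a) * ?l x) \<le> k x * ((x - m) * (1 + ?l x))"
      using k_pos[OF xJ] by (intro mult_left_mono) auto
    also have "\<dots> = ((x - m) * sqrt (k x)) * sqrt (k x) * (1 + ?l x)"
      using k_pos[OF xJ] by (simp add: mult_ac real_sqrt_mult_self) 
    also have "\<dots> \<le> (W x - W m) * sqrt (k x) * (1 + ?l x)"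
      using W_increment_ge[OF m xJ x(1)] k_pos[OF xJ] l0 by (intro mult_right_mono) auto
    finally have 1: "k x * (x - a) * ?l x \<le> (W x - W m) * sqrt (k x) * (1 + ?l x)" by (simp add: mult_ac)
    have 2: "\<Phi>' x - \<Phi>' m \<le> k x * (x - a) * ?l x" using dk_increment_le[OF xJ m x(1)] l by simp
    have 3: "0 \<le> (W x - W m)\<^sup>2 / 2 * (1 / (x - a))" using xJ by simp
    show "0 \<le> ?g' x" using 1 2 3 by linarith
  qed
  then show ?thesis using s m by (simp add: breg_def ln_div)
qed

lemma breg_le:
  assumes s: "s \<in> {a<..<b}" and m: "m \<in> {a<..<b}"
  shows "breg s m \<le> (W s - W m)\<^sup>2 / 2 * (1 + ln (1 + (s - a) / (m - a)))"
proof (cases "s \<le> m")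
  case True
  have "(W s - W m)\<^sup>2 / 2 * 1 \<le> (W s - W m)\<^sup>2 / 2 * (1 + ln (1 + (s - a) / (m - a)))"
    using s m by (intro mult_left_mono) auto
  then show ?thesis using breg_left[OF s m True] by simp
next
  case False
  have "ln ((s - a) / (m - a)) \<le> ln (1 + (s - a) / (m - a))" using s m by (subst ln_le_cancel_iff) (auto simp: add_pos_pos)
  then have "(W s - W m)\<^sup>2 / 2 * (1 + ln ((s - a) / (m - a))) \<le> (W s - W m)\<^sup>2 / 2 * (1 + ln (1 + (s - a) / (m - a)))"
    by (intro mult_left_mono) auto
  then show ?thesis using breg_right[OF s m] False by simp
qed

text \<open>By \<open>k_mono\<close>, sqrt k dominates the multiple of 1 / sqrt (s - a) that agrees
  with it at \<open>m\<close> to the right of m, and is dominated by it to the left; both facts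
  integrate to the same lower bound. It limits how far the mean of W f can fall below W m.\<close>

lemma W_growth:
  assumes s: "s \<in> {a<..<b}" and m: "m \<in> {a<..<b}"
  shows "2 * (m - a) * sqrt (k m) * (sqrt ((s - a) / (m - a)) - 1) \<le> W s - W m"
proof -
  let ?r = "sqrt (k m) * sqrt (m - a)"
  let ?g = "\<lambda>s. W s - W m - 2 * ?r * (sqrt (s - a) - sqrt (m - a))"
  let ?g' = "\<lambda>s. sqrt (k s) - ?r / sqrt (s - a)"
  have d: "(?g has_real_derivative ?g' x) (at x)" if xJ: "x \<in> {a<..<b}" for x
    using xJ by (auto intro!: derivative_eq_intros dW[OF xJ] simp: field_simps)
  have r: "?r = sqrt ((m - a) * k m)" by (simp add: real_sqrt_mult)
  have e: "sqrt (k x) = sqrt ((x - a) * k x) / sqrt (x - a)" if "x \<in> {a<..<b}" for x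
    using that by (simp add: real_sqrt_mult)
  have "0 \<le> ?g s"
  proof (cases "m \<le> s")
    case True
    have "?g m \<le> ?g s"
    proof (rule increment_ge[OF True, where g' = ?g'])
      fix x assume x: "m \<le> x" "x \<le> s"
      then have xJ: "x \<in> {a<..<b}" using s m by auto
      show "(?g has_real_derivative ?g' x) (at x)" by (rule d[OF xJ])
      show "0 \<le> ?g' x" unfolding r e[OF xJ] using k_mono[OF m xJ x(1)] xJ
        by (simp add: divide_right_mono)
    qed
    then show ?thesis by simp
  next
    case False
    then have sm: "s \<le> m" by simp
    have "- ?g s \<le> - ?g m"
    proof (rule increment_ge[OF sm, where g' = "\<lambda>x. - ?g' x"])
      fix x assume x: "s \<le> x" "x \<le> m"
      then have xJ: "x \<in> {a<..<b}" using s m by auto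
      show "((\<lambda>x. - ?g x) has_real_derivative - ?g' x) (at x)" by (rule DERIV_minus[OF d[OF xJ]])
      show "0 \<le> - ?g' x" unfolding r e[OF xJ] using k_mono[OF xJ m x(2)] xJ
        by (simp add: divide_right_mono)
    qed
    then show ?thesis by simp
  qed
  moreover have "2 * ?r * (sqrt (s - a) - sqrt (m - a)) = 2 * (m - a) * sqrt (k m) * (sqrt ((s - a) / (m - a)) - 1)"
  proof -
    have e1: "(m - a) * sqrt ((s - a) / (m - a)) = sqrt (m - a) * sqrt (s - a)"
    proof -
      have "(p * p) * (v / p) = p * v" if "p \<noteq> 0" for p v :: real using that by simp
      from this[of "sqrt (m - a)" "sqrt (s - a)"] show ?thesis using s m by (simp add: real_sqrt_divide)
    qed
    have e2: "sqrt (m - a) * sqrt (m - a) = m - a" using m by simp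
    have "2 * ?r * (sqrt (s - a) - sqrt (m - a))
        = 2 * sqrt (k m) * (sqrt (m - a) * sqrt (s - a) - sqrt (m - a) * sqrt (m - a))"
      by (simp only: right_diff_distrib mult_ac)
    also have "\<dots> = 2 * sqrt (k m) * ((m - a) * sqrt ((s - a) / (m - a)) - (m - a))"
      unfolding e1 e2 ..
    also have "\<dots> = 2 * (m - a) * sqrt (k m) * (sqrt ((s - a) / (m - a)) - 1)" by (simp add: algebra_simps)
    finally show ?thesis .
  qed
  ultimately show ?thesis by simp
qed

text \<open>To the right of \<open>t\<close> the decreasing \<open>k\<close> gives the linear bound
  directly. To the left \<open>k\<close> can grow, but by \<open>k_mono\<close> at most by the
  factor (t - a) / (z - a) = 1 + (t - z) / (z - a); the excess is the quadratic error, finite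
  because \<open>lo\<close> stays away from \<open>a\<close>.\<close>

lemma W_slope:
  assumes lh: "a < lo" "hi < b" and s: "s \<in> {lo..hi}" and t: "t \<in> {lo..hi}"
  shows "\<bar>W s - W t\<bar> \<le> sqrt (k t) * \<bar>s - t\<bar> + sqrt (k lo) / (lo - a) * \<bar>s - t\<bar>\<^sup>2"
proof -
  have J: "s \<in> {a<..<b}" "t \<in> {a<..<b}" "lo \<in> {a<..<b}" using assms by auto
  have C: "0 \<le> sqrt (k lo) / (lo - a)" using lh k_pos[OF J(3)] by simp
  show ?thesis
  proof (cases s t rule: linorder_cases)
    case equal then show ?thesis by simp
  next
    case greater
    then obtain z where z: "t < z" "z < s" "W s - W t = (s - t) * sqrt (k z)" using W_increment J by metis
    have zJ: "z \<in> {a<..<b}" using z J by auto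
    have "sqrt (k z) \<le> sqrt (k t)" using z J by (intro real_sqrt_le_mono k_anti) auto
    then have "\<bar>W s - W t\<bar> \<le> sqrt (k t) * \<bar>s - t\<bar>" using z greater k_pos[OF zJ]
      by (simp add: abs_mult mult.commute mult_left_mono)
    moreover have "0 \<le> sqrt (k lo) / (lo - a) * \<bar>s - t\<bar>\<^sup>2" by (intro mult_nonneg_nonneg C) simp
    ultimately show ?thesis by linarith
  next
    case less
    then obtain z where z: "s < z" "z < t" "W t - W s = (t - s) * sqrt (k z)" using W_increment J by metis
    have zJ: "z \<in> {a<..<b}" using z J by auto
    have za: "0 < z - a" using zJ by simp
    have "k z \<le> k t * ((t - a) / (z - a))" using k_mono[OF zJ J(2)] z za by (simp add: pos_le_divide_eq mult.commute)
    then have "sqrt (k z) \<le> sqrt (k t) * sqrt ((t - a) / (z - a))"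
      by (metis real_sqrt_le_iff real_sqrt_mult)
    also have "sqrt ((t - a) / (z - a)) \<le> (t - a) / (z - a)"
    proof -
      have "1 \<le> (t - a) / (z - a)" using z za by simp
      then show ?thesis by (metis (no_types, opaque_lifting) linorder_not_less mult_le_cancel_left1 not_one_le_zero order_trans power2_eq_square real_le_lsqrt zero_le_one)
    qed
    also have "(t - a) / (z - a) = 1 + (t - z) / (z - a)" using za by (simp add: field_simps)
    finally have "sqrt (k z) \<le> sqrt (k t) + sqrt (k t) * ((t - z) / (z - a))"
      using k_pos[OF J(2)] by (simp add: algebra_simps mult_left_mono)
    also have "sqrt (k t) * ((t - z) / (z - a)) \<le> sqrt (k lo) * ((t - s) / (lo - a))"
    proof (intro mult_mono frac_le)
      show "sqrt (k t) \<le> sqrt (k lo)" using t J by (intro real_sqrt_le_mono k_anti) auto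
    qed (use z s lh k_pos[OF J(3)] in auto)
    finally have "(t - s) * sqrt (k z) \<le> (t - s) * (sqrt (k t) + sqrt (k lo) * ((t - s) / (lo - a)))"
      using less by (intro mult_left_mono) auto
    moreover have "\<bar>W s - W t\<bar> = (t - s) * sqrt (k z)" using z less k_pos[OF zJ] by (simp add: abs_minus_commute[of "W s"] abs_mult)
    moreover have "sqrt (k t) * e + sqrt (k lo) / (lo - a) * e\<^sup>2 = e * (sqrt (k t) + sqrt (k lo) * (e / (lo - a)))" for e
      by (simp add: algebra_simps power2_eq_square)
    moreover have "\<bar>s - t\<bar> = t - s" using less by simp
    ultimately show ?thesis by simp
  qed
qed

end

section \<open>Entropy bounds from the logarithmic Sobolev and Poincare inequalities\<close>

locale functional_ineq = bounded_space +
  fixes A D CP :: real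
  assumes A0: "0 \<le> A" and D0: "0 \<le> D" and CP0: "0 \<le> CP"
    and lsi: "bfun M f \<Longrightarrow> bfun M G \<Longrightarrow> sl f G \<Longrightarrow> bfun M Y \<Longrightarrow> (\<And>x. x \<in> space M \<Longrightarrow> 1 \<le> Y x) \<Longrightarrow>
       E (\<lambda>x. (f x)\<^sup>2 * ln (Y x)) \<le> A * E (\<lambda>x. (G x)\<^sup>2) + (D + ln (E Y)) * E (\<lambda>x. (f x)\<^sup>2)"
    and poincare: "bfun M f \<Longrightarrow> bfun M G \<Longrightarrow> sl f G \<Longrightarrow> E (\<lambda>x. (f x - E f)\<^sup>2) \<le> CP * E (\<lambda>x. (G x)\<^sup>2)"
begin

lemma E_range:
  assumes "bfun M f" "\<And>x. x \<in> space M \<Longrightarrow> f x \<in> {lo..hi}" shows "E f \<in> {lo..hi}"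
  using E_mono[OF bfun_const assms(1), of lo] E_mono[OF assms(1) bfun_const, of hi] assms(2) by auto

text \<open>w = W f has slope F = sqrt (k f) G, so the right side is its energy. The bound
  \<open>breg_le\<close> needs h = w - W m, centred at W m and not at the mean of w. The crux is
  that the square of this shift is at most the variance V of w, so that h has second moment at most
  2 V. The dual inequality with Y = 1 + (f - a) / (m - a), of mean 2, then handles the logarithmic
  weight.\<close>

lemma half_convex_entropy:
  assumes hc: "half_convex a b k W \<Phi> \<Phi>'"
    and f: "bfun M f" "bfun M G" "sl f G" and lh: "a < lo" "hi < b"
    and rng: "\<And>x. x \<in> space M \<Longrightarrow> f x \<in> {lo..hi}"
  shows "E (\<lambda>x. \<Phi> (f x) - \<Phi> (E f) - \<Phi>' (E f) * (f x - E f))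
     \<le> (A + 2 * CP * (D + 2)) / 2 * E (\<lambda>x. k (f x) * (G x)\<^sup>2)"
proof -
  interpret half_convex a b k W \<Phi> \<Phi>' by (rule hc)
  define m where "m = E f"
  have m: "m \<in> {lo..hi}" unfolding m_def by (rule E_range[OF f(1) rng])
  then have mJ: "m \<in> {a<..<b}" using lh by auto
  have J: "f x \<in> {a<..<b}" if "x \<in> space M" for x using rng[OF that] lh by auto
  have sub: "{lo..hi} \<subseteq> {a<..<b}" using lh by auto
  have kc: "continuous_on {lo..hi} k" using k_cont sub by (rule continuous_on_subset)
  have Wc: "continuous_on {lo..hi} W" using dW sub
    by (intro continuous_at_imp_continuous_on ballI DERIV_isCont) blast
  have Pc: "continuous_on {lo..hi} \<Phi>" using d1 sub
    by (intro continuous_at_imp_continuous_on ballI DERIV_isCont) blast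
  have bk: "bfun M (\<lambda>x. k (f x))" by (rule bfun_comp_cont[OF f(1) kc _ rng]) auto
  have bks: "bfun M (\<lambda>x. sqrt (k (f x)))" by (rule bfun_cont[OF bk]) (auto intro!: continuous_intros)
  have bP: "bfun M (\<lambda>x. \<Phi> (f x))" by (rule bfun_comp_cont[OF f(1) Pc _ rng]) auto
  define w where "w x = W (f x)" for x
  have bw: "bfun M w" unfolding w_def by (rule bfun_comp_cont[OF f(1) Wc _ rng]) auto
  define F where "F x = sqrt (k (f x)) * G x" for x
  have bF: "bfun M F" unfolding F_def using bks f by auto
  have kp: "0 < k (f x)" if "x \<in> space M" for x by (rule k_pos[OF J[OF that]])
  have kk: "0 \<le> sqrt (k lo) / (lo - a)"
  proof (cases "lo < b")
    case True then show ?thesis using k_pos[of lo] lh by auto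
  next
    case False then show ?thesis using m lh by auto
  qed
  have slw: "sl w F" unfolding w_def F_def
  proof (rule slope_comp[OF f(2,3) kk _ bks])
    fix x z assume "x \<in> space M" "z \<in> space M"
    then show "\<bar>W (f x) - W (f z)\<bar> \<le> sqrt (k (f z)) * \<bar>f x - f z\<bar> + sqrt (k lo) / (lo - a) * \<bar>f x - f z\<bar>\<^sup>2"
      using W_slope[OF lh rng rng] by blast
  qed (use kp in \<open>auto simp: less_imp_le\<close>)
  have EF: "E (\<lambda>x. (F x)\<^sup>2) = E (\<lambda>x. k (f x) * (G x)\<^sup>2)"
    using kp by (intro Bochner_Integration.integral_cong) (auto simp: F_def power_mult_distrib less_imp_le)
  define h where "h x = w x - W m" for x
  have bh: "bfun M h" unfolding h_def using bw by auto
  have slh: "sl h F" using slope_shift[OF slw, of "- W m"] by (simp add: h_def[abs_def])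
  define V where "V = E (\<lambda>x. (w x - E w)\<^sup>2)"
  have V: "V \<le> CP * E (\<lambda>x. (F x)\<^sup>2)" unfolding V_def by (rule poincare[OF bw bF slw])
  have Eh: "E h = E w - W m" unfolding h_def using bw by (subst E_diff) auto
  have Eh2: "E (\<lambda>x. (h x)\<^sup>2) = V + (E h)\<^sup>2"
  proof -
    have "E (\<lambda>x. (h x)\<^sup>2) = E (\<lambda>x. (w x - E w)\<^sup>2 + (2 * E h * (w x - E w) + (E h)\<^sup>2))"
      by (intro Bochner_Integration.integral_cong) (auto simp: h_def Eh power2_eq_square algebra_simps)
    also have "\<dots> = V + (2 * E h * E (\<lambda>x. w x - E w) + (E h)\<^sup>2)"
    proof -
      have 1: "bfun M (\<lambda>x. (w x - E w)\<^sup>2)" "bfun M (\<lambda>x. 2 * E h * (w x - E w))" using bw by (auto intro!: bfun_mult bfun_power)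
      show ?thesis unfolding E_add[OF 1(1) bfun_add[OF 1(2) bfun_const]] E_add[OF 1(2) bfun_const] V_def by simp
    qed
    also have "E (\<lambda>x. w x - E w) = 0" using bw by (subst E_diff) auto
    finally show ?thesis by simp
  qed
  have "E (\<lambda>x. h x) \<le> E (\<lambda>x. sqrt (k m) * (f x - m))"
  proof (rule E_mono[OF bh])
    show "bfun M (\<lambda>x. sqrt (k m) * (f x - m))" using f by (intro bfun_mult bfun_diff) auto
    show "h x \<le> sqrt (k m) * (f x - m)" if "x \<in> space M" for x
      using W_tangent[OF J[OF that] mJ] by (simp add: h_def w_def)
  qed
  also have "\<dots> = 0" using f by (simp add: E_diff m_def)
  finally have Eh_le: "E h \<le> 0" by simp
  define q where "q = 2 * (m - a) * sqrt (k m)"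
  have q: "0 < q" unfolding q_def using mJ k_pos[OF mJ] by simp
  have grow: "q * (sqrt ((f x - a) / (m - a)) - 1) \<le> h x" if "x \<in> space M" for x
    unfolding q_def h_def w_def by (rule W_growth[OF J[OF that] mJ])
  have sig: "bfun M (\<lambda>x. (f x - a) / (m - a))" by (intro bfun_cdiv bfun_diff bfun_const f)
  have Esig: "E (\<lambda>x. (f x - a) / (m - a)) = 1"
    using f mJ by (simp add: E_diff m_def[symmetric])
  have "E (\<lambda>x. - q) \<le> E h"
  proof (rule E_mono[OF bfun_const bh])
    fix x assume x: "x \<in> space M"
    have "q * (- 1) \<le> q * (sqrt ((f x - a) / (m - a)) - 1)" using q J[OF x] mJ by (intro mult_left_mono) auto
    then show "- q \<le> h x" using grow[OF x] by simp
  qed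
  then have qE: "- E h \<le> q" by simp
  \<comment> \<open>\<open>W_growth\<close> says that sqrt ((f - a) / (m - a)) is at most 1 + h / q.
    Its square has mean 1, so squaring and integrating yields 2 q (- E h) \<le> E (h^2).\<close>
  have "E (\<lambda>x. (f x - a) / (m - a)) \<le> E (\<lambda>x. 1 + (2 / q * h x + (1 / q\<^sup>2) * (h x)\<^sup>2))"
  proof (rule E_mono[OF sig])
    show "bfun M (\<lambda>x. 1 + (2 / q * h x + (1 / q\<^sup>2) * (h x)\<^sup>2))" using bh by (intro bfun_add bfun_mult bfun_power) auto
    fix x assume x: "x \<in> space M"
    let ?r = "sqrt ((f x - a) / (m - a))"
    have "?r - 1 \<le> h x / q" using grow[OF x] q by (simp add: pos_le_divide_eq mult.commute)
    then have "?r\<^sup>2 \<le> (1 + h x / q)\<^sup>2" using J[OF x] mJ by (intro power_mono) auto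
    moreover have "?r\<^sup>2 = (f x - a) / (m - a)" using J[OF x] mJ by simp
    ultimately show "(f x - a) / (m - a) \<le> 1 + (2 / q * h x + (1 / q\<^sup>2) * (h x)\<^sup>2)"
      by (simp add: power2_sum power_divide)
  qed
  also have "\<dots> = 1 + (2 / q * E h + (1 / q\<^sup>2) * E (\<lambda>x. (h x)\<^sup>2))"
  proof -
    have 1: "bfun M (\<lambda>x. 2 / q * h x)" "bfun M (\<lambda>x. (1 / q\<^sup>2) * (h x)\<^sup>2)" using bh by (auto intro!: bfun_mult bfun_power bfun_cdiv)
    show ?thesis unfolding E_add[OF bfun_const bfun_add[OF 1]] E_add[OF 1] by simp
  qed
  finally have "0 \<le> (2 * q * E h + E (\<lambda>x. (h x)\<^sup>2)) / q\<^sup>2" unfolding Esig using q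
    by (simp add: field_simps power2_eq_square)
  then have "0 \<le> 2 * q * E h + E (\<lambda>x. (h x)\<^sup>2)" using q by (simp add: zero_le_divide_iff)
  then have "2 * q * (- E h) \<le> V + (E h)\<^sup>2" using Eh2 by simp
  \<comment> \<open>As 0 \<le> - E h \<le> q, twice the squared shift is at most V plus the squared
    shift, hence the squared shift is at most V.\<close>
  moreover have "2 * (- E h) * (- E h) \<le> 2 * q * (- E h)" using qE Eh_le by (intro mult_right_mono) auto
  ultimately have "(E h)\<^sup>2 \<le> V" by (simp add: power2_eq_square)
  then have h2: "E (\<lambda>x. (h x)\<^sup>2) \<le> 2 * CP * E (\<lambda>x. (F x)\<^sup>2)" using Eh2 V by simp
  let ?Y = "\<lambda>x. 1 + (f x - a) / (m - a)"
  have bY: "bfun M ?Y" using sig by auto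
  have Y1: "1 \<le> ?Y x" if "x \<in> space M" for x using J[OF that] mJ by simp
  have bl: "bfun M (\<lambda>x. ln (?Y x))" using Y1 by (intro bfun_ln[OF bY, of 1]) auto
  have EY: "E ?Y = 2" using E_add[OF bfun_const sig, of 1] Esig by simp
  have "E (\<lambda>x. (h x)\<^sup>2 * ln (?Y x)) \<le> A * E (\<lambda>x. (F x)\<^sup>2) + (D + ln (E ?Y)) * E (\<lambda>x. (h x)\<^sup>2)"
    by (rule lsi[OF bh bF slh bY Y1])
  also have "\<dots> \<le> A * E (\<lambda>x. (F x)\<^sup>2) + (D + 1) * E (\<lambda>x. (h x)\<^sup>2)"
    unfolding EY using ln_2_less_1 E_nonneg[of "\<lambda>x. (h x)\<^sup>2"] by (intro add_left_mono mult_right_mono) auto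
  finally have ent: "E (\<lambda>x. (h x)\<^sup>2 * ln (?Y x)) \<le> A * E (\<lambda>x. (F x)\<^sup>2) + (D + 1) * E (\<lambda>x. (h x)\<^sup>2)" .
  have bh2: "bfun M (\<lambda>x. (h x)\<^sup>2)" using bh by auto
  have bhl: "bfun M (\<lambda>x. (h x)\<^sup>2 * ln (?Y x))" using bh2 bl by auto
  have "E (\<lambda>x. \<Phi> (f x) - \<Phi> m - \<Phi>' m * (f x - m)) \<le> E (\<lambda>x. 1/2 * ((h x)\<^sup>2 + (h x)\<^sup>2 * ln (?Y x)))"
  proof (rule E_mono)
    show "bfun M (\<lambda>x. \<Phi> (f x) - \<Phi> m - \<Phi>' m * (f x - m))" using bP f by (intro bfun_diff bfun_mult) auto
    show "bfun M (\<lambda>x. 1/2 * ((h x)\<^sup>2 + (h x)\<^sup>2 * ln (?Y x)))" by (rule bfun_mult[OF bfun_const bfun_add[OF bh2 bhl]])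
    fix x assume x: "x \<in> space M"
    show "\<Phi> (f x) - \<Phi> m - \<Phi>' m * (f x - m) \<le> 1/2 * ((h x)\<^sup>2 + (h x)\<^sup>2 * ln (?Y x))"
      using breg_le[OF J[OF x] mJ] by (simp add: breg_def h_def w_def algebra_simps)
  qed
  also have "\<dots> = 1/2 * (E (\<lambda>x. (h x)\<^sup>2) + E (\<lambda>x. (h x)\<^sup>2 * ln (?Y x)))"
    using E_add[OF bh2 bhl] by simp
  also have "\<dots> \<le> 1/2 * (E (\<lambda>x. (h x)\<^sup>2) + (A * E (\<lambda>x. (F x)\<^sup>2) + (D + 1) * E (\<lambda>x. (h x)\<^sup>2)))"
    using ent by simp
  also have "\<dots> = 1/2 * (A * E (\<lambda>x. (F x)\<^sup>2) + (D + 2) * E (\<lambda>x. (h x)\<^sup>2))" by (simp add: algebra_simps)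
  also have "\<dots> \<le> 1/2 * (A * E (\<lambda>x. (F x)\<^sup>2) + (D + 2) * (2 * CP * E (\<lambda>x. (F x)\<^sup>2)))"
    using h2 D0 by (intro mult_left_mono add_left_mono) auto
  also have "\<dots> = (A + 2 * CP * (D + 2)) / 2 * E (\<lambda>x. (F x)\<^sup>2)" by (simp add: algebra_simps)
  finally show ?thesis unfolding m_def EF .
qed


lemma slope_uminus: "sl f G \<Longrightarrow> sl (\<lambda>x. - f x) G"
  by (rule slope_contraction) auto

text \<open>Apply \<open>half_convex_entropy\<close> to - f. This is the version for a second
  derivative that increases towards the upper end point.\<close>

lemma half_convex_entropy_mirror:
  assumes hc: "half_convex (- b) (- a) (\<lambda>s. k (- s)) W (\<lambda>s. \<Phi> (- s)) (\<lambda>s. - \<Phi>' (- s))"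
    and f: "bfun M f" "bfun M G" "sl f G" and lh: "a < lo" "hi < b"
    and rng: "\<And>x. x \<in> space M \<Longrightarrow> f x \<in> {lo..hi}"
  shows "E (\<lambda>x. \<Phi> (f x) - \<Phi> (E f) - \<Phi>' (E f) * (f x - E f))
     \<le> (A + 2 * CP * (D + 2)) / 2 * E (\<lambda>x. k (f x) * (G x)\<^sup>2)"
proof -
  have "E (\<lambda>x. \<Phi> (- (- f x)) - \<Phi> (- E (\<lambda>x. - f x)) - (- \<Phi>' (- E (\<lambda>x. - f x))) * (- f x - E (\<lambda>x. - f x)))
     \<le> (A + 2 * CP * (D + 2)) / 2 * E (\<lambda>x. k (- (- f x)) * (G x)\<^sup>2)"
    by (rule half_convex_entropy[OF hc bfun_uminus[OF f(1)] f(2) slope_uminus[OF f(3)], of "- hi" "- lo"])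
      (use lh rng in auto)
  moreover have "- \<Phi>' (E f) * (E f - f x) = \<Phi>' (E f) * (f x - E f)" for x by (simp add: algebra_simps)
  ultimately show ?thesis by (simp add: algebra_simps)
qed

lemma antiderivative:
  fixes k :: "real \<Rightarrow> real"
  assumes "continuous_on {a..b} k"
  obtains F where "\<And>s. s \<in> {a<..<b} \<Longrightarrow> (F has_real_derivative k s) (at s)"
proof (cases "a \<le> b")
  case True
  obtain F where F: "\<And>s. s \<in> {a..b} \<Longrightarrow> (F has_vector_derivative k s) (at s within {a..b})"
    using antiderivative_continuous[OF assms] by metis
  show ?thesis
  proof (rule that[of F])
    fix s assume s: "s \<in> {a<..<b}"
    have "(F has_vector_derivative k s) (at s within {a<..<b})"
      using F[of s] s by (intro has_vector_derivative_within_subset[OF F]) auto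
    then show "(F has_real_derivative k s) (at s)"
      using s by (simp add: has_real_derivative_iff_has_vector_derivative at_within_open[of s "{a<..<b}"])
  qed
next
  case False
  show ?thesis by (rule that[of "\<lambda>_. 0"]) (use False in auto)
qed

lemma concave_chord:
  fixes h :: "real \<Rightarrow> real"
  assumes "convex_on {a..b} (\<lambda>s. - h s)" "x \<in> {a..b}" "y \<in> {a..b}" "x \<le> s" "s \<le> y" "x < y"
  shows "(y - s) * h x + (s - x) * h y \<le> (y - x) * h s"
proof -
  let ?t = "(s - x) / (y - x)"
  have "- h ((1 - ?t) *\<^sub>R x + ?t *\<^sub>R y) \<le> (1 - ?t) * - h x + ?t * - h y"
    using assms by (intro convex_onD) auto
  moreover have "(1 - ?t) *\<^sub>R x + ?t *\<^sub>R y = s"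
  proof -
    have "(1 - t) *\<^sub>R x + t *\<^sub>R y = x + t * (y - x)" for t by (simp add: algebra_simps)
    from this[of ?t] show ?thesis using assms(6) by simp
  qed
  ultimately have "(1 - ?t) * h x + ?t * h y \<le> h s" by simp
  then have "(y - x) * ((1 - ?t) * h x + ?t * h y) \<le> (y - x) * h s" using assms(6) by (intro mult_left_mono) auto
  moreover have "(y - x) * ((1 - ?t) * h x + ?t * h y) = (y - s) * h x + (s - x) * h y"
  proof -
    have "(y - x) * ?t = s - x" using assms(6) by simp
    then have "(y - x) * ((1 - ?t) * h x + ?t * h y) = ((y - x) - (s - x)) * h x + (s - x) * h y"
      by (metis (no_types, opaque_lifting) distrib_left mult.assoc mult_1_right right_diff_distrib)
    then show ?thesis by simp
  qed
  ultimately show ?thesis by simp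
qed

text \<open>A function k whose reciprocal h is concave is decreasing up to the maximum point of h and increasing
  afterwards. Freezing k on either side of that point writes it, up to a factor 2, as a sum of one function that
  satisfies the assumptions of half_convex and one that does so after reflection.\<close>

lemma frozen_half_convex:
  fixes k :: "real \<Rightarrow> real"
  assumes kp: "\<And>s. s \<in> {a..b} \<Longrightarrow> 0 < k s" and kc: "continuous_on {a..b} k"
    and conc: "convex_on {a..b} (\<lambda>s. - (1 / k s))" and c: "c \<in> {a..b}"
    and cmin: "\<And>s. s \<in> {a..b} \<Longrightarrow> k c \<le> k s"
  obtains W \<Phi> \<Phi>' where "half_convex a b (\<lambda>s. k (min s c)) W \<Phi> \<Phi>'"
proof -
  let ?k = "\<lambda>s. k (min s c)"
  have mi: "min s c \<in> {a..b}" if "s \<in> {a..b}" for s using that c by auto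
  have cont: "continuous_on {a..b} ?k"
    by (rule continuous_on_compose2[OF kc]) (use mi in \<open>auto intro!: continuous_intros\<close>)
  then have "continuous_on {a..b} (\<lambda>s. sqrt (?k s))" by (intro continuous_intros)
  then obtain W where W: "\<And>s. s \<in> {a<..<b} \<Longrightarrow> (W has_real_derivative sqrt (?k s)) (at s)"
    using antiderivative by blast
  obtain P where P0: "\<And>s. s \<in> {a..b} \<Longrightarrow> (P has_vector_derivative ?k s) (at s within {a..b})"
    using antiderivative_continuous[OF cont] by metis
  have P: "(P has_real_derivative ?k s) (at s)" if "s \<in> {a<..<b}" for s
  proof -
    have "(P has_vector_derivative ?k s) (at s within {a<..<b})"
      using that by (intro has_vector_derivative_within_subset[OF P0]) auto
    then show ?thesis
      using that by (simp add: has_real_derivative_iff_has_vector_derivative at_within_open[of s "{a<..<b}"])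
  qed
  have "continuous_on {a..b} P"
    unfolding continuous_on_eq_continuous_within using P0 has_vector_derivative_continuous by blast
  then obtain F where F: "\<And>s. s \<in> {a<..<b} \<Longrightarrow> (F has_real_derivative P s) (at s)"
    using antiderivative by blast
  \<comment> \<open>The concave function 1 / k is maximal at \<open>c\<close>, hence increasing to
    the left of it.\<close>
  have left_anti: "k t \<le> k s" if "s \<in> {a..b}" "s \<le> t" "t \<le> c" for s t
  proof (cases "s < c")
    case True
    have "(c - t) * (1 / k s) + (t - s) * (1 / k c) \<le> (c - s) * (1 / k t)"
      using concave_chord[OF conc that(1) c that(2,3) True] by simp
    moreover have "(t - s) * (1 / k s) \<le> (t - s) * (1 / k c)"
      using that c cmin[OF that(1)] kp by (intro mult_left_mono frac_le) auto
    moreover have "(c - s) * p = (c - t) * p + (t - s) * p" for p by (simp add: algebra_simps)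
    ultimately have "(c - s) * (1 / k s) \<le> (c - s) * (1 / k t)" by (metis add_left_mono order_trans)
    then have le: "1 / k s \<le> 1 / k t" by (rule mult_left_le_imp_le) (use True in simp)
    have "0 < k s" "0 < k t" using kp that c by auto
    then show ?thesis using le by (simp add: field_simps)
  next
    case False
    then have "s = t" using that by simp
    then show ?thesis by simp
  qed
  have "half_convex a b ?k W F P"
  proof
    fix s assume s: "s \<in> {a<..<b}"
    show "0 < ?k s" using s c by (intro kp) auto
    show "(W has_real_derivative sqrt (?k s)) (at s)" "(P has_real_derivative ?k s) (at s)" "(F has_real_derivative P s) (at s)"
      using W P F s by auto
    fix t assume t: "t \<in> {a<..<b}" and st: "s \<le> t"
    show "?k t \<le> ?k s" using s t st c by (intro left_anti) auto
    show "(s - a) * ?k s \<le> (t - a) * ?k t"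
    proof -
      \<comment> \<open>In the chord inequality for the concave function 1 / k from \<open>a\<close>
        to \<open>u\<close>, the value at \<open>a\<close> is dropped as nonnegative; what is left
        says that the quotient of 1 / k by the distance to \<open>a\<close> decreases.\<close>
      have main: "(s - a) * k s \<le> (u - a) * k u" if "s \<le> u" "u \<le> c" for u
      proof -
        have u: "u \<in> {a..b}" using s that c by auto
        have au: "a < u" using s that by auto
        have "(u - s) * (1 / k a) + (s - a) * (1 / k u) \<le> (u - a) * (1 / k s)"
          using concave_chord[OF conc _ u _ that(1) au] s by auto
        moreover have "0 \<le> (u - s) * (1 / k a)" using that kp[of a] s by auto
        ultimately have le: "(s - a) / k u \<le> (u - a) / k s" by simp
        have "0 < k s" "0 < k u" using kp u s by auto
        then show ?thesis using le by (simp add: field_simps)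
      qed
      show ?thesis
      proof (cases "s \<le> c")
        case True
        have "(s - a) * k s \<le> (min t c - a) * k (min t c)" using True st by (intro main) auto
        also have "\<dots> \<le> (t - a) * k (min t c)" using kp[of "min t c"] t mi[of t] by (intro mult_right_mono) auto
        finally show ?thesis using True by simp
      next
        case False
        then show ?thesis using st kp[OF c] by (simp add: mult_right_mono)
      qed
    qed
  next
    show "continuous_on {a<..<b} ?k" by (rule continuous_on_subset[OF cont]) auto
  qed
  then show ?thesis by (rule that)
qed

text \<open>The two frozen functions k (min s c) and k (max s c) add up to k s + k c. Hence
  \<open>\<Theta>\<close>, the sum of their second antiderivatives minus \<Psi>, is convex, and the
  Bregman divergence of \<Psi> is at most the sum of the other two. Both frozen energies are at most
  the original one because k c is the minimum, so the two bounds with half the constant add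
  up.\<close>

theorem phi_entropy_inequality:
  fixes \<Psi> \<Psi>' k :: "real \<Rightarrow> real"
  assumes kp: "\<And>s. s \<in> {a..b} \<Longrightarrow> 0 < k s" and kc: "continuous_on {a..b} k"
    and conc: "convex_on {a..b} (\<lambda>s. - (1 / k s))"
    and d1: "\<And>s. s \<in> {a<..<b} \<Longrightarrow> (\<Psi> has_real_derivative \<Psi>' s) (at s)"
    and d2: "\<And>s. s \<in> {a<..<b} \<Longrightarrow> (\<Psi>' has_real_derivative k s) (at s)"
    and f: "bfun M f" "bfun M G" "sl f G" and lh: "a < lo" "hi < b"
    and rng: "\<And>x. x \<in> space M \<Longrightarrow> f x \<in> {lo..hi}"
  shows "E (\<lambda>x. \<Psi> (f x) - \<Psi> (E f) - \<Psi>' (E f) * (f x - E f))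
     \<le> (A + 2 * CP * (D + 2)) * E (\<lambda>x. k (f x) * (G x)\<^sup>2)"
proof -
  define m where "m = E f"
  have m: "m \<in> {lo..hi}" unfolding m_def by (rule E_range[OF f(1) rng])
  have J: "f x \<in> {a<..<b}" if "x \<in> space M" for x using rng[OF that] lh by auto
  have mJ: "m \<in> {a<..<b}" using m lh by auto
  have ab: "a < b" using mJ by simp
  obtain c where c: "c \<in> {a..b}" "\<And>s. s \<in> {a..b} \<Longrightarrow> k c \<le> k s"
    using continuous_attains_inf[OF compact_Icc _ kc] ab by fastforce
  obtain W1 F1 P1 where h1: "half_convex a b (\<lambda>s. k (min s c)) W1 F1 P1"
    using frozen_half_convex[OF kp kc conc c] by metis
  have "convex_on {- b..- a} (\<lambda>s. - (1 / k (- s)))"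
  proof (rule convex_onI)
    fix t x y :: real assume t: "0 < t" "t < 1" and xy: "x \<in> {- b..- a}" "y \<in> {- b..- a}"
    have "- (1 / k ((1 - t) *\<^sub>R (- x) + t *\<^sub>R (- y))) \<le> (1 - t) * - (1 / k (- x)) + t * - (1 / k (- y))"
      using xy t by (intro convex_onD[OF conc]) auto
    then show "- (1 / k (- ((1 - t) *\<^sub>R x + t *\<^sub>R y))) \<le> (1 - t) * - (1 / k (- x)) + t * - (1 / k (- y))"
      by (simp add: algebra_simps)
  qed simp
  moreover have "continuous_on {- b..- a} (\<lambda>s. k (- s))"
    by (rule continuous_on_compose2[OF kc]) (auto intro!: continuous_intros)
  ultimately obtain W2 F2 P2 where h2: "half_convex (- b) (- a) (\<lambda>s. k (- min s (- c))) W2 F2 P2"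
    using frozen_half_convex[of "- b" "- a" "\<lambda>s. k (- s)" "- c"] kp c by auto
  have h2': "half_convex (- b) (- a) (\<lambda>s. k (max (- s) c)) W2 (\<lambda>s. F2 (- (- s))) (\<lambda>s. - (- P2 (- (- s))))"
  proof -
    have "- min s (- c) = max (- s) c" for s :: real by (simp add: min_def max_def)
    then show ?thesis using h2 by simp
  qed
  define \<Theta> where "\<Theta> s = F1 s + F2 (- s) - \<Psi> s" for s
  define \<Theta>' where "\<Theta>' s = P1 s + - P2 (- s) - \<Psi>' s" for s
  interpret H1: half_convex a b "\<lambda>s. k (min s c)" W1 F1 P1 by (rule h1)
  interpret H2: half_convex "- b" "- a" "\<lambda>s. k (- min s (- c))" W2 F2 P2 by (rule h2)
  have dF2: "((\<lambda>s. F2 (- s)) has_real_derivative - P2 (- s)) (at s)" if "s \<in> {a<..<b}" for s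
    using DERIV_chain2[OF H2.d1[of "- s"] DERIV_minus[OF DERIV_ident]] that by simp
  have dP2: "((\<lambda>s. - P2 (- s)) has_real_derivative k (max s c)) (at s)" if "s \<in> {a<..<b}" for s
  proof -
    have "- min (- s) (- c) = max s c" by (simp add: min_def max_def)
    then show ?thesis
      using DERIV_minus[OF DERIV_chain2[OF H2.d2[of "- s"] DERIV_minus[OF DERIV_ident]]] that by simp
  qed
  have dT: "(\<Theta> has_real_derivative \<Theta>' s) (at s)" if "s \<in> {a<..<b}" for s
    unfolding \<Theta>_def[abs_def] \<Theta>'_def by (intro DERIV_diff DERIV_add H1.d1 dF2 d1 that)
  have dT': "(\<Theta>' has_real_derivative k (min s c) + k (max s c) - k s) (at s)" if "s \<in> {a<..<b}" for s
    unfolding \<Theta>'_def[abs_def] by (intro DERIV_diff DERIV_add H1.d2 dP2 d2 that)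
  have Tpos: "0 \<le> k (min s c) + k (max s c) - k s" if "s \<in> {a<..<b}" for s
    using kp[OF c(1)] that by (auto simp: min_def max_def)
  have "convex_on {a<..<b} \<Theta>"
    by (rule f''_ge0_imp_convex[OF _ dT dT' Tpos]) auto
  then have T0: "0 \<le> \<Theta> s - \<Theta> m - \<Theta>' m * (s - m)" if "s \<in> {a<..<b}" for s
    using convex_on_imp_above_tangent[of "{a<..<b}" \<Theta> m s "\<Theta>' m"] that mJ dT[OF mJ]
    by (auto simp: has_field_derivative_at_within interior_open)
  let ?C = "(A + 2 * CP * (D + 2)) / 2"
  have C0: "0 \<le> ?C" using A0 CP0 D0 by simp
  have sub: "{lo..hi} \<subseteq> {a<..<b}" using lh by auto
  have bcomp: "bfun M (\<lambda>x. \<phi> (f x))" if "\<And>s. s \<in> {a<..<b} \<Longrightarrow> (\<phi> has_real_derivative \<phi>' s) (at s)" for \<phi> \<phi>'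
  proof (rule bfun_comp_cont[OF f(1) _ _ rng])
    show "continuous_on {lo..hi} \<phi>" using that sub
      by (intro continuous_at_imp_continuous_on ballI DERIV_isCont) blast
  qed auto
  have kcl: "bfun M (\<lambda>x. k (g (f x)) * (G x)\<^sup>2)" if "continuous_on UNIV g" "\<And>s. s \<in> {a..b} \<Longrightarrow> g s \<in> {a..b}" for g
  proof (rule bfun_mult)
    show "bfun M (\<lambda>x. k (g (f x)))"
    proof (rule bfun_comp_cont[OF f(1) _ _ rng])
      show "continuous_on {lo..hi} (\<lambda>s. k (g s))"
        using sub that(2) by (intro continuous_on_compose2[OF kc continuous_on_subset[OF that(1)]]) force+
    qed auto
    show "bfun M (\<lambda>x. (G x)\<^sup>2)" using f by auto
  qed
  have le: "E (\<lambda>x. k (g (f x)) * (G x)\<^sup>2) \<le> E (\<lambda>x. k (f x) * (G x)\<^sup>2)"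
    if "continuous_on UNIV g" "\<And>s. s \<in> {a..b} \<Longrightarrow> g s \<in> {a..b}" "\<And>s. s \<in> {a..b} \<Longrightarrow> k (g s) \<le> k s" for g
  proof (rule E_mono[OF kcl[OF that(1,2)]])
    show "bfun M (\<lambda>x. k (f x) * (G x)\<^sup>2)" using kcl[of "\<lambda>s. s"] by auto
    show "k (g (f x)) * (G x)\<^sup>2 \<le> k (f x) * (G x)\<^sup>2" if "x \<in> space M" for x
      using J[OF that] by (intro mult_right_mono \<open>\<And>s. s \<in> {a..b} \<Longrightarrow> k (g s) \<le> k s\<close>) auto
  qed
  have "E (\<lambda>x. \<Psi> (f x) - \<Psi> m - \<Psi>' m * (f x - m))
     \<le> E (\<lambda>x. (F1 (f x) - F1 m - P1 m * (f x - m)) + (F2 (- f x) - F2 (- m) - (- P2 (- m)) * (f x - m)))"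
  proof (rule E_mono)
    show "bfun M (\<lambda>x. \<Psi> (f x) - \<Psi> m - \<Psi>' m * (f x - m))"
      by (intro bfun_diff bfun_mult bfun_const f bcomp[OF d1])
    show "bfun M (\<lambda>x. (F1 (f x) - F1 m - P1 m * (f x - m)) + (F2 (- f x) - F2 (- m) - (- P2 (- m)) * (f x - m)))"
      by (intro bfun_add bfun_diff bfun_mult bfun_const f bcomp[OF H1.d1] bcomp[OF dF2])
    fix x assume "x \<in> space M"
    from T0[OF J[OF this]] show "\<Psi> (f x) - \<Psi> m - \<Psi>' m * (f x - m)
      \<le> (F1 (f x) - F1 m - P1 m * (f x - m)) + (F2 (- f x) - F2 (- m) - (- P2 (- m)) * (f x - m))"
      by (simp add: \<Theta>_def \<Theta>'_def algebra_simps)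
  qed
  also have "\<dots> = E (\<lambda>x. F1 (f x) - F1 m - P1 m * (f x - m)) + E (\<lambda>x. F2 (- f x) - F2 (- m) - (- P2 (- m)) * (f x - m))"
    by (intro E_add bfun_diff bfun_mult bfun_const f bcomp[OF H1.d1] bcomp[OF dF2])
  finally have split: "E (\<lambda>x. \<Psi> (f x) - \<Psi> m - \<Psi>' m * (f x - m)) \<le> E (\<lambda>x. F1 (f x) - F1 m - P1 m * (f x - m))
     + E (\<lambda>x. F2 (- f x) - F2 (- m) - (- P2 (- m)) * (f x - m))" .
  let ?J = "E (\<lambda>x. k (f x) * (G x)\<^sup>2)"
  have "E (\<lambda>x. F1 (f x) - F1 m - P1 m * (f x - m)) \<le> ?C * E (\<lambda>x. k (min (f x) c) * (G x)\<^sup>2)"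
    unfolding m_def by (rule half_convex_entropy[OF h1 f lh rng])
  also have "\<dots> \<le> ?C * ?J"
    by (intro mult_left_mono C0 le[of "\<lambda>s. min s c"])
      (use c in \<open>auto simp: min_def intro: continuous_on_min[OF continuous_on_id continuous_on_const, unfolded min_def]\<close>)
  finally have 1: "E (\<lambda>x. F1 (f x) - F1 m - P1 m * (f x - m)) \<le> ?C * ?J" .
  have "E (\<lambda>x. F2 (- f x) - F2 (- m) - (- P2 (- m)) * (f x - m)) \<le> ?C * E (\<lambda>x. k (max (f x) c) * (G x)\<^sup>2)"
    unfolding m_def
    by (rule half_convex_entropy_mirror[OF _ f lh rng, of "\<lambda>s. k (max s c)" W2 "\<lambda>s. F2 (- s)" "\<lambda>s. - P2 (- s)"]) (rule h2')
  also have "\<dots> \<le> ?C * ?J"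
    by (intro mult_left_mono C0 le[of "\<lambda>s. max s c"])
      (use c in \<open>auto simp: max_def intro: continuous_on_max[OF continuous_on_id continuous_on_const, unfolded max_def]\<close>)
  finally have 2: "E (\<lambda>x. F2 (- f x) - F2 (- m) - (- P2 (- m)) * (f x - m)) \<le> ?C * ?J" .
  have "?C * ?J + ?C * ?J = (A + 2 * CP * (D + 2)) * ?J" by (simp add: field_simps)
  then show ?thesis using split 1 2 unfolding m_def by linarith
qed

end

section \<open>Convex sets and calculus in coordinates\<close>

text \<open>\<open>leb d\<close> is a product over the coordinates below \<open>d\<close>, while
  Borel sets live on all of \<open>nat \<Rightarrow> real\<close>. On \<open>eucl d\<close> the
  other coordinates are constantly \<open>undefined\<close>, so the inclusion is measurable and
  continuous functions on \<open>eucl d\<close> become measurable for \<open>leb d\<close>.\<close>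

lemma measurable_leb_id: "(\<lambda>x. x) \<in> leb d \<rightarrow>\<^sub>M (borel :: (nat \<Rightarrow> real) measure)"
proof -
  have "(\<lambda>x. x) \<in> leb d \<rightarrow>\<^sub>M PiM UNIV (\<lambda>_. borel)"
  proof (rule measurable_PiM_single')
    fix i :: nat
    show "(\<lambda>x. x i) \<in> leb d \<rightarrow>\<^sub>M borel"
    proof (cases "i < d")
      case True
      then show ?thesis unfolding leb_def
        using measurable_component_singleton[of i "{..<d}" "\<lambda>_. lborel :: real measure"] by simp
    next
      case False
      have "(\<lambda>x. x i) \<in> leb d \<rightarrow>\<^sub>M borel \<longleftrightarrow> (\<lambda>x. undefined :: real) \<in> leb d \<rightarrow>\<^sub>M borel"
        using False by (intro measurable_cong) (auto simp: space_leb eucl_undefined)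
      then show ?thesis by simp
    qed
  qed auto
  then show ?thesis
    by (subst measurable_cong_sets[OF refl sets_PiM_equal_borel[symmetric]])
qed

lemma borel_measurable_continuous_on_eucl:
  fixes g :: "(nat \<Rightarrow> real) \<Rightarrow> real"
  assumes "continuous_on (eucl d) g" shows "g \<in> borel_measurable (leb d)"
proof -
  have "(\<lambda>x. x) \<in> leb d \<rightarrow>\<^sub>M restrict_space borel (eucl d)"
    by (rule measurable_restrict_space2[OF _ measurable_leb_id]) (simp add: space_leb)
  from measurable_compose[OF this borel_measurable_continuous_on_restrict[OF assms]]
  show ?thesis by simp
qed

lemma sets_leb_open: assumes "open U" shows "U \<inter> eucl d \<in> sets (leb d)"
  using measurable_sets[OF measurable_leb_id borel_open[OF assms], of d] by (simp add: space_leb)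

text \<open>Balls for the maximum norm. By \<open>open_contains_box\<close> they form a
  neighbourhood base in \<open>eucl d\<close>, which translates topological notions into
  inequalities for coordinates.\<close>

definition box :: "nat \<Rightarrow> (nat \<Rightarrow> real) \<Rightarrow> real \<Rightarrow> (nat \<Rightarrow> real) set" where
  "box d x e = {y \<in> eucl d. \<forall>i<d. \<bar>y i - x i\<bar> < e}"

lemma open_box: "open {y :: nat \<Rightarrow> real. \<forall>i<d. \<bar>y i - x i\<bar> < e}"
proof -
  have "{y. \<forall>i<d. \<bar>y i - x i\<bar> < e} = (\<Inter>i\<in>{..<d}. {y. \<bar>y i - x i\<bar> < e})" by auto
  moreover have "open \<dots>"
  proof (intro open_INT ballI)
    fix i
    show "open {y. \<bar>y i - x i\<bar> < e}"
      by (intro open_Collect_less continuous_intros continuous_on_product_coordinates)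
  qed simp
  ultimately show ?thesis by simp
qed

lemma open_contains_box:
  assumes "open U" "z \<in> U" "z \<in> eucl d"
  obtains e where "0 < e" "box d z e \<subseteq> U"
proof -
  have "openin (product_topology (\<lambda>i::nat. euclidean :: real topology) UNIV) U"
    using assms(1) by (simp add: euclidean_product_topology)
  then obtain X where X: "z \<in> PiE UNIV X" "\<And>i. openin euclidean (X i)" "PiE UNIV X \<subseteq> U"
    using product_topology_open_contains_basis[OF _ assms(2)] by (metis (no_types, lifting))
  have "\<exists>e>0. \<forall>y. \<bar>y - z i\<bar> < e \<longrightarrow> y \<in> X i" for i
    using X(1) X(2)[of i] by (auto simp: open_dist dist_real_def PiE_iff)
  then obtain e where e: "\<And>i. 0 < e i" "\<And>i y. \<bar>y - z i\<bar> < e i \<Longrightarrow> y \<in> X i" by metis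
  define m where "m = Min (insert 1 (e ` {..<d}))"
  show ?thesis
  proof
    show "0 < m" using e(1) by (simp add: m_def)
    show "box d z m \<subseteq> U"
    proof
      fix y assume y: "y \<in> box d z m"
      have "y i \<in> X i" for i
      proof (cases "i < d")
        case True
        then have "m \<le> e i" by (simp add: m_def)
        then show ?thesis using y True by (intro e(2)) (auto simp: box_def)
      next
        case False
        then have "y i = z i" using y assms(3) by (auto simp: box_def eucl_undefined)
        then show ?thesis using e(1)[of i] by (intro e(2)) simp
      qed
      then show "y \<in> U" using X(3) by (auto simp: PiE_iff)
    qed
  qed
qed

lemma continuous_on_box:
  fixes g :: "(nat \<Rightarrow> real) \<Rightarrow> real"
  assumes g: "continuous_on S g" and z: "z \<in> S" "S \<subseteq> eucl d" and e: "0 < e"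
  obtains r where "0 < r" "\<And>y. y \<in> S \<Longrightarrow> y \<in> box d z r \<Longrightarrow> \<bar>g y - g z\<bar> < e"
proof -
  obtain U where U: "open U" "U \<inter> S = g -` {g z - e<..<g z + e} \<inter> S"
    using continuous_on_open_invariant[THEN iffD1, OF g, rule_format, of "{g z - e<..<g z + e}"] by auto
  then have "z \<in> U" using z e by auto
  then obtain r where r: "0 < r" "box d z r \<subseteq> U" using open_contains_box[OF U(1)] z by blast
  show ?thesis
  proof (rule that[OF r(1)])
    fix y assume "y \<in> S" "y \<in> box d z r"
    then have "y \<in> g -` {g z - e<..<g z + e}" using r(2) U(2) by blast
    then show "\<bar>g y - g z\<bar> < e" by (auto simp: abs_less_iff)
  qed
qed

text \<open>The interior relative to \<open>eucl d\<close>, written with boxes so that convexity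
  arguments can stay in coordinates.\<close>

definition core :: "nat \<Rightarrow> (nat \<Rightarrow> real) set \<Rightarrow> (nat \<Rightarrow> real) set" where
  "core d C = {x \<in> eucl d. \<exists>e>0. box d x e \<subseteq> C}"

lemma core_subset: "core d C \<subseteq> C" "core d C \<subseteq> eucl d"
  by (auto simp: core_def box_def)

lemma core_box:
  assumes "x \<in> core d C" obtains e where "0 < e" "box d x e \<subseteq> core d C"
proof -
  obtain e where e: "0 < e" "box d x e \<subseteq> C" using assms by (auto simp: core_def)
  have "box d x (e / 2) \<subseteq> core d C"
  proof
    fix y assume y: "y \<in> box d x (e / 2)"
    have "box d y (e / 2) \<subseteq> box d x e"
    proof
      fix z assume z: "z \<in> box d y (e / 2)"
      have "\<bar>z i - x i\<bar> < e" if "i < d" for i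
      proof -
        have "\<bar>z i - y i\<bar> < e / 2" "\<bar>y i - x i\<bar> < e / 2" using y z that by (auto simp: box_def)
        then show ?thesis by linarith
      qed
      then show "z \<in> box d x e" using z by (auto simp: box_def)
    qed
    then show "y \<in> core d C" using e y by (auto simp: core_def box_def intro!: exI[of _ "e / 2"])
  qed
  then show ?thesis using that[of "e / 2"] e by simp
qed

lemma core_open: obtains U where "open U" "core d C = U \<inter> eucl d"
proof -
  define U where "U = \<Union>{V. open V \<and> V \<inter> eucl d \<subseteq> core d C}"
  have "core d C \<subseteq> U"
  proof
    fix x assume x: "x \<in> core d C"
    then obtain e where e: "0 < e" "box d x e \<subseteq> core d C" using core_box by blast
    let ?V = "{y. \<forall>i<d. \<bar>y i - x i\<bar> < e}"
    have "?V \<inter> eucl d \<subseteq> core d C" using e(2) by (auto simp: box_def)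
    moreover have "x \<in> ?V" using e by simp
    ultimately show "x \<in> U" unfolding U_def using open_box[of d x e] by (intro UnionI[of ?V]) simp_all
  qed
  moreover have "U \<inter> eucl d \<subseteq> core d C" by (auto simp: U_def)
  moreover have "open U" unfolding U_def by (rule open_Union) auto
  ultimately show ?thesis using core_subset(2)[of d C] by (intro that[of U]) auto
qed

lemma sets_core [measurable]: "core d C \<in> sets (leb d)"
  using core_open sets_leb_open by metis

definition cvx :: "nat \<Rightarrow> (nat \<Rightarrow> real) set \<Rightarrow> bool" where
  "cvx d C \<longleftrightarrow> C \<subseteq> eucl d \<and> (\<forall>x\<in>C. \<forall>y\<in>C. \<forall>t. 0 < t \<and> t < 1 \<longrightarrow> cmb d t x y \<in> C)"

lemma cvx_core: assumes "cvx d C" shows "cvx d (core d C)"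
  unfolding cvx_def
proof (intro conjI ballI allI impI)
  show "core d C \<subseteq> eucl d" by (rule core_subset)
  fix x y t assume x: "x \<in> core d C" and y: "y \<in> core d C" and t: "0 < t \<and> t < (1::real)"
  obtain e where e: "0 < e" "box d x e \<subseteq> C" using x by (auto simp: core_def)
  have yC: "y \<in> C" using y core_subset by blast
  have "box d (cmb d t x y) (t * e) \<subseteq> C"
  proof
    fix z assume z: "z \<in> box d (cmb d t x y) (t * e)"
    define w where "w = (\<lambda>i\<in>{..<d}. (z i - (1 - t) * y i) / t)"
    have "w \<in> box d x e" unfolding box_def
    proof (intro CollectI conjI allI impI)
      show "w \<in> eucl d" by (simp add: w_def eucl_def)
      fix i assume i: "i < d"
      have "\<bar>z i - (t * x i + (1 - t) * y i)\<bar> < t * e" using z i by (auto simp: box_def)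
      moreover have "w i - x i = (z i - (t * x i + (1 - t) * y i)) / t" using t i by (simp add: w_def field_simps)
      ultimately show "\<bar>w i - x i\<bar> < e" using t by (simp add: pos_divide_less_eq mult.commute)
    qed
    then have "cmb d t w y \<in> C" using e yC assms t by (auto simp: cvx_def)
    moreover have "cmb d t w y = z"
      by (rule eucl_eqI[of _ d]) (use z t in \<open>auto simp: w_def box_def\<close>)
    ultimately show "z \<in> C" by simp
  qed
  then show "cmb d t x y \<in> core d C" using t e by (auto simp: core_def intro!: exI[of _ "t * e"])
qed

lemma cvx_slice: "cvx (Suc d) C \<Longrightarrow> cvx d {x \<in> eucl d. x(d := s) \<in> C}"
  unfolding cvx_def
proof (intro conjI ballI allI impI)
  fix x y t assume C: "C \<subseteq> eucl (Suc d) \<and> (\<forall>x\<in>C. \<forall>y\<in>C. \<forall>t. 0 < t \<and> t < 1 \<longrightarrow> cmb (Suc d) t x y \<in> C)"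
    and x: "x \<in> {x \<in> eucl d. x(d := s) \<in> C}" and y: "y \<in> {x \<in> eucl d. x(d := s) \<in> C}" and t: "0 < t \<and> t < (1::real)"
  have "cmb (Suc d) t (x(d := s)) (y(d := s)) \<in> C" using C x y t by blast
  moreover have "t * s + (1 - t) * s = s" by (simp add: algebra_simps)
  ultimately show "cmb d t x y \<in> {x \<in> eucl d. x(d := s) \<in> C}" unfolding cmb_upd_Suc by simp
qed auto

text \<open>The cone over a box in the slice at height \<open>s\<close> with apex at height
  \<open>u\<close> contains a one-sided neighbourhood on the side of \<open>u\<close>. A point y at
  height v is the combination of the apex, with weight l = (v - s) / (u - s), and of a point z at
  height s; z lies in the box if y is close to x and v to s.\<close>

lemma cone_point:
  assumes C: "cvx (Suc d) C" and x: "x \<in> eucl d" and e: "0 < e"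
    and sub: "\<And>z. z \<in> box d x e \<Longrightarrow> z(d := s) \<in> C"
    and p: "p(d := u) \<in> C" "p \<in> eucl d" "u \<noteq> s"
  shows "\<exists>r>0. \<forall>y\<in>eucl d. \<forall>v. (\<forall>i<d. \<bar>y i - x i\<bar> < r) \<and> \<bar>v - s\<bar> < r \<and> 0 < (v - s) / (u - s) \<longrightarrow> y(d := v) \<in> C"
proof -
  define D where "D = (\<Sum>i<d. \<bar>x i - p i\<bar>)"
  have D: "\<bar>x i - p i\<bar> \<le> D" if "i < d" for i unfolding D_def using that by (intro member_le_sum) auto
  have D0: "0 \<le> D" unfolding D_def by (intro sum_nonneg) auto
  define c where "c = \<bar>u - s\<bar>"
  have c: "0 < c" using p by (simp add: c_def)
  \<comment> \<open>The first bound gives l < 1 / 2, so division by 1 - l at most doubles; the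
    second then keeps z within \<open>e\<close> of x, where D / c accounts for the pull of the
    apex.\<close>
  define r where "r = min (c / 2) (e / (2 * (1 + D / c)))"
  have r: "0 < r" "r \<le> c / 2" "r * (1 + D / c) \<le> e / 2"
  proof -
    have q: "0 < 1 + D / c" using D0 c by (simp add: add_pos_nonneg)
    show "0 < r" using c e q by (simp add: r_def)
    show "r \<le> c / 2" unfolding r_def by (rule min.cobounded1)
    have "r * (1 + D / c) \<le> e / (2 * (1 + D / c)) * (1 + D / c)"
      using q by (intro mult_right_mono) (auto simp: r_def)
    also have "\<dots> = e / 2"
    proof -
      have "e / (2 * w) * w = e / 2" if "0 < w" for w using that by (simp add: field_simps)
      from this[OF q] show ?thesis .
    qed
    finally show "r * (1 + D / c) \<le> e / 2" .
  qed
  show ?thesis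
  proof (intro exI[of _ r] conjI ballI allI impI r)
    fix y v assume y: "y \<in> eucl d" and h: "(\<forall>i<d. \<bar>y i - x i\<bar> < r) \<and> \<bar>v - s\<bar> < r \<and> 0 < (v - s) / (u - s)"
    define l where "l = (v - s) / (u - s)"
    have l0: "0 < l" using h by (simp add: l_def)
    have la: "l = \<bar>v - s\<bar> / c" using l0 unfolding l_def c_def by (metis abs_divide abs_of_pos)
    have lr: "l < r / c" unfolding la using h c by (simp add: divide_strict_right_mono)
    also have "r / c \<le> 1 / 2" using r(2) c by (simp add: pos_divide_le_eq)
    finally have l2: "l < 1 / 2" .
    define z where "z = (\<lambda>i\<in>{..<d}. (y i - l * p i) / (1 - l))"
    have "z \<in> box d x e" unfolding box_def
    proof (intro CollectI conjI allI impI)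
      show "z \<in> eucl d" by (simp add: z_def eucl_def)
      fix i assume i: "i < d"
      have "z i - x i = ((y i - x i) + l * (x i - p i)) / (1 - l)" using i l2 by (simp add: z_def field_simps)
      then have "\<bar>z i - x i\<bar> = \<bar>(y i - x i) + l * (x i - p i)\<bar> / (1 - l)" using l2 by simp
      also have "\<dots> \<le> \<bar>(y i - x i) + l * (x i - p i)\<bar> / (1 / 2)" using l2 by (intro divide_left_mono) auto
      also have "\<bar>(y i - x i) + l * (x i - p i)\<bar> \<le> \<bar>y i - x i\<bar> + l * \<bar>x i - p i\<bar>"
        using l0 by (intro order_trans[OF abs_triangle_ineq]) (simp add: abs_mult)
      also have "\<dots> < r + r / c * D"
        using h i D[OF i] lr l0 D0 by (intro add_less_le_mono mult_mono) auto
      also have "r + r / c * D = r * (1 + D / c)" by (simp add: algebra_simps)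
      finally show "\<bar>z i - x i\<bar> < e" using r(3) by (simp add: divide_right_mono)
    qed
    then have "z(d := s) \<in> C" by (rule sub)
    then have "cmb (Suc d) (1 - l) (z(d := s)) (p(d := u)) \<in> C" using C p l0 l2 by (auto simp: cvx_def)
    moreover have "(1 - l) * s + (1 - (1 - l)) * u = v"
    proof -
      have "l * (u - s) = v - s" using p by (simp add: l_def)
      then show ?thesis by (simp add: algebra_simps)
    qed
    moreover have "cmb d (1 - l) z p = y"
      by (rule eucl_eqI[of _ d]) (use y l2 in \<open>auto simp: z_def\<close>)
    ultimately show "y(d := v) \<in> C" unfolding cmb_upd_Suc by simp
  qed
qed

text \<open>A cone with apex below, a cone with apex above and the slice itself together fill a
  neighbourhood of the point.\<close>

lemma slice_core:
  assumes C: "cvx (Suc d) C" and x: "x \<in> core d {x \<in> eucl d. x(d := s) \<in> C}"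
    and p: "p(d := u) \<in> C" "p \<in> eucl d" "u < s" and q: "q(d := v) \<in> C" "q \<in> eucl d" "s < v"
  shows "x(d := s) \<in> core (Suc d) C"
proof -
  obtain e where e: "0 < e" "box d x e \<subseteq> {x \<in> eucl d. x(d := s) \<in> C}" and xe: "x \<in> eucl d" using x by (auto simp: core_def)
  have sub: "z(d := s) \<in> C" if "z \<in> box d x e" for z using e that by auto
  obtain r1 where r1: "0 < r1" "\<And>y w. y \<in> eucl d \<Longrightarrow> (\<forall>i<d. \<bar>y i - x i\<bar> < r1) \<Longrightarrow> \<bar>w - s\<bar> < r1 \<Longrightarrow> 0 < (w - s) / (u - s) \<Longrightarrow> y(d := w) \<in> C"
    using cone_point[OF C xe e(1) sub p(1,2)] p(3) by blast
  obtain r2 where r2: "0 < r2" "\<And>y w. y \<in> eucl d \<Longrightarrow> (\<forall>i<d. \<bar>y i - x i\<bar> < r2) \<Longrightarrow> \<bar>w - s\<bar> < r2 \<Longrightarrow> 0 < (w - s) / (v - s) \<Longrightarrow> y(d := w) \<in> C"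
    using cone_point[OF C xe e(1) sub q(1,2)] q(3) by blast
  define r where "r = min e (min r1 r2)"
  have "box (Suc d) (x(d := s)) r \<subseteq> C"
  proof
    fix z assume z: "z \<in> box (Suc d) (x(d := s)) r"
    define y where "y = z(d := undefined)"
    have y: "y \<in> eucl d" using z by (auto simp: y_def box_def eucl_def PiE_def extensional_def)
    have zy: "z = y(d := z d)" by (simp add: y_def)
    have yi: "\<bar>y i - x i\<bar> < r" if "i < d" for i
      using z that by (auto simp: box_def y_def dest!: spec[of _ i])
    have zd: "\<bar>z d - s\<bar> < r" using z by (auto simp: box_def)
    consider "z d = s" | "z d < s" | "s < z d" by linarith
    then show "z \<in> C"
    proof cases
      case 1
      have "y \<in> box d x e" using y yi by (auto simp: box_def r_def)
      then show ?thesis using sub zy 1 by metis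
    next
      case 2
      have "y(d := z d) \<in> C" by (rule r1(2)[OF y]) (use yi zd 2 p(3) in \<open>auto simp: r_def divide_neg_neg\<close>)
      then show ?thesis using zy by simp
    next
      case 3
      have "y(d := z d) \<in> C" by (rule r2(2)[OF y]) (use yi zd 3 q(3) in \<open>auto simp: r_def\<close>)
      then show ?thesis using zy by simp
    qed
  qed
  moreover have "0 < r" unfolding r_def using e(1) r1(1) r2(1) by simp
  ultimately show ?thesis using eucl_Suc_upd[OF xe] unfolding core_def by blast
qed

lemma sets_slice:
  assumes "C \<in> sets (leb (Suc d))" shows "{x \<in> eucl d. x(d := s) \<in> C} \<in> sets (leb d)"
proof -
  have "(\<lambda>x. indicator C x :: real) \<in> borel_measurable (leb (Suc d))" using assms by simp
  then have "(\<lambda>x. indicator C (x(d := s)) :: real) \<in> borel_measurable (leb d)" by (rule measurable_leb_upd1)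
  then have "(\<lambda>x. indicator C (x(d := s)) :: real) -` {1} \<inter> space (leb d) \<in> sets (leb d)" by (rule measurable_sets) simp
  also have "(\<lambda>x. indicator C (x(d := s)) :: real) -` {1} \<inter> space (leb d) = {x \<in> eucl d. x(d := s) \<in> C}"
    by (auto simp: space_leb indicator_def split: if_splits)
  finally show ?thesis .
qed

text \<open>Induction with Fubini over the last coordinate. If \<open>C\<close> has points both
  below and above height s, then by \<open>slice_core\<close> a point of the slice outside the core
  of \<open>C\<close> is also outside the core of the slice, and those points are null by induction.
  Only the extreme heights, at most two and collected in \<open>X\<close>, escape.\<close>

lemma emeasure_convex_boundary:
  "cvx d C \<Longrightarrow> C \<in> sets (leb d) \<Longrightarrow> emeasure (leb d) (C - core d C) = 0"
proof (induction d arbitrary: C)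
  case 0
  have "C \<subseteq> core 0 C"
  proof
    fix x assume "x \<in> C"
    moreover have "C \<subseteq> eucl 0" using 0 by (simp add: cvx_def)
    moreover have "y = x" if "y \<in> eucl 0" "x \<in> eucl 0" for y using that by (auto simp: eucl_def)
    ultimately show "x \<in> core 0 C" by (auto simp: core_def box_def intro!: exI[of _ 1])
  qed
  then have "C - core 0 C = {}" by blast
  then show ?case by (simp only: emeasure_empty)
next
  case (Suc d)
  let ?B = "C - core (Suc d) C"
  let ?S = "\<lambda>s. {x \<in> eucl d. x(d := s) \<in> C}"
  define T where "T = {s. ?S s \<noteq> {}}"
  define X where "X = {s \<in> T. \<forall>u\<in>T. u \<le> s} \<union> {s \<in> T. \<forall>u\<in>T. s \<le> u}"
  have fX: "finite X"
  proof -
    have "finite {s \<in> T. \<forall>u\<in>T. u \<le> s}"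
    proof (cases "{s \<in> T. \<forall>u\<in>T. u \<le> s} = {}")
      case False
      then obtain s where "s \<in> T" "\<forall>u\<in>T. u \<le> s" by blast
      then have "{s \<in> T. \<forall>u\<in>T. u \<le> s} \<subseteq> {s}" by (auto intro: antisym)
      then show ?thesis by (rule finite_subset) simp
    qed (simp only: finite.emptyI)
    moreover have "finite {s \<in> T. \<forall>u\<in>T. s \<le> u}"
    proof (cases "{s \<in> T. \<forall>u\<in>T. s \<le> u} = {}")
      case False
      then obtain s where "s \<in> T" "\<forall>u\<in>T. s \<le> u" by blast
      then have "{s \<in> T. \<forall>u\<in>T. s \<le> u} \<subseteq> {s}" by (auto intro: antisym)
      then show ?thesis by (rule finite_subset) simp
    qed (simp only: finite.emptyI)
    ultimately show ?thesis by (simp add: X_def)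
  qed
  have mB: "?B \<in> sets (leb (Suc d))" using Suc.prems by auto
  have "emeasure (leb (Suc d)) ?B = (\<integral>\<^sup>+x. indicator ?B x \<partial>leb (Suc d))" using mB by simp
  also have "\<dots> = (\<integral>\<^sup>+s. (\<integral>\<^sup>+x. indicator ?B (x(d := s)) \<partial>leb d) \<partial>lborel)"
    using mB by (intro nn_integral_leb_Suc) simp
  also have "\<dots> = (\<integral>\<^sup>+(s::real). 0 \<partial>lborel)"
  proof (rule nn_integral_cong_AE)
    have "AE s in lborel. s \<notin> X" by (rule AE_not_in) (simp add: finite_imp_null_set_lborel fX)
    then show "AE s in lborel. (\<integral>\<^sup>+x. indicator ?B (x(d := s)) \<partial>leb d) = 0"
    proof eventually_elim
      case (elim s)
      show ?case
      proof (cases "s \<in> T")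
        case False
        then have "(\<integral>\<^sup>+x. indicator ?B (x(d := s)) \<partial>leb d) = (\<integral>\<^sup>+x. 0 \<partial>leb d)"
          by (intro nn_integral_cong) (auto simp: T_def space_leb indicator_def)
        then show ?thesis by simp
      next
        case True
        then obtain u v where uv: "u \<in> T" "u < s" "v \<in> T" "s < v"
          using elim unfolding X_def by force
        then obtain p q where pq: "p(d := u) \<in> C" "p \<in> eucl d" "q(d := v) \<in> C" "q \<in> eucl d"
          unfolding T_def by blast
        have mS: "?S s \<in> sets (leb d)" by (rule sets_slice[OF Suc.prems(2)])
        have "(\<integral>\<^sup>+x. indicator ?B (x(d := s)) \<partial>leb d) \<le> (\<integral>\<^sup>+x. indicator (?S s - core d (?S s)) x \<partial>leb d)"
        proof (rule nn_integral_mono)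
          fix x assume "x \<in> space (leb d)"
          then have x: "x \<in> eucl d" by (simp add: space_leb)
          have "x \<in> ?S s - core d (?S s)" if "x(d := s) \<in> ?B"
            using that x slice_core[OF Suc.prems(1) _ pq(1,2) uv(2) pq(3,4) uv(4)] by blast
          then show "indicator ?B (x(d := s)) \<le> (indicator (?S s - core d (?S s)) x :: ennreal)"
            by (auto simp: indicator_def)
        qed
        also have "\<dots> = 0" using Suc.IH[OF cvx_slice[OF Suc.prems(1)] mS] mS by simp
        finally show ?thesis by simp
      qed
    qed
  qed
  finally show ?case by simp
qed

section \<open>Euclidean distance, derivatives along segments, strong convexity\<close>

definition edist :: "nat \<Rightarrow> (nat \<Rightarrow> real) \<Rightarrow> (nat \<Rightarrow> real) \<Rightarrow> real" where
  "edist d x y = enorm d (\<lambda>i. x i - y i)"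

lemma enorm_nonneg: "0 \<le> enorm d x" by (simp add: enorm_def)

lemma edist_nonneg: "0 \<le> edist d x y" by (simp add: edist_def enorm_nonneg)

lemma enorm_cong: "(\<And>i. i < d \<Longrightarrow> x i = y i) \<Longrightarrow> enorm d x = enorm d y"
  unfolding enorm_def by (intro L2_set_cong) auto

lemma enorm_cmult: "enorm d (\<lambda>i. c * x i) = \<bar>c\<bar> * enorm d x"
  unfolding enorm_def L2_set_def power_mult_distrib sum_distrib_left[symmetric] real_sqrt_mult by simp

lemma edist_commute: "edist d x y = edist d y x"
  unfolding edist_def enorm_def L2_set_def by (intro arg_cong[where f = sqrt] sum.cong refl power2_commute)

lemma edist_triangle: "edist d x z \<le> edist d x y + edist d y z"
  using L2_set_triangle_ineq[of "\<lambda>i. x i - y i" "\<lambda>i. y i - z i" "{..<d}"]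
  by (simp add: edist_def enorm_def)

lemma coord_le_edist: "i < d \<Longrightarrow> \<bar>x i - y i\<bar> \<le> edist d x y"
proof -
  assume "i < d"
  then have "\<bar>x i - y i\<bar> \<le> L2_set (\<lambda>i. \<bar>x i - y i\<bar>) {..<d}" by (intro member_le_L2_set) auto
  then show ?thesis by (simp add: edist_def enorm_def L2_set_def)
qed

lemma edist_le_sum: "edist d x y \<le> (\<Sum>i<d. \<bar>x i - y i\<bar>)"
  unfolding edist_def enorm_def by (rule L2_set_le_sum_abs)

lemma edist_cmb_left: "t \<le> 1 \<Longrightarrow> edist d x (cmb d t x y) = (1 - t) * edist d x y"
proof -
  assume "t \<le> 1"
  have "edist d x (cmb d t x y) = enorm d (\<lambda>i. (1 - t) * (x i - y i))"
    unfolding edist_def by (rule enorm_cong) (simp add: algebra_simps)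
  then show ?thesis using \<open>t \<le> 1\<close> by (simp add: enorm_cmult edist_def)
qed

lemma edist_cmb_right: "0 \<le> t \<Longrightarrow> edist d y (cmb d t x y) = t * edist d x y"
proof -
  assume "0 \<le> t"
  have "edist d y (cmb d t x y) = enorm d (\<lambda>i. t * (y i - x i))"
    unfolding edist_def by (rule enorm_cong) (simp add: algebra_simps)
  then show ?thesis using \<open>0 \<le> t\<close> edist_commute[of d x y] by (simp add: enorm_cmult edist_def)
qed

definition segment :: "nat \<Rightarrow> (nat \<Rightarrow> real) \<Rightarrow> (nat \<Rightarrow> real) \<Rightarrow> real \<Rightarrow> nat \<Rightarrow> real" where
  "segment d x w t = (\<lambda>i\<in>{..<d}. x i + t * w i)"

definition box_open :: "nat \<Rightarrow> (nat \<Rightarrow> real) set \<Rightarrow> bool" where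
  "box_open d S \<longleftrightarrow> S \<subseteq> eucl d \<and> (\<forall>z\<in>S. \<exists>e>0. box d z e \<subseteq> S)"

lemma box_mono: "e \<le> e' \<Longrightarrow> box d x e \<subseteq> box d x e'"
  by (force simp: box_def)

lemma mvt_between:
  fixes g :: "real \<Rightarrow> real"
  assumes "\<And>t. \<bar>t - p\<bar> \<le> \<bar>q - p\<bar> \<Longrightarrow> (g has_real_derivative g' t) (at t)"
  obtains z where "\<bar>z - p\<bar> \<le> \<bar>q - p\<bar>" "g q - g p = (q - p) * g' z"
proof (cases p q rule: linorder_cases)
  case less
  have "\<exists>z. p < z \<and> z < q \<and> g q - g p = (q - p) * g' z"
    by (rule MVT2[OF less]) (use assms in auto)
  then show ?thesis using that by force
next
  case equal then show ?thesis using that[of p] by simp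
next
  case greater
  have "\<exists>z. q < z \<and> z < p \<and> g p - g q = (p - q) * g' z"
    by (rule MVT2[OF greater]) (use assms in auto)
  then obtain z where "q < z" "z < p" "g p - g q = (p - q) * g' z" by blast
  then show ?thesis using that[of z] by (auto simp: algebra_simps)
qed

text \<open>\<open>Ck_on\<close> provides derivatives along the coordinate axes only. The increment
  along the segment is telescoped over single coordinates, each treated by the mean value theorem,
  and continuity of the partials at the base point makes all intermediate values close.\<close>

lemma directional_derivative:
  assumes S: "box_open d S"
    and cont: "\<And>i. i < d \<Longrightarrow> continuous_on S (partial i F)"
    and diff: "\<And>i x. i < d \<Longrightarrow> x \<in> S \<Longrightarrow> (\<lambda>t. F (x(i := t))) differentiable (at (x i))"
    and z: "segment d x w t \<in> S"
  shows "((\<lambda>t. F (segment d x w t)) has_real_derivative (\<Sum>i<d. partial i F (segment d x w t) * w i)) (at t)"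
  unfolding DERIV_def LIM_eq
proof (intro allI impI)
  fix e :: real assume e: "0 < e"
  define z where "z = segment d x w t"
  have zS: "z \<in> S" and Se: "S \<subseteq> eucl d" using z S by (auto simp: z_def box_open_def)
  \<comment> \<open>The added 1 makes \<open>W\<close> positive and the final sum, whose total
    weight is W - 1, strictly smaller than \<open>e\<close>.\<close>
  define W where "W = 1 + (\<Sum>i<d. \<bar>w i\<bar>)"
  have W: "0 < W" unfolding W_def by (intro add_pos_nonneg sum_nonneg) auto
  have wW: "\<bar>w i\<bar> < W" if "i < d" for i
  proof -
    have "\<bar>w i\<bar> \<le> (\<Sum>i<d. \<bar>w i\<bar>)" using that by (intro member_le_sum) auto
    then show ?thesis by (simp add: W_def)
  qed
  have "\<exists>r>0. \<forall>y\<in>S. y \<in> box d z r \<longrightarrow> \<bar>partial i F y - partial i F z\<bar> < e / W" if "i < d" for i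
    using continuous_on_box[OF cont[OF that] zS Se, of "e / W"] e W by (metis divide_pos_pos)
  then obtain r where r: "\<And>i. i < d \<Longrightarrow> 0 < r i"
    "\<And>i y. i < d \<Longrightarrow> y \<in> S \<Longrightarrow> y \<in> box d z (r i) \<Longrightarrow> \<bar>partial i F y - partial i F z\<bar> < e / W" by metis
  obtain e0 where e0: "0 < e0" "box d z e0 \<subseteq> S" using S zS by (auto simp: box_open_def)
  define m where "m = Min (insert e0 (r ` {..<d}))"
  have m0: "0 < m" using e0 r(1) by (simp add: m_def)
  have me0: "m \<le> e0" and mr: "\<And>i. i < d \<Longrightarrow> m \<le> r i" by (auto simp: m_def)
  show "\<exists>s>0. \<forall>h. h \<noteq> 0 \<and> norm (h - 0) < s \<longrightarrow>
      norm ((F (segment d x w (t + h)) - F (segment d x w t)) / h - (\<Sum>i<d. partial i F (segment d x w t) * w i)) < e"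
  proof (intro exI[of _ "m / W"] conjI allI impI)
    show "0 < m / W" using m0 W by simp
    fix h :: real assume h: "h \<noteq> 0 \<and> norm (h - 0) < m / W"
    have hw: "\<bar>h * w i\<bar> < m" if "i < d" for i
    proof -
      have "\<bar>h * w i\<bar> \<le> \<bar>h\<bar> * W" using wW[OF that] by (simp add: abs_mult mult_left_mono)
      also have "\<dots> < m / W * W" using h W by (intro mult_strict_right_mono) auto
      finally show ?thesis using W by simp
    qed
    define zz where "zz j = (\<lambda>i\<in>{..<d}. z i + (if i < j then h * w i else 0))" for j :: nat
    have zeu: "z \<in> eucl d" using zS Se by blast
    have zz0: "zz 0 = z" by (rule eucl_eqI[OF _ zeu]) (auto simp: zz_def eucl_def)
    have zzd: "zz d = segment d x w (t + h)"
      by (rule eucl_eqI[of _ d]) (auto simp: zz_def z_def segment_def eucl_def algebra_simps)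
    have step: "\<exists>q. \<bar>partial j F q - partial j F z\<bar> < e / W \<and> F (zz (Suc j)) - F (zz j) = h * w j * partial j F q"
      if j: "j < d" for j
    proof -
      let ?y = "\<lambda>s. (zz j)(j := s)"
      have yb: "?y s \<in> box d z m" if "\<bar>s - z j\<bar> \<le> \<bar>h * w j\<bar>" for s
        unfolding box_def
      proof (intro CollectI conjI allI impI)
        show "?y s \<in> eucl d" using j by (intro eucl_upd) (auto simp: zz_def eucl_def)
        show "\<bar>?y s i - z i\<bar> < m" if "i < d" for i
          using that hw[OF that] hw[OF j] \<open>\<bar>s - z j\<bar> \<le> \<bar>h * w j\<bar>\<close> m0 by (auto simp: zz_def)
      qed
      have yS: "?y s \<in> S" if "\<bar>s - z j\<bar> \<le> \<bar>h * w j\<bar>" for s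
        using subsetD[OF subset_trans[OF box_mono[OF me0] e0(2)] yb[OF that]] .
      have d: "((\<lambda>s. F (?y s)) has_real_derivative partial j F (?y s)) (at s)"
        if "\<bar>s - z j\<bar> \<le> \<bar>(z j + h * w j) - z j\<bar>" for s
      proof -
        have "?y s \<in> S" using yS that by simp
        from diff[OF j this] have "(\<lambda>t. F (?y t)) differentiable (at s)" by simp
        then have "((\<lambda>t. F (?y t)) has_real_derivative deriv (\<lambda>t. F (?y t)) s) (at s)"
          by (simp add: DERIV_deriv_iff_real_differentiable)
        then show ?thesis by (simp add: partial_def)
      qed
      obtain s where s: "\<bar>s - z j\<bar> \<le> \<bar>(z j + h * w j) - z j\<bar>"
        "F (?y (z j + h * w j)) - F (?y (z j)) = ((z j + h * w j) - z j) * partial j F (?y s)"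
        using mvt_between[OF d] by blast
      have s': "\<bar>s - z j\<bar> \<le> \<bar>h * w j\<bar>" using s(1) by simp
      have "?y (z j + h * w j) = zz (Suc j)" using j by (auto simp: zz_def fun_eq_iff)
      moreover have "?y (z j) = zz j" using j by (auto simp: zz_def fun_eq_iff)
      moreover have "\<bar>partial j F (?y s) - partial j F z\<bar> < e / W"
        by (rule r(2)[OF j yS[OF s'] subsetD[OF box_mono[OF mr[OF j]] yb[OF s']]])
      ultimately show ?thesis using s(2) by (intro exI[of _ "?y s"]) simp
    qed
    then obtain q where q: "\<And>j. j < d \<Longrightarrow> \<bar>partial j F (q j) - partial j F z\<bar> < e / W"
      "\<And>j. j < d \<Longrightarrow> F (zz (Suc j)) - F (zz j) = h * w j * partial j F (q j)" by metis
    have "F (segment d x w (t + h)) - F z = (\<Sum>j<d. F (zz (Suc j)) - F (zz j))"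
      using sum_lessThan_telescope[of "\<lambda>j. F (zz j)" d] by (simp add: zz0 zzd)
    also have "\<dots> = (\<Sum>j<d. h * w j * partial j F (q j))" by (intro sum.cong refl q(2)) simp
    also have "\<dots> = h * (\<Sum>j<d. w j * partial j F (q j))" by (simp add: sum_distrib_left mult.assoc)
    finally have "(F (segment d x w (t + h)) - F z) / h = (\<Sum>j<d. w j * partial j F (q j))" using h by simp
    then have "(F (segment d x w (t + h)) - F z) / h - (\<Sum>i<d. partial i F z * w i)
        = (\<Sum>j<d. w j * (partial j F (q j) - partial j F z))"
      by (simp add: sum_subtractf[symmetric] algebra_simps)
    also have "\<bar>\<dots>\<bar> \<le> (\<Sum>j<d. \<bar>w j\<bar> * (e / W))"
    proof (rule order_trans[OF sum_abs sum_mono])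
      fix j assume "j \<in> {..<d}"
      then show "\<bar>w j * (partial j F (q j) - partial j F z)\<bar> \<le> \<bar>w j\<bar> * (e / W)"
        unfolding abs_mult using q(1)[of j] by (intro mult_left_mono) auto
    qed
    also have "\<dots> = (\<Sum>j<d. \<bar>w j\<bar>) * (e / W)" by (rule sum_distrib_right[symmetric])
    also have "(\<Sum>j<d. \<bar>w j\<bar>) = W - 1" by (simp add: W_def)
    also have "(W - 1) * (e / W) < W * (e / W)" using e W by (intro mult_strict_right_mono) auto
    also have "\<dots> = e" using W by simp
    finally show "norm ((F (segment d x w (t + h)) - F (segment d x w t)) / h
        - (\<Sum>i<d. partial i F (segment d x w t) * w i)) < e" by (simp add: z_def)
  qed
qed

lemma Ck_on_partial:
  assumes "Ck_on d 2 S f"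
  shows "i < d \<Longrightarrow> continuous_on S (partial i f)"
    and "i < d \<Longrightarrow> x \<in> S \<Longrightarrow> (\<lambda>t. f (x(i := t))) differentiable (at (x i))"
    and "i < d \<Longrightarrow> j < d \<Longrightarrow> continuous_on S (partial j (partial i f))"
    and "i < d \<Longrightarrow> j < d \<Longrightarrow> x \<in> S \<Longrightarrow> (\<lambda>t. partial i f (x(j := t))) differentiable (at (x j))"
proof -
  have *: "set is \<subseteq> {..<d} \<Longrightarrow> length is \<le> 2 \<Longrightarrow> continuous_on S (foldr partial is f)"
    "set is \<subseteq> {..<d} \<Longrightarrow> length is < 2 \<Longrightarrow> i < d \<Longrightarrow> x \<in> S \<Longrightarrow>
       (\<lambda>t. foldr partial is f (x(i := t))) differentiable (at (x i))" for "is" i x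
    using assms unfolding Ck_on_def by (meson less_imp_le)+
  show "i < d \<Longrightarrow> continuous_on S (partial i f)" using *(1)[of "[i]"] by simp
  show "i < d \<Longrightarrow> x \<in> S \<Longrightarrow> (\<lambda>t. f (x(i := t))) differentiable (at (x i))" using *(2)[of "[]" i x] by simp
  show "i < d \<Longrightarrow> j < d \<Longrightarrow> continuous_on S (partial j (partial i f))" using *(1)[of "[j, i]"] by simp
  show "i < d \<Longrightarrow> j < d \<Longrightarrow> x \<in> S \<Longrightarrow> (\<lambda>t. partial i f (x(j := t))) differentiable (at (x j))"
    using *(2)[of "[i]" j x] by simp
qed

lemma Ck_on_subset: "Ck_on d k S f \<Longrightarrow> T \<subseteq> S \<Longrightarrow> Ck_on d k T f"
  unfolding Ck_on_def by (meson continuous_on_subset subsetD)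

lemma segment_derivatives:
  assumes S: "box_open d S" and f: "Ck_on d 2 S f" and z: "segment d x w t \<in> S"
  shows "((\<lambda>t. f (segment d x w t)) has_real_derivative (\<Sum>i<d. partial i f (segment d x w t) * w i)) (at t)"
    and "((\<lambda>t. \<Sum>i<d. partial i f (segment d x w t) * w i) has_real_derivative
          (\<Sum>i<d. (\<Sum>j<d. partial j (partial i f) (segment d x w t) * w j) * w i)) (at t)"
proof -
  show "((\<lambda>t. f (segment d x w t)) has_real_derivative (\<Sum>i<d. partial i f (segment d x w t) * w i)) (at t)"
    by (rule directional_derivative[OF S Ck_on_partial(1)[OF f] Ck_on_partial(2)[OF f] z])
  have "((\<lambda>t. partial i f (segment d x w t)) has_real_derivative
      (\<Sum>j<d. partial j (partial i f) (segment d x w t) * w j)) (at t)" if "i < d" for i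
    by (rule directional_derivative[OF S Ck_on_partial(3)[OF f that] Ck_on_partial(4)[OF f that] z])
  then show "((\<lambda>t. \<Sum>i<d. partial i f (segment d x w t) * w i) has_real_derivative
          (\<Sum>i<d. (\<Sum>j<d. partial j (partial i f) (segment d x w t) * w j) * w i)) (at t)"
    by (intro DERIV_sum DERIV_cmult_right) auto
qed

text \<open>Along the segment, f minus \<alpha> / 2 times the squared distance from \<open>y\<close>
  has nonnegative second derivative; in the resulting convexity inequality the corrections combine
  to t - t^2 = t (1 - t).\<close>

lemma strong_convexity:
  assumes S: "box_open d S" "cvx d S" and f: "Ck_on d 2 S f" and hess: "\<And>x. x \<in> S \<Longrightarrow> hessian_ge d \<alpha> f x"
    and xy: "x \<in> S" "y \<in> S" and t: "0 < t" "t < 1"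
  shows "f (cmb d t x y) + \<alpha> / 2 * t * (1 - t) * (edist d x y)\<^sup>2 \<le> t * f x + (1 - t) * f y"
proof -
  define w where "w i = x i - y i" for i
  have xe: "x \<in> eucl d" "y \<in> eucl d" using xy S by (auto simp: box_open_def)
  have seg: "segment d y w s = cmb d s x y" for s
    by (rule eucl_eqI[of _ d]) (auto simp: segment_def w_def eucl_def algebra_simps cmb_def)
  have s1: "segment d y w 1 = x" by (rule eucl_eqI[OF _ xe(1)]) (auto simp: segment_def w_def eucl_def)
  have s0: "segment d y w 0 = y" by (rule eucl_eqI[OF _ xe(2)]) (auto simp: segment_def w_def eucl_def)
  have inS: "segment d y w s \<in> S" if "s \<in> {0..1}" for s
  proof -
    consider "s = 0" | "s = 1" | "0 < s" "s < 1" using \<open>s \<in> {0..1}\<close> by fastforce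
    then show ?thesis
    proof cases
      case 3 then show ?thesis using S(2) xy unfolding cvx_def seg by blast
    qed (use s0 s1 xy in auto)
  qed
  let ?N = "(enorm d w)\<^sup>2"
  let ?\<phi> = "\<lambda>s. f (segment d y w s)"
  let ?\<phi>1 = "\<lambda>s. \<Sum>i<d. partial i f (segment d y w s) * w i"
  let ?\<phi>2 = "\<lambda>s. \<Sum>i<d. (\<Sum>j<d. partial j (partial i f) (segment d y w s) * w j) * w i"
  have "convex_on {0..1} (\<lambda>s. ?\<phi> s - \<alpha> / 2 * ?N * s\<^sup>2)"
  proof (rule f''_ge0_imp_convex[where f' = "\<lambda>s. ?\<phi>1 s - \<alpha> * ?N * s" and f'' = "\<lambda>s. ?\<phi>2 s - \<alpha> * ?N"])
    fix s :: real assume s: "s \<in> {0..1}"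
    show "((\<lambda>s. ?\<phi> s - \<alpha> / 2 * ?N * s\<^sup>2) has_real_derivative ?\<phi>1 s - \<alpha> * ?N * s) (at s)"
      using segment_derivatives(1)[OF S(1) f inS[OF s]] by (auto intro!: derivative_eq_intros)
    show "((\<lambda>s. ?\<phi>1 s - \<alpha> * ?N * s) has_real_derivative ?\<phi>2 s - \<alpha> * ?N) (at s)"
      using segment_derivatives(2)[OF S(1) f inS[OF s]] by (intro DERIV_diff) (auto intro!: derivative_eq_intros)
    \<comment> \<open>Exchanging the two sums brings the second derivatives into the order used by
      \<open>hessian_ge\<close>.\<close>
    have "?\<phi>2 s = (\<Sum>i<d. \<Sum>j<d. partial i (partial j f) (segment d y w s) * w i * w j)"
      by (subst sum.swap) (simp add: sum_distrib_right)
    then show "0 \<le> ?\<phi>2 s - \<alpha> * ?N" using hess[OF inS[OF s]] unfolding hessian_ge_def by simp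
  qed simp
  then have "(\<lambda>s. ?\<phi> s - \<alpha> / 2 * ?N * s\<^sup>2) ((1 - t) *\<^sub>R 0 + t *\<^sub>R 1)
     \<le> (1 - t) * (?\<phi> 0 - \<alpha> / 2 * ?N * 0\<^sup>2) + t * (?\<phi> 1 - \<alpha> / 2 * ?N * 1\<^sup>2)"
    using t by (intro convex_onD) auto
  then have "?\<phi> t - \<alpha> / 2 * ?N * t\<^sup>2 \<le> (1 - t) * f y + t * (f x - \<alpha> / 2 * ?N)" by (simp add: s0 s1)
  moreover have "?N = (edist d x y)\<^sup>2" by (simp add: edist_def w_def[abs_def])
  moreover have "\<alpha> / 2 * t * (1 - t) * N = t * (\<alpha> / 2 * N) - \<alpha> / 2 * N * t\<^sup>2" for N
    by (simp add: field_simps power2_eq_square)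
  ultimately show ?thesis unfolding seg by (simp add: right_diff_distrib)
qed

definition cube :: "nat \<Rightarrow> real \<Rightarrow> (nat \<Rightarrow> real) set" where
  "cube d R = {x \<in> eucl d. \<forall>i<d. \<bar>x i\<bar> \<le> R}"

lemma compact_cube: "compact (cube d R)"
proof -
  let ?S = "\<lambda>i. if i < d then {- R..R} else {undefined}"
  have "compactin (product_topology (\<lambda>i::nat. euclidean :: real topology) UNIV) (PiE UNIV ?S)"
    by (subst compactin_PiE) auto
  moreover have "PiE UNIV ?S = cube d R"
    by (rule set_eqI) (auto simp: cube_def eucl_def PiE_iff extensional_def abs_le_iff minus_le_iff split: if_splits)
  ultimately show ?thesis by (simp add: euclidean_product_topology)
qed

lemma cube_subset: "cube d R \<subseteq> eucl d" by (auto simp: cube_def)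

lemma bounded_on_cube:
  fixes g :: "(nat \<Rightarrow> real) \<Rightarrow> real"
  assumes "continuous_on (eucl d) g"
  obtains B where "0 < B" "\<And>x. x \<in> cube d R \<Longrightarrow> \<bar>g x\<bar> \<le> B"
proof -
  have "compact (g ` cube d R)"
    by (intro compact_continuous_image compact_cube continuous_on_subset[OF assms cube_subset])
  then obtain B where B: "\<And>y. y \<in> g ` cube d R \<Longrightarrow> \<bar>y\<bar> \<le> B" using compact_imp_bounded bounded_real by metis
  show ?thesis
  proof (rule that[of "\<bar>B\<bar> + 1"])
    show "\<bar>g x\<bar> \<le> \<bar>B\<bar> + 1" if "x \<in> cube d R" for x using B[of "g x"] that by fastforce
  qed simp
qed

lemma cvx_cube: "cvx d (cube d R)"
  unfolding cvx_def
proof (intro conjI ballI allI impI)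
  fix x y t assume xy: "x \<in> cube d R" "y \<in> cube d R" and t: "0 < t \<and> t < (1::real)"
  have "\<bar>t * x i + (1 - t) * y i\<bar> \<le> R" if "i < d" for i
  proof -
    have "\<bar>t * x i + (1 - t) * y i\<bar> \<le> t * \<bar>x i\<bar> + (1 - t) * \<bar>y i\<bar>"
      using t by (intro order_trans[OF abs_triangle_ineq]) (simp add: abs_mult)
    also have "\<dots> \<le> t * R + (1 - t) * R" using xy that t by (intro add_mono mult_left_mono) (auto simp: cube_def)
    finally show ?thesis by (simp add: algebra_simps)
  qed
  then show "cmb d t x y \<in> cube d R" by (simp add: cube_def)
qed (rule cube_subset)

lemma sets_cube [measurable]: "cube d R \<in> sets (leb d)"
proof -
  have "closed (cube d R)" using compact_cube by (rule compact_imp_closed)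
  then have "cube d R \<in> sets borel" by (rule borel_closed)
  from measurable_sets[OF measurable_leb_id this, of d] cube_subset[of d R]
  show ?thesis by (simp add: space_leb Int_absorb2)
qed

lemma edist_cube: "x \<in> cube d R \<Longrightarrow> y \<in> cube d R \<Longrightarrow> edist d x y \<le> real d * (2 * R)"
proof -
  assume xy: "x \<in> cube d R" "y \<in> cube d R"
  have "edist d x y \<le> (\<Sum>i<d. \<bar>x i - y i\<bar>)" by (rule edist_le_sum)
  also have "\<dots> \<le> (\<Sum>i<d. 2 * R)"
  proof (rule sum_mono)
    fix i assume "i \<in> {..<d}"
    then have "\<bar>x i\<bar> \<le> R" "\<bar>y i\<bar> \<le> R" using xy by (auto simp: cube_def)
    then show "\<bar>x i - y i\<bar> \<le> 2 * R" by linarith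
  qed
  finally show ?thesis by simp
qed

lemma box_open_eucl: "box_open d (eucl d)"
  by (auto simp: box_open_def box_def intro!: exI[of _ 1])

lemma box_open_core: "box_open d (core d C)"
  unfolding box_open_def using core_subset(2) core_box by blast

text \<open>Second-order Taylor expansion along the segment with Cauchy-Schwarz for the linear term.
  \<open>H\<close> sums bounds for the second partials over the compact cube; it depends on the cube
  and on \<open>d\<close>, but is lost in the limits behind \<open>lsi_exp\<close> and
  \<open>poincare_base\<close>.\<close>

lemma smooth_slope:
  assumes "smooth d f"
  shows "slope (cube d R) (edist d) f (\<lambda>x. enorm d (grad f x))"
proof -
  have f: "Ck_on d 2 (eucl d) f" using assms by (simp add: smooth_def)
  have "\<exists>B>0. \<forall>x\<in>cube d R. \<bar>partial j (partial i f) x\<bar> \<le> B" if "i < d" "j < d" for i j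
    using bounded_on_cube[OF Ck_on_partial(3)[OF f that]] by metis
  then obtain b where b: "\<And>i j. i < d \<Longrightarrow> j < d \<Longrightarrow> 0 < b i j"
    "\<And>i j x. i < d \<Longrightarrow> j < d \<Longrightarrow> x \<in> cube d R \<Longrightarrow> \<bar>partial j (partial i f) x\<bar> \<le> b i j" by metis
  define H where "H = (\<Sum>i<d. \<Sum>j<d. b i j)"
  have H0: "0 \<le> H" unfolding H_def using b(1) by (intro sum_nonneg) (auto intro: less_imp_le)
  show ?thesis
  proof (rule slopeI[OF enorm_nonneg H0])
    fix x z assume xz: "x \<in> cube d R" "z \<in> cube d R"
    define w where "w i = x i - z i" for i
    define r where "r = edist d x z"
    have r0: "0 \<le> r" by (simp add: r_def edist_nonneg)
    have wr: "\<bar>w i\<bar> \<le> r" if "i < d" for i unfolding w_def r_def by (rule coord_le_edist[OF that])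
    have xe: "x \<in> eucl d" "z \<in> eucl d" using xz cube_subset by blast+
    have seg: "segment d z w s = cmb d s x z" for s
      by (rule eucl_eqI[of _ d]) (auto simp: segment_def w_def eucl_def algebra_simps cmb_def)
    have s1: "segment d z w 1 = x" by (rule eucl_eqI[OF _ xe(1)]) (auto simp: segment_def w_def eucl_def)
    have s0: "segment d z w 0 = z" by (rule eucl_eqI[OF _ xe(2)]) (auto simp: segment_def w_def eucl_def)
    have inC: "segment d z w s \<in> cube d R" if "s \<in> {0..1}" for s
    proof -
      consider "s = 0" | "s = 1" | "0 < s" "s < 1" using \<open>s \<in> {0..1}\<close> by fastforce
      then show ?thesis
      proof cases
        case 3 then show ?thesis using cvx_cube xz unfolding cvx_def seg by blast
      qed (use s0 s1 xz in auto)
    qed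
    have inE: "segment d z w s \<in> eucl d" for s by (simp add: segment_def eucl_def)
    let ?\<phi> = "\<lambda>s. f (segment d z w s)"
    let ?\<phi>1 = "\<lambda>s. \<Sum>i<d. partial i f (segment d z w s) * w i"
    let ?\<phi>2 = "\<lambda>s. \<Sum>i<d. (\<Sum>j<d. partial j (partial i f) (segment d z w s) * w j) * w i"
    note der = segment_derivatives[OF box_open_eucl f inE]
    have phi2: "\<bar>?\<phi>2 s\<bar> \<le> H * r\<^sup>2" if "s \<in> {0..1}" for s
    proof -
      have "\<bar>?\<phi>2 s\<bar> \<le> (\<Sum>i<d. \<bar>(\<Sum>j<d. partial j (partial i f) (segment d z w s) * w j) * w i\<bar>)" by (rule sum_abs)
      also have "\<dots> \<le> (\<Sum>i<d. (\<Sum>j<d. b i j * r) * r)"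
      proof (rule sum_mono)
        fix i assume i: "i \<in> {..<d}"
        have "\<bar>\<Sum>j<d. partial j (partial i f) (segment d z w s) * w j\<bar> \<le> (\<Sum>j<d. b i j * r)"
        proof (rule order_trans[OF sum_abs sum_mono])
          fix j assume j: "j \<in> {..<d}"
          show "\<bar>partial j (partial i f) (segment d z w s) * w j\<bar> \<le> b i j * r"
            unfolding abs_mult using b(1)[of i j] b(2)[of i j "segment d z w s"] i j inC[OF that] wr[of j]
            by (intro mult_mono) auto
        qed
        then show "\<bar>(\<Sum>j<d. partial j (partial i f) (segment d z w s) * w j) * w i\<bar> \<le> (\<Sum>j<d. b i j * r) * r"
          unfolding abs_mult using wr[of i] i by (intro mult_mono) (auto intro: order_trans[OF abs_ge_zero])
      qed
      also have "\<dots> = H * r\<^sup>2" by (simp add: H_def sum_distrib_right power2_eq_square mult.assoc)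
      finally show ?thesis .
    qed
    obtain s where s: "0 < s" "s < 1" "?\<phi> 1 - ?\<phi> 0 = (1 - 0) * ?\<phi>1 s"
      using MVT2[of 0 1 ?\<phi> ?\<phi>1] der(1) by force
    obtain u where u: "0 < u" "u < s" "?\<phi>1 s - ?\<phi>1 0 = (s - 0) * ?\<phi>2 u"
      using MVT2[of 0 s ?\<phi>1 ?\<phi>2] der(2) s(1) by force
    have "\<bar>s * ?\<phi>2 u\<bar> \<le> 1 * (H * r\<^sup>2)"
      unfolding abs_mult using s u phi2[of u] by (intro mult_mono) auto
    moreover have "?\<phi> 1 - ?\<phi> 0 = ?\<phi>1 0 + s * ?\<phi>2 u" using s(3) u(3) by simp
    ultimately have "\<bar>?\<phi> 1 - ?\<phi> 0\<bar> \<le> \<bar>?\<phi>1 0\<bar> + H * r\<^sup>2"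
      using abs_triangle_ineq[of "?\<phi>1 0" "s * ?\<phi>2 u"] by simp
    moreover have "\<bar>?\<phi>1 0\<bar> \<le> enorm d (grad f z) * r"
    proof -
      have "\<bar>?\<phi>1 0\<bar> \<le> (\<Sum>i<d. \<bar>partial i f z\<bar> * \<bar>w i\<bar>)"
        unfolding s0 by (intro order_trans[OF sum_abs]) (simp add: abs_mult)
      also have "\<dots> \<le> L2_set (\<lambda>i. partial i f z) {..<d} * L2_set w {..<d}" by (rule L2_set_mult_ineq)
      finally show ?thesis by (simp add: enorm_def grad_def r_def edist_def w_def[abs_def])
    qed
    ultimately show "\<bar>f x - f z\<bar> \<le> enorm d (grad f z) * edist d x z + H * (edist d x z)\<^sup>2"
      by (simp add: s0 s1 r_def)
  qed
qed

lemma smooth_continuous: "smooth d f \<Longrightarrow> continuous_on (eucl d) f"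
  unfolding smooth_def Ck_on_def by (metis bot.extremum foldr.simps(1) id_apply le_zero_eq list.set(1) list.size(3))

lemma grad_norm_continuous: "smooth d f \<Longrightarrow> continuous_on (eucl d) (\<lambda>x. enorm d (grad f x))"
  unfolding enorm_def L2_set_def grad_def
  by (intro continuous_intros Ck_on_partial(1)[of d]) (auto simp: smooth_def)

section \<open>Perturbed log-concave measures\<close>

lemma borel_eucl [measurable]: "eucl d \<in> sets borel"
proof -
  have "eucl d = (\<Inter>i\<in>{d..}. {x. x i = undefined})"
  proof (intro set_eqI iffI)
    fix x :: "nat \<Rightarrow> real" assume "x \<in> (\<Inter>i\<in>{d..}. {x. x i = undefined})"
    then have "x i = undefined" if "d \<le> i" for i using that by blast
    then show "x \<in> eucl d" by (simp add: eucl_def PiE_def extensional_def)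
  qed (auto simp: eucl_undefined)
  moreover have "closed (\<Inter>i\<in>{d..}. {x :: nat \<Rightarrow> real. x i = undefined})"
    by (intro closed_INT ballI closed_Collect_eq[OF continuous_on_product_coordinates continuous_on_const])
  ultimately show ?thesis by (simp add: borel_closed)
qed

lemma core_borel: "core d C \<in> sets borel"
proof -
  obtain U where U: "open U" "core d C = U \<inter> eucl d" using core_open by metis
  then show ?thesis by (simp add: borel_open sets.Int)
qed

lemma continuous_on_core_measurable:
  fixes v :: "(nat \<Rightarrow> real) \<Rightarrow> real"
  assumes "continuous_on (core d C) v"
  shows "(\<lambda>x. indicator (core d C) x * v x) \<in> borel_measurable (leb d)"
proof -
  have "(\<lambda>x. indicator (core d C) x *\<^sub>R v x) \<in> borel_measurable borel"
    by (rule borel_measurable_continuous_on_indicator[OF core_borel assms])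
  from measurable_compose[OF measurable_leb_id this] show ?thesis by simp
qed

lemma continuous_on_edist: "continuous_on A (\<lambda>y. edist d y z)"
  unfolding edist_def enorm_def L2_set_def
  by (intro continuous_intros continuous_on_product_coordinates[THEN continuous_on_subset]) auto

lemma lipschitz_continuous_eucl:
  fixes g :: "(nat \<Rightarrow> real) \<Rightarrow> real"
  assumes "\<And>x z. x \<in> eucl d \<Longrightarrow> z \<in> eucl d \<Longrightarrow> \<bar>g x - g z\<bar> \<le> L * edist d x z"
  shows "continuous_on (eucl d) g"
  unfolding continuous_on_def
proof
  fix z assume z: "z \<in> eucl d"
  have "((\<lambda>y. L * edist d y z) \<longlongrightarrow> L * edist d z z) (at z within eucl d)"
    using continuous_on_edist[of "eucl d" d z] z by (intro tendsto_intros) (auto simp: continuous_on_def)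
  moreover have "edist d z z = 0" by (simp add: edist_def enorm_def L2_set_def)
  ultimately have lim: "((\<lambda>y. L * edist d y z) \<longlongrightarrow> 0) (at z within eucl d)" by simp
  have "\<forall>\<^sub>F y in at z within eucl d. norm (g y - g z) \<le> L * edist d y z"
    unfolding eventually_at_topological using assms z by auto
  from Lim_null_comparison[OF this lim] show "(g \<longlongrightarrow> g z) (at z within eucl d)"
    by (rule LIM_zero_cancel)
qed

text \<open>The infimal convolution is Lipschitz and, since r powr \<beta> is at most 1 + r, it stays within
  a distance of the Hoelder function that does not depend on the dimension.\<close>

lemma holder_lipschitz_approximation:
  fixes a :: "(nat \<Rightarrow> real) \<Rightarrow> real"
  assumes K: "0 \<le> K" and \<beta>: "0 < \<beta>" "\<beta> \<le> 1"
    and a: "\<And>x y. x \<in> eucl d \<Longrightarrow> y \<in> eucl d \<Longrightarrow> \<bar>a x - a y\<bar> \<le> K * edist d x y powr \<beta>"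
  obtains b where "\<And>x z. x \<in> eucl d \<Longrightarrow> z \<in> eucl d \<Longrightarrow> \<bar>b x - b z\<bar> \<le> K * edist d x z"
    "\<And>x. x \<in> eucl d \<Longrightarrow> b x \<le> a x" "\<And>x. x \<in> eucl d \<Longrightarrow> a x \<le> b x + K"
proof -
  have pw: "s powr \<beta> \<le> 1 + s" if "0 \<le> s" for s
  proof (cases "s \<le> 1")
    case True
    then have "s powr \<beta> \<le> 1 powr \<beta>" using that \<beta> by (intro powr_mono2) auto
    then show ?thesis using that by simp
  next
    case False
    then have "s powr \<beta> \<le> s powr 1" using \<beta> by (intro powr_mono) auto
    then show ?thesis using False by simp
  qed
  define b where "b x = (INF y\<in>eucl d. a y + K * edist d x y)" for x
  have lower: "a x - K \<le> a y + K * edist d x y" if "x \<in> eucl d" "y \<in> eucl d" for x y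
  proof -
    have "a x - a y \<le> K * edist d x y powr \<beta>" using a[OF that] by simp
    also have "\<dots> \<le> K * (1 + edist d x y)" using K by (intro mult_left_mono pw edist_nonneg)
    finally show ?thesis by (simp add: algebra_simps)
  qed
  have ne: "eucl d \<noteq> {}" using cmb_in_eucl by blast
  have bdd: "bdd_below ((\<lambda>y. a y + K * edist d x y) ` eucl d)" if "x \<in> eucl d" for x
    using lower[OF that] by (intro bdd_belowI2) auto
  have le: "b x \<le> a y + K * edist d x y" if "x \<in> eucl d" "y \<in> eucl d" for x y
    unfolding b_def using that by (intro cINF_lower bdd)
  have ge: "c \<le> b x" if "\<And>y. y \<in> eucl d \<Longrightarrow> c \<le> a y + K * edist d x y" for c x
    unfolding b_def using that ne by (intro cINF_greatest)
  have half: "b x - b z \<le> K * edist d x z" if "x \<in> eucl d" "z \<in> eucl d" for x z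
  proof -
    have "b x - K * edist d x z \<le> b z"
    proof (rule ge)
      fix y assume y: "y \<in> eucl d"
      have "K * edist d x y \<le> K * (edist d x z + edist d z y)" using K by (intro mult_left_mono edist_triangle)
      then show "b x - K * edist d x z \<le> a y + K * edist d z y" using le[OF that(1) y] by (simp add: algebra_simps)
    qed
    then show ?thesis by simp
  qed
  show ?thesis
  proof (rule that[of b])
    fix x assume x: "x \<in> eucl d"
    show "b x \<le> a x" using le[OF x x] by (simp add: edist_def enorm_def L2_set_def)
    show "a x \<le> b x + K" using ge[of "a x - K" x] lower[OF x] by simp
    fix z assume z: "z \<in> eucl d"
    show "\<bar>b x - b z\<bar> \<le> K * edist d x z" using half[OF x z] half[OF z x] edist_commute[of d x z] by (simp add: abs_le_iff)
  qed
qed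

text \<open>Prekopa-Leindler for exp (U - v), exp (V - v) and exp (W - v) on the convex set
  \<open>S\<close>, extended by 0. Strong convexity of \<open>v\<close> supplies the quadratic gain,
  and there is no linear term, so L = 0.\<close>

lemma displacement_density:
  fixes v :: "(nat \<Rightarrow> real) \<Rightarrow> real"
  assumes S: "S \<in> sets (leb d)" "cvx d S" "S \<subseteq> cube d R" and \<alpha>: "0 < \<alpha>"
    and sc: "\<And>x y t. x \<in> S \<Longrightarrow> y \<in> S \<Longrightarrow> 0 < t \<Longrightarrow> t < 1 \<Longrightarrow>
      v (cmb d t x y) + \<alpha> / 2 * t * (1 - t) * (edist d x y)\<^sup>2 \<le> t * v x + (1 - t) * v y"
    and int: "integrable (restrict_space (leb d) S) (\<lambda>x. exp (- v x))"
    and Z: "Z = (\<integral>x. exp (- v x) \<partial>restrict_space (leb d) S)" "0 < Z"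
  shows "displacement (density (restrict_space (leb d) S) (\<lambda>x. ennreal (exp (- v x) / Z))) (edist d) (real d * (2 * R)) (cmb d) \<alpha> 0"
proof -
  let ?L = "restrict_space (leb d) S"
  let ?M = "density ?L (\<lambda>x. ennreal (exp (- v x) / Z))"
  have Se: "S \<subseteq> eucl d" using S by (auto simp: cvx_def)
  have Sint: "S \<inter> space (leb d) \<in> sets (leb d)" using S by auto
  have spL: "space ?L = S" using Se by (simp add: space_restrict_space space_leb Int_absorb2)
  have vm[measurable]: "(\<lambda>x. exp (- v x)) \<in> borel_measurable ?L" using int by auto
  have "prob_space ?M"
  proof
    have "emeasure ?M (space ?M) = (\<integral>\<^sup>+x. ennreal (exp (- v x) / Z) \<partial>?L)"
      by (simp add: emeasure_density cong: nn_integral_cong)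
    also have "\<dots> = ennreal (\<integral>x. exp (- v x) / Z \<partial>?L)"
      using int Z(2) by (intro nn_integral_eq_integral) auto
    also have "(\<integral>x. exp (- v x) / Z \<partial>?L) = 1" using Z by simp
    finally show "emeasure ?M (space ?M) = 1" by simp
  qed
  then interpret prob_space ?M .
  have EM: "integral\<^sup>L ?M F = (\<integral>x. indicator S x * (exp (- v x) * F x) \<partial>leb d) / Z"
    if [measurable]: "F \<in> borel_measurable ?L" for F
  proof -
    have "integral\<^sup>L ?M F = (\<integral>x. exp (- v x) / Z * F x \<partial>?L)"
      using Z(2) by (intro integral_real_density) auto
    also have "\<dots> = (\<integral>x. exp (- v x) * F x \<partial>?L) / Z" by simp
    also have "(\<integral>x. exp (- v x) * F x \<partial>?L) = (\<integral>x. indicator S x * (exp (- v x) * F x) \<partial>leb d)"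
      by (subst integral_restrict_space[OF Sint]) simp
    finally show ?thesis .
  qed
  show ?thesis
  proof
    fix x y assume "x \<in> space ?M" "y \<in> space ?M"
    then have xy: "x \<in> S" "y \<in> S" by (auto simp: spL)
    show "0 \<le> edist d x y" by (rule edist_nonneg)
    show "edist d x y \<le> real d * (2 * R)" using xy S by (intro edist_cube) auto
    fix t :: real assume t: "0 < t" "t < 1"
    show "cmb d t x y \<in> space ?M" using xy t S by (simp add: spL cvx_def)
    show "edist d x (cmb d t x y) = (1 - t) * edist d x y" using t by (intro edist_cmb_left) auto
    show "edist d y (cmb d t x y) = t * edist d x y" using t by (intro edist_cmb_right) auto
  next
    fix t U V W
    assume t: "0 < (t::real)" "t < 1" and UVW: "bfun ?M U" "bfun ?M V" "bfun ?M W"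
      and le: "\<And>x y. x \<in> space ?M \<Longrightarrow> y \<in> space ?M \<Longrightarrow> t * U x + (1 - t) * V y + 2 * 0 * t * (1 - t) * edist d x y
         \<le> W (cmb d t x y) + \<alpha> / 2 * t * (1 - t) * (edist d x y)\<^sup>2"
    have mL: "F \<in> borel_measurable ?L" if "bfun ?M F" for F using bfun_meas[OF that] by simp
    let ?w = "\<lambda>F x. indicator S x * (exp (- v x) * exp (F x)) :: real"
    have wint: "integrable (leb d) (?w F)" if F: "bfun ?M F" for F
    proof -
      obtain B where B: "\<And>x. x \<in> S \<Longrightarrow> \<bar>F x\<bar> \<le> B" using bfun_bound[OF F] by (auto simp: spL)
      have Fm[measurable]: "F \<in> borel_measurable ?L" by (rule mL[OF F])
      have "integrable ?L (\<lambda>x. exp (- v x) * exp (F x))"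
      proof (rule Bochner_Integration.integrable_bound[where f = "\<lambda>x. exp B * exp (- v x)"])
        show "integrable ?L (\<lambda>x. exp B * exp (- v x))" using int by simp
        show "(\<lambda>x. exp (- v x) * exp (F x)) \<in> borel_measurable ?L" by measurable
        show "AE x in ?L. norm (exp (- v x) * exp (F x)) \<le> norm (exp B * exp (- v x))"
        proof (rule AE_I2)
          fix x assume "x \<in> space ?L"
          then have "F x \<le> B" using B[of x] by (simp add: spL)
          then show "norm (exp (- v x) * exp (F x)) \<le> norm (exp B * exp (- v x))" by (simp add: mult.commute)
        qed
      qed
      then show ?thesis using integrable_restrict_space[OF Sint, of "\<lambda>x. exp (- v x) * exp (F x)"] by simp
    qed
    have "(\<integral>x. ?w U x \<partial>leb d) powr t * (\<integral>x. ?w V x \<partial>leb d) powr (1 - t) \<le> (\<integral>x. ?w W x \<partial>leb d)"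
    proof (rule prekopa_leindler[OF wint[OF UVW(1)] wint[OF UVW(2)] wint[OF UVW(3)] _ _ _ t])
      fix x y
      show "?w U x powr t * ?w V y powr (1 - t) \<le> ?w W (cmb d t x y)"
      proof (cases "x \<in> S \<and> y \<in> S")
        case True
        then have xy: "x \<in> S" "y \<in> S" by auto
        have z: "cmb d t x y \<in> S" using xy t S by (simp add: cvx_def)
        have "?w U x powr t * ?w V y powr (1 - t) = exp (t * (U x - v x) + (1 - t) * (V y - v y))"
          using xy by (simp add: powr_def exp_add[symmetric])
        also have "\<dots> \<le> exp (W (cmb d t x y) - v (cmb d t x y))"
          using le[of x y] sc[OF xy t] xy by (simp add: spL algebra_simps)
        also have "\<dots> = ?w W (cmb d t x y)" using z by (simp add: exp_add[symmetric])
        finally show ?thesis .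
      next
        case False
        then have "?w U x powr t * ?w V y powr (1 - t) = 0" by auto
        moreover have "0 \<le> ?w W (cmb d t x y)" by simp
        ultimately show ?thesis by linarith
      qed
    qed auto
    moreover have "0 \<le> (\<integral>x. ?w F x \<partial>leb d)" for F by (intro integral_nonneg_AE) auto
    moreover have "Z powr t * Z powr (1 - t) = Z" using Z(2) by (simp flip: powr_add)
    moreover have E: "integral\<^sup>L ?M (\<lambda>x. exp (F x)) = (\<integral>x. ?w F x \<partial>leb d) / Z" if "bfun ?M F" for F
    proof (rule EM)
      have [measurable]: "F \<in> borel_measurable ?L" by (rule mL[OF that])
      show "(\<lambda>x. exp (F x)) \<in> borel_measurable ?L" by measurable
    qed
    ultimately show "(integral\<^sup>L ?M (\<lambda>x. exp (U x))) powr t * (integral\<^sup>L ?M (\<lambda>x. exp (V x))) powr (1 - t)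
        \<le> integral\<^sup>L ?M (\<lambda>x. exp (W x))"
      unfolding E[OF UVW(1)] E[OF UVW(2)] E[OF UVW(3)] using Z(2)
      by (simp add: powr_divide divide_right_mono)
  qed (use \<alpha> in auto)
qed

text \<open>exp K is the price of comparing \<open>p\<close> with exp (- v + b). The other factor is
  A + 2 CP (D + 2) from \<open>phi_entropy_inequality\<close> with A = 4 / \<alpha> and D = 4 K^2 /
  \<alpha>. K occurs in two roles, as bound for the remainder and as Lipschitz constant of
  \<open>b\<close>.\<close>

definition phi_const :: "real \<Rightarrow> real \<Rightarrow> real" where
  "phi_const \<alpha> K = exp K * (4 / \<alpha> + 2 * poincare_const \<alpha> K * (4 * K\<^sup>2 / \<alpha> + 2))"

lemma phi_const_pos: "0 < \<alpha> \<Longrightarrow> 0 < phi_const \<alpha> K"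
  using poincare_const_pos[of \<alpha> K] by (simp add: phi_const_def add_pos_nonneg)

text \<open>In the application \<open>Om\<close> is the interior of the set where \<open>p\<close>
  is positive, \<open>v\<close> the regular convex potential there and \<open>b\<close> the
  Lipschitz part of the perturbation. The bounded remainder survives only in the two-sided estimate
  of \<open>p\<close>.\<close>

locale perturbed_log_concave =
  fixes d :: nat and p :: "(nat \<Rightarrow> real) \<Rightarrow> real" and Om v b \<alpha> K
  assumes \<alpha>: "0 < \<alpha>" and K: "0 \<le> K"
    and p_meas [measurable]: "p \<in> borel_measurable (leb d)" and p_nonneg: "\<And>x. x \<in> eucl d \<Longrightarrow> 0 \<le> p x"
    and p_one: "(\<integral>\<^sup>+x. ennreal (p x) \<partial>leb d) = 1"
    and Om: "Om \<in> sets (leb d)" "cvx d Om"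
    and v_meas: "(\<lambda>x. indicator Om x * v x) \<in> borel_measurable (leb d)"
    and v_sc: "\<And>x y t. x \<in> Om \<Longrightarrow> y \<in> Om \<Longrightarrow> 0 < t \<Longrightarrow> t < 1 \<Longrightarrow>
      v (cmb d t x y) + \<alpha> / 2 * t * (1 - t) * (edist d x y)\<^sup>2 \<le> t * v x + (1 - t) * v y"
    and b_lip: "\<And>x z. x \<in> eucl d \<Longrightarrow> z \<in> eucl d \<Longrightarrow> \<bar>b x - b z\<bar> \<le> K * edist d x z"
    and p_ge: "\<And>x. x \<in> Om \<Longrightarrow> exp (- v x + b x) \<le> p x"
    and p_le: "\<And>x. x \<in> Om \<Longrightarrow> p x \<le> exp K * exp (- v x + b x)"
    and p_out: "AE x in leb d. x \<notin> Om \<longrightarrow> p x = 0"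
begin

abbreviation "P \<equiv> dmeasure d p"

lemma prob_space_P: "prob_space P"
proof
  show "emeasure P (space P) = 1"
    using p_one by (simp add: dmeasure_def emeasure_density cong: nn_integral_cong)
qed

sublocale P: prob_space P by (rule prob_space_P)

lemma space_P [simp]: "space P = eucl d" and sets_P [measurable_cong, simp]: "sets P = sets (leb d)"
  by (simp_all add: dmeasure_def space_leb)

lemma p_integrable: "integrable (leb d) p"
proof (rule integrableI_bounded)
  have "(\<integral>\<^sup>+x. ennreal (norm (p x)) \<partial>leb d) = (\<integral>\<^sup>+x. ennreal (p x) \<partial>leb d)"
    using p_nonneg by (intro nn_integral_cong) (auto simp: space_leb)
  then show "(\<integral>\<^sup>+x. ennreal (norm (p x)) \<partial>leb d) < \<infinity>" using p_one by simp
qed (rule p_meas)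

lemma integral_P: "F \<in> borel_measurable (leb d) \<Longrightarrow> integral\<^sup>L P F = (\<integral>x. p x * F x \<partial>leb d)"
  unfolding dmeasure_def using p_nonneg by (intro integral_real_density) (auto simp: space_leb)

lemma b_measurable: "b \<in> borel_measurable (leb d)"
  by (rule borel_measurable_continuous_on_eucl[OF lipschitz_continuous_eucl[OF b_lip]])

lemma integral_P_restrict:
  assumes F[measurable]: "F \<in> borel_measurable (leb d)" and Q[measurable]: "Q \<in> sets (leb d)"
  shows "(\<integral>x. indicator Q x * F x \<partial>P) = (\<integral>x. p x * F x \<partial>restrict_space (leb d) (Om \<inter> Q))"
proof -
  have s: "(Om \<inter> Q) \<inter> space (leb d) \<in> sets (leb d)" using Om Q by auto
  have "(\<integral>x. indicator Q x * F x \<partial>P) = (\<integral>x. p x * (indicator Q x * F x) \<partial>leb d)"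
    by (rule integral_P) measurable
  also have "\<dots> = (\<integral>x. indicator (Om \<inter> Q) x *\<^sub>R (p x * F x) \<partial>leb d)"
  proof (rule integral_cong_AE)
    show "AE x in leb d. p x * (indicator Q x * F x) = indicator (Om \<inter> Q) x *\<^sub>R (p x * F x)"
      using p_out by eventually_elim (auto simp: indicator_def)
    show "(\<lambda>x. indicator (Om \<inter> Q) x *\<^sub>R (p x * F x)) \<in> borel_measurable (leb d)" using Om Q by measurable
    show "(\<lambda>x. p x * (indicator Q x * F x)) \<in> borel_measurable (leb d)" using Om Q by measurable
  qed
  also have "\<dots> = (\<integral>x. p x * F x \<partial>restrict_space (leb d) (Om \<inter> Q))"
    by (rule integral_restrict_space[OF s, symmetric])
  finally show ?thesis .
qed

text \<open>Bregman divergence and energy are both nonnegative, so \<open>p\<close> can be exchanged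
  for exp (- v + b) under both integrals at the cost of a single factor exp K. The centre
  \<open>m\<close> is the mean under the comparison measure, not under \<open>P\<close>; it stays
  existential here and is replaced in \<open>cube_entropy_interval\<close>.\<close>

lemma cube_phi_entropy:
  fixes \<Psi> \<Psi>' k :: "real \<Rightarrow> real"
  assumes pos: "0 < measure P (cube d R)"
    and kp: "\<And>s. s \<in> {s0..s1} \<Longrightarrow> 0 < k s" and kc: "continuous_on {s0..s1} k"
    and conc: "convex_on {s0..s1} (\<lambda>s. - (1 / k s))"
    and d1: "\<And>s. s \<in> {s0<..<s1} \<Longrightarrow> (\<Psi> has_real_derivative \<Psi>' s) (at s)"
    and d2: "\<And>s. s \<in> {s0<..<s1} \<Longrightarrow> (\<Psi>' has_real_derivative k s) (at s)"
    and f[measurable]: "f \<in> borel_measurable (leb d)" and G[measurable]: "G \<in> borel_measurable (leb d)"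
    and Gb: "\<And>x. x \<in> cube d R \<Longrightarrow> \<bar>G x\<bar> \<le> B"
    and sl: "slope (cube d R) (edist d) f G"
    and lh: "s0 < lo" "hi < s1" and rng: "\<And>x. x \<in> cube d R \<Longrightarrow> f x \<in> {lo..hi}"
    and \<Psi>f[measurable]: "(\<lambda>x. \<Psi> (f x)) \<in> borel_measurable (leb d)"
    and kf[measurable]: "(\<lambda>x. k (f x)) \<in> borel_measurable (leb d)"
  shows "\<exists>m\<in>{lo..hi}. (\<integral>x. indicator (cube d R) x * (\<Psi> (f x) - \<Psi> m - \<Psi>' m * (f x - m)) \<partial>P)
     \<le> phi_const \<alpha> K * (\<integral>x. indicator (cube d R) x * (k (f x) * (G x)\<^sup>2) \<partial>P)"
proof -
  define S where "S = Om \<inter> cube d R"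
  let ?L = "restrict_space (leb d) S"
  have S: "S \<in> sets (leb d)" "cvx d S" "S \<subseteq> cube d R" "S \<subseteq> Om" "S \<subseteq> eucl d"
    using Om sets_cube cvx_cube cube_subset by (auto simp: S_def cvx_def)
  have Sint: "S \<inter> space (leb d) \<in> sets (leb d)" using S by auto
  have spL: "space ?L = S" using S(5) by (simp add: space_restrict_space space_leb Int_absorb2)
  have mL: "F \<in> borel_measurable ?L" if "F \<in> borel_measurable (leb d)" for F :: "_ \<Rightarrow> real"
    using that by (rule measurable_restrict_space1)
  have pL[measurable]: "p \<in> borel_measurable ?L" and bL[measurable]: "b \<in> borel_measurable ?L"
    by (rule mL[OF p_meas], rule mL[OF b_measurable])
  have vL[measurable]: "v \<in> borel_measurable ?L"
  proof -
    have "(\<lambda>x. indicator Om x * v x) \<in> borel_measurable ?L" by (rule mL[OF v_meas])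
    then show ?thesis by (rule subst[OF measurable_cong, rotated]) (use S in \<open>auto simp: spL\<close>)
  qed
  have pint: "integrable ?L p"
    using integrable_mult_indicator[OF S(1) p_integrable] by (simp add: integrable_restrict_space[OF Sint])
  have "S \<noteq> {}"
  proof
    assume "S = {}"
    have "(\<integral>x. indicator (cube d R) x * 1 \<partial>P) = (\<integral>x. p x * 1 \<partial>?L)"
      unfolding S_def by (rule integral_P_restrict) auto
    also have "\<dots> = 0" unfolding \<open>S = {}\<close> by (subst integral_restrict_space) auto
    finally show False using pos cube_subset[of d R] by (simp add: Int_absorb2)
  qed
  then obtain x0 where o: "x0 \<in> S" by blast
  define B where "B = \<bar>b x0\<bar> + K * (real d * (2 * R))"
  have bB: "\<bar>b x\<bar> \<le> B" if "x \<in> S" for x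
  proof -
    have "\<bar>b x - b x0\<bar> \<le> K * edist d x x0" using S that o by (intro b_lip) auto
    also have "\<dots> \<le> K * (real d * (2 * R))" using K S that o by (intro mult_left_mono edist_cube) auto
    finally show ?thesis by (simp add: B_def)
  qed
  have vint: "integrable ?L (\<lambda>x. exp (- v x))"
  proof (rule Bochner_Integration.integrable_bound[where f = "\<lambda>x. exp B * p x"])
    show "integrable ?L (\<lambda>x. exp B * p x)" using pint by simp
    show "AE x in ?L. norm (exp (- v x)) \<le> norm (exp B * p x)"
    proof (rule AE_I2)
      fix x assume "x \<in> space ?L"
      then have x: "x \<in> S" by (simp add: spL)
      have "exp (- v x) = exp (- b x) * exp (- v x + b x)" by (simp flip: exp_add)
      also have "\<dots> \<le> exp B * p x" using bB[OF x] p_ge[of x] x S by (intro mult_mono) auto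
      finally show "norm (exp (- v x)) \<le> norm (exp B * p x)" by simp
    qed
  qed measurable
  define Z where "Z = (\<integral>x. exp (- v x) \<partial>?L)"
  have Zpos: "0 < Z"
  proof -
    have "measure P (cube d R) = (\<integral>x. indicator (cube d R) x * 1 \<partial>P)"
      using cube_subset[of d R] by (simp add: Int_absorb2)
    also have "\<dots> = (\<integral>x. p x * 1 \<partial>?L)"
      unfolding S_def by (rule integral_P_restrict) auto
    also have "\<dots> \<le> (\<integral>x. exp (K + B) * exp (- v x) \<partial>?L)"
    proof (rule integral_mono)
      fix x assume "x \<in> space ?L"
      then have x: "x \<in> S" by (simp add: spL)
      have "p x \<le> exp K * exp (- v x + b x)" using x S by (intro p_le) auto
      also have "\<dots> \<le> exp (K + B) * exp (- v x)" using bB[OF x] by (simp flip: exp_add)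
      finally show "p x * 1 \<le> exp (K + B) * exp (- v x)" by simp
    qed (use pint vint in auto)
    also have "\<dots> = exp (K + B) * Z" by (simp add: Z_def)
    finally have "0 < exp (K + B) * Z" using pos by linarith
    then show ?thesis by (simp add: zero_less_mult_iff)
  qed
  define M where "M = density ?L (\<lambda>x. ennreal (exp (- v x) / Z))"
  interpret M: displacement M "edist d" "real d * (2 * R)" "cmb d" \<alpha> 0
    unfolding M_def
    by (rule displacement_density[OF S(1,2,3) \<alpha> v_sc vint Z_def Zpos]) (use S(4) in blast)+
  have spM: "space M = S" by (simp add: M_def spL)
  have bfM: "bfun M F \<longleftrightarrow> bfun ?L F" for F by (simp add: bfun_def M_def)
  have bb: "bfun M b" unfolding bfM using bB by (intro bfunI[of _ _ B]) (auto simp: spL)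
  define c where "c = M.E (\<lambda>x. exp (b x))"
  have c: "0 < c" unfolding c_def by (rule M.E_exp_pos[OF bb])
  \<comment> \<open>Subtracting ln c makes exp b' a probability density, the normalization under
    which \<open>tilt\<close> and \<open>tilted_poincare\<close> are stated.\<close>
  define b' where "b' x = b x - ln c" for x
  have bb': "bfun M b'" unfolding b'_def using bb by auto
  have one: "M.E (\<lambda>x. exp (b' x)) = 1" using c by (simp add: b'_def exp_diff c_def)
  have lip': "\<bar>b' x - b' z\<bar> \<le> K * edist d x z" if "x \<in> space M" "z \<in> space M" for x z
    using that S b_lip[of x z] by (auto simp: b'_def spM)
  define N where "N = density M (\<lambda>x. ennreal (exp (b' x)))"
  interpret N: displacement N "edist d" "real d * (2 * R)" "cmb d" \<alpha> K
    unfolding N_def by (rule M.tilt[OF refl bb' K lip' one])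
  have spN: "space N = S" by (simp add: N_def spM)
  have bfN: "bfun N F \<longleftrightarrow> bfun ?L F" for F by (simp add: bfun_def N_def M_def)
  interpret F: functional_ineq N "edist d" "real d * (2 * R)" "4 / \<alpha>" "4 * K\<^sup>2 / \<alpha>" "poincare_const \<alpha> K"
  proof
    show "0 \<le> 4 / \<alpha>" "0 \<le> 4 * K\<^sup>2 / \<alpha>" "0 \<le> poincare_const \<alpha> K"
      using \<alpha> poincare_const_pos[OF \<alpha>, of K] by auto
    fix f G assume f: "bfun N f" "bfun N G" "N.sl f G"
    show "N.E (\<lambda>x. (f x - N.E f)\<^sup>2) \<le> poincare_const \<alpha> K * N.E (\<lambda>x. (G x)\<^sup>2)"
      unfolding N_def
      by (rule M.tilted_poincare[OF refl bb' K lip' one]) (use f in \<open>auto simp: bfN bfM spN spM\<close>)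
    fix Y assume "bfun N Y" "\<And>x. x \<in> space N \<Longrightarrow> 1 \<le> Y x"
    then show "N.E (\<lambda>x. (f x)\<^sup>2 * ln (Y x)) \<le> 4 / \<alpha> * N.E (\<lambda>x. (G x)\<^sup>2)
        + (4 * K\<^sup>2 / \<alpha> + ln (N.E Y)) * N.E (\<lambda>x. (f x)\<^sup>2)"
      by (intro N.lsi_dual f)
  qed
  have EN: "N.E F = (\<integral>x. exp (- v x + b x) * F x \<partial>?L) / (Z * c)" if F: "bfun ?L F" for F
  proof -
    have [measurable]: "F \<in> borel_measurable ?L" by (rule bfun_meas[OF F])
    have "N.E F = M.E (\<lambda>x. exp (b' x) * F x)" unfolding N_def by (rule M.tilted_E[OF bb']) (simp add: bfM F)
    also have "\<dots> = (\<integral>x. exp (- v x) / Z * (exp (b' x) * F x) \<partial>?L)"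
      unfolding M_def b'_def using Zpos by (intro integral_real_density) auto
    also have "\<dots> = (\<integral>x. (exp (- v x + b x) * F x) / (Z * c) \<partial>?L)"
    proof (intro Bochner_Integration.integral_cong refl)
      fix x
      have "exp (b' x) = exp (b x) / c" using c by (simp add: b'_def exp_diff)
      then show "exp (- v x) / Z * (exp (b' x) * F x) = (exp (- v x + b x) * F x) / (Z * c)"
        by (simp only: exp_add) simp
    qed
    finally show ?thesis by simp
  qed
  have bp: "integrable ?L (\<lambda>x. p x * F x)" "integrable ?L (\<lambda>x. exp (- v x + b x) * F x)" if F: "bfun ?L F" for F
  proof -
    have Fm[measurable]: "F \<in> borel_measurable ?L" by (rule bfun_meas[OF F])
    obtain C where C: "0 < C" "\<And>x. x \<in> space ?L \<Longrightarrow> \<bar>F x\<bar> \<le> C" using bfun_bound[OF F] by metis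
    have i: "integrable ?L (\<lambda>x. C * p x)" using pint by simp
    have pn: "0 \<le> p x" if "x \<in> space ?L" for x using that S p_nonneg by (auto simp: spL)
    have 1: "norm (p x * F x) \<le> norm (C * p x)" if "x \<in> space ?L" for x
    proof -
      have "p x * \<bar>F x\<bar> \<le> p x * C" using C(2)[OF that] pn[OF that] by (intro mult_left_mono)
      then show ?thesis using pn[OF that] C(1) by (simp add: abs_mult mult.commute[of C])
    qed
    have 2: "norm (exp (- v x + b x) * F x) \<le> norm (C * p x)" if "x \<in> space ?L" for x
    proof -
      have "exp (- v x + b x) * \<bar>F x\<bar> \<le> p x * C"
        using C that p_ge[of x] S pn[OF that] by (intro mult_mono) (auto simp: spL)
      then show ?thesis using pn[OF that] C(1) by (simp add: abs_mult mult.commute[of C])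
    qed
    show "integrable ?L (\<lambda>x. p x * F x)" by (rule Bochner_Integration.integrable_bound[OF i]) (use 1 in auto)
    show "integrable ?L (\<lambda>x. exp (- v x + b x) * F x)" by (rule Bochner_Integration.integrable_bound[OF i]) (use 2 in auto)
  qed
  have rS: "f x \<in> {lo..hi}" if "x \<in> S" for x using rng that S by auto
  have lohi: "lo \<le> hi" using rS[OF o] by simp
  have bf: "bfun ?L f" using rS by (intro bfunI[of _ _ "\<bar>lo\<bar> + \<bar>hi\<bar>"] mL f) (force simp: spL)
  have bG: "bfun ?L G" using Gb S by (intro bfunI mL G) (auto simp: spL)
  have slN: "N.sl f G" using sl S unfolding slope_def spN by blast
  define m where "m = N.E f"
  have m: "m \<in> {lo..hi}" unfolding m_def by (rule F.E_range) (use bf rS in \<open>auto simp: bfN spN\<close>)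
  let ?B = "\<lambda>x. \<Psi> (f x) - \<Psi> m - \<Psi>' m * (f x - m)"
  let ?J = "\<lambda>x. k (f x) * (G x)\<^sup>2"
  have C0: "N.E ?B \<le> (4 / \<alpha> + 2 * poincare_const \<alpha> K * (4 * K\<^sup>2 / \<alpha> + 2)) * N.E ?J" (is "_ \<le> ?C * _")
    unfolding m_def
    by (rule F.phi_entropy_inequality[OF kp kc conc d1 d2 _ _ slN lh]) (use bf bG rS in \<open>auto simp: bfN spN\<close>)
  have subI: "{lo..hi} \<subseteq> {s0<..<s1}" "{lo..hi} \<subseteq> {s0..s1}" using lh by auto
  have bPsi: "bfun ?L (\<lambda>x. \<Psi> (f x))"
  proof (rule bfun_comp_cont[OF bf])
    show "continuous_on {lo..hi} \<Psi>" using d1 subI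
      by (intro continuous_at_imp_continuous_on ballI DERIV_isCont) blast
  qed (use rS in \<open>auto simp: spL\<close>)
  have bk: "bfun ?L (\<lambda>x. k (f x))"
    by (rule bfun_comp_cont[OF bf continuous_on_subset[OF kc subI(2)]]) (use rS in \<open>auto simp: spL\<close>)
  have bB: "bfun ?L ?B" using bPsi bf by (intro bfun_diff bfun_mult bfun_const)
  have bJ: "bfun ?L ?J" using bk bG by (intro bfun_mult bfun_power)
  have "convex_on {s0<..<s1} \<Psi>"
    by (rule f''_ge0_imp_convex[OF _ d1 d2]) (use kp in \<open>auto simp: less_imp_le\<close>)
  then have Bn: "0 \<le> ?B x" if "x \<in> S" for x
    using convex_on_imp_above_tangent[of "{s0<..<s1}" \<Psi> m "f x" "\<Psi>' m"] rS[OF that] m subI d1[of m]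
    by (auto simp: has_field_derivative_at_within interior_open subset_eq)
  have Jn: "0 \<le> ?J x" if "x \<in> S" for x using rS[OF that] subI kp[of "f x"] by (auto simp: subset_eq)
  have Cn: "0 \<le> ?C" using \<alpha> poincare_const_pos[OF \<alpha>, of K] by simp
  have "(\<integral>x. indicator (cube d R) x * ?B x \<partial>P) = (\<integral>x. p x * ?B x \<partial>?L)"
    unfolding S_def by (rule integral_P_restrict) measurable
  also have "\<dots> \<le> (\<integral>x. exp K * (exp (- v x + b x) * ?B x) \<partial>?L)"
  proof (rule integral_mono)
    fix x assume "x \<in> space ?L"
    then have x: "x \<in> S" by (simp add: spL)
    have "p x * ?B x \<le> (exp K * exp (- v x + b x)) * ?B x"
      using x S Bn[OF x] by (intro mult_right_mono p_le) auto
    then show "p x * ?B x \<le> exp K * (exp (- v x + b x) * ?B x)" by (simp only: mult.assoc)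
  qed (use bp[OF bB] in auto)
  also have "\<dots> = exp K * (Z * c * N.E ?B)" using Zpos c by (simp add: EN[OF bB])
  also have "\<dots> \<le> exp K * (Z * c * (?C * N.E ?J))" using C0 Zpos c by (intro mult_left_mono) auto
  also have "\<dots> = exp K * ?C * (\<integral>x. exp (- v x + b x) * ?J x \<partial>?L)" using Zpos c by (simp add: EN[OF bJ])
  also have "\<dots> \<le> exp K * ?C * (\<integral>x. p x * ?J x \<partial>?L)"
  proof (rule mult_left_mono[OF integral_mono])
    fix x assume "x \<in> space ?L"
    then have x: "x \<in> S" by (simp add: spL)
    show "exp (- v x + b x) * ?J x \<le> p x * ?J x"
      using x S Jn[OF x] by (intro mult_right_mono p_ge) auto
  qed (use bp[OF bJ] Cn in auto)
  also have "(\<integral>x. p x * ?J x \<partial>?L) = (\<integral>x. indicator (cube d R) x * ?J x \<partial>P)"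
    unfolding S_def by (rule integral_P_restrict[symmetric]) measurable
  finally show ?thesis using m unfolding phi_const_def by blast
qed

end

section \<open>From cubes to the whole space\<close>

text \<open>The error constant may depend on the cube. Working with slopes instead of gradients
  admits f^2 with slope 2 |f| G on the same footing as a smooth f.\<close>

definition has_slope :: "nat \<Rightarrow> ((nat \<Rightarrow> real) \<Rightarrow> real) \<Rightarrow> ((nat \<Rightarrow> real) \<Rightarrow> real) \<Rightarrow> bool" where
  "has_slope d f G \<longleftrightarrow> continuous_on (eucl d) f \<and> continuous_on (eucl d) G \<and> (\<forall>R. slope (cube d R) (edist d) f G)"

lemma smooth_has_slope: "smooth d f \<Longrightarrow> has_slope d f (\<lambda>x. enorm d (grad f x))"
  by (simp add: has_slope_def smooth_continuous grad_norm_continuous smooth_slope)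

lemma has_slope_measurable:
  assumes "has_slope d f G"
  shows "f \<in> borel_measurable (leb d)" "G \<in> borel_measurable (leb d)"
  using assms by (auto simp: has_slope_def intro: borel_measurable_continuous_on_eucl)

text \<open>Expanding the square around \<open>z\<close>, the linear part has the coefficient 2 |f
  z| G z at first order; the squared increment, controlled by the Lipschitz constant
  \<open>D\<close> on the cube, joins the quadratic error.\<close>

lemma has_slope_square:
  assumes fG: "has_slope d f G" shows "has_slope d (\<lambda>x. (f x)\<^sup>2) (\<lambda>x. 2 * \<bar>f x\<bar> * G x)"
  unfolding has_slope_def
proof (intro conjI allI)
  have c: "continuous_on (eucl d) f" "continuous_on (eucl d) G" using fG by (auto simp: has_slope_def)
  show "continuous_on (eucl d) (\<lambda>x. (f x)\<^sup>2)" "continuous_on (eucl d) (\<lambda>x. 2 * \<bar>f x\<bar> * G x)"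
    by (intro continuous_intros c)+
  fix R
  obtain B where B: "0 < B" "\<And>x. x \<in> cube d R \<Longrightarrow> \<bar>f x\<bar> \<le> B" using bounded_on_cube[OF c(1)] by metis
  obtain C where C: "0 < C" "\<And>x. x \<in> cube d R \<Longrightarrow> \<bar>G x\<bar> \<le> C" using bounded_on_cube[OF c(2)] by metis
  have "slope (cube d R) (edist d) f G" using fG by (simp add: has_slope_def)
  then obtain H where H: "0 \<le> H" "\<And>x. x \<in> cube d R \<Longrightarrow> 0 \<le> G x"
    "\<And>x z. x \<in> cube d R \<Longrightarrow> z \<in> cube d R \<Longrightarrow> \<bar>f x - f z\<bar> \<le> G z * edist d x z + H * (edist d x z)\<^sup>2"
    using slopeE by metis
  define D where "D = C + H * (real d * (2 * \<bar>R\<bar>))"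
  have D: "0 \<le> D" using C H by (simp add: D_def)
  show "slope (cube d R) (edist d) (\<lambda>x. (f x)\<^sup>2) (\<lambda>x. 2 * \<bar>f x\<bar> * G x)"
  proof (rule slopeI)
    show "0 \<le> 2 * B * H + D\<^sup>2" using B H by simp
    show "0 \<le> 2 * \<bar>f x\<bar> * G x" if "x \<in> cube d R" for x using H(2)[OF that] by simp
    fix x z assume xz: "x \<in> cube d R" "z \<in> cube d R"
    define r where "r = edist d x z"
    have r0: "0 \<le> r" by (simp add: r_def edist_nonneg)
    have "r \<le> real d * (2 * R)" unfolding r_def using xz by (rule edist_cube)
    also have "\<dots> \<le> real d * (2 * \<bar>R\<bar>)" by (intro mult_left_mono) auto
    finally have rd: "r \<le> real d * (2 * \<bar>R\<bar>)" .
    have fz: "\<bar>f x - f z\<bar> \<le> G z * r + H * r\<^sup>2" using H(3)[OF xz] by (simp add: r_def)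
    have "G z * r \<le> C * r" using C(2)[OF xz(2)] r0 by (intro mult_right_mono) auto
    moreover have "H * r\<^sup>2 \<le> H * (real d * (2 * \<bar>R\<bar>)) * r"
    proof -
      have "r * r \<le> real d * (2 * \<bar>R\<bar>) * r" using rd r0 by (rule mult_right_mono)
      from mult_left_mono[OF this H(1)] show ?thesis by (simp add: power2_eq_square mult.assoc)
    qed
    ultimately have "\<bar>f x - f z\<bar> \<le> D * r" using fz by (simp add: D_def algebra_simps)
    then have "\<bar>f x - f z\<bar>\<^sup>2 \<le> (D * r)\<^sup>2" by (intro power_mono) auto
    then have sq: "(f x - f z)\<^sup>2 \<le> D\<^sup>2 * r\<^sup>2" by (simp add: power_mult_distrib)
    have "(f x)\<^sup>2 - (f z)\<^sup>2 = 2 * f z * (f x - f z) + (f x - f z)\<^sup>2" by (simp add: power2_eq_square algebra_simps)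
    then have "\<bar>(f x)\<^sup>2 - (f z)\<^sup>2\<bar> \<le> \<bar>2 * f z * (f x - f z)\<bar> + (f x - f z)\<^sup>2"
      using abs_triangle_ineq[of "2 * f z * (f x - f z)" "(f x - f z)\<^sup>2"] by simp
    also have "\<bar>2 * f z * (f x - f z)\<bar> = 2 * \<bar>f z\<bar> * \<bar>f x - f z\<bar>" by (simp add: abs_mult)
    also have "\<dots> \<le> 2 * \<bar>f z\<bar> * (G z * r + H * r\<^sup>2)" using fz by (intro mult_left_mono) auto
    also have "\<dots> = 2 * \<bar>f z\<bar> * G z * r + 2 * \<bar>f z\<bar> * H * r\<^sup>2" by (simp add: algebra_simps)
    also have "2 * \<bar>f z\<bar> * H * r\<^sup>2 \<le> 2 * B * H * r\<^sup>2"
      using B(2)[OF xz(2)] H(1) by (intro mult_right_mono mult_left_mono) auto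
    finally show "\<bar>(f x)\<^sup>2 - (f z)\<^sup>2\<bar> \<le> 2 * \<bar>f z\<bar> * G z * edist d x z + (2 * B * H + D\<^sup>2) * (edist d x z)\<^sup>2"
      using sq unfolding r_def[symmetric] by (simp add: algebra_simps)
  qed
qed

lemma measurable_comp_closed:
  fixes \<phi> :: "real \<Rightarrow> real"
  assumes "continuous_on I \<phi>" "I \<in> sets borel" and f: "f \<in> borel_measurable M" and I: "\<And>x. x \<in> space M \<Longrightarrow> f x \<in> I"
  shows "(\<lambda>x. \<phi> (f x)) \<in> borel_measurable M"
proof -
  have "(\<lambda>s. indicator I s *\<^sub>R \<phi> s) \<in> borel_measurable borel"
    using assms by (intro borel_measurable_continuous_on_indicator)
  then have "(\<lambda>x. indicator I (f x) *\<^sub>R \<phi> (f x)) \<in> borel_measurable M" by (rule measurable_compose[OF f])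
  then show ?thesis by (rule subst[OF measurable_cong, rotated]) (use I in auto)
qed

lemma interval_shrink:
  fixes I :: "real set"
  assumes "convex I" "c \<in> interior I" "x \<in> I" "0 < t" "t \<le> 1"
  shows "(1 - t) * x + t * c \<in> interior I"
  using mem_interior_convex_shrink[OF assms] by (simp add: algebra_simps)

text \<open>Provides the room on both sides of the range that the strict inequalities in
  \<open>cube_phi_entropy\<close> ask for.\<close>

lemma open_interval_margin:
  fixes O1 :: "real set"
  assumes "open O1" "convex O1" "lo \<in> O1" "hi \<in> O1" "lo \<le> hi"
  obtains s0 s1 where "s0 < lo" "hi < s1" "{s0..s1} \<subseteq> O1"
proof -
  obtain e where e: "0 < e" "ball lo e \<subseteq> O1" using assms openE by blast
  obtain f where f: "0 < f" "ball hi f \<subseteq> O1" using assms openE by blast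
  have a: "lo - e / 2 \<in> O1" using e by (intro subsetD[OF e(2)]) (auto simp: dist_real_def)
  have b: "hi + f / 2 \<in> O1" using f by (intro subsetD[OF f(2)]) (auto simp: dist_real_def)
  have "is_interval O1" using assms(2) by (simp add: is_interval_convex_1)
  then have "{lo - e / 2..hi + f / 2} \<subseteq> O1"
    using mem_is_interval_1_I[OF _ a b] by auto
  with e(1) f(1) show ?thesis by (intro that[of "lo - e / 2" "hi + f / 2"]) simp_all
qed

context perturbed_log_concave
begin

lemma bounded_cube_integrable:
  fixes F :: "(nat \<Rightarrow> real) \<Rightarrow> real"
  assumes [measurable]: "F \<in> borel_measurable (leb d)" and B: "\<And>x. x \<in> cube d R \<Longrightarrow> \<bar>F x\<bar> \<le> B"
  shows "integrable P (\<lambda>x. indicator (cube d R) x * F x)"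
proof (rule P.integrable_const_bound[where B = "\<bar>B\<bar>"])
  show "AE x in P. norm (indicator (cube d R) x * F x) \<le> \<bar>B\<bar>"
    using B by (intro AE_I2) (auto simp: indicator_def intro: order_trans[OF _ abs_ge_self])
qed measurable

lemma cube_mono: "r \<le> s \<Longrightarrow> cube d r \<subseteq> cube d s"
  unfolding cube_def by (auto intro: order_trans)

lemma prob_cube: "(\<integral>x. indicator (cube d R) x \<partial>P) = measure P (cube d R)"
  using cube_subset[of d R] by (simp add: Int_absorb2)

lemma prob_cube_tendsto: "(\<lambda>n. measure P (cube d (real n))) \<longlonglongrightarrow> 1"
proof -
  have "incseq (\<lambda>n. cube d (real n))" by (auto simp: incseq_def cube_def intro: order_trans)
  moreover have U: "(\<Union>n. cube d (real n)) = eucl d"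
  proof
    show "eucl d \<subseteq> (\<Union>n. cube d (real n))"
    proof
      fix x assume x: "x \<in> eucl d"
      obtain n where n: "(\<Sum>i<d. \<bar>x i\<bar>) \<le> real n" using real_arch_simple by blast
      have "\<bar>x i\<bar> \<le> (\<Sum>i<d. \<bar>x i\<bar>)" if "i < d" for i using that by (intro member_le_sum) auto
      then show "x \<in> (\<Union>n. cube d (real n))" using x n by (auto simp: cube_def intro!: exI[of _ n] intro: order_trans)
    qed
  qed (use cube_subset in auto)
  moreover have "range (\<lambda>n. cube d (real n)) \<subseteq> sets P" by auto
  ultimately have "(\<lambda>n. measure P (cube d (real n))) \<longlonglongrightarrow> measure P (\<Union>n. cube d (real n))"
    by (intro P.finite_Lim_measure_incseq)
  then show ?thesis using P.prob_space by (simp add: U)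
qed

text \<open>f may reach end points of \<open>I\<close>, where \<Psi> is only continuous. Contracting
  f towards the interior point \<open>c0\<close> moves its range over the cube into a compact part
  of the interior. As the contraction parameter tends to 0, convexity of \<open>k\<close> controls
  the energies, and where f sits at an end point its slope is 0.\<close>

lemma cube_entropy_interval:
  fixes \<Psi> \<Psi>' k :: "real \<Rightarrow> real"
  assumes pos: "0 < measure P (cube d R)"
    and I: "closed I" "is_interval I" and c0: "c0 \<in> interior I"
    and cont: "continuous_on I \<Psi>"
    and d1: "\<And>s. s \<in> interior I \<Longrightarrow> (\<Psi> has_real_derivative \<Psi>' s) (at s)"
    and d2: "\<And>s. s \<in> interior I \<Longrightarrow> (\<Psi>' has_real_derivative k s) (at s)"
    and kp: "\<And>s. s \<in> interior I \<Longrightarrow> 0 < k s" and kconv: "convex_on (interior I) k"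
    and conc: "convex_on (interior I) (\<lambda>s. - (1 / k s))"
    and fG: "has_slope d f G" and fI: "\<And>x. x \<in> eucl d \<Longrightarrow> f x \<in> I"
    and G0: "\<And>x. x \<in> eucl d \<Longrightarrow> f x \<notin> interior I \<Longrightarrow> G x = 0"
    and J: "integrable P (\<lambda>x. k (f x) * (G x)\<^sup>2)"
  defines "m \<equiv> (\<integral>x. indicator (cube d R) x * f x \<partial>P) / measure P (cube d R)"
  shows "m \<in> I"
    and "(\<integral>x. indicator (cube d R) x * \<Psi> (f x) \<partial>P) - measure P (cube d R) * \<Psi> m
      \<le> phi_const \<alpha> K * (\<integral>x. k (f x) * (G x)\<^sup>2 \<partial>P)"
proof -
  let ?Q = "cube d R" let ?i = "\<lambda>x. indicator ?Q x :: real"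
  define q where "q = measure P ?Q"
  have q: "0 < q" using pos by (simp add: q_def)
  have cI: "convex I" using I by (simp add: is_interval_convex_1)
  have oI: "open (interior I)" "convex (interior I)" using cI by (auto intro: convex_interior)
  have kc: "continuous_on (interior I) k" using kconv oI by (intro convex_on_continuous)
  have fc: "continuous_on (eucl d) f" and Gc: "continuous_on (eucl d) G" using fG by (auto simp: has_slope_def)
  note [measurable] = has_slope_measurable[OF fG]
  have Qe: "?Q \<subseteq> eucl d" by (rule cube_subset)
  have Qne: "?Q \<noteq> {}" using pos by auto
  have fcQ: "continuous_on ?Q f" by (rule continuous_on_subset[OF fc Qe])
  obtain xl where xl: "xl \<in> ?Q" "\<And>x. x \<in> ?Q \<Longrightarrow> f xl \<le> f x"
    using continuous_attains_inf[OF compact_cube Qne fcQ] by blast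
  obtain xh where xh: "xh \<in> ?Q" "\<And>x. x \<in> ?Q \<Longrightarrow> f x \<le> f xh"
    using continuous_attains_sup[OF compact_cube Qne fcQ] by blast
  let ?lo = "f xl" and ?hi = "f xh"
  have lI: "?lo \<in> I" "?hi \<in> I" using fI xl(1) xh(1) Qe by auto
  obtain BG where BG: "\<And>x. x \<in> ?Q \<Longrightarrow> \<bar>G x\<bar> \<le> BG" using bounded_on_cube[OF Gc] by metis
  have fint: "integrable P (\<lambda>x. ?i x * f x)"
  proof (rule bounded_cube_integrable[where B = "\<bar>?lo\<bar> + \<bar>?hi\<bar>"])
    show "\<bar>f x\<bar> \<le> \<bar>?lo\<bar> + \<bar>?hi\<bar>" if "x \<in> ?Q" for x using xl(2)[OF that] xh(2)[OF that] by linarith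
  qed measurable
  have iint: "integrable P ?i" by (rule P.integrable_const_bound[where B = 1]) (auto simp: indicator_def)
  have G2int: "integrable P (\<lambda>x. ?i x * (G x)\<^sup>2)"
  proof (rule bounded_cube_integrable[where B = "BG\<^sup>2"])
    fix x assume "x \<in> ?Q"
    then have "\<bar>G x\<bar>\<^sup>2 \<le> BG\<^sup>2" using BG by (intro power_mono) auto
    then show "\<bar>(G x)\<^sup>2\<bar> \<le> BG\<^sup>2" by simp
  qed measurable
  have mI: "m \<in> {?lo..?hi}"
  proof -
    have 1: "?i x * ?lo \<le> ?i x * f x" "?i x * f x \<le> ?i x * ?hi" for x
      using xl(2)[of x] xh(2)[of x] by (cases "x \<in> ?Q"; simp)+
    have "(\<integral>x. ?i x * ?lo \<partial>P) \<le> (\<integral>x. ?i x * f x \<partial>P)"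
      by (rule integral_mono[OF integrable_mult_left[OF iint] fint 1(1)])
    moreover have "(\<integral>x. ?i x * f x \<partial>P) \<le> (\<integral>x. ?i x * ?hi \<partial>P)"
      by (rule integral_mono[OF fint integrable_mult_left[OF iint] 1(2)])
    ultimately have "(\<integral>x. ?i x \<partial>P) * ?lo \<le> (\<integral>x. ?i x * f x \<partial>P)" "(\<integral>x. ?i x * f x \<partial>P) \<le> (\<integral>x. ?i x \<partial>P) * ?hi"
      by (simp_all only: integral_mult_left_zero)
    then have "q * ?lo \<le> (\<integral>x. ?i x * f x \<partial>P)" "(\<integral>x. ?i x * f x \<partial>P) \<le> q * ?hi"
      unfolding prob_cube q_def .
    then show ?thesis using q by (simp add: m_def q_def[symmetric] field_simps)
  qed
  show mI': "m \<in> I" using mem_is_interval_1_I[OF I(2) lI] mI by auto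
  define C where "C = phi_const \<alpha> K"
  have C0: "0 \<le> C" unfolding C_def using phi_const_pos[OF \<alpha>] by (simp add: less_imp_le)
  let ?J = "\<integral>x. k (f x) * (G x)\<^sup>2 \<partial>P"
  let ?G2 = "\<integral>x. ?i x * (G x)\<^sup>2 \<partial>P"
  define g where "g t x = (1 - t) * f x + t * c0" for t x
  have gO: "g t x \<in> interior I" if "0 < t" "t \<le> 1" "x \<in> eucl d" for t x
    unfolding g_def using interval_shrink[OF cI c0 fI] that by blast
  have step: "(\<integral>x. ?i x * \<Psi> (g t x) \<partial>P) - q * \<Psi> ((1 - t) * m + t * c0) \<le> C * (?J + t * k c0 * ?G2)"
    if t: "0 < t" "t < 1" for t
  proof -
    let ?l = "(1 - t) * ?lo + t * c0" and ?h = "(1 - t) * ?hi + t * c0"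
    have lh: "?l \<in> interior I" "?h \<in> interior I" using interval_shrink[OF cI c0] lI t by auto
    have lh': "?l \<le> ?h" using xl(2)[OF xh(1)] t by (simp add: mult_left_mono)
    obtain s0 s1 where s: "s0 < ?l" "?h < s1" "{s0..s1} \<subseteq> interior I"
      using open_interval_margin[OF oI lh lh'] by metis
    have rng: "g t x \<in> {?l..?h}" if "x \<in> ?Q" for x
      using xl(2)[OF that] xh(2)[OF that] t by (auto simp: g_def intro!: mult_left_mono)
    have gm[measurable]: "g t \<in> borel_measurable (leb d)" unfolding g_def by measurable
    have Pm[measurable]: "(\<lambda>x. \<Psi> (g t x)) \<in> borel_measurable (leb d)"
      by (rule measurable_comp_closed[OF cont _ gm]) (use I gO[of t] t interior_subset in \<open>auto simp: space_leb borel_closed\<close>)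
    have km[measurable]: "(\<lambda>x. k (g t x)) \<in> borel_measurable (leb d)"
      by (rule measurable_comp_closed[OF kc _ gm]) (use oI gO[of t] t in \<open>auto simp: space_leb borel_open\<close>)
    have slg: "slope ?Q (edist d) (g t) (\<lambda>x. \<bar>1 - t\<bar> * G x)"
      unfolding g_def using fG by (intro slope_shift slope_cmult) (auto simp: has_slope_def)
    have Gt: "\<bar>\<bar>1 - t\<bar> * G x\<bar> \<le> BG" if "x \<in> ?Q" for x
    proof -
      have "\<bar>\<bar>1 - t\<bar> * G x\<bar> \<le> 1 * \<bar>G x\<bar>" unfolding abs_mult using t by (intro mult_right_mono) auto
      then show ?thesis using BG[OF that] by simp
    qed
    obtain n where n: "n \<in> {?l..?h}"
      "(\<integral>x. ?i x * (\<Psi> (g t x) - \<Psi> n - \<Psi>' n * (g t x - n)) \<partial>P) \<le> C * (\<integral>x. ?i x * (k (g t x) * (\<bar>1 - t\<bar> * G x)\<^sup>2) \<partial>P)"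
    proof -
      have in1: "s \<in> interior I" if "s \<in> {s0..s1}" for s using s(3) that by blast
      have in2: "s \<in> interior I" if "s \<in> {s0<..<s1}" for s using s(3) that by auto
      have cs: "convex_on {s0..s1} (\<lambda>s. - (1 / k s))" by (rule convex_on_subset[OF conc s(3)]) simp
      have Gm: "(\<lambda>x. \<bar>1 - t\<bar> * G x) \<in> borel_measurable (leb d)" by measurable
      have "\<exists>m\<in>{?l..?h}. (\<integral>x. ?i x * (\<Psi> (g t x) - \<Psi> m - \<Psi>' m * (g t x - m)) \<partial>P)
          \<le> phi_const \<alpha> K * (\<integral>x. ?i x * (k (g t x) * (\<bar>1 - t\<bar> * G x)\<^sup>2) \<partial>P)"
        by (rule cube_phi_entropy[OF pos kp[OF in1] continuous_on_subset[OF kc s(3)] cs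
            d1[OF in2] d2[OF in2] gm Gm Gt slg s(1,2) rng Pm km])
      then show ?thesis using that unfolding C_def by blast
    qed
    have nO: "n \<in> interior I" and subO: "{?l..?h} \<subseteq> interior I" using n(1) s by auto
    define mt where "mt = (1 - t) * m + t * c0"
    have mt: "mt \<in> {?l..?h}" using mI t by (auto simp: mt_def intro!: mult_left_mono)
    \<comment> \<open>The centre \<open>n\<close> belongs to another measure. The tangent of \<Psi>
      at \<open>n\<close> lies below \<Psi> at the true mean \<open>mt\<close>, so passing to
      \<open>mt\<close> can only decrease the left side.\<close>
    have tang: "\<Psi> n + \<Psi>' n * (mt - n) \<le> \<Psi> mt"
    proof -
      have "convex_on (interior I) \<Psi>"
        by (rule f''_ge0_imp_convex[OF oI(2) d1 d2]) (auto intro: less_imp_le kp)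
      then have "\<Psi>' n * (mt - n) \<le> \<Psi> mt - \<Psi> n"
        using convex_on_imp_above_tangent[of "interior I" \<Psi> n mt "\<Psi>' n"] mt nO subO d1[OF nO] oI
        by (auto simp: convex_connected has_field_derivative_at_within subset_eq)
      then show ?thesis by simp
    qed
    have bI: "bounded (\<Psi> ` {?l..?h})"
      using cont subO interior_subset by (intro compact_imp_bounded compact_continuous_image) (auto intro: continuous_on_subset)
    obtain BP where BP: "\<And>s. s \<in> {?l..?h} \<Longrightarrow> \<bar>\<Psi> s\<bar> \<le> BP" using bI unfolding bounded_real by blast
    have gint: "integrable P (\<lambda>x. ?i x * g t x)"
    proof (rule bounded_cube_integrable[where B = "\<bar>?l\<bar> + \<bar>?h\<bar>"])
      show "\<bar>g t x\<bar> \<le> \<bar>?l\<bar> + \<bar>?h\<bar>" if "x \<in> ?Q" for x using rng[OF that] unfolding atLeastAtMost_iff by linarith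
    qed measurable
    have Pint: "integrable P (\<lambda>x. ?i x * \<Psi> (g t x))"
      by (rule bounded_cube_integrable[OF Pm BP[OF rng]])
    have "(\<integral>x. ?i x * g t x \<partial>P) = (\<integral>x. (1 - t) * (?i x * f x) + t * c0 * ?i x \<partial>P)"
      by (intro Bochner_Integration.integral_cong) (auto simp: g_def algebra_simps)
    also have "\<dots> = (1 - t) * (\<integral>x. ?i x * f x \<partial>P) + t * c0 * q"
      using fint iint prob_cube by (subst Bochner_Integration.integral_add) (auto simp: q_def)
    also have "(\<integral>x. ?i x * f x \<partial>P) = q * m" using q by (simp add: m_def q_def[symmetric])
    finally have Eg: "(\<integral>x. ?i x * g t x \<partial>P) = q * mt" by (simp add: mt_def algebra_simps)
    have "(\<integral>x. ?i x * (\<Psi> (g t x) - \<Psi> n - \<Psi>' n * (g t x - n)) \<partial>P)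
       = (\<integral>x. ?i x * \<Psi> (g t x) - \<Psi>' n * (?i x * g t x) + (\<Psi>' n * n - \<Psi> n) * ?i x \<partial>P)"
      by (intro Bochner_Integration.integral_cong) (auto simp: algebra_simps)
    also have "\<dots> = (\<integral>x. ?i x * \<Psi> (g t x) \<partial>P) - \<Psi>' n * (q * mt) + (\<Psi>' n * n - \<Psi> n) * q"
      using Pint gint iint Eg prob_cube
      by (subst Bochner_Integration.integral_add, simp, simp, subst Bochner_Integration.integral_diff) (auto simp: q_def)
    also have "\<dots> = (\<integral>x. ?i x * \<Psi> (g t x) \<partial>P) - q * (\<Psi> n + \<Psi>' n * (mt - n))" by (simp add: algebra_simps)
    finally have "(\<integral>x. ?i x * \<Psi> (g t x) \<partial>P) - q * \<Psi> mt \<le> (\<integral>x. ?i x * (\<Psi> (g t x) - \<Psi> n - \<Psi>' n * (g t x - n)) \<partial>P)"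
      using mult_left_mono[OF tang, of q] q by simp
    also have "\<dots> \<le> C * (\<integral>x. ?i x * (k (g t x) * (\<bar>1 - t\<bar> * G x)\<^sup>2) \<partial>P)" by (rule n(2))
    also have "\<dots> \<le> C * (\<integral>x. k (f x) * (G x)\<^sup>2 + t * k c0 * (?i x * (G x)\<^sup>2) \<partial>P)"
    proof (intro mult_left_mono C0 integral_mono)
      have "bounded (k ` {?l..?h})"
        using kc subO by (intro compact_imp_bounded compact_continuous_image) (auto intro: continuous_on_subset)
      then obtain Bk where Bk: "\<And>s. s \<in> {?l..?h} \<Longrightarrow> \<bar>k s\<bar> \<le> Bk" unfolding bounded_real by blast
      show "integrable P (\<lambda>x. ?i x * (k (g t x) * (\<bar>1 - t\<bar> * G x)\<^sup>2))"
      proof (rule bounded_cube_integrable[where B = "Bk * BG\<^sup>2"])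
        fix x assume x: "x \<in> ?Q"
        have "(\<bar>1 - t\<bar> * G x)\<^sup>2 \<le> BG\<^sup>2" using Gt[OF x] by (subst power2_abs[symmetric], intro power_mono) auto
        then show "\<bar>k (g t x) * (\<bar>1 - t\<bar> * G x)\<^sup>2\<bar> \<le> Bk * BG\<^sup>2"
          unfolding abs_mult using Bk[OF rng[OF x]] by (intro mult_mono) auto
      qed measurable
      show "integrable P (\<lambda>x. k (f x) * (G x)\<^sup>2 + t * k c0 * (?i x * (G x)\<^sup>2))"
        using J G2int by (intro Bochner_Integration.integrable_add integrable_mult_right)
      fix x assume "x \<in> space P"
      then have x: "x \<in> eucl d" by simp
      have kG: "0 \<le> k (f x) * (G x)\<^sup>2" using kp[of "f x"] G0[OF x] by (cases "f x \<in> interior I") (auto simp: less_imp_le)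
      have kc0: "0 < k c0" by (rule kp[OF c0])
      show "?i x * (k (g t x) * (\<bar>1 - t\<bar> * G x)\<^sup>2) \<le> k (f x) * (G x)\<^sup>2 + t * k c0 * (?i x * (G x)\<^sup>2)"
      proof (cases "x \<in> ?Q \<and> f x \<in> interior I")
        case True
        \<comment> \<open>Convexity of the second derivative bounds the weight along the contraction
          by the original weight plus a term of order t; without it the limit t to 0 would lack a
          bound by the integral of k (f) G^2.\<close>
        have "k ((1 - t) *\<^sub>R f x + t *\<^sub>R c0) \<le> (1 - t) * k (f x) + t * k c0"
          using True t c0 by (intro convex_onD[OF kconv]) auto
        also have "\<dots> \<le> 1 * k (f x) + t * k c0" using t kp[of "f x"] True by (intro add_right_mono mult_right_mono) auto
        finally have k1: "k (g t x) \<le> k (f x) + t * k c0" by (simp add: g_def)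
        have kg: "0 \<le> k (g t x)" using kp[OF gO[OF _ _ x]] t by (simp add: less_imp_le)
        have "(\<bar>1 - t\<bar> * G x)\<^sup>2 \<le> 1 * (G x)\<^sup>2" unfolding power_mult_distrib using t
          by (intro mult_right_mono) (auto intro: power_le_one)
        then have "k (g t x) * (\<bar>1 - t\<bar> * G x)\<^sup>2 \<le> (k (f x) + t * k c0) * (G x)\<^sup>2"
          using k1 kg by (intro mult_mono) auto
        then show ?thesis using True by (simp add: algebra_simps)
      next
        case False
        then have "?i x * (k (g t x) * (\<bar>1 - t\<bar> * G x)\<^sup>2) = 0" using G0[OF x] by auto
        moreover have "0 \<le> t * k c0 * (?i x * (G x)\<^sup>2)" using t kc0 by simp
        ultimately show ?thesis using kG by linarith
      qed
    qed
    also have "(\<integral>x. k (f x) * (G x)\<^sup>2 + t * k c0 * (?i x * (G x)\<^sup>2) \<partial>P) = ?J + t * k c0 * ?G2"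
      using J G2int by (subst Bochner_Integration.integral_add) auto
    finally show ?thesis by (simp add: mt_def)
  qed
  \<comment> \<open>The offset 2 keeps every term strictly between 0 and 1, as \<open>step\<close>
    requires.\<close>
  define th where "th n = 1 / real (n + 2)" for n
  have th: "0 < th n" "th n < 1" for n by (auto simp: th_def)
  have th0: "th \<longlonglongrightarrow> 0" unfolding th_def by real_asymp
  let ?lo' = "min ?lo c0" and ?hi' = "max ?hi c0"
  have c0I: "c0 \<in> I" using c0 interior_subset by blast
  have lh'I: "?lo' \<in> I" "?hi' \<in> I" using lI c0I by (auto simp: min_def max_def)
  have sub': "{?lo'..?hi'} \<subseteq> I"
  proof
    fix s assume "s \<in> {?lo'..?hi'}"
    then show "s \<in> I" using mem_is_interval_1_I[OF I(2) lh'I, of s] by simp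
  qed
  have "bounded (\<Psi> ` {?lo'..?hi'})"
    using cont sub' by (intro compact_imp_bounded compact_continuous_image) (auto intro: continuous_on_subset)
  then obtain BP where BP: "\<And>s. s \<in> {?lo'..?hi'} \<Longrightarrow> \<bar>\<Psi> s\<bar> \<le> BP" unfolding bounded_real by blast
  have Pf[measurable]: "(\<lambda>x. \<Psi> (f x)) \<in> borel_measurable (leb d)"
    by (rule measurable_comp_closed[OF cont]) (use I fI in \<open>auto simp: space_leb borel_closed\<close>)
  have gI: "(1 - t) * s + t * c0 \<in> I" if "s \<in> I" "0 < t" "t \<le> 1" for s t
    using interval_shrink[OF cI c0 that] interior_subset by blast
  have lim: "(\<lambda>n. \<Psi> ((1 - th n) * s + th n * c0)) \<longlonglongrightarrow> \<Psi> s" if s: "s \<in> I" for s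
  proof (rule continuous_on_tendsto_compose[OF cont _ s])
    have "(\<lambda>n. (1 - th n) * s + th n * c0) \<longlonglongrightarrow> (1 - 0) * s + 0 * c0" by (intro tendsto_intros th0)
    then show "(\<lambda>n. (1 - th n) * s + th n * c0) \<longlonglongrightarrow> s" by simp
    show "\<forall>\<^sub>F n in sequentially. (1 - th n) * s + th n * c0 \<in> I"
      using gI[OF s th(1)] th(2) by (intro always_eventually) (auto simp: less_imp_le)
  qed
  have lim1: "(\<lambda>n. \<integral>x. ?i x * \<Psi> (g (th n) x) \<partial>P) \<longlonglongrightarrow> (\<integral>x. ?i x * \<Psi> (f x) \<partial>P)"
  proof (rule integral_dominated_convergence[where w = "\<lambda>_. \<bar>BP\<bar>"])
    show "AE x in P. (\<lambda>n. ?i x * \<Psi> (g (th n) x)) \<longlonglongrightarrow> ?i x * \<Psi> (f x)"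
      unfolding g_def by (intro AE_I2 tendsto_mult tendsto_const lim) (simp add: fI)
    show "AE x in P. norm (?i x * \<Psi> (g (th n) x)) \<le> \<bar>BP\<bar>" for n
    proof (rule AE_I2)
      fix x
      show "norm (?i x * \<Psi> (g (th n) x)) \<le> \<bar>BP\<bar>"
      proof (cases "x \<in> ?Q")
        case True
        have "?lo' \<le> g (th n) x"
        proof -
          have "(1 - th n) * ?lo' + th n * ?lo' \<le> g (th n) x" unfolding g_def
            using xl(2)[OF True] th[of n] by (intro add_mono mult_left_mono) auto
          then show ?thesis by (simp add: algebra_simps)
        qed
        moreover have "g (th n) x \<le> ?hi'"
        proof -
          have "g (th n) x \<le> (1 - th n) * ?hi' + th n * ?hi'" unfolding g_def
            using xh(2)[OF True] th[of n] by (intro add_mono mult_left_mono) auto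
          then show ?thesis by (simp add: algebra_simps)
        qed
        ultimately have "\<bar>\<Psi> (g (th n) x)\<bar> \<le> BP" by (intro BP) auto
        then show ?thesis using True by simp
      qed simp
    qed
    show "(\<lambda>x. ?i x * \<Psi> (f x)) \<in> borel_measurable P" by measurable
    show "(\<lambda>x. ?i x * \<Psi> (g (th n) x)) \<in> borel_measurable P" for n
    proof -
      have gm[measurable]: "g (th n) \<in> borel_measurable (leb d)" unfolding g_def by measurable
      have [measurable]: "(\<lambda>x. \<Psi> (g (th n) x)) \<in> borel_measurable (leb d)"
      proof (rule measurable_comp_closed[OF cont _ gm])
        show "I \<in> sets borel" using I by (simp add: borel_closed)
        fix x assume "x \<in> space (leb d)"
        then have "x \<in> eucl d" by (simp add: space_leb)
        then show "g (th n) x \<in> I"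
          by (rule subsetD[OF interior_subset gO[OF th(1) less_imp_le[OF th(2)]]])
      qed
      show ?thesis by measurable
    qed
  qed simp
  have lim2: "(\<lambda>n. (\<integral>x. ?i x * \<Psi> (g (th n) x) \<partial>P) - q * \<Psi> ((1 - th n) * m + th n * c0))
      \<longlonglongrightarrow> (\<integral>x. ?i x * \<Psi> (f x) \<partial>P) - q * \<Psi> m"
    by (intro tendsto_intros lim1 lim mI')
  have lim3: "(\<lambda>n. C * (?J + th n * k c0 * ?G2)) \<longlonglongrightarrow> C * (?J + 0 * k c0 * ?G2)"
    by (intro tendsto_intros th0)
  have "(\<integral>x. ?i x * \<Psi> (f x) \<partial>P) - q * \<Psi> m \<le> C * (?J + 0 * k c0 * ?G2)"
    by (rule LIMSEQ_le[OF lim2 lim3]) (use step[OF th] in auto)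
  then show "(\<integral>x. ?i x * \<Psi> (f x) \<partial>P) - measure P ?Q * \<Psi> m \<le> phi_const \<alpha> K * ?J"
    by (simp add: q_def C_def)
qed

end

context perturbed_log_concave
begin

text \<open>Monotone convergence over growing cubes. Through it, integrability of \<Psi> (f) and of
  f^2 is a conclusion and not an assumption.\<close>

lemma cube_limit_integrable:
  fixes F :: "(nat \<Rightarrow> real) \<Rightarrow> real"
  assumes F[measurable]: "F \<in> borel_measurable (leb d)" and F0: "\<And>x. x \<in> eucl d \<Longrightarrow> 0 \<le> F x"
    and int: "\<And>n. integrable P (\<lambda>x. indicator (cube d (real n)) x * F x)"
    and le: "\<And>n. (\<integral>x. indicator (cube d (real n)) x * F x \<partial>P) \<le> c"
  shows "integrable P F" "(\<integral>x. F x \<partial>P) \<le> c"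
proof -
  let ?F = "\<lambda>n x. indicator (cube d (real n)) x * F x"
  have sup: "ennreal (F x) = (SUP n. ennreal (?F n x))" if x: "x \<in> eucl d" for x
  proof (rule antisym)
    obtain n where n: "(\<Sum>i<d. \<bar>x i\<bar>) \<le> real n" using real_arch_simple by blast
    have "\<bar>x i\<bar> \<le> (\<Sum>i<d. \<bar>x i\<bar>)" if "i < d" for i using that by (intro member_le_sum) auto
    then have "x \<in> cube d (real n)" using x n by (auto simp: cube_def intro: order_trans)
    then have "ennreal (F x) = ennreal (?F n x)" by simp
    then show "ennreal (F x) \<le> (SUP n. ennreal (?F n x))" by (simp only:) (rule SUP_upper, simp)
    show "(SUP n. ennreal (?F n x)) \<le> ennreal (F x)"
      using F0[OF x] by (intro SUP_least ennreal_leI) (simp add: indicator_def)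
  qed
  have inc: "incseq (\<lambda>n x. if x \<in> eucl d then ennreal (?F n x) else 0)"
  proof (rule incseq_SucI, rule le_funI)
    fix n x
    show "(if x \<in> eucl d then ennreal (?F n x) else 0) \<le> (if x \<in> eucl d then ennreal (?F (Suc n) x) else 0)"
    proof -
      have "x \<in> cube d (real (Suc n))" if "x \<in> cube d (real n)" using cube_mono[of "real n" "real (Suc n)"] that by auto
      then show ?thesis using F0[of x] by (cases "x \<in> cube d (real n)") (auto intro!: ennreal_leI)
    qed
  qed
  have m: "(\<lambda>x. if x \<in> eucl d then ennreal (?F n x) else 0) \<in> borel_measurable P" for n
  proof -
    have "(\<lambda>x. ennreal (?F n x)) \<in> borel_measurable P" by measurable
    then show ?thesis by (rule subst[OF measurable_cong, rotated]) simp
  qed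
  have "(\<integral>\<^sup>+x. ennreal (F x) \<partial>P) = (\<integral>\<^sup>+x. (SUP n. if x \<in> eucl d then ennreal (?F n x) else 0) \<partial>P)"
    by (intro nn_integral_cong) (simp add: sup)
  also have "\<dots> = (SUP n. \<integral>\<^sup>+x. (if x \<in> eucl d then ennreal (?F n x) else 0) \<partial>P)"
    by (rule nn_integral_monotone_convergence_SUP[OF inc m])
  also have "\<dots> \<le> ennreal c"
  proof (rule SUP_least)
    fix n
    have "(\<integral>\<^sup>+x. (if x \<in> eucl d then ennreal (?F n x) else 0) \<partial>P) = (\<integral>\<^sup>+x. ennreal (?F n x) \<partial>P)"
      by (intro nn_integral_cong) simp
    also have "\<dots> = ennreal (\<integral>x. ?F n x \<partial>P)"
      by (rule nn_integral_eq_integral[OF int]) (use F0 in \<open>auto simp: indicator_def\<close>)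
    also have "\<dots> \<le> ennreal c" using le by (rule ennreal_leI)
    finally show "(\<integral>\<^sup>+x. (if x \<in> eucl d then ennreal (?F n x) else 0) \<partial>P) \<le> ennreal c" .
  qed
  finally have b: "(\<integral>\<^sup>+x. ennreal (F x) \<partial>P) \<le> ennreal c" .
  have c0: "0 \<le> c"
  proof -
    have "0 \<le> (\<integral>x. ?F 0 x \<partial>P)" by (intro integral_nonneg_AE AE_I2) (simp add: F0)
    then show ?thesis using le[of 0] by simp
  qed
  show i: "integrable P F"
  proof (rule integrableI_bounded)
    have "(\<integral>\<^sup>+x. ennreal (norm (F x)) \<partial>P) = (\<integral>\<^sup>+x. ennreal (F x) \<partial>P)"
      by (intro nn_integral_cong) (simp add: F0)
    then show "(\<integral>\<^sup>+x. ennreal (norm (F x)) \<partial>P) < \<infinity>" using b by (simp add: le_less_trans)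
  qed measurable
  have "AE x in P. 0 \<le> F x" by (rule AE_I2) (simp add: F0)
  then have "ennreal (\<integral>x. F x \<partial>P) \<le> ennreal c"
    using b nn_integral_eq_integral[OF i] by simp
  then show "(\<integral>x. F x \<partial>P) \<le> c" using c0 by simp
qed

lemma slope_bounded_on_cube:
  assumes "has_slope d f G" obtains B where "0 < B" "\<And>x. x \<in> cube d R \<Longrightarrow> \<bar>f x\<bar> \<le> B"
  using bounded_on_cube assms unfolding has_slope_def by metis

lemma cube_integral_tendsto:
  fixes F :: "(nat \<Rightarrow> real) \<Rightarrow> real"
  assumes F: "integrable P F"
  shows "(\<lambda>n. \<integral>x. indicator (cube d (real n)) x * F x \<partial>P) \<longlonglongrightarrow> (\<integral>x. F x \<partial>P)"
proof (rule integral_dominated_convergence[where w = "\<lambda>x. norm (F x)"])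
  have [measurable]: "F \<in> borel_measurable P" using F by auto
  show "F \<in> borel_measurable P" "\<And>n. (\<lambda>x. indicator (cube d (real n)) x * F x) \<in> borel_measurable P" by measurable
  show "integrable P (\<lambda>x. norm (F x))" using F by simp
  show "AE x in P. (\<lambda>n. indicator (cube d (real n)) x * F x) \<longlonglongrightarrow> F x"
  proof (rule AE_I2)
    fix x assume "x \<in> space P"
    then have x: "x \<in> eucl d" by simp
    obtain N where N: "(\<Sum>i<d. \<bar>x i\<bar>) \<le> real N" using real_arch_simple by blast
    have xi: "\<bar>x i\<bar> \<le> (\<Sum>i<d. \<bar>x i\<bar>)" if "i < d" for i using that by (intro member_le_sum) auto
    have "indicator (cube d (real n)) x * F x = F x" if "N \<le> n" for n
    proof -
      have "real N \<le> real n" using that by simp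
      then have "\<bar>x i\<bar> \<le> real n" if "i < d" for i using xi[OF that] N by linarith
      then show ?thesis using x by (simp add: cube_def)
    qed
    then show "(\<lambda>n. indicator (cube d (real n)) x * F x) \<longlonglongrightarrow> F x"
      by (intro tendsto_eventually eventually_sequentiallyI[of N])
  qed
  show "AE x in P. norm (indicator (cube d (real n)) x * F x) \<le> norm (F x)" for n
    by (intro AE_I2) (simp add: indicator_def)
qed

text \<open>\<Psi> (f) may change sign, so the limit is taken for its Bregman remainder
  \<open>B\<close> at the mean \<open>a\<close>, which is nonnegative and differs from \<Psi> (f) by
  an affine function of the integrable f. The cube inequality is centred at the cube mean, but these
  means converge to a and \<Psi> is continuous.\<close>

lemma phi_entropy_interior:
  fixes \<Psi> \<Psi>' k :: "real \<Rightarrow> real"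
  assumes I: "closed I" "is_interval I"
    and cont: "continuous_on I \<Psi>" and conv: "convex_on I \<Psi>"
    and d1: "\<And>s. s \<in> interior I \<Longrightarrow> (\<Psi> has_real_derivative \<Psi>' s) (at s)"
    and d2: "\<And>s. s \<in> interior I \<Longrightarrow> (\<Psi>' has_real_derivative k s) (at s)"
    and kp: "\<And>s. s \<in> interior I \<Longrightarrow> 0 < k s" and kconv: "convex_on (interior I) k"
    and conc: "convex_on (interior I) (\<lambda>s. - (1 / k s))"
    and fG: "has_slope d f G" and fI: "\<And>x. x \<in> eucl d \<Longrightarrow> f x \<in> I"
    and G0: "\<And>x. x \<in> eucl d \<Longrightarrow> f x \<notin> interior I \<Longrightarrow> G x = 0"
    and J: "integrable P (\<lambda>x. k (f x) * (G x)\<^sup>2)"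
    and f: "integrable P f" and m: "(\<integral>x. f x \<partial>P) \<in> interior I"
  shows "integrable P (\<lambda>x. \<Psi> (f x))"
    and "(\<integral>x. \<Psi> (f x) \<partial>P) - \<Psi> (\<integral>x. f x \<partial>P) \<le> phi_const \<alpha> K * (\<integral>x. k (f x) * (G x)\<^sup>2 \<partial>P)"
proof -
  define a where "a = (\<integral>x. f x \<partial>P)"
  have aO: "a \<in> interior I" and aI: "a \<in> I" using m interior_subset by (auto simp: a_def)
  define C where "C = phi_const \<alpha> K"
  let ?J = "\<integral>x. k (f x) * (G x)\<^sup>2 \<partial>P"
  let ?i = "\<lambda>n x. indicator (cube d (real n)) x :: real"
  define q where "q n = measure P (cube d (real n))" for n
  define mn where "mn n = (\<integral>x. ?i n x * f x \<partial>P) / q n" for n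
  define B where "B s = \<Psi> s - \<Psi> a - \<Psi>' a * (s - a)" for s
  have cI: "connected I" using I by (simp add: is_interval_connected_1)
  have B0: "0 \<le> B s" if "s \<in> I" for s
    using convex_on_imp_above_tangent[OF conv cI aO that, of "\<Psi>' a"] d1[OF aO]
    by (simp add: B_def has_field_derivative_at_within)
  note [measurable] = has_slope_measurable[OF fG]
  have Pf[measurable]: "(\<lambda>x. \<Psi> (f x)) \<in> borel_measurable (leb d)"
    by (rule measurable_comp_closed[OF cont]) (use I fI in \<open>auto simp: space_leb borel_closed\<close>)
  have Bm[measurable]: "(\<lambda>x. B (f x)) \<in> borel_measurable (leb d)" unfolding B_def by measurable
  have fi: "integrable P (\<lambda>x. ?i n x * f x)" for n
  proof -
    obtain b where "\<And>x. x \<in> cube d (real n) \<Longrightarrow> \<bar>f x\<bar> \<le> b" using slope_bounded_on_cube[OF fG] by metis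
    then show ?thesis by (intro bounded_cube_integrable) auto
  qed
  have ii: "integrable P (?i n)" for n by (rule P.integrable_const_bound[where B = 1]) (auto simp: indicator_def)
  have Pi: "integrable P (\<lambda>x. ?i n x * \<Psi> (f x))" for n
  proof -
    have "continuous_on (eucl d) (\<lambda>x. \<Psi> (f x))"
      using fG fI by (intro continuous_on_compose2[OF cont]) (auto simp: has_slope_def)
    then obtain b where "\<And>x. x \<in> cube d (real n) \<Longrightarrow> \<bar>\<Psi> (f x)\<bar> \<le> b" using bounded_on_cube by metis
    then show ?thesis by (intro bounded_cube_integrable) auto
  qed
  have Bi: "integrable P (\<lambda>x. ?i n x * B (f x))" and
    EB: "(\<integral>x. ?i n x * B (f x) \<partial>P) = (\<integral>x. ?i n x * \<Psi> (f x) \<partial>P) - \<Psi>' a * (\<integral>x. ?i n x * f x \<partial>P) + (\<Psi>' a * a - \<Psi> a) * q n" for n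
  proof -
    have e: "?i n x * B (f x) = ?i n x * \<Psi> (f x) - \<Psi>' a * (?i n x * f x) + (\<Psi>' a * a - \<Psi> a) * ?i n x" for x
      by (simp add: B_def algebra_simps)
    show "integrable P (\<lambda>x. ?i n x * B (f x))" unfolding e
      by (intro Bochner_Integration.integrable_add Bochner_Integration.integrable_diff integrable_mult_right Pi fi ii)
    show "(\<integral>x. ?i n x * B (f x) \<partial>P) = (\<integral>x. ?i n x * \<Psi> (f x) \<partial>P) - \<Psi>' a * (\<integral>x. ?i n x * f x \<partial>P) + (\<Psi>' a * a - \<Psi> a) * q n"
      unfolding e
      by (subst Bochner_Integration.integral_add[OF Bochner_Integration.integrable_diff[OF Pi integrable_mult_right[OF fi]] integrable_mult_right[OF ii]],
          subst Bochner_Integration.integral_diff[OF Pi integrable_mult_right[OF fi]])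
        (simp only: integral_mult_right_zero prob_cube q_def)
  qed
  have qlim: "q \<longlonglongrightarrow> 1" unfolding q_def by (rule prob_cube_tendsto)
  have flim: "(\<lambda>n. \<integral>x. ?i n x * f x \<partial>P) \<longlonglongrightarrow> a" unfolding a_def by (rule cube_integral_tendsto[OF f])
  have mlim: "mn \<longlonglongrightarrow> a" unfolding mn_def using tendsto_divide[OF flim qlim] by simp
  have evq: "\<forall>\<^sub>F n in sequentially. 0 < q n" using order_tendstoD(1)[OF qlim, of 0] by simp
  have cube: "mn n \<in> I" "(\<integral>x. ?i n x * \<Psi> (f x) \<partial>P) - q n * \<Psi> (mn n) \<le> C * ?J" if "0 < q n" for n
    using cube_entropy_interval[OF that[unfolded q_def] I aO cont d1 d2 kp kconv conc fG fI G0 J]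
    unfolding mn_def q_def C_def by blast+
  have Plim: "(\<lambda>n. \<Psi> (mn n)) \<longlonglongrightarrow> \<Psi> a"
    using evq cube(1) by (intro continuous_on_tendsto_compose[OF cont mlim aI]) (auto elim: eventually_mono)
  \<comment> \<open>The discrepancy between centring at the cube mean and at \<open>a\<close>. In
    the limit its terms cancel, so r tends to 0.\<close>
  define r where "r n = q n * \<Psi> (mn n) - \<Psi>' a * (\<integral>x. ?i n x * f x \<partial>P) + (\<Psi>' a * a - \<Psi> a) * q n" for n
  have "r \<longlonglongrightarrow> 1 * \<Psi> a - \<Psi>' a * a + (\<Psi>' a * a - \<Psi> a) * 1"
    unfolding r_def by (intro tendsto_intros qlim Plim flim)
  then have rlim: "(\<lambda>n. C * ?J + r n) \<longlonglongrightarrow> C * ?J" using tendsto_add[of "\<lambda>_. C * ?J"] by fastforce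
  \<comment> \<open>The cube of size \<open>N\<close> stays fixed while the cube of size
    \<open>n\<close>, on which the inequality is used, grows; nonnegativity of \<open>B\<close>
    compares the two.\<close>
  have bound: "(\<integral>x. ?i N x * B (f x) \<partial>P) \<le> C * ?J" for N
  proof (rule tendsto_lowerbound[OF rlim])
    show "\<forall>\<^sub>F n in sequentially. (\<integral>x. ?i N x * B (f x) \<partial>P) \<le> C * ?J + r n"
      using evq eventually_ge_at_top[of N]
    proof eventually_elim
      case (elim n)
      have "(\<integral>x. ?i N x * B (f x) \<partial>P) \<le> (\<integral>x. ?i n x * B (f x) \<partial>P)"
      proof (rule integral_mono[OF Bi Bi])
        fix x assume "x \<in> space P"
        then have "0 \<le> B (f x)" by (simp add: B0 fI)
        moreover have "cube d (real N) \<subseteq> cube d (real n)" using elim by (intro cube_mono) simp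
        ultimately show "?i N x * B (f x) \<le> ?i n x * B (f x)" by (auto simp: indicator_def)
      qed
      also have "\<dots> \<le> C * ?J + r n" using cube(2)[OF elim(1)] unfolding EB r_def by simp
      finally show ?case .
    qed
  qed simp
  have BI: "integrable P (\<lambda>x. B (f x))" "(\<integral>x. B (f x) \<partial>P) \<le> C * ?J"
    using cube_limit_integrable[OF Bm _ Bi bound] B0 fI by auto
  have e: "\<Psi> (f x) = B (f x) + (\<Psi>' a * f x + (\<Psi> a - \<Psi>' a * a))" for x by (simp add: B_def algebra_simps)
  show "integrable P (\<lambda>x. \<Psi> (f x))" unfolding e using BI f by simp
  have "(\<integral>x. \<Psi> (f x) \<partial>P) = (\<integral>x. B (f x) \<partial>P) + (\<Psi>' a * a + (\<Psi> a - \<Psi>' a * a))"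
    unfolding e using BI f P.prob_space by (simp add: a_def)
  then show "(\<integral>x. \<Psi> (f x) \<partial>P) - \<Psi> (\<integral>x. f x \<partial>P) \<le> phi_const \<alpha> K * ?J"
    using BI(2) by (simp add: a_def C_def)
qed

text \<open>Square integrability is not assumed: the means over large cubes are controlled by the values on one fixed cube.\<close>

lemma square_integrable:
  assumes fG: "has_slope d f G" and G2: "integrable P (\<lambda>x. (G x)\<^sup>2)"
  shows "integrable P (\<lambda>x. (f x)\<^sup>2)"
proof -
  let ?i = "\<lambda>n x. indicator (cube d (real n)) x :: real"
  define q where "q n = measure P (cube d (real n))" for n
  define mn where "mn n = (\<integral>x. ?i n x * f x \<partial>P) / q n" for n
  define V where "V = phi_const \<alpha> K * (\<integral>x. 2 * (G x)\<^sup>2 \<partial>P)"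
  note [measurable] = has_slope_measurable[OF fG]
  have qlim: "q \<longlonglongrightarrow> 1" unfolding q_def by (rule prob_cube_tendsto)
  have "\<forall>\<^sub>F n in sequentially. 0 < q n" using order_tendstoD(1)[OF qlim, of 0] by simp
  then obtain N where N: "\<And>n. N \<le> n \<Longrightarrow> 0 < q n" unfolding eventually_sequentially by blast
  have fi: "integrable P (\<lambda>x. ?i n x * f x)" and f2i: "integrable P (\<lambda>x. ?i n x * (f x)\<^sup>2)" for n
  proof -
    obtain b where "\<And>x. x \<in> cube d (real n) \<Longrightarrow> \<bar>f x\<bar> \<le> b" using slope_bounded_on_cube[OF fG] by metis
    then show "integrable P (\<lambda>x. ?i n x * f x)" by (intro bounded_cube_integrable) auto
    obtain c where "\<And>x. x \<in> cube d (real n) \<Longrightarrow> \<bar>(f x)\<^sup>2\<bar> \<le> c" using slope_bounded_on_cube[OF has_slope_square[OF fG]] by metis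
    then show "integrable P (\<lambda>x. ?i n x * (f x)\<^sup>2)" by (intro bounded_cube_integrable) auto
  qed
  have ii: "integrable P (?i n)" for n by (rule P.integrable_const_bound[where B = 1]) (auto simp: indicator_def)
  have cube: "(\<integral>x. ?i n x * (f x)\<^sup>2 \<partial>P) - q n * (mn n)\<^sup>2 \<le> V" if "N \<le> n" for n
  proof -
    have "(\<integral>x. ?i n x * (f x)\<^sup>2 \<partial>P) - measure P (cube d (real n)) * ((\<integral>x. ?i n x * f x \<partial>P) / measure P (cube d (real n)))\<^sup>2
        \<le> phi_const \<alpha> K * (\<integral>x. 2 * (G x)\<^sup>2 \<partial>P)"
      by (rule cube_entropy_interval(2)[where I = UNIV and ?c0.0 = 0 and \<Psi> = "\<lambda>s. s\<^sup>2" and \<Psi>' = "\<lambda>s. 2 * s" and k = "\<lambda>_. 2"])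
        (use N[OF that] fG G2 in \<open>auto simp: q_def convex_on_const intro!: continuous_intros derivative_eq_intros\<close>)
    then show ?thesis by (simp add: q_def mn_def V_def)
  qed
  obtain b where b: "0 < b" "\<And>x. x \<in> cube d (real N) \<Longrightarrow> \<bar>f x\<bar> \<le> b" using slope_bounded_on_cube[OF fG] by metis
  define W where "W = V + 2 * (V / q N + b\<^sup>2)"
  have qN: "0 < q N" using N by simp
  have q1: "q n \<le> 1" for n by (simp add: q_def)
  have bound: "(\<integral>x. ?i n x * (f x)\<^sup>2 \<partial>P) \<le> W" if n: "N \<le> n" for n
  proof -
    let ?m = "mn n"
    have dec: "?i n x * (f x - ?m)\<^sup>2 = ?i n x * (f x)\<^sup>2 - 2 * ?m * (?i n x * f x) + ?m\<^sup>2 * ?i n x" for x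
      by (simp add: power2_eq_square algebra_simps)
    have di: "integrable P (\<lambda>x. ?i n x * (f x - ?m)\<^sup>2)" unfolding dec
      by (intro Bochner_Integration.integrable_add Bochner_Integration.integrable_diff integrable_mult_right f2i fi ii)
    have "(\<integral>x. ?i n x * (f x - ?m)\<^sup>2 \<partial>P) = (\<integral>x. ?i n x * (f x)\<^sup>2 \<partial>P) - 2 * ?m * (\<integral>x. ?i n x * f x \<partial>P) + ?m\<^sup>2 * q n"
      unfolding dec
      by (subst Bochner_Integration.integral_add[OF Bochner_Integration.integrable_diff[OF f2i integrable_mult_right[OF fi]] integrable_mult_right[OF ii]],
          subst Bochner_Integration.integral_diff[OF f2i integrable_mult_right[OF fi]])
        (simp only: integral_mult_right_zero prob_cube q_def)
    also have "(\<integral>x. ?i n x * f x \<partial>P) = q n * ?m" using N[OF n] by (simp add: mn_def)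
    finally have var: "(\<integral>x. ?i n x * (f x - ?m)\<^sup>2 \<partial>P) \<le> V" using cube[OF n] by (simp add: power2_eq_square algebra_simps)
    \<comment> \<open>On the fixed cube |f| is at most \<open>b\<close>, so the deviation of f from
      the mean \<open>?m\<close> has square at least half of \<open>?m\<close> squared minus
      \<open>b\<close> squared. Since its integral over the larger cube is at most \<open>V\<close>,
      this bounds \<open>?m\<close> independently of \<open>n\<close>.\<close>
    have "(?m\<^sup>2 / 2 - b\<^sup>2) * q N = (\<integral>x. (?m\<^sup>2 / 2 - b\<^sup>2) * ?i N x \<partial>P)"
      by (simp only: integral_mult_right_zero prob_cube q_def)
    also have "\<dots> \<le> (\<integral>x. ?i n x * (f x - ?m)\<^sup>2 \<partial>P)"
    proof (rule integral_mono[OF integrable_mult_right[OF ii] di])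
      fix x
      show "(?m\<^sup>2 / 2 - b\<^sup>2) * ?i N x \<le> ?i n x * (f x - ?m)\<^sup>2"
      proof (cases "x \<in> cube d (real N)")
        case True
        then have xn: "x \<in> cube d (real n)" using n cube_mono[of "real N" "real n"] by auto
        have "\<bar>f x\<bar>\<^sup>2 \<le> b\<^sup>2" using b(2)[OF True] by (intro power_mono) auto
        moreover have "0 \<le> (2 * f x - ?m)\<^sup>2" by simp
        ultimately have "?m\<^sup>2 / 2 - b\<^sup>2 \<le> (f x - ?m)\<^sup>2" by (simp add: power2_eq_square algebra_simps)
        then show ?thesis using True xn by simp
      qed simp
    qed
    also have "\<dots> \<le> V" by (rule var)
    finally have "?m\<^sup>2 / 2 - b\<^sup>2 \<le> V / q N" using qN by (simp add: pos_le_divide_eq)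
    then have m2: "?m\<^sup>2 \<le> 2 * (V / q N + b\<^sup>2)" by simp
    have "q n * ?m\<^sup>2 \<le> 1 * ?m\<^sup>2" using q1 by (intro mult_right_mono) auto
    then show ?thesis using cube[OF n] m2 by (simp add: W_def)
  qed
  have "(\<integral>x. ?i n x * (f x)\<^sup>2 \<partial>P) \<le> W" for n
  proof -
    have "(\<integral>x. ?i n x * (f x)\<^sup>2 \<partial>P) \<le> (\<integral>x. ?i (max n N) x * (f x)\<^sup>2 \<partial>P)"
    proof (rule integral_mono[OF f2i f2i])
      fix x
      have "cube d (real n) \<subseteq> cube d (real (max n N))" by (intro cube_mono) simp
      then show "?i n x * (f x)\<^sup>2 \<le> ?i (max n N) x * (f x)\<^sup>2" by (auto simp: indicator_def)
    qed
    also have "\<dots> \<le> W" by (rule bound) simp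
    finally show ?thesis .
  qed
  then show ?thesis by (intro cube_limit_integrable(1)[OF _ _ f2i]) auto
qed

end

section \<open>End points and degenerate divergences\<close>

lemma convex_second_derivative_nonneg:
  fixes f :: "real \<Rightarrow> real"
  assumes O1: "open O1" "connected O1" and f: "convex_on O1 f"
    and d1: "\<And>s. s \<in> O1 \<Longrightarrow> (f has_real_derivative f' s) (at s)"
    and d2: "\<And>s. s \<in> O1 \<Longrightarrow> (f' has_real_derivative k s) (at s)"
    and s: "s \<in> O1"
  shows "0 \<le> k s"
proof -
  have tan: "f' x * (y - x) \<le> f y - f x" if "x \<in> O1" "y \<in> O1" for x y
    using convex_on_imp_above_tangent[OF f O1(2) _ that(2), of x "f' x"] d1[OF that(1)] that(1) O1(1)
    by (simp add: interior_open has_field_derivative_at_within)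
  have "mono_on O1 f'"
  proof (rule mono_onI)
    fix x y assume xy: "x \<in> O1" "y \<in> O1" "x \<le> y"
    show "f' x \<le> f' y"
    proof (cases "x = y")
      case False
      have "f' x * (y - x) + f' y * (x - y) \<le> 0" using tan[OF xy(1,2)] tan[OF xy(2,1)] by linarith
      then have "f' x * (y - x) \<le> f' y * (y - x)" by (simp add: algebra_simps)
      then show ?thesis by (rule mult_right_le_imp_le) (use False xy in simp)
    qed simp
  qed
  then show ?thesis by (rule mono_on_imp_deriv_nonneg[OF _ d2[OF s]]) (use s O1 in \<open>simp add: interior_open\<close>)
qed

lemma extremum_of_interval:
  fixes I :: "real set"
  assumes "is_interval I" "m \<notin> interior I"
  shows "(\<forall>s\<in>I. m \<le> s) \<or> (\<forall>s\<in>I. s \<le> m)"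
proof (rule ccontr)
  assume "\<not> ?thesis"
  then obtain s1 s2 where s: "s1 \<in> I" "s1 < m" "s2 \<in> I" "m < s2" by (auto simp: not_le)
  have "{s1<..<s2} \<subseteq> I"
  proof
    fix x assume "x \<in> {s1<..<s2}"
    then show "x \<in> I" using mem_is_interval_1_I[OF assms(1) s(1,3), of x] by simp
  qed
  then have "{s1<..<s2} \<subseteq> interior I" by (intro interior_maximal) auto
  then show False using s assms(2) by auto
qed

text \<open>A value outside the interior of \<open>I\<close> is the least or the greatest element of
  \<open>I\<close>, so every partial derivative is taken at an extremum. Therefore whatever
  \<open>deriv (deriv \<Psi>)\<close> means at an end point gets multiplied by 0.\<close>

lemma smooth_grad_zero:
  assumes f: "smooth d f" and I: "is_interval I" and fI: "\<And>x. x \<in> eucl d \<Longrightarrow> f x \<in> I"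
    and x: "x \<in> eucl d" "f x \<notin> interior I"
  shows "enorm d (grad f x) = 0"
proof -
  have "partial i f x = 0" if i: "i < d" for i
  proof -
    let ?g = "\<lambda>t. f (x(i := t))"
    have "Ck_on d 2 (eucl d) f" using f by (simp add: smooth_def)
    then have "?g differentiable (at (x i))" using i x by (intro Ck_on_partial(2))
    then have d: "(?g has_real_derivative partial i f x) (at (x i))"
      by (simp add: DERIV_deriv_iff_real_differentiable partial_def)
    have gI: "?g t \<in> I" for t using x i by (intro fI eucl_upd)
    have gx: "?g (x i) = f x" by simp
    from extremum_of_interval[OF I x(2)] show ?thesis
    proof
      assume "\<forall>s\<in>I. f x \<le> s"
      then show ?thesis using gI gx by (intro DERIV_local_min[OF d, of 1]) auto
    next
      assume "\<forall>s\<in>I. s \<le> f x"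
      then show ?thesis using gI gx by (intro DERIV_local_max[OF d, of 1]) auto
    qed
  qed
  then show ?thesis by (simp add: enorm_def grad_def L2_set_def)
qed

context perturbed_log_concave
begin

lemma Ent_eq:
  assumes "integrable P (\<lambda>x. \<Psi> (f x))"
  shows "Ent \<Psi> P f = ereal ((\<integral>x. \<Psi> (f x) \<partial>P) - \<Psi> (\<integral>x. f x \<partial>P))"
  unfolding Ent_def ext_integral_eq_integral[OF assms] by simp

text \<open>Three situations are separated before \<open>phi_entropy_interior\<close> applies: an
  infinite right side; a mean at an end point of \<open>I\<close>, which forces f to be almost
  surely constant; and a zero of the second derivative, which forces \<Psi> to be affine. In the
  last two the entropy is 0.\<close>

theorem entropy_inequality:
  assumes I: "closed I" "is_interval I" and div: "divergence I \<Psi>"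
    and fG: "has_slope d f G" and fI: "\<And>x. x \<in> eucl d \<Longrightarrow> f x \<in> I"
    and G0: "\<And>x. x \<in> eucl d \<Longrightarrow> f x \<notin> interior I \<Longrightarrow> G x = 0"
    and f: "integrable P f" and m: "(\<integral>x. f x \<partial>P) \<in> I"
  shows "Ent \<Psi> P f \<le> ereal (phi_const \<alpha> K) * ext_integral P (\<lambda>x. deriv (deriv \<Psi>) (f x) * (G x)\<^sup>2)"
proof -
  define k where "k = deriv (deriv \<Psi>)"
  define a where "a = (\<integral>x. f x \<partial>P)"
  have aI: "a \<in> I" using m by (simp add: a_def)
  have cI: "convex I" using I by (simp add: is_interval_convex_1)
  have oI: "open (interior I)" "convex (interior I)" "connected (interior I)"
    using cI by (auto intro: convex_interior convex_connected)
  have cont: "continuous_on I \<Psi>" and conv: "convex_on I \<Psi>" and kconv: "convex_on (interior I) k"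
    and conc: "convex_on (interior I) (\<lambda>s. - (1 / k s))"
    using div by (auto simp: divergence_def k_def)
  have d1: "(\<Psi> has_real_derivative deriv \<Psi> s) (at s)" and d2: "(deriv \<Psi> has_real_derivative k s) (at s)"
    if "s \<in> interior I" for s
    using div that by (auto simp: divergence_def k_def DERIV_deriv_iff_real_differentiable)
  have convO: "convex_on (interior I) \<Psi>" by (rule convex_on_subset[OF conv interior_subset oI(2)])
  have k0: "0 \<le> k s" if "s \<in> interior I" for s
    by (rule convex_second_derivative_nonneg[OF oI(1,3) convO d1 d2 that])
  have kc: "continuous_on (interior I) k" using kconv oI by (intro convex_on_continuous)
  have nn: "0 \<le> k (f x) * (G x)\<^sup>2" if "x \<in> eucl d" for x
    using k0[of "f x"] G0[OF that] by (cases "f x \<in> interior I") auto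
  note [measurable] = has_slope_measurable[OF fG]
  have Jm: "(\<lambda>x. k (f x) * (G x)\<^sup>2) \<in> borel_measurable (leb d)"
  proof -
    have [measurable]: "(\<lambda>s. indicator (interior I) s *\<^sub>R k s) \<in> borel_measurable borel"
      using oI kc by (intro borel_measurable_continuous_on_indicator) auto
    have "(\<lambda>x. (indicator (interior I) (f x) *\<^sub>R k (f x)) * (G x)\<^sup>2) \<in> borel_measurable (leb d)" by measurable
    then show ?thesis
      by (rule subst[OF measurable_cong, rotated]) (use G0 in \<open>auto simp: space_leb indicator_def\<close>)
  qed
  define X where "X = (\<integral>\<^sup>+x. ennreal (k (f x) * (G x)\<^sup>2) \<partial>P)"
  have ext: "ext_integral P (\<lambda>x. k (f x) * (G x)\<^sup>2) = enn2ereal X"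
    unfolding X_def by (rule ext_integral_nonneg) (simp add: nn)
  have C: "0 < phi_const \<alpha> K" by (rule phi_const_pos[OF \<alpha>])
  show ?thesis
  proof (cases "X = \<infinity>")
    case True
    then show ?thesis using C unfolding k_def[symmetric] ext by simp
  next
    case False
    have J: "integrable P (\<lambda>x. k (f x) * (G x)\<^sup>2)"
    proof (rule integrableI_bounded)
      have "(\<integral>\<^sup>+x. ennreal (norm (k (f x) * (G x)\<^sup>2)) \<partial>P) = X"
        unfolding X_def by (intro nn_integral_cong) (simp add: nn)
      then show "(\<integral>\<^sup>+x. ennreal (norm (k (f x) * (G x)\<^sup>2)) \<partial>P) < \<infinity>" using False by (simp add: less_top)
    qed (use Jm in measurable)
    let ?J = "\<integral>x. k (f x) * (G x)\<^sup>2 \<partial>P"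
    have J0: "0 \<le> ?J" by (intro integral_nonneg_AE AE_I2) (simp add: nn)
    \<comment> \<open>Common to both degenerate cases: an affine relation through the mean makes the
      entropy vanish, while the right side is nonnegative.\<close>
    have affine: ?thesis if e: "AE x in P. \<Psi> (f x) = \<Psi> a + c * (f x - a)" for c
    proof -
      have [measurable]: "(\<lambda>x. \<Psi> (f x)) \<in> borel_measurable (leb d)"
        by (rule measurable_comp_closed[OF cont]) (use I fI in \<open>auto simp: space_leb borel_closed\<close>)
      have i: "integrable P (\<lambda>x. \<Psi> a + c * (f x - a))" using f by simp
      have "integrable P (\<lambda>x. \<Psi> (f x))"
        by (rule integrable_cong_AE_imp[OF i]) (use e in \<open>auto elim: eventually_mono\<close>)
      moreover have "(\<integral>x. \<Psi> (f x) \<partial>P) = (\<integral>x. \<Psi> a + c * (f x - a) \<partial>P)"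
        by (rule integral_cong_AE) (use e in \<open>auto\<close>)
      moreover have "\<dots> = \<Psi> a" using f P.prob_space by (simp add: a_def)
      ultimately have "Ent \<Psi> P f = 0" by (simp add: Ent_eq a_def zero_ereal_def)
      then show ?thesis unfolding k_def[symmetric] ext_integral_eq_integral[OF J] using C J0 by simp
    qed
    show ?thesis
    proof (cases "a \<in> interior I")
      case False
      have "AE x in P. f x = a"
        using extremum_of_interval[OF I(2) False]
      proof
        assume le: "\<forall>s\<in>I. a \<le> s"
        have "(\<integral>x. f x - a \<partial>P) = 0" using f P.prob_space by (simp add: a_def)
        moreover have "AE x in P. 0 \<le> f x - a" using le fI by (intro AE_I2) auto
        ultimately have "AE x in P. f x - a = 0" using f by (subst (asm) integral_nonneg_eq_0_iff_AE) auto
        then show ?thesis by (auto elim: eventually_mono)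
      next
        assume le: "\<forall>s\<in>I. s \<le> a"
        have "(\<integral>x. a - f x \<partial>P) = 0" using f P.prob_space by (simp add: a_def)
        moreover have "AE x in P. 0 \<le> a - f x" using le fI by (intro AE_I2) auto
        ultimately have "AE x in P. a - f x = 0" using f by (subst (asm) integral_nonneg_eq_0_iff_AE) auto
        then show ?thesis by (auto elim: eventually_mono)
      qed
      then have "AE x in P. \<Psi> (f x) = \<Psi> a + 0 * (f x - a)" by (auto elim: eventually_mono)
      then show ?thesis by (rule affine)
    next
      case aO: True
      show ?thesis
      proof (cases "\<forall>s\<in>interior I. 0 < k s")
        case True
        have kp: "\<And>s. s \<in> interior I \<Longrightarrow> 0 < k s" using True by blast
        have 1: "integrable P (\<lambda>x. \<Psi> (f x))"
          by (rule phi_entropy_interior(1)[OF I cont conv d1 d2 kp kconv conc fG fI G0 J f aO[unfolded a_def]])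
        have 2: "(\<integral>x. \<Psi> (f x) \<partial>P) - \<Psi> (\<integral>x. f x \<partial>P) \<le> phi_const \<alpha> K * ?J"
          by (rule phi_entropy_interior(2)[OF I cont conv d1 d2 kp kconv conc fG fI G0 J f aO[unfolded a_def]])
        show ?thesis unfolding k_def[symmetric] ext_integral_eq_integral[OF J] Ent_eq[of \<Psi> f, OF 1] using 2 by simp
      next
        case False
        then obtain s0 where s0: "s0 \<in> interior I" "k s0 = 0" using k0 by (meson antisym_conv linorder_not_less order.refl)
        \<comment> \<open>With 1 / 0 = 0 the convex function - 1 / k has its greatest value 0 at
          \<open>s0\<close>. If it were negative at \<open>s\<close>, convexity would fail on the
          segment from s through s0 to a point s' slightly beyond, at distance e / 2 from s0 and so
          still in the interior.\<close>
        have kz: "k s = 0" if s: "s \<in> interior I" for s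
        proof (rule ccontr)
          assume "k s \<noteq> 0"
          then have ks: "0 < k s" using k0[OF s] by simp
          then have ne: "s \<noteq> s0" using s0 by auto
          obtain e where e: "0 < e" "ball s0 e \<subseteq> interior I" using openE[OF oI(1) s0(1)] by blast
          define h where "h = e / (2 * \<bar>s0 - s\<bar>)"
          have h: "0 < h" using e ne by (simp add: h_def)
          define s' where "s' = s0 + h * (s0 - s)"
          have "\<bar>s' - s0\<bar> = e / 2" using h ne e by (simp add: s'_def abs_mult h_def)
          then have s': "s' \<in> interior I" using e by (intro subsetD[OF e(2)]) (simp add: dist_real_def abs_minus_commute)
          define t where "t = 1 / (1 + h)"
          have t: "0 < t" "t < 1" using h by (auto simp: t_def)
          have "(1 - t) *\<^sub>R s + t *\<^sub>R s' = s0"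
          proof -
            have t1: "t * (1 + h) = 1" using h by (simp add: t_def)
            have "(1 - t) *\<^sub>R s + t *\<^sub>R s' = s + (t * (1 + h)) * (s0 - s)" by (simp add: s'_def algebra_simps)
            then show ?thesis by (simp add: t1)
          qed
          then have "- (1 / k s0) \<le> (1 - t) * - (1 / k s) + t * - (1 / k s')"
            using convex_onD[OF conc, of t s s'] t s s' by auto
          moreover have "(1 - t) * - (1 / k s) < 0" using t ks by (simp add: mult_less_0_iff)
          moreover have "t * - (1 / k s') \<le> 0" using t k0[OF s'] by simp
          ultimately show False using s0(2) by simp
        qed
        have "\<exists>c. \<forall>s\<in>interior I. deriv \<Psi> s = c"
          by (rule has_field_derivative_zero_constant[OF oI(2)])
            (use d2 kz in \<open>force intro: has_field_derivative_at_within\<close>)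
        then obtain c where c: "\<And>s. s \<in> interior I \<Longrightarrow> deriv \<Psi> s = c" by blast
        have "\<exists>b. \<forall>s\<in>interior I. \<Psi> s - c * s = b"
        proof (rule has_field_derivative_zero_constant[OF oI(2)])
          fix s assume s: "s \<in> interior I"
          have "((\<lambda>s. \<Psi> s - c * s) has_real_derivative deriv \<Psi> s - c) (at s)"
            using d1[OF s] by (auto intro!: derivative_eq_intros)
          then show "((\<lambda>s. \<Psi> s - c * s) has_real_derivative 0) (at s within interior I)"
            using c[OF s] by (simp add: has_field_derivative_at_within)
        qed
        then obtain b where b: "\<And>s. s \<in> interior I \<Longrightarrow> \<Psi> s - c * s = b" by blast
        \<comment> \<open>The affine formula is known in the interior; continuity of \<Psi> carries
          it to the end points, where f may take values.\<close>
        have cl: "closure (interior I) = I"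
          using convex_closure_interior[OF cI] aO I(1) by auto
        have "\<Psi> s - c * s = b" if "s \<in> I" for s
        proof (rule continuous_constant_on_closure[where S = "interior I" and f = "\<lambda>s. \<Psi> s - c * s"])
          show "continuous_on (closure (interior I)) (\<lambda>s. \<Psi> s - c * s)"
            unfolding cl using cont by (intro continuous_intros)
        qed (use b that cl in auto)
        from this[OF fI] this[OF aI] have "\<Psi> (f x) = \<Psi> a + c * (f x - a)" if "x \<in> eucl d" for x
          using that by (simp add: algebra_simps)
        then show ?thesis by (intro affine[of c] AE_I2) simp
      qed
    qed
  qed
qed

end

section \<open>Square and entropy function as divergences\<close>

lemma deriv_square: "deriv (\<lambda>s::real. s\<^sup>2) = (\<lambda>s. 2 * s)"
  by (rule ext, rule DERIV_imp_deriv) (auto intro!: derivative_eq_intros)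

lemma deriv_linear: "deriv (\<lambda>s::real. 2 * s) = (\<lambda>s. 2)"
  by (rule ext, rule DERIV_imp_deriv) (auto intro!: derivative_eq_intros)

lemma divergence_square: "divergence UNIV (\<lambda>s. s\<^sup>2)"
proof -
  have "convex_on UNIV (\<lambda>s::real. s\<^sup>2)"
    by (rule f''_ge0_imp_convex[where f' = "\<lambda>s. 2 * s" and f'' = "\<lambda>_. 2"]) (auto intro!: derivative_eq_intros)
  moreover have "(\<lambda>s::real. s\<^sup>2) differentiable (at s)" "(\<lambda>s::real. 2 * s) differentiable (at s)" for s
    by (auto intro!: derivative_intros)
  ultimately show ?thesis
    by (auto simp: divergence_def deriv_square deriv_linear convex_on_const intro!: continuous_intros)
qed

lemma entropy_derivs:
  fixes s :: real assumes "0 < s"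
  shows "((\<lambda>s. s * ln s) has_real_derivative ln s + 1) (at s)"
    and "(deriv (\<lambda>s. s * ln s) has_real_derivative 1 / s) (at s)"
    and "deriv (deriv (\<lambda>s. s * ln s)) s = 1 / s"
proof -
  have d: "((\<lambda>s. s * ln s) has_real_derivative ln t + 1) (at t)" if "0 < t" for t :: real
    using that by (auto intro!: derivative_eq_intros)
  show "((\<lambda>s. s * ln s) has_real_derivative ln s + 1) (at s)" by (rule d[OF assms])
  have "((\<lambda>s. ln s + 1) has_real_derivative 1 / s) (at s)" using assms by (auto intro!: derivative_eq_intros)
  then show dd: "(deriv (\<lambda>s. s * ln s) has_real_derivative 1 / s) (at s)"
    by (rule has_field_derivative_transform_within_open[OF _ open_greaterThan[of 0]])
      (use assms DERIV_imp_deriv[OF d] in auto)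
  show "deriv (deriv (\<lambda>s. s * ln s)) s = 1 / s" by (rule DERIV_imp_deriv[OF dd])
qed

lemma convex_on_eq:
  assumes f: "convex_on A f" and eq: "\<And>x. x \<in> A \<Longrightarrow> f x = g x"
  shows "convex_on A g"
  unfolding convex_on_def
proof (intro conjI ballI allI impI)
  show "convex A" using f by (simp add: convex_on_def)
  fix x y u v assume *: "x \<in> A" "y \<in> A" "0 \<le> (u::real)" "0 \<le> (v::real)" "u + v = 1"
  have "u *\<^sub>R x + v *\<^sub>R y \<in> A" using f * by (auto simp: convex_on_def intro: convexD)
  moreover have "f (u *\<^sub>R x + v *\<^sub>R y) \<le> u * f x + v * f y" using f * by (auto simp: convex_on_def)
  ultimately show "g (u *\<^sub>R x + v *\<^sub>R y) \<le> u * g x + v * g y" using * eq by simp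
qed

text \<open>The delicate point is 0, where the product is 0 and continuity is the limit of s ln s.
  Convexity on the closed half-line follows from the open one unless a point is 0, and then it reads
  (t y) ln (t y) \<le> t (y ln y), true because ln t is negative.\<close>

lemma divergence_entropy: "divergence {0..} (\<lambda>s. s * ln s)"
proof -
  have c: "continuous_on {0..} (\<lambda>s::real. s * ln s)"
    unfolding continuous_on_def
  proof
    fix s :: real assume s: "s \<in> {0..}"
    show "((\<lambda>s. s * ln s) \<longlongrightarrow> s * ln s) (at s within {0..})"
    proof (cases "s = 0")
      case True
      have "((\<lambda>s::real. s * ln s) \<longlongrightarrow> 0) (at_right 0)" by real_asymp
      moreover have "at (0::real) within {0..} = at_right 0"
        by (simp add: at_within_Ici_at_right)
      ultimately show ?thesis using True by simp
    next
      case False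
      then show ?thesis using s by (auto intro!: tendsto_intros)
    qed
  qed
  have co: "convex_on {0<..} (\<lambda>s::real. s * ln s)"
    by (rule f''_ge0_imp_convex[where f' = "\<lambda>s. ln s + 1" and f'' = "\<lambda>s. 1 / s"])
      (auto intro!: derivative_eq_intros)
  have cz: "(t * y) * ln (t * y) \<le> t * (y * ln y)" if "0 < t" "t < 1" "0 \<le> y" for t y :: real
  proof (cases "y = 0")
    case False
    then have y: "0 < y" using that by simp
    have "t * y * ln t \<le> 0" using that y by (simp add: mult_nonneg_nonpos)
    then show ?thesis using that y by (simp add: ln_mult algebra_simps)
  qed simp
  have cv: "convex_on {0..} (\<lambda>s::real. s * ln s)"
  proof (rule convex_onI)
    fix t x y :: real assume t: "0 < t" "t < 1" and xy: "x \<in> {0..}" "y \<in> {0..}"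
    show "((1 - t) *\<^sub>R x + t *\<^sub>R y) * ln ((1 - t) *\<^sub>R x + t *\<^sub>R y) \<le> (1 - t) * (x * ln x) + t * (y * ln y)"
    proof (cases "x = 0 \<or> y = 0")
      case True
      then show ?thesis using cz[of t y] cz[of "1 - t" x] t xy by auto
    next
      case False
      then show ?thesis using convex_onD[OF co, of t x y] t xy by auto
    qed
  qed simp
  have "convex_on {0<..} (\<lambda>s::real. 1 / s)"
    by (rule f''_ge0_imp_convex[where f' = "\<lambda>s. - 1 / s\<^sup>2" and f'' = "\<lambda>s. 2 / s ^ 3"])
      (auto intro!: derivative_eq_intros simp: field_simps power2_eq_square power3_eq_cube)
  then have k: "convex_on {0<..} (deriv (deriv (\<lambda>s::real. s * ln s)))"
    by (rule convex_on_eq) (simp add: entropy_derivs(3))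
  have kc: "convex_on {0<..} (\<lambda>s::real. - 1 / deriv (deriv (\<lambda>s::real. s * ln s)) s)"
  proof -
    have n: "convex_on {0<..} (\<lambda>s::real. - s)"
      by (rule f''_ge0_imp_convex[where f' = "\<lambda>s. - 1" and f'' = "\<lambda>s. 0"]) (auto intro!: derivative_eq_intros)
    show ?thesis by (rule convex_on_eq[OF n]) (simp add: entropy_derivs(3))
  qed
  have d: "(\<lambda>s::real. s * ln s) differentiable (at s)" "deriv (\<lambda>s::real. s * ln s) differentiable (at s)"
    if "s \<in> {0<..}" for s :: real
    using entropy_derivs(1,2)[of s] that by (auto simp: real_differentiable_def)
  show ?thesis unfolding divergence_def interior_real_atLeast using c cv k kc d by blast
qed

context perturbed_log_concave
begin

text \<open>Variance is the entropy of s^2, with second derivative 2. For s ln s and f^2 the energy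
  is (1 / f^2) (2 |f| G)^2 = 4 G^2 off the zeros of f. No integrability of f is given: with infinite
  energy the claims are trivial, otherwise \<open>square_integrable\<close> provides it.\<close>

lemma variance_and_log_sobolev:
  assumes f: "smooth d f"
  shows "Var P f \<le> ereal (2 * phi_const \<alpha> K) * ext_integral P (\<lambda>x. (enorm d (grad f x))\<^sup>2)" (is ?var)
    and "Ent (\<lambda>s. s * ln s) P (\<lambda>x. (f x)\<^sup>2)
      \<le> ereal (4 * phi_const \<alpha> K) * ext_integral P (\<lambda>x. (enorm d (grad f x))\<^sup>2)" (is ?ent)
proof -
  define G where "G x = enorm d (grad f x)" for x
  have fG: "has_slope d f G" unfolding G_def by (rule smooth_has_slope[OF f])
  have C: "0 < phi_const \<alpha> K" by (rule phi_const_pos[OF \<alpha>])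
  note [measurable] = has_slope_measurable[OF fG]
  define X where "X = (\<integral>\<^sup>+x. ennreal ((G x)\<^sup>2) \<partial>P)"
  have ext: "ext_integral P (\<lambda>x. (G x)\<^sup>2) = enn2ereal X" unfolding X_def by (rule ext_integral_nonneg) simp
  have "?var \<and> ?ent"
  proof (cases "X = \<infinity>")
    case True
    then show ?thesis using C unfolding G_def[symmetric] ext by simp
  next
    case False
    have G2: "integrable P (\<lambda>x. (G x)\<^sup>2)"
      by (rule integrableI_bounded) (use False in \<open>auto simp: X_def less_top\<close>)
    let ?J = "\<integral>x. (G x)\<^sup>2 \<partial>P"
    have f2: "integrable P (\<lambda>x. (f x)\<^sup>2)" by (rule square_integrable[OF fG G2])
    have f1: "integrable P f"
    proof (rule Bochner_Integration.integrable_bound[where f = "\<lambda>x. 1 + (f x)\<^sup>2"])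
      show "AE x in P. norm (f x) \<le> norm (1 + (f x)\<^sup>2)"
      proof (rule AE_I2)
        fix x
        have "0 \<le> (\<bar>f x\<bar> - 1)\<^sup>2" by simp
        also have "(\<bar>f x\<bar> - 1)\<^sup>2 = (f x)\<^sup>2 - 2 * \<bar>f x\<bar> + 1" by (simp add: power2_diff)
        finally show "norm (f x) \<le> norm (1 + (f x)\<^sup>2)" by simp
      qed
    qed (use f2 in auto)
    define m where "m = (\<integral>x. f x \<partial>P)"
    have "Ent (\<lambda>s. s\<^sup>2) P f \<le> ereal (phi_const \<alpha> K) * ext_integral P (\<lambda>x. deriv (deriv (\<lambda>s. s\<^sup>2)) (f x) * (G x)\<^sup>2)"
      by (rule entropy_inequality[OF _ _ divergence_square fG _ _ f1]) auto
    also have "ext_integral P (\<lambda>x. deriv (deriv (\<lambda>s. s\<^sup>2)) (f x) * (G x)\<^sup>2) = ereal (2 * ?J)"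
      unfolding deriv_square deriv_linear using G2 by (subst ext_integral_eq_integral) auto
    also have "Ent (\<lambda>s. s\<^sup>2) P f = Var P f"
    proof -
      have e: "(f x - m)\<^sup>2 = (f x)\<^sup>2 - 2 * m * f x + m\<^sup>2" for x by (simp add: power2_eq_square algebra_simps)
      have i: "integrable P (\<lambda>x. (f x - m)\<^sup>2)" unfolding e using f1 f2 by simp
      have "(\<integral>x. (f x - m)\<^sup>2 \<partial>P) = (\<integral>x. (f x)\<^sup>2 \<partial>P) - 2 * m * m + m\<^sup>2"
        unfolding e using f1 f2 P.prob_space by (simp add: m_def)
      then show ?thesis unfolding Ent_eq[of "\<lambda>s. s\<^sup>2" f, OF f2] Var_def m_def[symmetric] ext_integral_eq_integral[OF i]
        by (simp add: power2_eq_square)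
    qed
    finally have var: ?var unfolding G_def[symmetric] ext_integral_eq_integral[OF G2] by (simp add: mult_ac)
    have sq: "has_slope d (\<lambda>x. (f x)\<^sup>2) (\<lambda>x. 2 * \<bar>f x\<bar> * G x)" by (rule has_slope_square[OF fG])
    let ?k = "deriv (deriv (\<lambda>s::real. s * ln s))"
    \<comment> \<open>On the zeros of \<open>f\<close> the slope of f^2 vanishes, so the value of
      the second derivative at 0 does not matter; there the energy density is 0 and only an
      inequality holds.\<close>
    have pt: "?k ((f x)\<^sup>2) * (2 * \<bar>f x\<bar> * G x)\<^sup>2 \<le> 4 * (G x)\<^sup>2" "0 \<le> ?k ((f x)\<^sup>2) * (2 * \<bar>f x\<bar> * G x)\<^sup>2" for x
    proof -
      have "?k ((f x)\<^sup>2) * (2 * \<bar>f x\<bar> * G x)\<^sup>2 = (if f x = 0 then 0 else 4 * (G x)\<^sup>2)"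
        by (simp add: entropy_derivs(3) power_mult_distrib)
      then show "?k ((f x)\<^sup>2) * (2 * \<bar>f x\<bar> * G x)\<^sup>2 \<le> 4 * (G x)\<^sup>2" "0 \<le> ?k ((f x)\<^sup>2) * (2 * \<bar>f x\<bar> * G x)\<^sup>2" by auto
    qed
    have "Ent (\<lambda>s. s * ln s) P (\<lambda>x. (f x)\<^sup>2)
      \<le> ereal (phi_const \<alpha> K) * ext_integral P (\<lambda>x. ?k ((f x)\<^sup>2) * (2 * \<bar>f x\<bar> * G x)\<^sup>2)"
    proof (rule entropy_inequality[OF _ _ divergence_entropy sq _ _ f2])
      show "2 * \<bar>f x\<bar> * G x = 0" if "x \<in> eucl d" "(f x)\<^sup>2 \<notin> interior {0..}" for x
        using that by (auto simp: interior_real_atLeast)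
      have "0 \<le> (\<integral>x. (f x)\<^sup>2 \<partial>P)" by (intro integral_nonneg_AE) simp
      then show "(\<integral>x. (f x)\<^sup>2 \<partial>P) \<in> {0..}" by simp
    qed auto
    also have "ext_integral P (\<lambda>x. ?k ((f x)\<^sup>2) * (2 * \<bar>f x\<bar> * G x)\<^sup>2) \<le> ereal (4 * ?J)"
    proof -
      have "(\<integral>\<^sup>+x. ennreal (?k ((f x)\<^sup>2) * (2 * \<bar>f x\<bar> * G x)\<^sup>2) \<partial>P) \<le> (\<integral>\<^sup>+x. ennreal (4 * (G x)\<^sup>2) \<partial>P)"
        by (intro nn_integral_mono ennreal_leI pt)
      then have "enn2ereal (\<integral>\<^sup>+x. ennreal (?k ((f x)\<^sup>2) * (2 * \<bar>f x\<bar> * G x)\<^sup>2) \<partial>P) \<le> enn2ereal (\<integral>\<^sup>+x. ennreal (4 * (G x)\<^sup>2) \<partial>P)"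
        by (simp only: less_eq_ennreal.rep_eq)
      also have "\<dots> = ext_integral P (\<lambda>x. 4 * (G x)\<^sup>2)" by (rule ext_integral_nonneg[symmetric]) simp
      also have "\<dots> = ereal (4 * ?J)" using G2 by (subst ext_integral_eq_integral) auto
      finally show ?thesis using pt(2) by (subst ext_integral_nonneg) auto
    qed
    then have "ereal (phi_const \<alpha> K) * ext_integral P (\<lambda>x. ?k ((f x)\<^sup>2) * (2 * \<bar>f x\<bar> * G x)\<^sup>2) \<le> ereal (phi_const \<alpha> K) * ereal (4 * ?J)"
      using C by (intro ereal_mult_left_mono) auto
    finally have ent: ?ent unfolding G_def[symmetric] ext_integral_eq_integral[OF G2] by (simp add: mult_ac)
    show ?thesis using var ent by blast
  qed
  then show ?var ?ent by blast+
qed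

end

section \<open>Weakly log-concave densities as perturbed log-concave ones\<close>

text \<open>\<open>Om\<close> is the interior of the convex set \<open>C\<close> where
  \<open>u\<close> is finite. It lies in the interior of the support, so the regularity and Hessian
  conditions hold on it, and it carries the whole measure because a measurable convex set exceeds
  its interior only by a null set.\<close>

lemma weakly_log_concave_decomposition:
  assumes \<alpha>: "0 < \<alpha>" and K: "0 < K" and \<beta>: "0 < \<beta>" "\<beta> \<le> 1" and wlc: "weakly_log_concave d \<alpha> \<beta> K p"
  shows "\<exists>Om v b. perturbed_log_concave d p Om v b \<alpha> K"
proof -
  from wlc obtain u a where pd: "prob_density d p"
    and pu: "\<And>x. x \<in> eucl d \<Longrightarrow> p x = (if u x = \<infinity> then 0 else exp (- real_of_ereal (u x) + a x))"
    and um: "\<And>x. x \<in> eucl d \<Longrightarrow> u x \<noteq> -\<infinity>" and uc: "ext_convex d u"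
    and C2: "Ck_on d 2 (top_of_set (eucl d) interior_of dsupport d p) (\<lambda>x. real_of_ereal (u x))"
    and hess: "\<And>x. x \<in> top_of_set (eucl d) interior_of dsupport d p \<Longrightarrow> hessian_ge d \<alpha> (\<lambda>x. real_of_ereal (u x)) x"
    and hold: "\<And>x y. x \<in> eucl d \<Longrightarrow> y \<in> eucl d \<Longrightarrow> \<bar>a x - a y\<bar> \<le> K * edist d x y powr \<beta>"
    unfolding weakly_log_concave_def Let_def edist_def by blast
  define v where "v x = real_of_ereal (u x)" for x
  define C where "C = {x \<in> eucl d. p x \<noteq> 0}"
  define Om where "Om = core d C"
  have pm: "p \<in> borel_measurable (leb d)" and p0: "\<And>x. x \<in> eucl d \<Longrightarrow> 0 \<le> p x" and p1: "(\<integral>\<^sup>+x. ennreal (p x) \<partial>leb d) = 1"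
    using pd by (auto simp: prob_density_def)
  have Cu: "x \<in> C \<longleftrightarrow> x \<in> eucl d \<and> u x \<noteq> \<infinity>" for x by (auto simp: C_def pu)
  have Cs: "C \<in> sets (leb d)"
  proof -
    have "p -` (- {0}) \<inter> space (leb d) \<in> sets (leb d)" by (rule measurable_sets[OF pm]) simp
    moreover have "p -` (- {0}) \<inter> space (leb d) = C" by (auto simp: C_def space_leb)
    ultimately show ?thesis by simp
  qed
  have Cc: "cvx d C" unfolding cvx_def
  proof (intro conjI ballI allI impI)
    show "C \<subseteq> eucl d" by (auto simp: C_def)
    fix x y t assume x: "x \<in> C" and y: "y \<in> C" and t: "0 < t \<and> t < (1::real)"
    have xy: "x \<in> eucl d" "y \<in> eucl d" "u x \<noteq> \<infinity>" "u y \<noteq> \<infinity>" using x y by (auto simp: Cu)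
    \<comment> \<open>\<open>ext_convex\<close> is used at 1 - t, since it weights the second point.
      As \<open>u\<close> is never -\<infinity>, the right side is finite when both values
      are.\<close>
    define X where "X = ereal (1 - (1 - t)) * u x + ereal (1 - t) * u y"
    have "u (\<lambda>i\<in>{..<d}. (1 - (1 - t)) * x i + (1 - t) * y i) \<le> X"
      unfolding X_def using uc[unfolded ext_convex_def, rule_format, OF xy(1,2), of "1 - t"] t by simp
    moreover have "(\<lambda>i\<in>{..<d}. (1 - (1 - t)) * x i + (1 - t) * y i) = cmb d t x y" by (simp add: cmb_def)
    ultimately have "u (cmb d t x y) \<le> X" by (simp only:)
    moreover have "X \<noteq> \<infinity>"
      unfolding X_def using xy um[OF xy(1)] um[OF xy(2)] by (cases "u x"; cases "u y") auto
    ultimately have "u (cmb d t x y) \<noteq> \<infinity>" by (metis ereal_infty_less_eq(1))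
    then show "cmb d t x y \<in> C" by (simp add: Cu)
  qed
  have OC: "Om \<subseteq> C" "Om \<subseteq> eucl d" unfolding Om_def by (rule core_subset)+
  have "Om \<subseteq> top_of_set (eucl d) interior_of dsupport d p"
  proof (rule interior_of_maximal)
    have "C \<subseteq> dsupport d p" unfolding dsupport_def C_def by (rule closure_of_subset) auto
    then show "Om \<subseteq> dsupport d p" using OC by blast
    obtain U where "open U" "core d C = U \<inter> eucl d" using core_open by metis
    then show "openin (top_of_set (eucl d)) Om" unfolding Om_def openin_open by blast
  qed
  then have C2': "Ck_on d 2 Om v" and hess': "\<And>x. x \<in> Om \<Longrightarrow> hessian_ge d \<alpha> v x"
    using Ck_on_subset[OF C2] hess by (auto simp: v_def[abs_def])
  have Oc: "cvx d Om" "box_open d Om" unfolding Om_def by (rule cvx_core[OF Cc], rule box_open_core)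
  have vc: "continuous_on Om v"
  proof -
    have "continuous_on Om (foldr partial [] v)" using C2' unfolding Ck_on_def by (metis bot.extremum list.set(1) list.size(3) zero_le)
    then show ?thesis by simp
  qed
  obtain b where b: "\<And>x z. x \<in> eucl d \<Longrightarrow> z \<in> eucl d \<Longrightarrow> \<bar>b x - b z\<bar> \<le> K * edist d x z"
    "\<And>x. x \<in> eucl d \<Longrightarrow> b x \<le> a x" "\<And>x. x \<in> eucl d \<Longrightarrow> a x \<le> b x + K"
    using holder_lipschitz_approximation[OF less_imp_le[OF K] \<beta> hold] by metis
  have pO: "p x = exp (- v x + a x)" if "x \<in> Om" for x
    using that OC pu[of x] Cu[of x] by (auto simp: v_def)
  have "perturbed_log_concave d p Om v b \<alpha> K"
  proof
    show "0 \<le> K" using K by simp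
    show "Om \<in> sets (leb d)" unfolding Om_def by (rule sets_core)
    show "(\<lambda>x. indicator Om x * v x) \<in> borel_measurable (leb d)"
      using continuous_on_core_measurable vc unfolding Om_def by blast
    show "v (cmb d t x y) + \<alpha> / 2 * t * (1 - t) * (edist d x y)\<^sup>2 \<le> t * v x + (1 - t) * v y"
      if "x \<in> Om" "y \<in> Om" "0 < t" "t < 1" for x y t
      by (rule strong_convexity[OF Oc(2,1) C2' hess' that])
    show "exp (- v x + b x) \<le> p x" if "x \<in> Om" for x using that OC b(2)[of x] by (auto simp: pO)
    show "p x \<le> exp K * exp (- v x + b x)" if "x \<in> Om" for x
      using that OC b(3)[of x] by (auto simp: pO simp flip: exp_add)
    have "C - Om \<in> null_sets (leb d)"
      using emeasure_convex_boundary[OF Cc Cs] Cs by (auto simp: null_sets_def Om_def)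
    then have "AE x in leb d. x \<notin> C - Om" by (rule AE_not_in)
    then show "AE x in leb d. x \<notin> Om \<longrightarrow> p x = 0"
      using AE_space by eventually_elim (auto simp: C_def space_leb)
  qed (use \<alpha> pm p0 p1 Oc b in auto)
  then show ?thesis by blast
qed

theorem theorem6:
  fixes \<alpha> \<beta> K :: real
  assumes "\<alpha> > 0" and "K > 0" and "0 < \<beta>" and "\<beta> \<le> 1"
  shows "\<exists>C>0. \<forall>d\<ge>1. \<forall>p. weakly_log_concave d \<alpha> \<beta> K p \<longrightarrow>
    (\<forall>I \<Psi> f. closed I \<and> is_interval I \<and> divergence I \<Psi> \<and>
        smooth d f \<and> (\<forall>x\<in>eucl d. f x \<in> I) \<and>
        integrable (dmeasure d p) f \<and> (\<integral>x. f x \<partial>dmeasure d p) \<in> I \<longrightarrow>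
        Ent \<Psi> (dmeasure d p) f
          \<le> ereal C * ext_integral (dmeasure d p)
              (\<lambda>x. deriv (deriv \<Psi>) (f x) * (enorm d (grad f x))\<^sup>2)) \<and>
    (\<forall>f. smooth d f \<longrightarrow>
        Var (dmeasure d p) f
          \<le> ereal (2 * C) * ext_integral (dmeasure d p) (\<lambda>x. (enorm d (grad f x))\<^sup>2) \<and>
        Ent (\<lambda>s. s * ln s) (dmeasure d p) (\<lambda>x. (f x)\<^sup>2)
          \<le> ereal (4 * C) * ext_integral (dmeasure d p) (\<lambda>x. (enorm d (grad f x))\<^sup>2))"
\<comment> \<open>The witness contains neither \<open>d\<close> nor \<beta>: the exponent entered
  through r powr \<beta> \<le> 1 + r, and every quantity depending on the dimension was an error
  constant that vanished in a limit.\<close>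
proof (intro exI[of _ "phi_const \<alpha> K"] conjI allI impI)
  show "0 < phi_const \<alpha> K" by (rule phi_const_pos[OF assms(1)])
  fix d :: nat and p assume "weakly_log_concave d \<alpha> \<beta> K p"
  then obtain Om v b where "perturbed_log_concave d p Om v b \<alpha> K"
    using weakly_log_concave_decomposition[OF assms] by blast
  then interpret perturbed_log_concave d p Om v b \<alpha> K .
  show "Ent \<Psi> P f \<le> ereal (phi_const \<alpha> K) * ext_integral P (\<lambda>x. deriv (deriv \<Psi>) (f x) * (enorm d (grad f x))\<^sup>2)"
    if "closed I \<and> is_interval I \<and> divergence I \<Psi> \<and> smooth d f \<and> (\<forall>x\<in>eucl d. f x \<in> I) \<and>
        integrable P f \<and> (\<integral>x. f x \<partial>P) \<in> I" for I \<Psi> f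
    using that smooth_grad_zero[of d f I] by (intro entropy_inequality[of I] smooth_has_slope) auto
  fix f assume f: "smooth d f"
  show "Var P f \<le> ereal (2 * phi_const \<alpha> K) * ext_integral P (\<lambda>x. (enorm d (grad f x))\<^sup>2)"
    by (rule variance_and_log_sobolev(1)[OF f])
  show "Ent (\<lambda>s. s * ln s) P (\<lambda>x. (f x)\<^sup>2)
      \<le> ereal (4 * phi_const \<alpha> K) * ext_integral P (\<lambda>x. (enorm d (grad f x))\<^sup>2)"
    by (rule variance_and_log_sobolev(2)[OF f])
qed

end
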